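(* Let $\Omega\subset\mathbb R^n$, $n\ge2$, be any open set with $\mathcal L^n(\Omega)<\infty$ and $\mathcal H^{n-1}(\partial\Omega)<\infty$. Let $\mu$ be a Borel measure on $\Omega$ with $\mu(\Omega)<\infty$ such that $\mu(B_r(x)\cap\Omega)\le C_\mu r^\alpha$ for all $x\in\Omega$, $r>0$, for some $\alpha\in(n-1,n]$, $C_\mu>0$. (i) Let $1<p<n$, $r>1$, $q=\min\{\frac{p\alpha}{n-p},\frac{r\alpha}{n-1}\}$. Then there exists $C=C(n,p,r,\alpha,C_\mu)$ such that $$\|\nabla u\|_{L^q(\Omega,\mu)}\le C\Big(\max\{\mu(\Omega)^{\frac n\alpha},\mathcal L^n(\Omega)\}^{\frac\alpha{qn}-\frac{n-p}{pn}}\|\nabla^2u\|_{L^p(\Omega)}+\max\{\mu(\Omega)^{\frac{n-1}\alpha},\mathcal H^{n-1}(\partial\Omega)\}^{\frac\alpha{q(n-1)}-\frac1r}\|u\|_{\mathcal V^1L^r(\partial\Omega)}\Big)$$ for every $u\in V^2L^p(\Omega)\cap\mathcal V^1L^r(\partial\Omega)\cap C_b(\overline\Omega)$. (ii) Let $\beta>0$ and $\gamma=\min\{\frac n{n-1},\beta\}$. Then there exists $C=C(n,\beta,\alpha,C_\mu,\mathcal L^n(\Omega),\mathcal H^{n-1}(\partial\Omega),\mu(\Omega))$ such that $$\|\nabla u\|_{\exp L^\gamma(\Omega,\mu)}\le C\big(\|\nabla^2u\|_{L^n(\Omega)}+\|u\|_{\mathcal V^1\exp L^\beta(\partial\Omega)}\big)$$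 for every $u\in V^2L^n(\Omega)\cap\mathcal V^1\exp L^\beta(\partial\Omega)\cap C_b(\overline\Omega)$. (iii) Let $p>n$. Then there exists $C=C(n,p)$ such that $$\|\nabla u\|_{L^\infty(\Omega)}\le C\big(\mathcal L^n(\Omega)^{\frac1n-\frac1p}\|\nabla^2u\|_{L^p(\Omega)}+\|u\|_{\mathcal V^1L^\infty(\partial\Omega)}\big)$$ for every $u\in V^2L^p(\Omega)\cap\mathcal V^1L^\infty(\partial\Omega)\cap C_b(\overline\Omega)$.
   Context: $\mathcal L^n$ is Lebesgue measure, $\mathcal H^{n-1}$ the $(n-1)$-dimensional Hausdorff measure on $\partial\Omega$; spaces without indicated measure use these. Norms of $\nabla u$ with respect to $\mu$ are taken for the trace of $\nabla u$ with respect to $\mu$ (well defined since $\alpha>n-1$). $C_b(\overline\Omega)$: continuous functions on $\overline\Omega$ with bounded support; boundary quantities of $u$ refer to its restriction to $\partial\Omega$. $V^2X(\Omega)$: twice weakly differentiable $u$ with $|\nabla^2u|\in X(\Omega)$. A Borel $g:\partial\Omega\to\mathbb R$ is a Hajłasz upper gradient of $\varphi$ if $|\varphi(x)-\varphi(y)|\le|x-y|(g(x)+g(y))$ for $\mathcal H^{n-1}$-a.e. $x,y\in\partial\Omega$; for a rearrangement-invariant space $X(\partial\Omega)$, $\mathcal V^1X(\partial\Omega)$ is the set of $\varphi$ with an upper gradient in $X(\partial\Omega)$, with seminorm $\inf\|g\|_{X(\partial\Omega)}$ over such upper gradients. For a finite measure space $(\mathcal R,m)$, $\exp L^\gamma(\mathcal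 R,m)$ is the Orlicz space with Luxemburg norm built on a Young function equivalent to $e^{t^\gamma}-1$ near infinity. *)

theory Defs
  imports "HOL-Analysis.Analysis" "HOL-Probability.Essential_Supremum"
begin

definition Lp_mem :: "'a measure \<Rightarrow> real \<Rightarrow> ('a \<Rightarrow> real) \<Rightarrow> bool" where
  "Lp_mem M p f \<longleftrightarrow> f \<in> borel_measurable M \<and> (\<integral>\<^sup>+x. ennreal (\<bar>f x\<bar> powr p) \<partial>M) < \<infinity>"

definition Lp_norm :: "'a measure \<Rightarrow> real \<Rightarrow> ('a \<Rightarrow> real) \<Rightarrow> real" where
  "Lp_norm M p f = (enn2real (\<integral>\<^sup>+x. ennreal (\<bar>f x\<bar> powr p) \<partial>M)) powr (1 / p)"

definition Linf_mem :: "'a measure \<Rightarrow> ('a \<Rightarrow> real) \<Rightarrow> bool" where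
  "Linf_mem M f \<longleftrightarrow> f \<in> borel_measurable M \<and> esssup M (\<lambda>x. ereal \<bar>f x\<bar>) < \<infinity>"

definition Linf_norm :: "'a measure \<Rightarrow> ('a \<Rightarrow> real) \<Rightarrow> real" where
  "Linf_norm M f = max 0 (real_of_ereal (esssup M (\<lambda>x. ereal \<bar>f x\<bar>)))"

text \<open>Young function equivalent to exp(t^gamma) - 1 near infinity: the shift t0 makes it
  convex on [0,infinity) also for gamma < 1; for gamma >= 1, t0 = 0 and it is exp(t^gamma) - 1.\<close>

definition exp_shift :: "real \<Rightarrow> real" where
  "exp_shift \<gamma> = (max 0 ((1 - \<gamma>) / \<gamma>)) powr (1 / \<gamma>)"

definition young_exp :: "real \<Rightarrow> real \<Rightarrow> real" where
  "young_exp \<gamma> t = exp ((t + exp_shift \<gamma>) powr \<gamma>) - exp ((exp_shift \<gamma>) powr \<gamma>)"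

definition orlicz_mem :: "(real \<Rightarrow> real) \<Rightarrow> 'a measure \<Rightarrow> ('a \<Rightarrow> real) \<Rightarrow> bool" where
  "orlicz_mem \<Phi> M f \<longleftrightarrow> f \<in> borel_measurable M \<and>
     (\<exists>c>0. (\<integral>\<^sup>+x. ennreal (\<Phi> (\<bar>f x\<bar> / c)) \<partial>M) \<le> 1)"

definition luxemburg_norm :: "(real \<Rightarrow> real) \<Rightarrow> 'a measure \<Rightarrow> ('a \<Rightarrow> real) \<Rightarrow> real" where
  "luxemburg_norm \<Phi> M f = Inf {c. c > 0 \<and> (\<integral>\<^sup>+x. ennreal (\<Phi> (\<bar>f x\<bar> / c)) \<partial>M) \<le> 1}"

abbreviation expL_mem :: "real \<Rightarrow> 'a measure \<Rightarrow> ('a \<Rightarrow> real) \<Rightarrow> bool" where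
  "expL_mem \<gamma> \<equiv> orlicz_mem (young_exp \<gamma>)"

abbreviation expL_norm :: "real \<Rightarrow> 'a measure \<Rightarrow> ('a \<Rightarrow> real) \<Rightarrow> real" where
  "expL_norm \<gamma> \<equiv> luxemburg_norm (young_exp \<gamma>)"

definition hausdorff_const :: "real \<Rightarrow> real" where
  "hausdorff_const s = pi powr (s / 2) / Gamma (s / 2 + 1)"

definition hausdorff_pre :: "real \<Rightarrow> real \<Rightarrow> 'a::metric_space set \<Rightarrow> ennreal" where
  "hausdorff_pre s \<delta> A = (INF C \<in> {C :: nat \<Rightarrow> 'a set. A \<subseteq> (\<Union>i. C i) \<and>
        (\<forall>i. bounded (C i) \<and> diameter (C i) \<le> \<delta>)}.
      (\<Sum>i. ennreal (hausdorff_const s * (diameter (C i) / 2) powr s)))"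

definition hausdorff_outer :: "real \<Rightarrow> 'a::metric_space set \<Rightarrow> ennreal" where
  "hausdorff_outer s A = (SUP \<delta> \<in> {0<..}. hausdorff_pre s \<delta> A)"

definition hausdorff_measure :: "real \<Rightarrow> 'a::metric_space measure" where
  "hausdorff_measure s = measure_of UNIV (sets borel) (hausdorff_outer s)"

definition hajlasz_ug :: "'a::metric_space measure \<Rightarrow> ('a \<Rightarrow> real) \<Rightarrow> ('a \<Rightarrow> real) \<Rightarrow> bool" where
  "hajlasz_ug M \<phi> g \<longleftrightarrow> g \<in> borel_measurable M \<and>
     (\<exists>N \<in> null_sets M. \<forall>x \<in> space M - N. \<forall>y \<in> space M - N.
        \<bar>\<phi> x - \<phi> y\<bar> \<le> dist x y * (g x + g y))"

definition V1_mem :: "(('a \<Rightarrow> real) \<Rightarrow> bool) \<Rightarrow> 'a::metric_space measure \<Rightarrow> ('a \<Rightarrow> real) \<Rightarrow> bool" where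
  "V1_mem mem M \<phi> \<longleftrightarrow> (\<exists>g. hajlasz_ug M \<phi> g \<and> mem g)"

definition V1_seminorm :: "(('a \<Rightarrow> real) \<Rightarrow> bool) \<Rightarrow> (('a \<Rightarrow> real) \<Rightarrow> real) \<Rightarrow>
    'a::metric_space measure \<Rightarrow> ('a \<Rightarrow> real) \<Rightarrow> real" where
  "V1_seminorm mem nrm M \<phi> = Inf {nrm g | g. hajlasz_ug M \<phi> g \<and> mem g}"

definition pdiff :: "'n::finite \<Rightarrow> (real^'n \<Rightarrow> real) \<Rightarrow> real^'n \<Rightarrow> real" where
  "pdiff i f x = deriv (\<lambda>t. f (x + t *\<^sub>R axis i 1)) 0"

fun iter_pdiff :: "'n::finite list \<Rightarrow> (real^'n \<Rightarrow> real) \<Rightarrow> real^'n \<Rightarrow> real" where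
  "iter_pdiff [] f = f"
| "iter_pdiff (i # is) f = pdiff i (iter_pdiff is f)"

definition smooth_fun :: "(real^'n::finite \<Rightarrow> real) \<Rightarrow> bool" where
  "smooth_fun f \<longleftrightarrow> (\<forall>is. continuous_on UNIV (iter_pdiff is f) \<and>
     (\<forall>i x. (\<lambda>t. iter_pdiff is f (x + t *\<^sub>R axis i 1)) differentiable (at 0)))"

definition test_fun :: "(real^'n::finite) set \<Rightarrow> (real^'n \<Rightarrow> real) \<Rightarrow> bool" where
  "test_fun \<Omega> \<phi> \<longleftrightarrow> smooth_fun \<phi> \<and> (\<exists>K. compact K \<and> K \<subseteq> \<Omega> \<and> (\<forall>x. x \<notin> K \<longrightarrow> \<phi> x = 0))"

definition loc_integrable :: "(real^'n::finite) set \<Rightarrow> (real^'n \<Rightarrow> real) \<Rightarrow> bool" where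
  "loc_integrable \<Omega> f \<longleftrightarrow> (\<forall>K. compact K \<and> K \<subseteq> \<Omega> \<longrightarrow> set_integrable lebesgue K f)"

definition weak_pd :: "(real^'n::finite) set \<Rightarrow> (real^'n \<Rightarrow> real) \<Rightarrow> 'n \<Rightarrow> (real^'n \<Rightarrow> real) \<Rightarrow> bool" where
  "weak_pd \<Omega> u i g \<longleftrightarrow> loc_integrable \<Omega> u \<and> loc_integrable \<Omega> g \<and>
     (\<forall>\<phi>. test_fun \<Omega> \<phi> \<longrightarrow>
        (LINT x:\<Omega>|lebesgue. u x * pdiff i \<phi> x) = - (LINT x:\<Omega>|lebesgue. g x * \<phi> x))"

definition weak_grad_hess :: "(real^'n::finite) set \<Rightarrow> (real^'n \<Rightarrow> real) \<Rightarrow>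
    (real^'n \<Rightarrow> real^'n) \<Rightarrow> (real^'n \<Rightarrow> real^'n^'n) \<Rightarrow> bool" where
  "weak_grad_hess \<Omega> u G H \<longleftrightarrow> (\<forall>i. weak_pd \<Omega> u i (\<lambda>x. G x $ i)) \<and>
     (\<forall>i j. weak_pd \<Omega> (\<lambda>x. G x $ i) j (\<lambda>x. H x $ i $ j))"

definition prec_rep :: "(real^'n::finite \<Rightarrow> real^'n) \<Rightarrow> real^'n \<Rightarrow> real^'n" where
  "prec_rep G x = Lim (at_right 0)
     (\<lambda>\<rho>. (1 / measure lebesgue (ball x \<rho>)) *\<^sub>R (LINT y:ball x \<rho>|lebesgue. G y))"

definition Cb_closure :: "(real^'n::finite) set \<Rightarrow> (real^'n \<Rightarrow> real) \<Rightarrow> bool" where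
  "Cb_closure \<Omega> u \<longleftrightarrow> continuous_on (closure \<Omega>) u \<and> bounded {x \<in> closure \<Omega>. u x \<noteq> 0}"

definition bdry_measure :: "(real^'n::finite) set \<Rightarrow> (real^'n) measure" where
  "bdry_measure \<Omega> = restrict_space (hausdorff_measure (real CARD('n) - 1)) (frontier \<Omega>)"

definition admissible_domain :: "(real^'n::finite) set \<Rightarrow> bool" where
  "admissible_domain \<Omega> \<longleftrightarrow> open \<Omega> \<and> emeasure lebesgue \<Omega> < \<infinity> \<and>
     hausdorff_outer (real CARD('n) - 1) (frontier \<Omega>) < \<infinity>"

definition admissible_measure :: "(real^'n::finite) set \<Rightarrow> (real^'n) measure \<Rightarrow> real \<Rightarrow> real \<Rightarrow> bool" where
  "admissible_measure \<Omega> \<mu> \<alpha> C\<mu> \<longleftrightarrow> space \<mu> = \<Omega> \<and> sets \<mu> = sets (restrict_space borel \<Omega>) \<and>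
     emeasure \<mu> \<Omega> < \<infinity> \<and> (\<forall>x\<in>\<Omega>. \<forall>r>0. emeasure \<mu> (ball x r \<inter> \<Omega>) \<le> ennreal (C\<mu> * r powr \<alpha>))"

abbreviation Hn1 :: "(real^'n::finite) set \<Rightarrow> real" where
  "Hn1 \<Omega> \<equiv> enn2real (hausdorff_outer (real CARD('n) - 1) (frontier \<Omega>))"

end

theory Submission
  imports Defs
begin

text \<open>A ray from a point \<open>x\<close> of the domain and the opposite ray leave it at boundary points
  \<open>b\<^sub>1\<close> and \<open>b\<^sub>2\<close>. Subtracting the second order Taylor formulas at \<open>x\<close> along both segments bounds
  the directional derivative of \<open>u\<close> by the difference quotient of \<open>u\<close> between \<open>b\<^sub>1\<close> and \<open>b\<^sub>2\<close>, hence by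
  \<open>g b\<^sub>1 + g b\<^sub>2\<close> for a Hajlasz gradient \<open>g\<close>, plus integrals of the Hessian along the rays. Averaging over
  the directions turns the ray integrals into the Riesz potential of the Hessian with kernel
  \<open>|x - y|^(1-n)\<close>; the central projection from \<open>x\<close> distorts the boundary measure by the same kernel. As
  constants average to constants, only the part of \<open>g\<close> above a level \<open>s\<close> enters the boundary
  potential, and for every \<open>s \<ge> 0\<close> the gradient at \<open>x\<close> is at most a constant times
  \<open>I x + s + J\<^sub>s x\<close> (potential of the Hessian, level, potential of the excess of \<open>g\<close>). The bound
  passes to the precise representative by averaging over balls. As \<open>\<alpha> > n - 1\<close>, the kernel
  integrated over a set \<open>E\<close> against the measure on the domain is at most a power of the measure
  of \<open>E\<close>; by duality this controls both potentials, and choosing the levels yields strong type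
  estimates (i), exponential tails (ii) and, with no measure involved, the sup bound (iii).\<close>

section \<open>The covering outer measure is metric, hence a measure on the Borel sets\<close>

section \<open>Hausdorff measure\<close>

text \<open>Nothing is assumed on the shape of the boundary, so extension operators and local charts
  are out of reach; the only boundary points used are those seen from \<open>x\<close> along
  straight lines. Opposite rays serve two purposes: the unknown value of \<open>u\<close> at
  \<open>x\<close> cancels, and the chord between the exit points has length exactly the sum of the
  exit times times |v|, which cancels against the first order term, so that no geometric constant
  survives. The null set of the pointwise inequality does not depend on the level s, so s may be
  matched to the height at which the gradient is measured, and in (iii) to the sup norm of the upper
  gradient. The exponents are those of the two potentials separately: p\<alpha>/(n-p) and
  r\<alpha>/(n-1) in (i), n/(n-1) and \<beta> in (ii). Lowering both to their minimum costs, in (i),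
  the powers of \<mu>(\<Omega>) by Hoelder's inequality. Since \<mu> may be singular, a bound almost
  everywhere says nothing about the trace; it is carried to every point where the potential of the
  Hessian is finite, and such points have full \<mu> measure.\<close>

lemma hausdorff_pre_le_cover:
  assumes "A \<subseteq> (\<Union>i. C i)" "\<And>i. bounded (C i)" "\<And>i. diameter (C i) \<le> \<delta>"
  shows "hausdorff_pre s \<delta> A \<le> (\<Sum>i. ennreal (hausdorff_const s * (diameter (C i) / 2) powr s))"
  unfolding hausdorff_pre_def using assms by (intro INF_lower) auto

lemma hausdorff_pre_cover_approx:
  assumes "hausdorff_pre s \<delta> A < b"
  obtains C :: "nat \<Rightarrow> 'a::metric_space set" where "A \<subseteq> (\<Union>i. C i)" "\<And>i. bounded (C i)"
    "\<And>i. diameter (C i) \<le> \<delta>" "(\<Sum>i. ennreal (hausdorff_const s * (diameter (C i) / 2) powr s)) < b"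
  using assms unfolding hausdorff_pre_def INF_less_iff by blast

lemma hausdorff_pre_empty [simp]: "0 \<le> \<delta> \<Longrightarrow> hausdorff_pre s \<delta> {} = 0"
  using hausdorff_pre_le_cover[of "{}" "\<lambda>_. {}" \<delta> s] by auto

lemma hausdorff_pre_mono: "A \<subseteq> B \<Longrightarrow> hausdorff_pre s \<delta> A \<le> hausdorff_pre s \<delta> B"
  unfolding hausdorff_pre_def by (intro INF_superset_mono) auto

lemma hausdorff_pre_antimono: "\<delta> \<le> \<delta>' \<Longrightarrow> hausdorff_pre s \<delta>' A \<le> hausdorff_pre s \<delta> A"
  unfolding hausdorff_pre_def by (intro INF_superset_mono) (auto intro: order_trans)

lemma hausdorff_pre_subadditive:
  fixes A :: "nat \<Rightarrow> 'a::metric_space set"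
  assumes "0 \<le> \<delta>"
  shows "hausdorff_pre s \<delta> (\<Union>n. A n) \<le> (\<Sum>n. hausdorff_pre s \<delta> (A n))"
proof (rule ennreal_le_epsilon)
  let ?f = "\<lambda>D::'a set. ennreal (hausdorff_const s * (diameter D / 2) powr s)"
  fix e :: real assume e: "0 < e" and fin: "(\<Sum>n. hausdorff_pre s \<delta> (A n)) < top"
  have "\<exists>C. A n \<subseteq> (\<Union>i. C i) \<and> (\<forall>i. bounded (C i)) \<and> (\<forall>i. diameter (C i) \<le> \<delta>) \<and>
     (\<Sum>i. ?f (C i)) \<le> hausdorff_pre s \<delta> (A n) + ennreal e * ennreal ((1/2) ^ Suc n)" for n
  proof -
    have lt: "hausdorff_pre s \<delta> (A n) < top" using fin by (auto simp: less_top dest!: ennreal_suminf_lessD)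
    have "0 < ennreal e * ennreal ((1/2) ^ Suc n)" using e by (simp add: ennreal_zero_less_mult_iff)
    then have "hausdorff_pre s \<delta> (A n) < hausdorff_pre s \<delta> (A n) + ennreal e * ennreal ((1/2) ^ Suc n)"
      using lt by (simp add: ennreal_add_left_cancel_less)
    then show ?thesis by (elim hausdorff_pre_cover_approx) (blast intro: less_imp_le)
  qed
  then obtain C where C: "\<And>n. A n \<subseteq> (\<Union>i. C n i)" "\<And>n i. bounded (C n i)"
      "\<And>n i. diameter (C n i) \<le> \<delta>"
      "\<And>n. (\<Sum>i. ?f (C n i)) \<le> hausdorff_pre s \<delta> (A n) + ennreal e * ennreal ((1/2) ^ Suc n)" by metis
  define D where "D = case_prod C \<circ> prod_decode"
  have "(\<Union>n. A n) \<subseteq> (\<Union>i. D i)" using C(1) by (auto simp: D_def subset_eq) (metis prod.case prod_encode_inverse)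
  then have "hausdorff_pre s \<delta> (\<Union>n. A n) \<le> (\<Sum>i. ?f (D i))"
    using C by (intro hausdorff_pre_le_cover) (auto simp: D_def split: prod.splits)
  also have "... = (\<Sum>n. \<Sum>i. ?f (C n i))" using suminf_ennreal_2dimen[of "\<lambda>n. \<Sum>i. ?f (C n i)" "\<lambda>(n, i). ?f (C n i)"]
    by (simp add: D_def split_def)
  also have "... \<le> (\<Sum>n. hausdorff_pre s \<delta> (A n) + ennreal e * ennreal ((1/2) ^ Suc n))" by (intro suminf_le C) auto
  also have "... = (\<Sum>n. hausdorff_pre s \<delta> (A n)) + (\<Sum>n. ennreal e * ennreal ((1/2) ^ Suc n))"
    by (subst suminf_add[symmetric]) auto
  also have "(\<Sum>n. ennreal e * ennreal ((1/2) ^ Suc n)) = ennreal e" unfolding ennreal_suminf_cmult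
    by (subst suminf_ennreal_eq[OF zero_le_power power_half_series]) auto
  finally show "hausdorff_pre s \<delta> (\<Union>n. A n) \<le> (\<Sum>n. hausdorff_pre s \<delta> (A n)) + ennreal e" .
qed

lemma hausdorff_pre_le_outer: "0 < \<delta> \<Longrightarrow> hausdorff_pre s \<delta> A \<le> hausdorff_outer s A"
  unfolding hausdorff_outer_def by (intro SUP_upper) auto

lemma hausdorff_outer_empty [simp]: "hausdorff_outer s {} = 0"
  unfolding hausdorff_outer_def by (auto intro!: antisym SUP_least)

lemma hausdorff_outer_mono: "A \<subseteq> B \<Longrightarrow> hausdorff_outer s A \<le> hausdorff_outer s B"
  unfolding hausdorff_outer_def by (intro SUP_mono) (auto intro: hausdorff_pre_mono)

lemma hausdorff_outer_subadditive:
  "hausdorff_outer s (\<Union>n. A n) \<le> (\<Sum>n. hausdorff_outer s (A n))" unfolding hausdorff_outer_def[of s "\<Union>n. A n"]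
proof (rule SUP_least)
  fix \<delta> :: real assume \<delta>: "\<delta> \<in> {0<..}"
  then have "hausdorff_pre s \<delta> (\<Union>n. A n) \<le> (\<Sum>n. hausdorff_pre s \<delta> (A n))" by (intro hausdorff_pre_subadditive) auto
  also have "... \<le> (\<Sum>n. hausdorff_outer s (A n))" using \<delta> by (intro suminf_le hausdorff_pre_le_outer) auto
  finally show "hausdorff_pre s \<delta> (\<Union>n. A n) \<le> (\<Sum>n. hausdorff_outer s (A n))" .
qed

lemma hausdorff_outer_Un: "hausdorff_outer s (A \<union> B) \<le> hausdorff_outer s A + hausdorff_outer s B"
proof -
  have "hausdorff_outer s (\<Union>n. binaryset A B n) \<le> (\<Sum>n. hausdorff_outer s (binaryset A B n))"
    by (rule hausdorff_outer_subadditive)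
  also have "... = hausdorff_outer s A + hausdorff_outer s B" by (rule suminf_binaryset_eq) simp
  finally show ?thesis by (simp add: UN_binaryset_eq)
qed

text \<open>The scales e/(n+2) decrease to zero and all lie strictly below \<open>e\<close>.
  Strictness is what the separation lemma needs at each scale, and monotonicity along a sequence
  lets the supremum of a sum split.\<close>

lemma hausdorff_outer_eq_SUP_seq:
  assumes "0 < e"
  shows "hausdorff_outer s A = (SUP n. hausdorff_pre s (e / real (n + 2)) A)"
  unfolding hausdorff_outer_def
proof (intro antisym SUP_least)
  fix \<delta> :: real assume \<delta>: "\<delta> \<in> {0<..}"
  obtain n where "e / \<delta> < real n" using reals_Archimedean2 by blast
  then have "e / real (n + 2) \<le> \<delta>" using \<delta> assms by (auto simp: field_simps)
  then show "hausdorff_pre s \<delta> A \<le> (SUP n. hausdorff_pre s (e / real (n + 2)) A)"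
    by (intro SUP_upper2[of n] hausdorff_pre_antimono) auto
next
  fix n show "hausdorff_pre s (e / real (n + 2)) A \<le> (SUP \<delta>\<in>{0<..}. hausdorff_pre s \<delta> A)"
    using assms by (intro SUP_upper) auto
qed

text \<open>A covering set of diameter below \<open>e\<close> cannot meet both \<open>A\<close> and
  \<open>B\<close>, so every cover splits into the sets that meet \<open>A\<close> and the others.
  Discarded sets are replaced by the empty set, whose weight vanishes because
  \<open>0 powr s = 0\<close> for every \<open>s\<close>.\<close>

lemma hausdorff_pre_separated:
  fixes A B :: "'a::metric_space set"
  assumes sep: "\<And>x y. x \<in> A \<Longrightarrow> y \<in> B \<Longrightarrow> e \<le> dist x y" and "0 \<le> \<delta>" "\<delta> < e"
  shows "hausdorff_pre s \<delta> A + hausdorff_pre s \<delta> B \<le> hausdorff_pre s \<delta> (A \<union> B)"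
  unfolding hausdorff_pre_def[of s \<delta> "A \<union> B"]
proof (rule INF_greatest, clarify)
  let ?f = "\<lambda>D::'a set. ennreal (hausdorff_const s * (diameter D / 2) powr s)"
  fix C :: "nat \<Rightarrow> 'a set"
  assume C: "A \<union> B \<subseteq> (\<Union>i. C i)" "\<forall>i. bounded (C i) \<and> diameter (C i) \<le> \<delta>"
  define Ca where "Ca i = (if C i \<inter> A = {} then {} else C i)" for i
  define Cb where "Cb i = (if C i \<inter> A = {} then C i else {})" for i
  have "B \<subseteq> (\<Union>i. Cb i)"
  proof
    fix y assume y: "y \<in> B"
    then obtain i where i: "y \<in> C i" using C by auto
    have "C i \<inter> A = {}"
    proof (rule ccontr)
      assume "C i \<inter> A \<noteq> {}"
      then obtain x where x: "x \<in> C i" "x \<in> A" by auto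
      have "e \<le> dist x y" using sep x y by auto
      also have "... \<le> diameter (C i)" using diameter_bounded_bound[of "C i" x y] C(2) x i by auto
      also have "... \<le> \<delta>" using C by auto
      finally show False using assms by auto
    qed
    then show "y \<in> (\<Union>i. Cb i)" using i by (auto simp: Cb_def)
  qed
  then have b: "hausdorff_pre s \<delta> B \<le> (\<Sum>i. ?f (Cb i))"
    using C assms by (intro hausdorff_pre_le_cover) (auto simp: Cb_def)
  have "A \<subseteq> (\<Union>i. Ca i)" using C by (fastforce simp: Ca_def)
  then have a: "hausdorff_pre s \<delta> A \<le> (\<Sum>i. ?f (Ca i))"
    using C assms by (intro hausdorff_pre_le_cover) (auto simp: Ca_def)
  have "hausdorff_pre s \<delta> A + hausdorff_pre s \<delta> B \<le> (\<Sum>i. ?f (Ca i)) + (\<Sum>i. ?f (Cb i))" using a b by (rule add_mono)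
  also have "... = (\<Sum>i. ?f (Ca i) + ?f (Cb i))" by (subst suminf_add) auto
  also have "... = (\<Sum>i. ?f (C i))" by (intro suminf_cong) (auto simp: Ca_def Cb_def)
  finally show "hausdorff_pre s \<delta> A + hausdorff_pre s \<delta> B \<le> (\<Sum>i. ?f (C i))" .
qed

lemma hausdorff_outer_separated:
  fixes A B :: "'a::metric_space set"
  assumes sep: "\<And>x y. x \<in> A \<Longrightarrow> y \<in> B \<Longrightarrow> e \<le> dist x y" and e: "0 < e"
  shows "hausdorff_outer s A + hausdorff_outer s B \<le> hausdorff_outer s (A \<union> B)"
proof -
  have inc: "incseq (\<lambda>n. hausdorff_pre s (e / real (n + 2)) A)" for A :: "'a set"
    using e by (intro incseq_SucI hausdorff_pre_antimono) (simp add: frac_le)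
  have "hausdorff_outer s A + hausdorff_outer s B =
      (SUP n. hausdorff_pre s (e / real (n + 2)) A + hausdorff_pre s (e / real (n + 2)) B)"
    unfolding hausdorff_outer_eq_SUP_seq[OF e] by (rule ennreal_SUP_add[OF inc inc, symmetric])
  also have "... \<le> (SUP n. hausdorff_pre s (e / real (n + 2)) (A \<union> B))"
    using e by (intro SUP_mono' hausdorff_pre_separated[OF sep]) (auto simp: field_simps intro!: add_pos_nonneg)
  finally show ?thesis unfolding hausdorff_outer_eq_SUP_seq[OF e] .
qed

text \<open>Caratheodory's argument: the shells of points whose distance to the closed set lies between
  two consecutive reciprocals are mutually separated once every other shell is dropped, so their
  outer measures are summable.\<close>

lemma hausdorff_outer_closed_split:
  fixes F T :: "'a::metric_space set"
  assumes F: "closed F"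
  shows "hausdorff_outer s (T \<inter> F) + hausdorff_outer s (T - F) \<le> hausdorff_outer s T"
proof (cases "F = {} \<or> hausdorff_outer s T = \<infinity>")
  case True
  then show ?thesis by auto
next
  case False
  then have Fne: "F \<noteq> {}" and fin: "hausdorff_outer s T < \<infinity>" by (auto simp: less_top)
  let ?H = "hausdorff_outer s"
  define A where "A k = {x \<in> T - F. 1 / real (k + 1) \<le> infdist x F}" for k
  define R where "R k = A (Suc k) - A k" for k
  have sepF: "infdist x F \<le> dist x y + infdist y F" for x y using infdist_triangle[of x F y] by (simp add: add.commute)
  have part: "(\<Sum>k<m. ?H (R (2*k+p))) \<le> ?H (\<Union>k<m. R (2*k+p))" for m p
  proof (induction m)
    case (Suc m)
    let ?U = "\<Union>k<m. R (2*k+p)"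
    have "(\<Sum>k<Suc m. ?H (R (2*k+p))) \<le> ?H ?U + ?H (R (2*m+p))" using Suc by (simp add: add_right_mono)
    also have "... \<le> ?H (?U \<union> R (2*m+p))"
    proof (cases "m = 0")
      case False
      \<comment> \<open>Shells of equal parity: the earlier ones stay at distance at least 1/(2m+p)
        from \<open>F\<close>, the new one lies closer than 1/(2m+p+1), and the omitted shell
        between them supplies the gap. For m = 0 the union is empty, which avoids the reciprocal of
        zero.\<close>
      let ?e = "1 / real (2*m+p) - 1 / real (2*m+p+1)"
      show ?thesis
      proof (rule hausdorff_outer_separated[where e = ?e])
        have "1 / real (2*m+p+1) < 1 / real (2*m+p)" using False by (intro divide_strict_left_mono) auto
        then show "0 < ?e" by simp
        fix x y assume x: "x \<in> ?U" and y: "y \<in> R (2*m+p)"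
        from x obtain k where k: "k < m" "x \<in> R (2*k+p)" by auto
        have "1 / real (2*m+p) \<le> 1 / real (2*k+p+2)" using k by (intro divide_left_mono) auto
        also have "... \<le> infdist x F" using k by (auto simp: R_def A_def add_ac)
        finally have 1: "1 / real (2*m+p) \<le> infdist x F" .
        have "infdist y F < 1 / real (2*m+p+1)" using y by (auto simp: R_def A_def not_le)
        then show "?e \<le> dist x y" using 1 sepF[of x y] by linarith
      qed
    qed auto
    also have "?U \<union> R (2*m+p) = (\<Union>k<Suc m. R (2*k+p))" by (auto simp: less_Suc_eq)
    finally show ?case .
  qed auto
  have le: "(\<Sum>k<m. ?H (R (2*k+p))) \<le> ?H T" for m p
    by (rule order_trans[OF part]) (auto intro!: hausdorff_outer_mono simp: R_def A_def)
  have sum2: "(\<Sum>k<2*m. ?H (R k)) = (\<Sum>k<m. ?H (R (2*k+0))) + (\<Sum>k<m. ?H (R (2*k+1)))" for m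
    by (induction m) (auto simp: algebra_simps)
  have "(\<Sum>k. ?H (R k)) \<le> ?H T + ?H T"
  proof (subst suminf_eq_SUP, rule SUP_least)
    fix m
    have "(\<Sum>k<m. ?H (R k)) \<le> (\<Sum>k<2*m. ?H (R k))" by (intro sum_mono2) auto
    also have "... \<le> ?H T + ?H T" unfolding sum2 by (intro add_mono le)
    finally show "(\<Sum>k<m. ?H (R k)) \<le> ?H T + ?H T" .
  qed
  also have "... < \<infinity>" using fin by simp
  finally have sfin: "(\<Sum>k. ?H (R k)) \<noteq> \<infinity>" by simp
  \<comment> \<open>For x outside \<open>A j\<close>, the least index N with x in \<open>A N\<close>
    exceeds j, so x lies in the shell indexed by N - 1.\<close>
  have cover: "T - F \<subseteq> A j \<union> (\<Union>k. R (k + j))" for j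
  proof
    fix x assume x: "x \<in> T - F"
    then have "infdist x F > 0"
      using F Fne by (metis Diff_iff in_closed_iff_infdist_zero infdist_nonneg less_eq_real_def)
    then obtain n where n: "1 / real (n + 1) \<le> infdist x F" by (metis Suc_eq_plus1 less_imp_le nat_approx_posE)
    define N where "N = (LEAST n. x \<in> A n)"
    have "x \<in> A n" using n x by (auto simp: A_def)
    then have N: "x \<in> A N" unfolding N_def by (rule LeastI)
    show "x \<in> A j \<union> (\<Union>k. R (k + j))"
    proof (cases "N \<le> j")
      case True
      have "1 / real (j + 1) \<le> 1 / real (N + 1)" using True by (intro divide_left_mono) auto
      then show ?thesis using N by (auto simp: A_def)
    next
      case False
      then obtain k where k: "N = Suc (k + j)" by (metis add.commute less_imp_Suc_add not_le)
      then have "x \<notin> A (k + j)" using not_less_Least[of "k+j" "\<lambda>n. x \<in> A n"] N_def by auto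
      then show ?thesis using N k by (auto simp: R_def)
    qed
  qed
  show ?thesis
  proof (rule ennreal_le_epsilon)
    fix e :: real assume e: "0 < e"
    have sm: "summable (\<lambda>k. enn2real (?H (R k)))" and eq: "\<And>k. ennreal (enn2real (?H (R k))) = ?H (R k)"
    proof -
      show eq: "ennreal (enn2real (?H (R k))) = ?H (R k)" for k
        using sfin by (metis ennreal_enn2real_if ennreal_suminf_lessD infinity_ennreal_def less_top)
      show "summable (\<lambda>k. enn2real (?H (R k)))" by (rule summable_suminf_not_top) (use sfin eq in auto)
    qed
    obtain N where N: "\<And>n. n \<ge> N \<Longrightarrow> norm (\<Sum>i. enn2real (?H (R (i + n)))) < e" using suminf_exist_split[OF e sm] by blast
    have "(\<Sum>k. ?H (R (k + N))) = (\<Sum>k. ennreal (enn2real (?H (R (k + N)))))" by (simp only: eq)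
    also have "... = ennreal (\<Sum>i. enn2real (?H (R (i + N))))"
      by (intro suminf_ennreal2 summable_ignore_initial_segment[OF sm]) auto
    also have "... \<le> ennreal e" using N[of N] by (intro ennreal_leI) auto
    finally have tail: "(\<Sum>k. ?H (R (k + N))) \<le> ennreal e" .
    have "?H (T - F) \<le> ?H (A N \<union> (\<Union>k. R (k + N)))" by (intro hausdorff_outer_mono cover)
    also have "... \<le> ?H (A N) + ?H (\<Union>k. R (k + N))" by (rule hausdorff_outer_Un)
    also have "... \<le> ?H (A N) + ennreal e" by (intro add_left_mono order_trans[OF hausdorff_outer_subadditive tail])
    finally have "?H (T \<inter> F) + ?H (T - F) \<le> (?H (T \<inter> F) + ?H (A N)) + ennreal e" by (simp add: add.assoc add_left_mono)
    also have "?H (T \<inter> F) + ?H (A N) \<le> ?H (T \<inter> F \<union> A N)"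
    proof (rule hausdorff_outer_separated[where e = "1 / real (N + 1)"])
      fix x y assume "x \<in> T \<inter> F" "y \<in> A N"
      then show "1 / real (N + 1) \<le> dist x y" using sepF[of y x] by (auto simp: A_def dist_commute)
    qed auto
    also have "... \<le> ?H T" by (intro hausdorff_outer_mono) (auto simp: A_def)
    finally show "?H (T \<inter> F) + ?H (T - F) \<le> ?H T + ennreal e" by (simp add: add_right_mono)
  qed
qed

text \<open>\<open>measure_of\<close> yields the zero measure unless its set function is a measure
  on the sigma-algebra. Caratheodory's theorem supplies this: the sets that split every test set
  additively form a sigma-algebra, and it contains the closed sets.\<close>

lemma measure_space_hausdorff_outer:
  "measure_space UNIV (sets (borel :: 'a::metric_space measure)) (hausdorff_outer s :: 'a set \<Rightarrow> ennreal)"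
proof -
  let ?H = "hausdorff_outer s :: 'a set \<Rightarrow> ennreal"
  interpret P: sigma_algebra "UNIV :: 'a set" "UNIV :: 'a set set" using sigma_algebra_Pow[of "UNIV :: 'a set"] by simp
  have oms: "outer_measure_space UNIV ?H"
    unfolding outer_measure_space_def positive_def increasing_def countably_subadditive_def
    by (auto intro: hausdorff_outer_mono hausdorff_outer_subadditive)
  let ?L = "lambda_system UNIV UNIV ?H"
  have ms: "measure_space UNIV ?L ?H" using P.caratheodory_lemma[OF oms] .
  then have sa: "sigma_algebra UNIV ?L" by (simp add: measure_space_def)
  have closed: "F \<in> ?L" if "closed F" for F :: "'a set" unfolding P.lambda_system_eq
  proof (auto, rule antisym)
    fix T :: "'a set"
    show "?H (T \<inter> F) + ?H (T - F) \<le> ?H T" using that by (rule hausdorff_outer_closed_split)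
    show "?H T \<le> ?H (T \<inter> F) + ?H (T - F)" using hausdorff_outer_Un[of s "T \<inter> F" "T - F"] by (simp add: Int_Diff_Un)
  qed
  have "sets (borel :: 'a measure) \<subseteq> ?L"
    unfolding borel_eq_closed using closed sigma_algebra.sigma_sets_subset[OF sa, of "Collect closed"] by auto
  then show ?thesis using measure_down[OF ms] sets.sigma_algebra_axioms[of "borel :: 'a measure"] by simp
qed

lemma sets_hausdorff_measure [simp, measurable_cong]: "sets (hausdorff_measure s) = sets borel"
  unfolding hausdorff_measure_def using sets.sigma_sets_eq[of borel] by (simp add: sets_measure_of)

lemma space_hausdorff_measure [simp]: "space (hausdorff_measure s) = UNIV"
  unfolding hausdorff_measure_def by (simp add: space_measure_of)

lemma emeasure_hausdorff_measure:
  assumes "A \<in> sets borel"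
  shows "emeasure (hausdorff_measure s) A = hausdorff_outer s A"
  using measure_space_hausdorff_outer[of s] assms unfolding hausdorff_measure_def measure_space_def
  by (intro emeasure_measure_of_sigma) auto

section \<open>Integrals of |x - y|^(-a) against measures of polynomial growth, and integrals along
  rays\<close>

section \<open>Riesz-type kernels\<close>

lemma nn_integral_powr_to_inf:
  fixes a r :: real
  assumes "0 < a" "0 < r"
  shows "(\<integral>\<^sup>+t. ennreal (a * t powr (- a - 1)) * indicator {r..} t \<partial>lborel) = ennreal (r powr (- a))"
proof -
  have "((\<lambda>t. t powr (- a - 1)) has_integral - (r powr ((- a - 1) + 1)) / ((- a - 1) + 1)) {r..}"
    by (rule has_integral_powr_to_inf) (use assms in auto)
  then have "((\<lambda>t. a * t powr (- a - 1)) has_integral a * (- (r powr ((- a - 1) + 1)) / ((- a - 1) + 1))) {r..}"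
    by (rule has_integral_mult_right)
  then have "((\<lambda>t. a * t powr (- a - 1)) has_integral r powr (- a)) {r..}" using assms by simp
  then have "(\<integral>\<^sup>+t. ennreal (indicator {r..} t * (a * t powr (- a - 1))) \<partial>lborel) = ennreal (r powr (- a))"
    using assms by (intro nn_integral_has_integral_lebesgue) auto
  then show ?thesis by (elim back_subst[where P = "\<lambda>z. z = _"]) (auto intro!: nn_integral_cong simp: indicator_def)
qed

lemma nn_integral_powr_from_0:
  fixes b r :: real
  assumes "0 < b" "0 \<le> r"
  shows "(\<integral>\<^sup>+t. ennreal (b * t powr (b - 1)) * indicator {0..r} t \<partial>lborel) = ennreal (r powr b)"
proof -
  have "((\<lambda>t. t powr (b - 1)) has_integral (r powr ((b - 1) + 1)) / ((b - 1) + 1)) {0..r}"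
    by (rule has_integral_powr_from_0) (use assms in auto)
  then have "((\<lambda>t. b * t powr (b - 1)) has_integral b * ((r powr ((b - 1) + 1)) / ((b - 1) + 1))) {0..r}"
    by (rule has_integral_mult_right)
  then have "((\<lambda>t. b * t powr (b - 1)) has_integral r powr b) {0..r}" using assms by simp
  then have "(\<integral>\<^sup>+t. ennreal (indicator {0..r} t * (b * t powr (b - 1))) \<partial>lborel) = ennreal (r powr b)"
    using assms by (intro nn_integral_has_integral_lebesgue) auto
  then show ?thesis by (elim back_subst[where P = "\<lambda>z. z = _"]) (auto intro!: nn_integral_cong simp: indicator_def)
qed

text \<open>The kernel is the superposition of the indicators of \<open>dist x y \<le> t\<close>
  with density a t^(-a-1); Tonelli turns its integral into one of ball masses. Only an inequality
  holds, since at x = y the kernel has the value 0 by the convention for \<open>powr\<close>, while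
  the superposition is infinite.\<close>

lemma kernel_layer_cake:
  fixes y :: "'a::euclidean_space" and M :: "'a measure"
  assumes [measurable_cong]: "sets M = sets borel" and "sigma_finite_measure M" and a: "0 < a"
    and [measurable]: "E \<in> sets borel"
  shows "(\<integral>\<^sup>+x. ennreal (dist x y powr (- a)) * indicator E x \<partial>M) \<le>
    (\<integral>\<^sup>+t. ennreal (a * t powr (- a - 1)) * (indicator {0<..} t * emeasure M (E \<inter> cball y t)) \<partial>lborel)"
proof -
  let ?P = "{z. 0 < snd z \<and> dist (fst z) y \<le> snd z \<and> fst z \<in> E}"
  interpret M: sigma_finite_measure M by fact
  interpret P: pair_sigma_finite M lborel ..
  have "(\<integral>\<^sup>+x. ennreal (dist x y powr (- a)) * indicator E x \<partial>M) \<le>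
    (\<integral>\<^sup>+x. (\<integral>\<^sup>+t. ennreal (a * t powr (- a - 1)) *
        indicator ?P (x, t) \<partial>lborel) \<partial>M)"
  proof (rule nn_integral_mono, goal_cases)
    case (1 x)
    show ?case
    proof (cases "x \<in> E \<and> x \<noteq> y")
      case True
      then have "ennreal (dist x y powr (- a)) =
        (\<integral>\<^sup>+t. ennreal (a * t powr (- a - 1)) * indicator {dist x y..} t \<partial>lborel)"
        by (subst nn_integral_powr_to_inf) (use a in auto)
      also have "... \<le> (\<integral>\<^sup>+t. ennreal (a * t powr (- a - 1)) *
        indicator ?P (x, t) \<partial>lborel)" using True by (intro nn_integral_mono mult_left_mono)
          (auto simp: indicator_def intro: less_le_trans[of 0 "dist x y"])
      finally show ?thesis using True by simp
    qed auto
  qed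
  also have "... = (\<integral>\<^sup>+t. (\<integral>\<^sup>+x. ennreal (a * t powr (- a - 1)) *
        indicator ?P (x, t) \<partial>M) \<partial>lborel)" by (rule P.Fubini'[symmetric]) (auto simp: split_beta' pred_def)
  also have "... = (\<integral>\<^sup>+t. ennreal (a * t powr (- a - 1)) * (indicator {0<..} t * emeasure M (E \<inter> cball y t)) \<partial>lborel)"
  proof (rule nn_integral_cong, goal_cases)
    case (1 t)
    have "(\<integral>\<^sup>+x. ennreal (a * t powr (- a - 1)) *
        indicator ?P (x, t) \<partial>M)
      = (\<integral>\<^sup>+x. ennreal (a * t powr (- a - 1)) * indicator {0<..} t * indicator (E \<inter> cball y t) x \<partial>M)"
      by (intro nn_integral_cong) (auto simp: indicator_def dist_commute)
    also have "... = ennreal (a * t powr (- a - 1)) * indicator {0<..} t * emeasure M (E \<inter> cball y t)"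
      by (subst nn_integral_cmult_indicator) auto
    finally show ?case by (simp add: mult.assoc)
  qed
  finally show ?thesis .
qed

text \<open>Small balls are estimated by growth and large ones by the total mass; the two bounds are
  exchanged at the radius R with K R^\<alpha> = m, where they agree. The condition a < \<alpha>
  gives convergence at small radii.\<close>

lemma kernel_integral_bound:
  fixes y :: "'a::euclidean_space" and M :: "'a measure"
  assumes sM: "sets M = sets borel" and sf: "sigma_finite_measure M" and a: "0 < a" "a < \<alpha>" and K: "0 < K"
    and E: "E \<in> sets borel" and m: "0 \<le> m" "emeasure M E \<le> ennreal m"
    and gr: "\<And>t. 0 < t \<Longrightarrow> emeasure M (E \<inter> cball y t) \<le> ennreal (K * t powr \<alpha>)"
  shows "(\<integral>\<^sup>+x. ennreal (dist x y powr (- a)) * indicator E x \<partial>M)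
    \<le> ennreal (\<alpha> / (\<alpha> - a) * K powr (a / \<alpha>) * m powr (1 - a / \<alpha>))"
proof (cases "m = 0")
  case True
  have "(\<integral>\<^sup>+x. ennreal (dist x y powr (- a)) * indicator E x \<partial>M) = (\<integral>\<^sup>+x. 0 \<partial>M)"
  proof (rule nn_integral_cong_AE, goal_cases)
    case 1
    have "E \<in> null_sets M" using True m E sM by (auto intro: null_setsI)
    then have "AE x in M. x \<notin> E" by (rule AE_not_in)
    then show ?case by eventually_elim auto
  qed
  then show ?thesis by simp
next
  case False
  with m have m0: "0 < m" by simp
  define R where "R = (m / K) powr (1 / \<alpha>)"
  have R: "0 < R" using m0 K by (simp add: R_def)
  have \<alpha>: "0 < \<alpha>" using a by simp
  have Ra: "R powr \<alpha> = m / K" using \<alpha> m0 K by (simp add: R_def powr_powr)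
  have "(\<integral>\<^sup>+x. ennreal (dist x y powr (- a)) * indicator E x \<partial>M) \<le>
    (\<integral>\<^sup>+t. ennreal (a * t powr (- a - 1)) * (indicator {0<..} t * emeasure M (E \<inter> cball y t)) \<partial>lborel)"
    by (rule kernel_layer_cake) fact+
  also have "... \<le> (\<integral>\<^sup>+t. ennreal (a * K / (\<alpha> - a)) * (ennreal ((\<alpha> - a) * t powr (\<alpha> - a - 1)) * indicator {0..R} t) +
       ennreal m * (ennreal (a * t powr (- a - 1)) * indicator {R..} t) \<partial>lborel)"
  proof (rule nn_integral_mono, goal_cases)
    case (1 t)
    consider "t \<le> 0" | "0 < t" "t \<le> R" | "R < t" by linarith
    then show ?case
    proof cases
      case 2
      have "ennreal (a * t powr (- a - 1)) * (indicator {0<..} t * emeasure M (E \<inter> cball y t))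
        \<le> ennreal (a * t powr (- a - 1)) * ennreal (K * t powr \<alpha>)"
        using gr[OF 2(1)] 2 by (intro mult_left_mono) (auto simp: indicator_def)
      also have "... = ennreal ((a * K / (\<alpha> - a)) * ((\<alpha> - a) * t powr (\<alpha> - a - 1)))"
      proof -
        have "t powr (\<alpha> - a - 1) = t powr (- a - 1) * t powr \<alpha>" using 2 by (simp add: powr_add[symmetric] algebra_simps)
        then show ?thesis using a K by (simp add: ennreal_mult'[symmetric] mult_ac)
      qed
      also have "... = ennreal (a * K / (\<alpha> - a)) * (ennreal ((\<alpha> - a) * t powr (\<alpha> - a - 1)) * indicator {0..R} t)"
        using 2 a K by (subst ennreal_mult) auto
      finally show ?thesis by (meson add_increasing2 zero_le)
    next
      case 3
      then have t: "0 < t" using R by simp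
      have "emeasure M (E \<inter> cball y t) \<le> emeasure M E" using E sM by (intro emeasure_mono) auto
      also have "... \<le> ennreal m" by fact
      finally have "ennreal (a * t powr (- a - 1)) * (indicator {0<..} t * emeasure M (E \<inter> cball y t))
        \<le> ennreal (a * t powr (- a - 1)) * ennreal m" using t by (intro mult_left_mono) (auto simp: indicator_def)
      also have "... = ennreal m * (ennreal (a * t powr (- a - 1)) * indicator {R..} t)"
        using 3 by (simp add: mult.commute)
      finally show ?thesis by (meson add_increasing zero_le)
    qed auto
  qed
  also have "... = ennreal (a * K / (\<alpha> - a)) * ennreal (R powr (\<alpha> - a)) + ennreal m * ennreal (R powr (- a))"
    by (subst nn_integral_add, measurable, subst nn_integral_cmult, measurable, subst nn_integral_cmult, measurable)
       (use a R in \<open>simp add: nn_integral_powr_from_0 nn_integral_powr_to_inf\<close>)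
  also have "... = ennreal (a * K / (\<alpha> - a) * R powr (\<alpha> - a) + m * R powr (- a))"
    using a K m0 by (simp add: ennreal_mult'[symmetric] ennreal_plus)
  also have "a * K / (\<alpha> - a) * R powr (\<alpha> - a) + m * R powr (- a) = \<alpha> / (\<alpha> - a) * (m * R powr (- a))"
    using a K m0 R by (simp add: powr_diff powr_minus Ra field_simps)
  also have "R powr (- a) = K powr (a / \<alpha>) * m powr (- (a / \<alpha>))"
    using m0 K by (simp add: R_def powr_powr powr_divide powr_minus field_simps)
  also have "\<alpha> / (\<alpha> - a) * (m * (K powr (a / \<alpha>) * m powr (- (a / \<alpha>)))) =
     \<alpha> / (\<alpha> - a) * K powr (a / \<alpha>) * m powr (1 - a / \<alpha>)" using m0 by (simp add: powr_diff powr_minus field_simps)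
  finally show ?thesis .
qed

text \<open>Only radii t \<ge> R meet \<open>E\<close>, and for a > \<alpha> the growth bound alone
  is integrable at infinity. Hoelder's inequality needs this for the kernel off a ball below the
  critical exponent.\<close>

lemma kernel_integral_tail:
  fixes y :: "'a::euclidean_space" and M :: "'a measure"
  assumes sM: "sets M = sets borel" and sf: "sigma_finite_measure M" and a: "0 < \<alpha>" "\<alpha> < a" and K: "0 < K"
    and E: "E \<in> sets borel" and R: "0 < R" "\<And>x. x \<in> E \<Longrightarrow> R \<le> dist x y"
    and gr: "\<And>t. 0 < t \<Longrightarrow> emeasure M (E \<inter> cball y t) \<le> ennreal (K * t powr \<alpha>)"
  shows "(\<integral>\<^sup>+x. ennreal (dist x y powr (- a)) * indicator E x \<partial>M)
    \<le> ennreal (a * K / (a - \<alpha>) * R powr (\<alpha> - a))"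
proof -
  have "(\<integral>\<^sup>+x. ennreal (dist x y powr (- a)) * indicator E x \<partial>M) \<le>
    (\<integral>\<^sup>+t. ennreal (a * t powr (- a - 1)) * (indicator {0<..} t * emeasure M (E \<inter> cball y t)) \<partial>lborel)"
    by (rule kernel_layer_cake) (use assms in auto)
  also have "... \<le> (\<integral>\<^sup>+t. ennreal (a * K / (a - \<alpha>)) * (ennreal ((a - \<alpha>) * t powr (- (a - \<alpha>) - 1)) * indicator {R..} t) \<partial>lborel)"
  proof (rule nn_integral_mono, goal_cases)
    case (1 t)
    show ?case
    proof (cases "t < R")
      case True
      then have "E \<inter> cball y t = {}" using R by (force simp: dist_commute)
      then show ?thesis by simp
    next
      case False
      then have t: "0 < t" using R by simp
      have "ennreal (a * t powr (- a - 1)) * (indicator {0<..} t * emeasure M (E \<inter> cball y t))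
        \<le> ennreal (a * t powr (- a - 1)) * ennreal (K * t powr \<alpha>)"
        using gr[OF t] t by (intro mult_left_mono) (auto simp: indicator_def)
      also have "... = ennreal ((a * K / (a - \<alpha>)) * ((a - \<alpha>) * t powr (- (a - \<alpha>) - 1)))"
        using a K t by (simp add: ennreal_mult'[symmetric] powr_diff powr_minus powr_add field_simps)
      also have "... = ennreal (a * K / (a - \<alpha>)) * (ennreal ((a - \<alpha>) * t powr (- (a - \<alpha>) - 1)) * indicator {R..} t)"
        using False a K by (subst ennreal_mult) auto
      finally show ?thesis .
    qed
  qed
  also have "... = ennreal (a * K / (a - \<alpha>)) * ennreal (R powr (- (a - \<alpha>)))"
    by (subst nn_integral_cmult, measurable) (use a R nn_integral_powr_to_inf[of "a - \<alpha>" R] in simp)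
  also have "... = ennreal (a * K / (a - \<alpha>) * R powr (\<alpha> - a))" using a K by (subst ennreal_mult[symmetric]) auto
  finally show ?thesis .
qed

text \<open>The critical case, kernel and growth exponents being equal: the growth bound leaves 1/t
  on [R, 1], hence the logarithm. Beyond radius 1 the total mass takes over, as a t^(-a-1) has
  integral 1 over [1, \<infinity>).\<close>

lemma kernel_integral_log:
  fixes y :: "'a::euclidean_space" and M :: "'a measure"
  assumes sM: "sets M = sets borel" and sf: "sigma_finite_measure M" and a: "0 < a" and K: "0 < K"
    and E: "E \<in> sets borel" and R: "0 < R" "R \<le> 1" "\<And>x. x \<in> E \<Longrightarrow> R \<le> dist x y"
    and m: "0 \<le> m" "emeasure M E \<le> ennreal m"
    and gr: "\<And>t. 0 < t \<Longrightarrow> emeasure M (E \<inter> cball y t) \<le> ennreal (K * t powr a)"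
  shows "(\<integral>\<^sup>+x. ennreal (dist x y powr (- a)) * indicator E x \<partial>M) \<le> ennreal (a * K * ln (1 / R) + m)"
proof -
  let ?k = "\<lambda>t. ennreal (a * t powr (- a - 1)) * (indicator {0<..} t * emeasure M (E \<inter> cball y t))"
  have "(\<integral>\<^sup>+x. ennreal (dist x y powr (- a)) * indicator E x \<partial>M) \<le>
    (\<integral>\<^sup>+t. ?k t \<partial>lborel)" by (rule kernel_layer_cake) (use assms in auto)
  also have "... \<le> (\<integral>\<^sup>+t. ennreal (a * K) * (ennreal (1 / t) * indicator {R..1} t) +
       ennreal m * (ennreal (a * t powr (- a - 1)) * indicator {1..} t) \<partial>lborel)"
  proof (rule nn_integral_mono, goal_cases)
    case (1 t)
    consider "t < R" | "R \<le> t" "t \<le> 1" | "1 < t" by linarith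
    then show ?case
    proof cases
      case 1
      then have "E \<inter> cball y t = {}" using R by (force simp: dist_commute)
      then show ?thesis by simp
    next
      case 2
      then have t: "0 < t" using R by simp
      have "(?k t)
        \<le> ennreal (a * t powr (- a - 1)) * ennreal (K * t powr a)"
        using gr[OF t] t by (intro mult_left_mono) (auto simp: indicator_def)
      also have "... = ennreal ((a * K) * (1 / t))"
        using a K t by (simp add: ennreal_mult'[symmetric] powr_diff powr_minus field_simps)
      also have "... = ennreal (a * K) * (ennreal (1 / t) * indicator {R..1} t)"
        using 2 t a K by (subst ennreal_mult) auto
      finally show ?thesis by (meson add_increasing2 zero_le)
    next
      case 3
      have "emeasure M (E \<inter> cball y t) \<le> emeasure M E" using E sM by (intro emeasure_mono) auto
      also have "... \<le> ennreal m" by fact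
      finally have "(?k t)
        \<le> ennreal (a * t powr (- a - 1)) * ennreal m" using 3 by (intro mult_left_mono) (auto simp: indicator_def)
      also have "... = ennreal m * (ennreal (a * t powr (- a - 1)) * indicator {1..} t)"
        using 3 by (simp add: mult.commute)
      finally show ?thesis by (meson add_increasing zero_le)
    qed
  qed
  also have "... = ennreal (a * K) * (\<integral>\<^sup>+t. ennreal (1 / t) * indicator {R..1} t \<partial>lborel) + ennreal m * ennreal (1 powr (- a))"
    by (subst nn_integral_add, measurable, subst nn_integral_cmult, measurable, subst nn_integral_cmult, measurable)
       (use a R in \<open>simp add: nn_integral_powr_to_inf\<close>)
  also have "(\<integral>\<^sup>+t. ennreal (1 / t) * indicator {R..1} t \<partial>lborel) = ennreal (ln 1 - ln R)"
    by (rule nn_integral_FTC_Icc) (use R in \<open>auto intro!: derivative_eq_intros\<close>)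
  also have "ennreal (a * K) * ennreal (ln 1 - ln R) + ennreal m * ennreal (1 powr (- a)) = ennreal (a * K * ln (1 / R) + m)"
  proof -
    have "a * K * ln R \<le> 0" using a K R by (intro mult_nonneg_nonpos) auto
    then show ?thesis using a K R m
      by (simp add: ennreal_mult'[symmetric] ennreal_plus[symmetric] ln_div del: ennreal_plus)
  qed
  finally show ?thesis .
qed

lemma cone_change_of_variables:
  fixes F :: "'a::euclidean_space \<Rightarrow> ennreal" and w :: "'a \<Rightarrow> real \<Rightarrow> ennreal"
  assumes [measurable]: "F \<in> borel_measurable borel" "case_prod w \<in> borel_measurable (borel \<Otimes>\<^sub>M borel)"
  shows "(\<integral>\<^sup>+v. (\<integral>\<^sup>+s. indicator {0<..} s * w v s * F (x + s *\<^sub>R v) \<partial>lborel) \<partial>lborel) =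
    (\<integral>\<^sup>+y. F y * (\<integral>\<^sup>+s. indicator {0<..} s * w ((1 / s) *\<^sub>R (y - x)) s * ennreal (s powr - real DIM('a)) \<partial>lborel) \<partial>lborel)"
proof -
  let ?k = "\<lambda>y s. indicator {0<..} s * w ((1 / s) *\<^sub>R (y - x)) s * ennreal (s powr - real DIM('a))"
  have [measurable]: "(\<lambda>p. w (f p) (g p)) \<in> borel_measurable M"
    if [measurable]: "f \<in> borel_measurable M" "g \<in> borel_measurable M" for f g and M :: "'c measure"
  proof -
    have "(\<lambda>p. case_prod w (f p, g p)) \<in> borel_measurable M" by measurable
    then show ?thesis by simp
  qed
  have "(\<integral>\<^sup>+v. (\<integral>\<^sup>+s. indicator {0<..} s * w v s * F (x + s *\<^sub>R v) \<partial>lborel) \<partial>lborel) =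
    (\<integral>\<^sup>+s. (\<integral>\<^sup>+v. indicator {0<..} s * w v s * F (x + s *\<^sub>R v) \<partial>lborel) \<partial>lborel)"
    by (rule lborel_pair.Fubini'[symmetric]) measurable
  also have "... = (\<integral>\<^sup>+s. (\<integral>\<^sup>+y. F y * ?k y s \<partial>lborel) \<partial>lborel)"
  proof (rule nn_integral_cong, goal_cases)
    case (1 s)
    show ?case
    proof (cases "0 < s")
      case True
      have p: "ennreal (s ^ DIM('a)) * ennreal (s powr - real DIM('a)) = 1"
        using True by (simp add: ennreal_mult'[symmetric] powr_minus powr_realpow)
      have "(\<integral>\<^sup>+y. F y * ?k y s \<partial>lborel)
        = (\<integral>\<^sup>+v. ennreal (s ^ DIM('a)) * (F (x + s *\<^sub>R v) * (w ((1 / s) *\<^sub>R (x + s *\<^sub>R v - x)) s * ennreal (s powr - real DIM('a)))) \<partial>lborel)"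
        using True by (subst lborel_affine[of s x]) (auto simp: nn_integral_density nn_integral_distr)
      also have "... = (\<integral>\<^sup>+v. (ennreal (s ^ DIM('a)) * ennreal (s powr - real DIM('a))) * (w v s * F (x + s *\<^sub>R v)) \<partial>lborel)"
        using True by (intro nn_integral_cong) (simp add: mult_ac)
      finally show ?thesis using True by (simp add: p)
    qed auto
  qed
  also have "... = (\<integral>\<^sup>+y. (\<integral>\<^sup>+s. F y * ?k y s \<partial>lborel) \<partial>lborel)" by (rule lborel_pair.Fubini') measurable
  also have "... = (\<integral>\<^sup>+y. F y * (\<integral>\<^sup>+s. ?k y s \<partial>lborel) \<partial>lborel)" by (intro nn_integral_cong nn_integral_cmult) measurable
  finally show ?thesis .
qed

text \<open>A point at distance r from x is reached by directions in the annulus only at times in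
  [r/2, r]. This interval has length r/2 and the weight s^(-n) is at most (r/2)^(-n) on it, whence
  the kernel r^(1-n).\<close>

lemma cone_integral_annulus:
  fixes F :: "'a::euclidean_space \<Rightarrow> ennreal"
  assumes [measurable]: "F \<in> borel_measurable borel"
  shows "(\<integral>\<^sup>+v. indicator {v. 1 \<le> norm v \<and> norm v \<le> 2} v * (\<integral>\<^sup>+s. indicator {0<..} s * F (x + s *\<^sub>R v) \<partial>lborel) \<partial>lborel)
    \<le> ennreal (2 ^ DIM('a)) * (\<integral>\<^sup>+y. F y * ennreal (dist x y powr (1 - real DIM('a))) \<partial>lborel)"
proof -
  let ?V = "{v::'a. 1 \<le> norm v \<and> norm v \<le> 2}"
  have "(\<integral>\<^sup>+v. indicator ?V v * (\<integral>\<^sup>+s. indicator {0<..} s * F (x + s *\<^sub>R v) \<partial>lborel) \<partial>lborel) =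
     (\<integral>\<^sup>+v. (\<integral>\<^sup>+s. indicator {0<..} s * indicator ?V v * F (x + s *\<^sub>R v) \<partial>lborel) \<partial>lborel)"
    by (intro nn_integral_cong, subst nn_integral_cmult[symmetric]) (auto simp: mult_ac)
  also have "... = (\<integral>\<^sup>+y. F y * (\<integral>\<^sup>+s. indicator {0<..} s * indicator ?V ((1 / s) *\<^sub>R (y - x)) * ennreal (s powr - real DIM('a)) \<partial>lborel) \<partial>lborel)"
    by (rule cone_change_of_variables) auto
  also have "... \<le> (\<integral>\<^sup>+y. ennreal (2 ^ DIM('a)) * (F y * ennreal (dist x y powr (1 - real DIM('a)))) \<partial>lborel)"
  proof (rule nn_integral_mono, goal_cases)
    case (1 y)
    let ?r = "dist x y"
    have "(\<integral>\<^sup>+s. indicator {0<..} s * indicator ?V ((1 / s) *\<^sub>R (y - x)) * ennreal (s powr - real DIM('a)) \<partial>lborel)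
      \<le> (\<integral>\<^sup>+s. ennreal ((?r / 2) powr - real DIM('a)) * indicator {?r / 2..?r} s \<partial>lborel)"
    proof (rule nn_integral_mono, goal_cases)
      case (1 s)
      show ?case
      proof (cases "0 < s \<and> (1 / s) *\<^sub>R (y - x) \<in> ?V")
        case True
        then have "norm ((1 / s) *\<^sub>R (y - x)) = ?r / s" by (simp add: dist_norm norm_minus_commute)
        with True have "0 < s" "1 \<le> ?r / s" "?r / s \<le> 2" by auto
        then have s: "0 < s" "?r / 2 \<le> s" "s \<le> ?r" by (auto simp: field_simps)
        then have "s powr - real DIM('a) \<le> (?r / 2) powr - real DIM('a)" by (intro powr_mono2') auto
        then show ?thesis using s True by (simp add: ennreal_leI)
      qed (auto simp: indicator_def)
    qed
    also have "... = ennreal ((?r / 2) powr - real DIM('a)) * ennreal (?r / 2)"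
      by (subst nn_integral_cmult_indicator) (auto simp: field_simps)
    also have "... \<le> ennreal (2 ^ DIM('a) * ?r powr (1 - real DIM('a)))"
    proof (cases "?r = 0")
      case False
      have "(?r / 2) powr - real DIM('a) * (?r / 2) = 2 ^ DIM('a) * ?r powr (1 - real DIM('a)) / 2"
        using False by (simp add: powr_divide powr_minus powr_diff powr_realpow field_simps)
      also have "... \<le> 2 ^ DIM('a) * ?r powr (1 - real DIM('a))" by simp
      finally show ?thesis by (simp add: ennreal_mult'[symmetric] ennreal_leI)
    qed auto
    finally have "F y * (\<integral>\<^sup>+s. indicator {0<..} s * indicator ?V ((1 / s) *\<^sub>R (y - x)) * ennreal (s powr - real DIM('a)) \<partial>lborel)
      \<le> F y * ennreal (2 ^ DIM('a) * ?r powr (1 - real DIM('a)))" by (rule mult_left_mono) auto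
    then show ?case by (simp add: ennreal_mult mult_ac)
  qed
  also have "... = ennreal (2 ^ DIM('a)) * (\<integral>\<^sup>+y. F y * ennreal (dist x y powr (1 - real DIM('a))) \<partial>lborel)"
    by (rule nn_integral_cmult) measurable
  finally show ?thesis .
qed

text \<open>With directions of length at most \<rho>, a point y is reached no earlier than s = |y -
  x|/\<rho>, and integrating s^(-n) from there on gives the power 1 - n. The gain of a factor
  1/(n-1) is discarded.\<close>

lemma cone_integral_segment:
  fixes F :: "'a::euclidean_space \<Rightarrow> ennreal"
  assumes [measurable]: "F \<in> borel_measurable borel" and \<rho>: "0 < \<rho>" and dim: "2 \<le> DIM('a)"
  shows "(\<integral>\<^sup>+v. indicator (cball 0 \<rho>) v * (\<integral>\<^sup>+s. indicator {0<..1} s * F (x + s *\<^sub>R v) \<partial>lborel) \<partial>lborel)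
    \<le> ennreal (\<rho> ^ (DIM('a) - 1)) * (\<integral>\<^sup>+y. F y * ennreal (dist x y powr (1 - real DIM('a))) \<partial>lborel)"
proof -
  let ?n = "real DIM('a)"
  have sets_cball [measurable]: "cball (0::'a) \<rho> \<in> sets borel" by simp
  have "(\<integral>\<^sup>+v. indicator (cball 0 \<rho>) v * (\<integral>\<^sup>+s. indicator {0<..1} s * F (x + s *\<^sub>R v) \<partial>lborel) \<partial>lborel) =
     (\<integral>\<^sup>+v. (\<integral>\<^sup>+s. indicator {0<..} s * (indicator {..1} s * indicator (cball 0 \<rho>) v) * F (x + s *\<^sub>R v) \<partial>lborel) \<partial>lborel)"
    by (intro nn_integral_cong, subst nn_integral_cmult[symmetric]) (auto simp: indicator_def intro!: nn_integral_cong)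
  also have "... = (\<integral>\<^sup>+y. F y * (\<integral>\<^sup>+s. indicator {0<..} s * (indicator {..1} s * indicator (cball 0 \<rho>) ((1 / s) *\<^sub>R (y - x))) * ennreal (s powr - ?n) \<partial>lborel) \<partial>lborel)"
    by (rule cone_change_of_variables) (simp_all add: split_beta')
  also have "... \<le> (\<integral>\<^sup>+y. ennreal (\<rho> ^ (DIM('a) - 1)) * (F y * ennreal (dist x y powr (1 - ?n))) \<partial>lborel)"
  proof (rule nn_integral_mono_AE, goal_cases)
    case 1
    have "AE y in lborel. y \<noteq> x" by (rule AE_lborel_singleton)
    then show ?case
    proof eventually_elim
      case (elim y)
      let ?c = "dist x y / \<rho>"
      have c: "0 < ?c" using elim \<rho> by simp
      have "(\<integral>\<^sup>+s. indicator {0<..} s * (indicator {..1} s * indicator (cball 0 \<rho>) ((1 / s) *\<^sub>R (y - x))) * ennreal (s powr - ?n) \<partial>lborel)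
        \<le> (\<integral>\<^sup>+s. ennreal ((?n - 1) * s powr (- (?n - 1) - 1)) * indicator {?c..} s \<partial>lborel)"
      proof (rule nn_integral_mono, goal_cases)
        case (1 s)
        show ?case
        proof (cases "0 < s \<and> (1 / s) *\<^sub>R (y - x) \<in> cball 0 \<rho> \<and> s \<le> 1")
          case True
          then have "norm ((1 / s) *\<^sub>R (y - x)) = dist x y / s" by (simp add: dist_norm norm_minus_commute)
          with True have "dist x y / s \<le> \<rho>" by (metis mem_cball_0)
          then have s: "?c \<le> s" using \<rho> True by (simp add: field_simps)
          have "1 * s powr - ?n \<le> (?n - 1) * s powr - ?n" using dim by (intro mult_right_mono) auto
          then show ?thesis using s True by (auto simp: ennreal_leI indicator_def)
        qed (auto simp: indicator_def)
      qed
      also have "... = ennreal (?c powr - (?n - 1))" using dim c by (intro nn_integral_powr_to_inf) auto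
      also have "?c powr - (?n - 1) = \<rho> ^ (DIM('a) - 1) * dist x y powr (1 - ?n)"
        using \<rho> elim dim by (simp add: powr_divide powr_minus powr_diff powr_realpow[symmetric] of_nat_diff field_simps)
      finally have "F y * (\<integral>\<^sup>+s. indicator {0<..} s * (indicator {..1} s * indicator (cball 0 \<rho>) ((1 / s) *\<^sub>R (y - x))) * ennreal (s powr - ?n) \<partial>lborel)
        \<le> F y * ennreal (\<rho> ^ (DIM('a) - 1) * dist x y powr (1 - ?n))" by (rule mult_left_mono) auto
      then show ?case using \<rho> by (simp add: ennreal_mult mult_ac)
    qed
  qed
  also have "... = ennreal (\<rho> ^ (DIM('a) - 1)) * (\<integral>\<^sup>+y. F y * ennreal (dist x y powr (1 - ?n)) \<partial>lborel)"
    by (rule nn_integral_cmult) measurable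
  finally show ?thesis .
qed

text \<open>On a ball far from the pole the kernel changes by a bounded factor. If \<rho> > d/2,
  with d the distance of centre and pole, its integral is at most n w \<rho> (w the volume of the
  unit ball), and \<rho>^(1-n) \<le> (d/2)^(1-n). This control of means by the value at the centre
  lets potentials survive averaging.\<close>

lemma kernel_ball_average:
  fixes x0 y :: "'a::euclidean_space"
  assumes dim: "2 \<le> DIM('a)" and \<rho>: "0 < \<rho>" and ne: "y \<noteq> x0"
  shows "(\<integral>\<^sup>+x. ennreal (dist x y powr (1 - real DIM('a))) * indicator (ball x0 \<rho>) x \<partial>lborel)
    \<le> ennreal (real DIM('a) * 2 ^ DIM('a) * dist x0 y powr (1 - real DIM('a))) * emeasure lborel (ball x0 \<rho>)"
proof -
  let ?n = "real DIM('a)" and ?w = "unit_ball_vol (real DIM('a))" and ?d = "dist x0 y"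
  have w: "0 < ?w" by (rule unit_ball_vol_pos) simp
  have d: "0 < ?d" using ne by simp
  have vol: "emeasure lborel (ball x0 \<rho>) = ennreal (?w * \<rho> powr ?n)" using \<rho> by (simp add: emeasure_ball powr_realpow)
  have two: "(?d / 2) powr (1 - ?n) \<le> 2 ^ DIM('a) * ?d powr (1 - ?n)"
  proof -
    have "(?d / 2) powr (1 - ?n) = 2 ^ DIM('a) * ?d powr (1 - ?n) / 2"
      using d by (simp add: powr_divide powr_minus powr_diff powr_realpow field_simps)
    also have "... \<le> 2 ^ DIM('a) * ?d powr (1 - ?n)" by simp
    finally show ?thesis .
  qed
  show ?thesis
  proof (cases "2 * \<rho> \<le> ?d")
    case True
    have "(\<integral>\<^sup>+x. ennreal (dist x y powr (1 - ?n)) * indicator (ball x0 \<rho>) x \<partial>lborel)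
      \<le> (\<integral>\<^sup>+x. ennreal (?n * 2 ^ DIM('a) * ?d powr (1 - ?n)) * indicator (ball x0 \<rho>) x \<partial>lborel)"
    proof (rule nn_integral_mono, goal_cases)
      case (1 x)
      show ?case
      proof (cases "x \<in> ball x0 \<rho>")
        case x: True
        have "?d \<le> dist x0 x + dist x y" by (rule dist_triangle)
        then have "?d / 2 \<le> dist x y" using x True by auto
        then have "dist x y powr (1 - ?n) \<le> (?d / 2) powr (1 - ?n)" using d dim by (intro powr_mono2') auto
        also note two
        also have "2 ^ DIM('a) * ?d powr (1 - ?n) \<le> ?n * (2 ^ DIM('a) * ?d powr (1 - ?n))"
          using dim mult_right_mono[of 1 ?n "2 ^ DIM('a) * ?d powr (1 - ?n)"] by simp
        finally show ?thesis using x by (simp add: ennreal_leI mult.assoc)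
      qed auto
    qed
    also have "... = ennreal (?n * 2 ^ DIM('a) * ?d powr (1 - ?n)) * emeasure lborel (ball x0 \<rho>)"
      by (subst nn_integral_cmult_indicator) auto
    finally show ?thesis .
  next
    case False
    have "(\<integral>\<^sup>+x. ennreal (dist x y powr (- (?n - 1))) * indicator (ball x0 \<rho>) x \<partial>lborel)
      \<le> ennreal (?n / (?n - (?n - 1)) * ?w powr ((?n - 1) / ?n) * (?w * \<rho> powr ?n) powr (1 - (?n - 1) / ?n))"
    proof (rule kernel_integral_bound)
      show "emeasure lborel (ball x0 \<rho> \<inter> cball y t) \<le> ennreal (?w * t powr ?n)" if "0 < t" for t
      proof -
        have "emeasure lborel (ball x0 \<rho> \<inter> cball y t) \<le> emeasure lborel (cball y t)" by (intro emeasure_mono) auto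
        also have "... = ennreal (?w * t powr ?n)" using that by (simp add: emeasure_cball powr_realpow)
        finally show ?thesis .
      qed
    qed (use dim w \<rho> vol in \<open>auto simp: sigma_finite_lborel\<close>)
    also have "?n / (?n - (?n - 1)) * ?w powr ((?n - 1) / ?n) * (?w * \<rho> powr ?n) powr (1 - (?n - 1) / ?n) = ?n * ?w * \<rho>"
    proof -
      have e: "1 - (?n - 1) / ?n = 1 / ?n" using dim by (simp add: field_simps)
      have "?w powr ((?n - 1) / ?n) * ?w powr (1 / ?n) = ?w"
        using w dim by (subst powr_add[symmetric]) (simp add: field_simps)
      then show ?thesis using w \<rho> dim unfolding e by (simp add: powr_mult powr_powr mult_ac)
    qed
    also have "ennreal (?n * ?w * \<rho>) \<le> ennreal (?n * 2 ^ DIM('a) * ?d powr (1 - ?n)) * emeasure lborel (ball x0 \<rho>)"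
    proof -
      have "\<rho> powr (1 - ?n) \<le> (?d / 2) powr (1 - ?n)" using d dim False by (intro powr_mono2') auto
      also note two
      finally have "\<rho> powr (1 - ?n) * \<rho> powr ?n \<le> 2 ^ DIM('a) * ?d powr (1 - ?n) * \<rho> powr ?n"
        by (rule mult_right_mono) auto
      moreover have "\<rho> powr (1 - ?n) * \<rho> powr ?n = \<rho>" using \<rho> by (simp add: powr_add[symmetric])
      ultimately have "\<rho> \<le> 2 ^ DIM('a) * ?d powr (1 - ?n) * \<rho> powr ?n" by simp
      then have "(?n * ?w) * \<rho> \<le> (?n * ?w) * (2 ^ DIM('a) * ?d powr (1 - ?n) * \<rho> powr ?n)"
        using w by (intro mult_left_mono) auto
      then show ?thesis unfolding vol using w by (simp add: ennreal_mult'[symmetric] ennreal_leI mult_ac)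
    qed
    finally show ?thesis by simp
  qed
qed

section \<open>Weak and strong type estimates for functions bounded by a level plus a
  remainder\<close>

section \<open>Interpolation\<close>

text \<open>Where \<phi> \<ge> 2a the remainder \<open>J\<close> is at least a, so the measure m of
  this set satisfies a m \<le> B m^(1-1/\<kappa>) T; dividing by m^(1-1/\<kappa>), legitimate as the
  measure is finite, gives the claim.\<close>

lemma weak_type_level:
  fixes \<phi> :: "'a \<Rightarrow> real" and J :: "'a \<Rightarrow> ennreal"
  assumes "finite_measure M" and [measurable]: "\<phi> \<in> borel_measurable M" "J \<in> borel_measurable M"
    and bd: "AE x in M. ennreal (\<phi> x) \<le> ennreal a + J x" and a: "0 < a" and \<kappa>: "1 < \<kappa>"
    and B: "0 \<le> B" "0 \<le> T"
    and J: "\<And>E. E \<in> sets M \<Longrightarrow>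
      (\<integral>\<^sup>+x. J x * indicator E x \<partial>M) \<le> ennreal (B * measure M E powr (1 - 1 / \<kappa>) * T)"
  shows "emeasure M {x \<in> space M. 2 * a \<le> \<phi> x} \<le> ennreal ((B * T / a) powr \<kappa>)"
proof -
  interpret finite_measure M by fact
  define E where "E = {x \<in> space M. 2 * a \<le> \<phi> x}"
  have [measurable]: "E \<in> sets M" by (simp add: E_def)
  define m where "m = measure M E"
  have "ennreal (a * m) = (\<integral>\<^sup>+x. ennreal a * indicator E x \<partial>M)"
    using a by (subst nn_integral_cmult_indicator) (auto simp: m_def emeasure_eq_measure ennreal_mult)
  also have "... \<le> (\<integral>\<^sup>+x. J x * indicator E x \<partial>M)"
  proof (rule nn_integral_mono_AE, goal_cases)
    case 1
    show ?case using bd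
    proof eventually_elim
      case (elim x)
      show ?case
      proof (cases "x \<in> E")
        case True
        then have "ennreal a + ennreal a \<le> ennreal (\<phi> x)"
          using a by (subst ennreal_plus[symmetric]) (auto simp: E_def intro!: ennreal_leI)
        also note elim
        finally show ?thesis using True by (simp add: ennreal_add_left_cancel_le)
      qed auto
    qed
  qed
  also have "... \<le> ennreal (B * m powr (1 - 1 / \<kappa>) * T)" unfolding m_def by (rule J) simp
  finally have le: "a * m \<le> B * m powr (1 - 1 / \<kappa>) * T" using B by (simp add: ennreal_le_iff)
  have "m \<le> (B * T / a) powr \<kappa>"
  proof (cases "m = 0")
    case False
    then have m: "0 < m" by (simp add: m_def less_le)
    have "m powr (1 / \<kappa>) = m / m powr (1 - 1 / \<kappa>)" using m by (simp add: powr_diff)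
    also have "... \<le> B * T / a" using le m a by (simp add: field_simps)
    finally have "(m powr (1 / \<kappa>)) powr \<kappa> \<le> (B * T / a) powr \<kappa>" using \<kappa> by (intro powr_mono2) auto
    then show ?thesis using m \<kappa> by (simp add: powr_powr)
  qed simp
  then show ?thesis unfolding E_def[symmetric] emeasure_eq_measure m_def by (rule ennreal_leI)
qed

text \<open>A Chebyshev bound: where |f| > l, the factor |f|^(1-p) is at most l^(1-p).\<close>

lemma truncated_integral_bound:
  fixes f :: "'b \<Rightarrow> real"
  assumes [measurable]: "f \<in> borel_measurable N" and l: "0 < l" and p: "1 \<le> p" and Np: "0 \<le> Np"
    and fN: "(\<integral>\<^sup>+y. ennreal (\<bar>f y\<bar> powr p) \<partial>N) \<le> ennreal Np"
  shows "(\<integral>\<^sup>+y. ennreal \<bar>f y\<bar> * indicator {y. l < \<bar>f y\<bar>} y \<partial>N) \<le> ennreal (l powr (1 - p) * Np)"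
proof -
  have "(\<integral>\<^sup>+y. ennreal \<bar>f y\<bar> * indicator {y. l < \<bar>f y\<bar>} y \<partial>N) \<le>
     (\<integral>\<^sup>+y. ennreal (l powr (1 - p)) * ennreal (\<bar>f y\<bar> powr p) \<partial>N)"
  proof (rule nn_integral_mono, goal_cases)
    case (1 y)
    show ?case
    proof (cases "l < \<bar>f y\<bar>")
      case True
      have "\<bar>f y\<bar> = \<bar>f y\<bar> powr (1 - p) * \<bar>f y\<bar> powr p" using True l by (simp add: powr_add[symmetric])
      also have "... \<le> l powr (1 - p) * \<bar>f y\<bar> powr p" using True l p by (intro mult_right_mono powr_mono2') auto
      finally show ?thesis using True by (simp add: ennreal_mult'[symmetric] ennreal_leI)
    qed auto
  qed
  also have "... = ennreal (l powr (1 - p)) * (\<integral>\<^sup>+y. ennreal (\<bar>f y\<bar> powr p) \<partial>N)" by (rule nn_integral_cmult) simp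
  also have "... \<le> ennreal (l powr (1 - p)) * ennreal Np" by (rule mult_left_mono[OF fN]) simp
  finally show ?thesis using Np by (simp add: ennreal_mult)
qed

text \<open>As in the Marcinkiewicz theorem, the truncation level \<open>l\<close> is tied to the height
  \<open>2 * A * l powr \<theta>\<close> of \<open>\<phi>\<close>.\<close>

lemma strong_type_interpolation:
  fixes \<phi> :: "'a \<Rightarrow> real" and f :: "'b \<Rightarrow> real" and J :: "real \<Rightarrow> 'a \<Rightarrow> ennreal"
  assumes M: "finite_measure M" and N: "sigma_finite_measure N"
    and [measurable]: "\<phi> \<in> borel_measurable M" "\<And>l. J l \<in> borel_measurable M" "f \<in> borel_measurable N"
    and \<phi>: "\<And>x. 0 \<le> \<phi> x"
    and bd: "\<And>l. 0 < l \<Longrightarrow> AE x in M. ennreal (\<phi> x) \<le> ennreal (A * l powr \<theta>) + J l x"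
    and A: "0 < A" and B: "0 < B" and \<kappa>: "1 < \<kappa>" and p: "1 < p" and \<theta>: "0 < \<theta>" and Np: "0 \<le> Np"
    and fN: "(\<integral>\<^sup>+y. ennreal (\<bar>f y\<bar> powr p) \<partial>N) \<le> ennreal Np"
    and J: "\<And>l E. 0 < l \<Longrightarrow> E \<in> sets M \<Longrightarrow>
      (\<integral>\<^sup>+x. J l x * indicator E x \<partial>M) \<le> ennreal (B * measure M E powr (1 - 1 / \<kappa>)) *
        (\<integral>\<^sup>+y. ennreal \<bar>f y\<bar> * indicator {y. l < \<bar>f y\<bar>} y \<partial>N)"
    and Q: "Q * \<theta> = \<kappa> * (\<theta> + p - 1)"
  shows "(\<integral>\<^sup>+x. ennreal (\<phi> x powr Q) \<partial>M) \<le>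
    ennreal ((2 * A) powr Q * (\<theta> * Q) * (B / A) powr \<kappa> * Np powr \<kappa> / (p - 1))"
proof -
  let ?E = "\<lambda>l. {x \<in> space M. 2 * (A * l powr \<theta>) \<le> \<phi> x}"
  let ?k = "\<lambda>y l. ennreal \<bar>f y\<bar> * indicator {z. 0 < snd z \<and> snd z < \<bar>f (fst z)\<bar>} (y, l)"
  interpret M: finite_measure M by fact
  interpret N: sigma_finite_measure N by fact
  interpret P: pair_sigma_finite M lborel ..
  interpret PN: pair_sigma_finite N lborel ..
  define T where "T l = (\<integral>\<^sup>+y. ennreal \<bar>f y\<bar> * indicator {y. l < \<bar>f y\<bar>} y \<partial>N)" for l
  have "0 < \<kappa> * (\<theta> + p - 1)" using \<kappa> \<theta> p by simp
  then have Q0: "0 < Q" using \<theta> Q by (metis zero_less_mult_pos2)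
  define b where "b = \<theta> * Q"
  let ?h = "\<lambda>x l. ennreal (b * l powr (b - 1)) * indicator {z. 0 \<le> snd z \<and> 2 * (A * snd z powr \<theta>) \<le> \<phi> (fst z)} (x, l)"
  have b: "0 < b" using \<theta> Q0 by (simp add: b_def)
  have Tle: "T l \<le> ennreal (l powr (1 - p) * Np)" if "0 < l" for l
    unfolding T_def by (rule truncated_integral_bound) (use that p Np fN in auto)
  have level: "emeasure M (?E l)
      \<le> ennreal ((B / (A * l powr \<theta>)) powr \<kappa> * (l powr (1 - p) * Np) powr (\<kappa> - 1)) * T l" if l: "0 < l" for l
  proof -
    define t where "t = enn2real (T l)"
    have Tfin: "T l < top" using Tle[OF l] by (rule le_less_trans) simp
    then have t: "T l = ennreal t" by (simp add: t_def ennreal_enn2real_if less_top[symmetric])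
    have t0: "0 \<le> t" by (simp add: t_def)
    have tle: "t \<le> l powr (1 - p) * Np" using Tle[OF l] Np unfolding t by (simp add: ennreal_le_iff)
    have "emeasure M (?E l) \<le> ennreal ((B * t / (A * l powr \<theta>)) powr \<kappa>)"
    proof (rule weak_type_level)
      show "AE x in M. ennreal (\<phi> x) \<le> ennreal (A * l powr \<theta>) + J l x" by (rule bd[OF l])
      show "(\<integral>\<^sup>+x. J l x * indicator E x \<partial>M) \<le> ennreal (B * measure M E powr (1 - 1 / \<kappa>) * t)"
        if "E \<in> sets M" for E using J[OF l that] t0 B by (simp add: T_def[symmetric] t ennreal_mult)
    qed (use A B l \<kappa> t0 M in auto)
    also have "(B * t / (A * l powr \<theta>)) powr \<kappa> = (B / (A * l powr \<theta>)) powr \<kappa> * t powr \<kappa>"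
      using A B l t0 by (simp add: powr_mult[symmetric])
    \<comment> \<open>Only one power of the tail integral is kept; the other \<kappa> - 1 are spent
      on the Chebyshev bound. What remains is linear in the tail integral, so Tonelli applies to
      it.\<close>
    also have "t powr \<kappa> \<le> (l powr (1 - p) * Np) powr (\<kappa> - 1) * t"
    proof (cases "t = 0")
      case False
      then have "t powr \<kappa> = t powr (\<kappa> - 1) * t" using t0 by (simp add: powr_diff)
      also have "... \<le> (l powr (1 - p) * Np) powr (\<kappa> - 1) * t" using t0 tle \<kappa> by (intro mult_right_mono powr_mono2) auto
      finally show ?thesis .
    qed simp
    then have "ennreal ((B / (A * l powr \<theta>)) powr \<kappa> * t powr \<kappa>) \<le>
      ennreal ((B / (A * l powr \<theta>)) powr \<kappa> * ((l powr (1 - p) * Np) powr (\<kappa> - 1) * t))"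
      by (intro ennreal_leI mult_left_mono) auto
    finally show ?thesis using t0 by (simp add: t ennreal_mult mult.assoc)
  qed
  \<comment> \<open>Layer cake in the truncation level instead of the height: \<phi> = 2 A
    L^\<theta> defines L, and with b = \<theta> Q the power \<phi>^Q is (2A)^Q times the integral of
    b l^(b-1) over [0, L].\<close>
  have lc: "ennreal (\<phi> x powr Q) = (\<integral>\<^sup>+l. ennreal ((2 * A) powr Q) *
       (?h x l) \<partial>lborel)" for x
  proof -
    define L where "L = (\<phi> x / (2 * A)) powr (1 / \<theta>)"
    have iff: "0 \<le> l \<Longrightarrow> 2 * (A * l powr \<theta>) \<le> \<phi> x \<longleftrightarrow> l \<le> L" for l
    proof -
      assume l: "0 \<le> l"
      have "2 * (A * l powr \<theta>) \<le> \<phi> x \<longleftrightarrow> l powr \<theta> \<le> \<phi> x / (2 * A)" using A by (simp add: field_simps)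
      also have "\<phi> x / (2 * A) = L powr \<theta>" using \<theta> A \<phi>[of x] by (simp add: L_def powr_powr)
      also have "l powr \<theta> \<le> L powr \<theta> \<longleftrightarrow> l \<le> L" using powr_mono2[of \<theta> l L] powr_less_mono2[of \<theta> L l] \<theta> l
        by (cases "l \<le> L") (auto simp: L_def)
      finally show ?thesis .
    qed
    have "(\<integral>\<^sup>+l. ennreal ((2 * A) powr Q) *
       (?h x l) \<partial>lborel)
      = (\<integral>\<^sup>+l. ennreal ((2 * A) powr Q) * (ennreal (b * l powr (b - 1)) * indicator {0..L} l) \<partial>lborel)"
      using iff by (intro nn_integral_cong) (auto simp: indicator_def)
    also have "... = ennreal ((2 * A) powr Q) * ennreal (L powr b)"
      by (subst nn_integral_cmult, measurable) (simp add: nn_integral_powr_from_0 b L_def)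
    also have "L powr b = (\<phi> x / (2 * A)) powr Q" using \<theta> by (simp add: L_def powr_powr b_def)
    also have "ennreal ((2 * A) powr Q) * ennreal ((\<phi> x / (2 * A)) powr Q) = ennreal (\<phi> x powr Q)"
      using A \<phi>[of x] by (simp add: ennreal_mult[symmetric] powr_mult[symmetric])
    finally show ?thesis by simp
  qed
  have "(\<integral>\<^sup>+x. ennreal (\<phi> x powr Q) \<partial>M) = (\<integral>\<^sup>+l. (\<integral>\<^sup>+x. ennreal ((2 * A) powr Q) *
       (?h x l) \<partial>M) \<partial>lborel)" unfolding lc by (rule P.Fubini'[symmetric]) (simp add: split_beta', measurable)
  also have "... \<le> (\<integral>\<^sup>+l. ennreal ((2 * A) powr Q * b * (B / A) powr \<kappa> * Np powr (\<kappa> - 1)) *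
      (ennreal (l powr (p - 2)) * (indicator {0<..} l * T l)) \<partial>lborel)"
  proof (rule nn_integral_mono_AE, goal_cases)
    case 1
    have "AE l in lborel. l \<noteq> (0::real)" by (rule AE_lborel_singleton)
    then show ?case
    proof eventually_elim
      case (elim l)
      show ?case
      proof (cases "0 < l")
        case True
        have "(\<integral>\<^sup>+x. ennreal ((2 * A) powr Q) *
          (?h x l) \<partial>M)
          = (\<integral>\<^sup>+x. ennreal ((2 * A) powr Q * (b * l powr (b - 1))) * indicator (?E l) x \<partial>M)"
          using True b by (intro nn_integral_cong) (auto simp: indicator_def ennreal_mult)
        also have "... = ennreal ((2 * A) powr Q * (b * l powr (b - 1))) * emeasure M (?E l)"
          by (rule nn_integral_cmult_indicator) simp
        also have "... \<le> ennreal ((2 * A) powr Q * (b * l powr (b - 1))) *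
          (ennreal ((B / (A * l powr \<theta>)) powr \<kappa> * (l powr (1 - p) * Np) powr (\<kappa> - 1)) * T l)"
          by (intro mult_left_mono level True) auto
        also have "... = ennreal ((2 * A) powr Q * (b * l powr (b - 1)) *
          ((B / (A * l powr \<theta>)) powr \<kappa> * (l powr (1 - p) * Np) powr (\<kappa> - 1))) * T l"
          using b by (simp add: ennreal_mult mult.assoc)
        also have "(2 * A) powr Q * (b * l powr (b - 1)) *
          ((B / (A * l powr \<theta>)) powr \<kappa> * (l powr (1 - p) * Np) powr (\<kappa> - 1)) =
          (2 * A) powr Q * b * (B / A) powr \<kappa> * Np powr (\<kappa> - 1) * l powr (p - 2)"
        proof -
          \<comment> \<open>The hypothesis on \<open>Q\<close> is exactly what makes the exponents
            add up to p - 2.\<close>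
          have "l powr (b - 1) * (l powr (- (\<theta> * \<kappa>)) * l powr ((1 - p) * (\<kappa> - 1))) = l powr (p - 2)"
            unfolding powr_add[symmetric]
            by (rule arg_cong[where f = "\<lambda>e. l powr e"]) (use Q in \<open>simp add: b_def algebra_simps\<close>)
          moreover have "(B / (A * l powr \<theta>)) powr \<kappa> = (B / A) powr \<kappa> * l powr (- (\<theta> * \<kappa>))"
            using True A B by (simp add: powr_divide powr_mult powr_powr powr_minus field_simps)
          moreover have "(l powr (1 - p) * Np) powr (\<kappa> - 1) = l powr ((1 - p) * (\<kappa> - 1)) * Np powr (\<kappa> - 1)"
            using True Np by (simp add: powr_mult powr_powr)
          ultimately show ?thesis by (simp add: mult_ac)
        qed
        finally show ?thesis using True b by (simp add: ennreal_mult mult.assoc)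
      next
        case False
        with elim show ?thesis by (simp add: indicator_def)
      qed
    qed
  qed
  also have "... = ennreal ((2 * A) powr Q * b * (B / A) powr \<kappa> * Np powr (\<kappa> - 1)) *
      (\<integral>\<^sup>+l. (\<integral>\<^sup>+y. ennreal (l powr (p - 2)) * ?k y l \<partial>N) \<partial>lborel)"
  proof -
    have "ennreal (l powr (p - 2)) * (indicator {0<..} l * T l) =
      (\<integral>\<^sup>+y. ennreal (l powr (p - 2)) * ?k y l \<partial>N)" for l
    proof -
      have "ennreal (l powr (p - 2)) * (indicator {0<..} l * T l) =
       (\<integral>\<^sup>+y. ennreal (l powr (p - 2)) * (indicator {0<..} l * (ennreal \<bar>f y\<bar> * indicator {y. l < \<bar>f y\<bar>} y)) \<partial>N)"
        unfolding T_def by (simp add: nn_integral_cmult)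
      also have "... = (\<integral>\<^sup>+y. ennreal (l powr (p - 2)) * ?k y l \<partial>N)"
        by (intro nn_integral_cong) (auto simp: indicator_def)
      finally show ?thesis .
    qed
    then show ?thesis
      by (simp only:) (rule nn_integral_cmult, rule N.borel_measurable_nn_integral, simp add: split_beta', measurable)
  qed
  also have "(\<integral>\<^sup>+l. (\<integral>\<^sup>+y. ennreal (l powr (p - 2)) * ?k y l \<partial>N) \<partial>lborel)
     = (\<integral>\<^sup>+y. (\<integral>\<^sup>+l. ennreal (l powr (p - 2)) * ?k y l \<partial>lborel) \<partial>N)"
    by (rule PN.Fubini') (simp add: split_beta', measurable)
  \<comment> \<open>Integrating l^(p-2) over the levels below |f| yields |f|^(p-1)/(p-1);
    convergence at l = 0 is where p > 1 enters.\<close>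
  also have "... \<le> (\<integral>\<^sup>+y. ennreal (1 / (p - 1)) * ennreal (\<bar>f y\<bar> powr p) \<partial>N)"
  proof (rule nn_integral_mono, goal_cases)
    case (1 y)
    have "(\<integral>\<^sup>+l. ennreal (l powr (p - 2)) * ?k y l \<partial>lborel)
      \<le> (\<integral>\<^sup>+l. ennreal (\<bar>f y\<bar> / (p - 1)) * (ennreal ((p - 1) * l powr ((p - 1) - 1)) * indicator {0..\<bar>f y\<bar>} l) \<partial>lborel)"
    proof (rule nn_integral_mono, goal_cases)
      case (1 l)
      have "ennreal (\<bar>f y\<bar> / (p - 1)) * ennreal ((p - 1) * l powr ((p - 1) - 1)) = ennreal (l powr (p - 2)) * ennreal \<bar>f y\<bar>"
        using p by (simp add: ennreal_mult[symmetric])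
      then show ?case by (auto simp: indicator_def)
    qed
    also have "... = ennreal (\<bar>f y\<bar> / (p - 1)) * ennreal (\<bar>f y\<bar> powr (p - 1))"
      by (subst nn_integral_cmult, measurable) (use p nn_integral_powr_from_0[of "p - 1" "\<bar>f y\<bar>"] in simp)
    also have "... = ennreal (1 / (p - 1)) * ennreal (\<bar>f y\<bar> powr p)"
      using p by (cases "f y = 0") (auto simp: ennreal_mult[symmetric] powr_diff)
    finally show ?case .
  qed
  also have "... \<le> ennreal (1 / (p - 1)) * ennreal Np" by (subst nn_integral_cmult) (auto intro!: mult_left_mono fN)
  finally have "(\<integral>\<^sup>+x. ennreal (\<phi> x powr Q) \<partial>M) \<le>
    ennreal ((2 * A) powr Q * b * (B / A) powr \<kappa> * Np powr (\<kappa> - 1)) * (ennreal (1 / (p - 1)) * ennreal Np)"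
    by (simp add: mult_left_mono)
  also have "... = ennreal ((2 * A) powr Q * b * (B / A) powr \<kappa> * (Np powr (\<kappa> - 1) * Np) / (p - 1))"
    using b p Np by (simp add: ennreal_mult[symmetric])
  also have "Np powr (\<kappa> - 1) * Np = Np powr \<kappa>" using Np by (cases "Np = 0") (auto simp: powr_diff)
  finally show ?thesis by (simp add: b_def)
qed

section \<open>Rays leaving an open set, measurably in point and direction\<close>

section \<open>Exit points of rays\<close>

definition stays :: "'a::real_normed_vector set \<Rightarrow> 'a \<Rightarrow> 'a \<Rightarrow> real \<Rightarrow> bool" where
  "stays U x v t \<longleftrightarrow> (\<forall>s\<in>{0..t}. x + s *\<^sub>R v \<in> U)"

definition leaves :: "'a::real_normed_vector set \<Rightarrow> 'a \<Rightarrow> 'a \<Rightarrow> bool" where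
  "leaves U x v \<longleftrightarrow> x \<in> U \<and> (\<exists>t\<ge>0. \<not> stays U x v t)"

definition exit_time :: "'a::real_normed_vector set \<Rightarrow> 'a \<Rightarrow> 'a \<Rightarrow> real" where
  "exit_time U x v = (if leaves U x v then Sup {t. 0 \<le> t \<and> stays U x v t} else 0)"

definition exit_point :: "'a::real_normed_vector set \<Rightarrow> 'a \<Rightarrow> 'a \<Rightarrow> 'a" where
  "exit_point U x v = x + exit_time U x v *\<^sub>R v"

lemma stays_antimono: "stays U x v t \<Longrightarrow> s \<le> t \<Longrightarrow> stays U x v s" by (auto simp: stays_def)

text \<open>The complement is the projection along the compact interval [0, t] of a closed set.
  Openness jointly in point and direction makes the exit quantities measurable on the product, as
  the exchanges of almost-everywhere quantifiers over x and v require.\<close>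

lemma open_stays:
  fixes U :: "'a::euclidean_space set"
  assumes "open U"
  shows "open {p. stays U (fst p) (snd p) t}"
proof -
  let ?p = "(\<lambda>q::real \<times> 'a \<times> 'a. fst (snd q) + fst q *\<^sub>R snd (snd q))"
  have cont: "continuous_on UNIV ?p" by (intro continuous_intros)
  have "closed (?p -` (- U))" using continuous_closed_vimage[of "- U"] cont assms
    by (intro closed_vimage) (auto simp: closed_def[symmetric] continuous_on_eq_continuous_within intro: cont)
  from closed_compact_projection[OF compact_Icc this, of 0 t]
  have "closed {y. \<exists>s. s \<in> {0..t} \<and> (s, y) \<in> ?p -` (- U)}" .
  moreover have "{p. stays U (fst p) (snd p) t} =
     - {y. \<exists>s. s \<in> {0..t} \<and> (s, y) \<in> ?p -` (- U)}" by (auto simp: stays_def)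
  ultimately show ?thesis by (simp add: open_closed)
qed

text \<open>A stay up to t extends beyond t because the domain is open; therefore the inequality is
  strict, and the exit point itself lies outside.\<close>

lemma stays_iff:
  assumes "leaves U x v" "open U" "0 \<le> t"
  shows "stays U x v t \<longleftrightarrow> t < exit_time U x v"
proof -
  let ?S = "{t. 0 \<le> t \<and> stays U x v t}"
  obtain T where T: "0 \<le> T" "\<not> stays U x v T" using assms by (auto simp: leaves_def)
  have ub: "s \<le> T" if "s \<in> ?S" for s using that T stays_antimono[of U x v s T] by force
  then have bdd: "bdd_above ?S" by (auto simp: bdd_above_def)
  have ne: "0 \<in> ?S" using assms by (auto simp: stays_def leaves_def)
  show ?thesis
  proof
    assume st: "stays U x v t"
    then have "x + t *\<^sub>R v \<in> U" using assms(3) by (auto simp: stays_def)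
    moreover have "open ((\<lambda>s. x + s *\<^sub>R v) -` U)" by (intro open_vimage assms(2) continuous_intros)
    ultimately obtain d where d: "0 < d" "\<And>s. dist s t < d \<Longrightarrow> x + s *\<^sub>R v \<in> U" unfolding open_dist by auto
    have "stays U x v (t + d / 2)" unfolding stays_def
    proof
      fix s assume s: "s \<in> {0..t + d / 2}"
      show "x + s *\<^sub>R v \<in> U"
      proof (cases "s \<le> t")
        case True then show ?thesis using st s by (auto simp: stays_def)
      next
        case False then show ?thesis using d s by (auto simp: dist_real_def)
      qed
    qed
    then have "t + d / 2 \<le> Sup ?S" using assms(3) d bdd by (intro cSup_upper) auto
    then show "t < exit_time U x v" using assms(1) d by (simp add: exit_time_def)
  next
    assume "t < exit_time U x v"
    then have "t < Sup ?S" using assms(1) by (simp add: exit_time_def)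
    then obtain s where "s \<in> ?S" "t < s" using less_cSup_iff[of ?S t] ne bdd by blast
    then show "stays U x v t" using stays_antimono[of U x v s t] by auto
  qed
qed

lemma exit_time_pos: "leaves U x v \<Longrightarrow> open U \<Longrightarrow> 0 < exit_time U x v"
  using stays_iff[of U x v 0] by (auto simp: stays_def leaves_def)

lemma segment_before_exit:
  assumes "leaves U x v" "open U" "0 \<le> t" "t < exit_time U x v"
  shows "x + t *\<^sub>R v \<in> U"
  using stays_iff[OF assms(1,2,3)] assms by (auto simp: stays_def)

lemma exit_point_frontier:
  fixes U :: "'a::real_normed_vector set"
  assumes lv: "leaves U x v" and op: "open U"
  shows "exit_point U x v \<in> frontier U"
proof -
  let ?\<tau> = "exit_time U x v"
  have pos: "0 < ?\<tau>" by (rule exit_time_pos[OF lv op])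
  have "((\<lambda>t. x + t *\<^sub>R v) \<longlongrightarrow> x + ?\<tau> *\<^sub>R v) (at_left ?\<tau>)" by (intro tendsto_intros)
  moreover have "eventually (\<lambda>t. x + t *\<^sub>R v \<in> closure U) (at_left ?\<tau>)" using eventually_at_left_real[OF pos]
  proof eventually_elim
    case (elim t)
    then have "x + t *\<^sub>R v \<in> U" by (intro segment_before_exit[OF lv op]) auto
    then show ?case using closure_subset by blast
  qed
  ultimately have 1: "exit_point U x v \<in> closure U"
    unfolding exit_point_def by (intro Lim_in_closed_set[OF closed_closure]) auto
  have "exit_point U x v \<notin> U"
  proof
    assume a: "exit_point U x v \<in> U"
    have "stays U x v ?\<tau>" unfolding stays_def
    proof
      fix s assume "s \<in> {0..?\<tau>}"
      then show "x + s *\<^sub>R v \<in> U"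
        using a segment_before_exit[OF lv op, of s] by (cases "s = ?\<tau>") (auto simp: exit_point_def)
    qed
    then show False using stays_iff[OF lv op, of ?\<tau>] pos by simp
  qed
  with 1 op show ?thesis by (simp add: frontier_def interior_open)
qed

lemma leaves_measurable:
  fixes U :: "'a::euclidean_space set"
  assumes "open U"
  shows "{p. leaves U (fst p) (snd p)} \<in> sets (borel \<Otimes>\<^sub>M borel)"
proof -
  have "{p. leaves U (fst p) (snd p)} = (U \<times> UNIV) \<inter> (\<Union>k::nat. - {p. stays U (fst p) (snd p) (real k)})"
  proof (intro set_eqI iffI)
    fix p assume p: "p \<in> {p. leaves U (fst p) (snd p)}"
    then obtain t where t: "fst p \<in> U" "0 \<le> t" "\<not> stays U (fst p) (snd p) t" by (auto simp: leaves_def)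
    obtain k :: nat where "t \<le> real k" using real_arch_simple by blast
    then have "\<not> stays U (fst p) (snd p) (real k)" using t stays_antimono by blast
    then show "p \<in> (U \<times> UNIV) \<inter> (\<Union>k::nat. - {p. stays U (fst p) (snd p) (real k)})"
      using t by (auto simp: mem_Times_iff)
  qed (auto simp: leaves_def, meson of_nat_0_le_iff)
  also have "... \<in> sets borel" using open_stays[OF assms] assms
    by (intro sets.Int sets.countable_UN borel_open open_Times) (auto intro!: borel_open borel_closed simp: closed_def)
  finally show ?thesis by (simp add: borel_prod[symmetric])
qed

text \<open>By strictness in \<open>stays_iff\<close>, an exit time above c is witnessed by a stay
  up to a rational time above c, and staying up to a given time is an open condition.\<close>

lemma exit_time_measurable:
  fixes U :: "'a::euclidean_space set"
  assumes op: "open U"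
  shows "(\<lambda>p. exit_time U (fst p) (snd p)) \<in> borel_measurable (borel \<Otimes>\<^sub>M borel)"
proof (rule borel_measurableI_greater)
  fix c :: real
  have lm: "{p. leaves U (fst p) (snd p)} \<in> sets (borel :: ('a \<times> 'a) measure)"
    using leaves_measurable[OF op] by (simp add: borel_prod[symmetric])
  have st: "{p. stays U (fst p) (snd p) t} \<in> sets (borel :: ('a \<times> 'a) measure)" for t
    using open_stays[OF op] by (rule borel_open)
  have "{p. c < exit_time U (fst p) (snd p)} =
     (if c < 0 then UNIV else {p. leaves U (fst p) (snd p)} \<inter> (\<Union>q\<in>{q\<in>\<rat>. c < q}. {p. stays U (fst p) (snd p) q}))"
  proof (cases "c < 0")
    case True
    have "0 \<le> exit_time U (fst p) (snd p)" for p :: "'a \<times> 'a"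
      using exit_time_pos[OF _ op, of "fst p" "snd p"] by (cases "leaves U (fst p) (snd p)") (auto simp: exit_time_def)
    then show ?thesis using True by (auto intro: less_le_trans)
  next
    case False
    have "c < exit_time U x v \<longleftrightarrow> leaves U x v \<and> (\<exists>q\<in>{q\<in>\<rat>. c < q}. stays U x v q)" for x v
    proof
      assume a: "c < exit_time U x v"
      then have lv: "leaves U x v" using False by (auto simp: exit_time_def split: if_splits)
      obtain q where "q \<in> \<rat>" "c < q" "q < exit_time U x v" using Rats_dense_in_real[OF a] by blast
      then show "leaves U x v \<and> (\<exists>q\<in>{q\<in>\<rat>. c < q}. stays U x v q)" using stays_iff[OF lv op, of q] lv False by auto
    next
      assume "leaves U x v \<and> (\<exists>q\<in>{q\<in>\<rat>. c < q}. stays U x v q)"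
      then show "c < exit_time U x v" using stays_iff[OF _ op, of x v] False by force
    qed
    then show ?thesis using False by auto
  qed
  also have "... \<in> sets borel" using lm st countable_rat by (auto intro!: sets.countable_UN' countable_Collect)
  finally show "{p \<in> space (borel \<Otimes>\<^sub>M borel). c < exit_time U (fst p) (snd p)} \<in> sets (borel \<Otimes>\<^sub>M borel)"
    by (simp add: borel_prod[symmetric] space_pair_measure)
qed

lemma exit_point_measurable:
  fixes U :: "'a::euclidean_space set"
  assumes op: "open U"
  shows "(\<lambda>p. exit_point U (fst p) (snd p)) \<in> borel_measurable (borel \<Otimes>\<^sub>M borel)"
  unfolding exit_point_def using exit_time_measurable[OF op] by measurable

text \<open>The directions that never leave form a set Z with x + Z inside the domain, hence of
  finite measure, and Z is invariant under dilation by 2. Then |Z| = 2^n |Z| forces |Z| = 0.\<close>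

lemma AE_leaves:
  fixes U :: "'a::euclidean_space set"
  assumes op: "open U" and fin: "emeasure lborel U < \<infinity>" and x: "x \<in> U"
  shows "AE v in lborel. leaves U x v"
proof -
  define Z where "Z = {v. \<not> leaves U x v}"
  have Zeq: "Z = {v. \<forall>t\<ge>0. x + t *\<^sub>R v \<in> U}"
  proof -
    have "\<not> leaves U x v \<longleftrightarrow> (\<forall>t\<ge>0. x + t *\<^sub>R v \<in> U)" for v
    proof
      assume nl: "\<not> leaves U x v"
      show "\<forall>t\<ge>0. x + t *\<^sub>R v \<in> U"
      proof (intro allI impI)
        fix t :: real assume "0 \<le> t"
        with nl x have "stays U x v t" by (auto simp: leaves_def)
        then show "x + t *\<^sub>R v \<in> U" using \<open>0 \<le> t\<close> by (auto simp: stays_def)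
      qed
    qed (auto simp: leaves_def stays_def)
    then show ?thesis by (simp add: Z_def)
  qed
  have [measurable]: "Z \<in> sets borel"
  proof -
    have "(\<lambda>v::'a. (x, v)) \<in> borel \<rightarrow>\<^sub>M borel \<Otimes>\<^sub>M borel" by measurable
    from measurable_sets[OF this leaves_measurable[OF op]]
    have "{v. leaves U x v} \<in> sets borel" by (simp add: vimage_def)
    then have "- {v. leaves U x v} \<in> sets borel" by (rule borel_comp)
    then show ?thesis by (simp add: Z_def Collect_neg_eq)
  qed
  have "(+) x ` Z \<subseteq> U" using Zeq by (auto dest!: spec[of _ 1])
  have tr: "(+) (- x) -` Z \<inter> space lborel \<subseteq> U" using Zeq by (auto dest!: spec[of _ 1])
  have "emeasure lborel Z = emeasure (distr lborel borel ((+) (- x))) Z" by (simp add: lborel_distr_plus)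
  also have "... = emeasure lborel ((+) (- x) -` Z \<inter> space lborel)" by (rule emeasure_distr) auto
  also have "... \<le> emeasure lborel U" using op by (intro emeasure_mono tr) auto
  finally have Zfin: "emeasure lborel Z < \<infinity>" using fin by simp
  have scal: "(\<lambda>v. 0 + 2 *\<^sub>R v) -` Z \<inter> space (lborel :: 'a measure) = Z"
  proof (intro set_eqI iffI)
    fix v assume "v \<in> (\<lambda>v. 0 + 2 *\<^sub>R v) -` Z \<inter> space (lborel :: 'a measure)"
    then have "\<forall>t\<ge>0. x + (t * 2) *\<^sub>R v \<in> U" by (simp add: Zeq)
    then have "x + ((t / 2) * 2) *\<^sub>R v \<in> U" if "0 \<le> t" for t using that by (meson divide_nonneg_nonneg zero_le_numeral)
    then show "v \<in> Z" by (simp add: Zeq)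
  qed (auto simp: Zeq)
  have "emeasure lborel Z = emeasure (density (distr lborel borel (\<lambda>v. 0 + 2 *\<^sub>R v)) (\<lambda>_. ennreal (\<bar>2\<bar> ^ DIM('a)))) Z"
    by (subst lborel_affine[of 2 0]) auto
  also have "... = ennreal (2 ^ DIM('a)) * emeasure (distr lborel borel (\<lambda>v::'a. 0 + 2 *\<^sub>R v)) Z"
    by (subst emeasure_density_const) auto
  also have "emeasure (distr lborel borel (\<lambda>v::'a. 0 + 2 *\<^sub>R v)) Z = emeasure lborel Z"
    by (subst emeasure_distr) (use scal in auto)
  finally have eq: "emeasure lborel Z = ennreal (2 ^ DIM('a)) * emeasure lborel Z" .
  obtain e where e: "emeasure lborel Z = ennreal e" "0 \<le> e" using Zfin by (cases "emeasure lborel Z") auto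
  have "e = 2 ^ DIM('a) * e" using eq e by (simp add: ennreal_mult[symmetric])
  moreover have "(2::real) ^ DIM('a) \<noteq> 1" using DIM_positive[where 'a='a] by (metis less_irrefl one_less_numeral_iff one_less_power semiring_norm(76))
  ultimately have "e = 0" by simp
  then have "Z \<in> null_sets lborel" using e by (intro null_setsI) auto
  then show ?thesis using AE_not_in[of Z lborel] by (simp add: Z_def)
qed

section \<open>Directions that hit a set, measured by the Hausdorff measure of that set\<close>

section \<open>Central projection of Hausdorff measure\<close>

lemma hausdorff_const_pos: "0 \<le> s \<Longrightarrow> 0 < hausdorff_const s"
  unfolding hausdorff_const_def by (intro divide_pos_pos Gamma_real_pos) auto

text \<open>Balls of radius 2\<epsilon> centred at the multiples of \<epsilon> along the line cover
  the tube; a number of order 1/\<epsilon> suffices, each of volume of order \<epsilon>^n. For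
  \<epsilon> > 1 the ball of radius 2 already meets the bound.\<close>

lemma tube_cover:
  fixes e :: "'a::euclidean_space"
  assumes e: "norm e = 1" and \<epsilon>: "0 < \<epsilon>" and dim: "1 \<le> DIM('a)"
  obtains U where "U \<in> sets borel" "{v. norm v \<le> 2 \<and> (\<exists>t. norm (v - t *\<^sub>R e) \<le> \<epsilon>)} \<subseteq> U"
    "emeasure lborel U \<le> ennreal (9 * unit_ball_vol (real DIM('a)) * 2 ^ DIM('a) * \<epsilon> ^ (DIM('a) - 1))"
proof (cases "\<epsilon> \<le> 1")
  case True
  let ?w = "unit_ball_vol (real DIM('a))"
  have w: "0 < ?w" by (rule unit_ball_vol_pos) simp
  define N where "N = \<lceil>2 / \<epsilon> + 1\<rceil>"
  define U where "U = (\<Union>k\<in>{- N..N}. cball ((of_int k * \<epsilon>) *\<^sub>R e) (2 * \<epsilon>))"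
  have N: "real_of_int N \<le> 2 / \<epsilon> + 2" "2 / \<epsilon> + 1 \<le> real_of_int N" unfolding N_def by linarith+
  have N0: "0 \<le> N" using N(2) \<epsilon> by (metis add_nonneg_nonneg divide_nonneg_pos of_int_0_le_iff order_trans zero_le_numeral zero_le_one)
  show ?thesis
  proof
    show "U \<in> sets borel" by (auto simp: U_def)
    show "{v. norm v \<le> 2 \<and> (\<exists>t. norm (v - t *\<^sub>R e) \<le> \<epsilon>)} \<subseteq> U"
    proof clarify
      fix v t assume v: "norm v \<le> 2" and t: "norm (v - t *\<^sub>R e) \<le> \<epsilon>"
      have "norm (t *\<^sub>R e) \<le> norm v + norm (t *\<^sub>R e - v)" by (metis add.commute diff_add_cancel norm_triangle_ineq)
      then have "\<bar>t\<bar> \<le> 2 + \<epsilon>" using v t e by (simp add: norm_minus_commute)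
      then have "\<bar>t / \<epsilon>\<bar> \<le> 2 / \<epsilon> + 1" using \<epsilon> by (simp add: field_simps)
      define k where "k = round (t / \<epsilon>)"
      have k: "\<bar>real_of_int k - t / \<epsilon>\<bar> \<le> 1 / 2" unfolding k_def by (rule of_int_round_abs_le)
      then have "real_of_int k < real_of_int (N + 1)" "real_of_int (- N - 1) < real_of_int k"
        unfolding of_int_add of_int_diff of_int_minus of_int_1 using N \<open>\<bar>t / \<epsilon>\<bar> \<le> 2 / \<epsilon> + 1\<close> by linarith+
      then have kN: "k \<in> {- N..N}" by (simp only: of_int_less_iff) auto
      have "\<bar>t / \<epsilon> - real_of_int k\<bar> \<le> 1" using k by linarith
      then have "\<bar>t / \<epsilon> - real_of_int k\<bar> * \<epsilon> \<le> 1 * \<epsilon>" using \<epsilon> by (intro mult_right_mono) auto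
      moreover have "\<bar>t / \<epsilon> - real_of_int k\<bar> * \<epsilon> = \<bar>(t / \<epsilon> - real_of_int k) * \<epsilon>\<bar>" using \<epsilon> by (simp add: abs_mult)
      moreover have "(t / \<epsilon> - real_of_int k) * \<epsilon> = t - of_int k * \<epsilon>" using \<epsilon> by (simp add: left_diff_distrib)
      ultimately have "\<bar>t - of_int k * \<epsilon>\<bar> \<le> \<epsilon>" by simp
      then have "norm (t *\<^sub>R e - (of_int k * \<epsilon>) *\<^sub>R e) \<le> \<epsilon>" using e by (simp add: scaleR_left_diff_distrib[symmetric])
      moreover have "v - (of_int k * \<epsilon>) *\<^sub>R e = (v - t *\<^sub>R e) + (t *\<^sub>R e - (of_int k * \<epsilon>) *\<^sub>R e)" by simp
      ultimately have "norm (v - (of_int k * \<epsilon>) *\<^sub>R e) \<le> \<epsilon> + \<epsilon>" using t by (metis add_mono norm_triangle_le)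
      then show "v \<in> U" using kN by (auto simp: U_def dist_norm norm_minus_commute)
    qed
    have "emeasure lborel U \<le> (\<Sum>k\<in>{- N..N}. emeasure lborel (cball ((of_int k * \<epsilon>) *\<^sub>R e) (2 * \<epsilon>)))"
      unfolding U_def by (rule emeasure_subadditive_finite) auto
    also have "... = (\<Sum>k\<in>{- N..N}. ennreal (?w * (2 * \<epsilon>) ^ DIM('a)))" using \<epsilon> by (simp add: emeasure_cball)
    also have "... = ennreal (real (card {- N..N}) * (?w * (2 * \<epsilon>) ^ DIM('a)))"
      using w \<epsilon> by (simp add: ennreal_mult ennreal_of_nat_eq_real_of_nat)
    also have "real (card {- N..N}) = 2 * real_of_int N + 1" using N0 by simp
    \<comment> \<open>Since N \<le> 2/\<epsilon> + 2, the number of balls is at most 4/\<epsilon> +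
      5 \<le> 9/\<epsilon>, the origin of the 9 in \<open>proj_const\<close>.\<close>
    also have "(2 * real_of_int N + 1) * (?w * (2 * \<epsilon>) ^ DIM('a)) \<le> (9 / \<epsilon>) * (?w * (2 * \<epsilon>) ^ DIM('a))"
    proof (rule mult_right_mono)
      have "5 \<le> 5 / \<epsilon>" using True \<epsilon> by (simp add: field_simps)
      then show "2 * real_of_int N + 1 \<le> 9 / \<epsilon>" using N by simp
    qed (use w \<epsilon> in auto)
    also have "(9 / \<epsilon>) * (?w * (2 * \<epsilon>) ^ DIM('a)) = 9 * ?w * 2 ^ DIM('a) * \<epsilon> ^ (DIM('a) - 1)"
    proof -
      have "\<epsilon> ^ DIM('a) = \<epsilon> * \<epsilon> ^ (DIM('a) - 1)" using dim by (metis Suc_diff_1 Suc_le_eq One_nat_def power_Suc)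
      then show ?thesis using \<epsilon> by (simp add: power_mult_distrib)
    qed
    finally show "emeasure lborel U \<le> ennreal (9 * ?w * 2 ^ DIM('a) * \<epsilon> ^ (DIM('a) - 1))" by (simp add: ennreal_leI)
  qed
next
  case False
  let ?w = "unit_ball_vol (real DIM('a))"
  have w: "0 < ?w" by (rule unit_ball_vol_pos) simp
  show ?thesis
  proof
    show "cball 0 2 \<in> sets borel" by simp
    show "{v. norm v \<le> 2 \<and> (\<exists>t. norm (v - t *\<^sub>R e) \<le> \<epsilon>)} \<subseteq> cball 0 2" by auto
    have "1 \<le> \<epsilon> ^ (DIM('a) - 1)" using False by (intro one_le_power) auto
    then have "1 * (?w * 2 ^ DIM('a)) \<le> (9 * \<epsilon> ^ (DIM('a) - 1)) * (?w * 2 ^ DIM('a))"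
      using w by (intro mult_right_mono) auto
    then show "emeasure lborel (cball 0 2 :: 'a set) \<le> ennreal (9 * ?w * 2 ^ DIM('a) * \<epsilon> ^ (DIM('a) - 1))"
      by (simp add: emeasure_cball ennreal_leI mult_ac)
  qed
qed

definition proj_const :: "'a::euclidean_space itself \<Rightarrow> real" where
  "proj_const _ = 9 * unit_ball_vol (real DIM('a)) * 2 ^ DIM('a)"

lemma proj_const_pos: "0 < proj_const TYPE('a::euclidean_space)"
  unfolding proj_const_def by (intro mult_pos_pos unit_ball_vol_pos) auto

text \<open>Seen from x, a set of diameter d at distance at least R fills a narrow cone: rescaling a
  hit x + t v by 1/t, where t \<ge> R/2 because |v| \<le> 2, places v within 2d/R of the line
  through one fixed hit.\<close>

lemma cone_cover:
  fixes D :: "'a::euclidean_space set"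
  assumes D: "bounded D" and R: "0 < R" and dim: "2 \<le> DIM('a)"
  obtains U where "U \<in> sets borel"
    "{v. 1 \<le> norm v \<and> norm v \<le> 2 \<and> (\<exists>t>0. x + t *\<^sub>R v \<in> D \<and> R \<le> t * norm v)} \<subseteq> U"
    "emeasure lborel U \<le> ennreal (proj_const TYPE('a) * (2 * diameter D / R) ^ (DIM('a) - 1))"
proof (cases "{v. 1 \<le> norm v \<and> norm v \<le> 2 \<and> (\<exists>t>0. x + t *\<^sub>R v \<in> D \<and> R \<le> t * norm v)} = {}")
  case True
  then show ?thesis using that[of "{}"] by auto
next
  case False
  let ?A = "{v. 1 \<le> norm v \<and> norm v \<le> 2 \<and> (\<exists>t>0. x + t *\<^sub>R v \<in> D \<and> R \<le> t * norm v)}"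
  let ?d = "diameter D"
  have d0: "0 \<le> ?d" by (rule diameter_ge_0[OF D])
  from False obtain v0 t0 where v0: "1 \<le> norm v0" "norm v0 \<le> 2" "t0 > 0" "x + t0 *\<^sub>R v0 \<in> D" "R \<le> t0 * norm v0" by auto
  define e where "e = (1 / norm v0) *\<^sub>R v0"
  have e: "norm e = 1" using v0 by (auto simp: e_def)
  have sub: "?A \<subseteq> {v. norm v \<le> 2 \<and> (\<exists>t. norm (v - t *\<^sub>R e) \<le> \<epsilon>)}" if \<epsilon>: "2 * ?d / R \<le> \<epsilon>" for \<epsilon>
  proof
    fix v assume "v \<in> ?A"
    then obtain t where v: "1 \<le> norm v" "norm v \<le> 2" "0 < t" "x + t *\<^sub>R v \<in> D" "R \<le> t * norm v" by blast
    have "dist (x + t *\<^sub>R v) (x + t0 *\<^sub>R v0) \<le> ?d" by (rule diameter_bounded_bound[OF D v(4) v0(4)])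
    then have 1: "norm (t *\<^sub>R v - t0 *\<^sub>R v0) \<le> ?d" by (simp add: dist_norm)
    have "v - (t0 * norm v0 / t) *\<^sub>R e = (1 / t) *\<^sub>R (t *\<^sub>R v - t0 *\<^sub>R v0)" using v v0 by (auto simp: e_def algebra_simps)
    then have "norm (v - (t0 * norm v0 / t) *\<^sub>R e) = norm (t *\<^sub>R v - t0 *\<^sub>R v0) / t" using v by simp
    also have "... \<le> ?d / t" using 1 v by (intro divide_right_mono) auto
    also have "... \<le> 2 * ?d / R"
    proof -
      have "R \<le> t * 2" using v by (meson less_imp_le mult_left_mono order_trans)
      then have "?d * R \<le> ?d * (t * 2)" using d0 by (rule mult_left_mono)
      then show ?thesis using v R by (simp add: field_simps)
    qed
    finally have "norm (v - (t0 * norm v0 / t) *\<^sub>R e) \<le> \<epsilon>" using \<epsilon> by simp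
    then show "v \<in> {v. norm v \<le> 2 \<and> (\<exists>t. norm (v - t *\<^sub>R e) \<le> \<epsilon>)}" using v by blast
  qed
  have dim1: "1 \<le> DIM('a)" using dim by simp
  show ?thesis
  proof (cases "?d = 0")
    case False
    then have "0 < 2 * ?d / R" using d0 R by simp
    then obtain U where U: "U \<in> sets borel" "{v. norm v \<le> 2 \<and> (\<exists>t. norm (v - t *\<^sub>R e) \<le> 2 * ?d / R)} \<subseteq> U"
      "emeasure lborel U \<le> ennreal (9 * unit_ball_vol (real DIM('a)) * 2 ^ DIM('a) * (2 * ?d / R) ^ (DIM('a) - 1))"
      by (rule tube_cover[OF e _ dim1])
    show ?thesis
    proof (rule that)
      show "?A \<subseteq> U" using sub[OF order_refl] U(2) by (rule subset_trans)
    qed (use U in \<open>simp_all add: proj_const_def\<close>)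
  next
    case True
    \<comment> \<open>Diameter zero would require a tube of radius zero; tubes of radius 1/(k+1) are
      intersected instead, and n \<ge> 2 makes their measures tend to 0.\<close>
    have "\<exists>U. U \<in> sets borel \<and> ?A \<subseteq> U \<and> emeasure lborel U \<le> ennreal (proj_const TYPE('a) * (1 / real (Suc k)) ^ (DIM('a) - 1))" for k
    proof -
      have pos: "0 < 1 / real (Suc k)" by simp
      obtain U where U: "U \<in> sets borel" "{v. norm v \<le> 2 \<and> (\<exists>t. norm (v - t *\<^sub>R e) \<le> 1 / real (Suc k))} \<subseteq> U"
        "emeasure lborel U \<le> ennreal (9 * unit_ball_vol (real DIM('a)) * 2 ^ DIM('a) * (1 / real (Suc k)) ^ (DIM('a) - 1))"
        by (rule tube_cover[OF e pos dim1])
      moreover have "?A \<subseteq> {v. norm v \<le> 2 \<and> (\<exists>t. norm (v - t *\<^sub>R e) \<le> 1 / real (Suc k))}" by (rule sub) (simp add: True)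
      ultimately show ?thesis unfolding proj_const_def by (intro exI[of _ U]) auto
    qed
    then have "\<forall>k. \<exists>U. U \<in> sets borel \<and> ?A \<subseteq> U \<and> emeasure lborel U \<le> ennreal (proj_const TYPE('a) * (1 / real (Suc k)) ^ (DIM('a) - 1))"
      by blast
    from choice[OF this] obtain U where U: "\<And>k. U k \<in> sets borel" "\<And>k. ?A \<subseteq> U k"
      "\<And>k. emeasure lborel (U k) \<le> ennreal (proj_const TYPE('a) * (1 / real (Suc k)) ^ (DIM('a) - 1))" by blast
    show ?thesis
    proof (rule that)
      show "(\<Inter>k. U k) \<in> sets borel" using U by auto
      show "?A \<subseteq> (\<Inter>k. U k)" using U(2) by blast
      have "emeasure lborel (\<Inter>k. U k) \<le> ennreal (proj_const TYPE('a) * (1 / real (Suc k)) ^ (DIM('a) - 1))" for k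
        by (rule order_trans[OF emeasure_mono U(3)[of k]]) (use U in auto)
      moreover have "(\<lambda>k. ennreal (proj_const TYPE('a) * (1 / real (Suc k)) ^ (DIM('a) - 1))) \<longlonglongrightarrow> ennreal (proj_const TYPE('a) * 0 ^ (DIM('a) - 1))"
        by (intro tendsto_intros LIMSEQ_Suc[OF lim_1_over_n])
      ultimately have "emeasure lborel (\<Inter>k. U k) \<le> ennreal (proj_const TYPE('a) * 0 ^ (DIM('a) - 1))"
        by (intro LIMSEQ_le_const) auto
      then show "emeasure lborel (\<Inter>k. U k) \<le> ennreal (proj_const TYPE('a) * (2 * ?d / R) ^ (DIM('a) - 1))"
        using True by simp
    qed
  qed
qed

text \<open>Each member of a cover of \<open>E\<close> accounts for directions of measure of order
  (diameter/R)^(n-1), which is its weight in the Hausdorff pre-measure. The scale 1 of the cover is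
  arbitrary, since every pre-measure lies below the outer measure.\<close>

lemma projection_measure_bound:
  fixes E S :: "'a::euclidean_space set"
  assumes R: "0 < R" "\<And>y. y \<in> E \<Longrightarrow> R \<le> dist x y" and dim: "2 \<le> DIM('a)"
    and S: "S \<in> sets borel" "\<And>v. v \<in> S \<Longrightarrow> 1 \<le> norm v \<and> norm v \<le> 2 \<and> (\<exists>t>0. x + t *\<^sub>R v \<in> E)"
  shows "emeasure lborel S \<le> ennreal (proj_const TYPE('a) * (4 / R) ^ (DIM('a) - 1) / hausdorff_const (real DIM('a) - 1))
     * hausdorff_outer (real DIM('a) - 1) E"
proof -
  let ?n = "DIM('a)" and ?h = "hausdorff_const (real DIM('a) - 1)"
  define c where "c = proj_const TYPE('a) * (4 / R) ^ (?n - 1) / ?h"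
  have h: "0 < ?h" using dim by (intro hausdorff_const_pos) auto
  have c: "0 < c" unfolding c_def using h R proj_const_pos by (intro divide_pos_pos mult_pos_pos) auto
  have "emeasure lborel S \<le> ennreal c * hausdorff_pre (real ?n - 1) 1 E"
  proof (rule ennreal_le_epsilon)
    fix \<epsilon> :: real assume \<epsilon>: "0 < \<epsilon>" and "ennreal c * hausdorff_pre (real ?n - 1) 1 E < top"
    then have fin: "hausdorff_pre (real ?n - 1) 1 E < top" using c R(1) by (auto simp: ennreal_mult_less_top)
    have "0 < ennreal (\<epsilon> / c)" using divide_pos_pos[OF \<epsilon> c] by (subst ennreal_less_zero_iff)
    with fin have "hausdorff_pre (real ?n - 1) 1 E < hausdorff_pre (real ?n - 1) 1 E + ennreal (\<epsilon> / c)"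
      by (simp add: ennreal_add_left_cancel_less)
    then obtain C where C: "E \<subseteq> (\<Union>i. C i)" "\<And>i. bounded (C i)" "\<And>i. diameter (C i) \<le> 1"
      "(\<Sum>i. ennreal (?h * (diameter (C i) / 2) powr (real ?n - 1))) < hausdorff_pre (real ?n - 1) 1 E + ennreal (\<epsilon> / c)"
      by (rule hausdorff_pre_cover_approx) auto
    have "\<exists>U. U \<in> sets borel \<and>
      {v. 1 \<le> norm v \<and> norm v \<le> 2 \<and> (\<exists>t>0. x + t *\<^sub>R v \<in> C i \<and> R \<le> t * norm v)} \<subseteq> U \<and>
      emeasure lborel U \<le> ennreal (proj_const TYPE('a) * (2 * diameter (C i) / R) ^ (?n - 1))" for i
    proof -
      obtain V where "V \<in> sets borel"
        "{v. 1 \<le> norm v \<and> norm v \<le> 2 \<and> (\<exists>t>0. x + t *\<^sub>R v \<in> C i \<and> R \<le> t * norm v)} \<subseteq> V"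
        "emeasure lborel V \<le> ennreal (proj_const TYPE('a) * (2 * diameter (C i) / R) ^ (?n - 1))"
        by (rule cone_cover[OF C(2)[of i] R(1) dim])
      then show ?thesis by blast
    qed
    then have "\<forall>i. \<exists>U. U \<in> sets borel \<and>
      {v. 1 \<le> norm v \<and> norm v \<le> 2 \<and> (\<exists>t>0. x + t *\<^sub>R v \<in> C i \<and> R \<le> t * norm v)} \<subseteq> U \<and>
      emeasure lborel U \<le> ennreal (proj_const TYPE('a) * (2 * diameter (C i) / R) ^ (?n - 1))" by blast
    from choice[OF this] obtain U where U: "\<And>i. U i \<in> sets borel"
      "\<And>i. {v. 1 \<le> norm v \<and> norm v \<le> 2 \<and> (\<exists>t>0. x + t *\<^sub>R v \<in> C i \<and> R \<le> t * norm v)} \<subseteq> U i"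
      "\<And>i. emeasure lborel (U i) \<le> ennreal (proj_const TYPE('a) * (2 * diameter (C i) / R) ^ (?n - 1))" by blast
    have "S \<subseteq> (\<Union>i. U i)"
    proof
      fix v assume v: "v \<in> S"
      then obtain t where t: "1 \<le> norm v" "norm v \<le> 2" "t > 0" "x + t *\<^sub>R v \<in> E" using S by blast
      then obtain i where i: "x + t *\<^sub>R v \<in> C i" using C by auto
      have "R \<le> t * norm v" using R(2)[OF t(4)] t by (simp add: dist_norm)
      then show "v \<in> (\<Union>i. U i)" using U(2)[of i] t i by blast
    qed
    then have "emeasure lborel S \<le> emeasure lborel (\<Union>i. U i)" using U by (intro emeasure_mono) auto
    also have "... \<le> (\<Sum>i. emeasure lborel (U i))" using U by (intro emeasure_subadditive_countably) auto
    also have "... \<le> (\<Sum>i. ennreal c * ennreal (?h * (diameter (C i) / 2) powr (real ?n - 1)))"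
    proof (intro suminf_le)
      fix i
      have d: "0 \<le> diameter (C i)" by (rule diameter_ge_0[OF C(2)])
      \<comment> \<open>Writing 2d/R = (4/R)(d/2) separates the factor (4/R)^(n-1) from the
        half-diameter in the Hausdorff weight.\<close>
      have eq: "proj_const TYPE('a) * (2 * diameter (C i) / R) ^ (?n - 1) = c * (?h * (diameter (C i) / 2) powr (real ?n - 1))"
      proof -
        have "(diameter (C i) / 2) powr (real ?n - 1) = (diameter (C i) / 2) ^ (?n - 1)"
        proof (cases "diameter (C i) = 0")
          case False
          then show ?thesis using d dim by (subst powr_realpow[symmetric]) (auto simp: of_nat_diff)
        qed (use dim in auto)
        moreover have "(2 * diameter (C i) / R) ^ (?n - 1) = (4 / R) ^ (?n - 1) * (diameter (C i) / 2) ^ (?n - 1)"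
          by (simp add: power_mult_distrib[symmetric])
        ultimately show ?thesis using h by (simp add: c_def)
      qed
      have "emeasure lborel (U i) \<le> ennreal (proj_const TYPE('a) * (2 * diameter (C i) / R) ^ (?n - 1))" by (rule U(3))
      also note eq
      also have "ennreal (c * (?h * (diameter (C i) / 2) powr (real ?n - 1))) =
          ennreal c * ennreal (?h * (diameter (C i) / 2) powr (real ?n - 1))" by (rule ennreal_mult) (use c h in auto)
      finally show "emeasure lborel (U i) \<le> ennreal c * ennreal (?h * (diameter (C i) / 2) powr (real ?n - 1))" .
    qed auto
    also have "... = ennreal c * (\<Sum>i. ennreal (?h * (diameter (C i) / 2) powr (real ?n - 1)))"
      by (rule ennreal_suminf_cmult)
    also have "... \<le> ennreal c * (hausdorff_pre (real ?n - 1) 1 E + ennreal (\<epsilon> / c))"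
      using C(4) by (intro mult_left_mono) auto
    also have "... = ennreal c * hausdorff_pre (real ?n - 1) 1 E + ennreal \<epsilon>"
      using c \<epsilon> by (simp add: distrib_left ennreal_mult[symmetric])
    finally show "emeasure lborel S \<le> ennreal c * hausdorff_pre (real ?n - 1) 1 E + ennreal \<epsilon>" .
  qed
  also have "... \<le> ennreal c * hausdorff_outer (real ?n - 1) E" by (intro mult_left_mono hausdorff_pre_le_outer) auto
  finally show ?thesis unfolding c_def .
qed

definition proj_kernel_const :: "'a::euclidean_space itself \<Rightarrow> real" where
  "proj_kernel_const _ = proj_const TYPE('a) * 8 ^ (DIM('a) - 1) / hausdorff_const (real DIM('a) - 1)"

lemma proj_kernel_const_pos: "2 \<le> DIM('a) \<Longrightarrow> 0 < proj_kernel_const TYPE('a::euclidean_space)"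
  unfolding proj_kernel_const_def by (intro divide_pos_pos mult_pos_pos proj_const_pos hausdorff_const_pos) auto

text \<open>Dyadic shells around x convert the fixed distance R of the previous bound into the
  actual distance, at the cost of 8 in place of 4. Hence the push-forward of Lebesgue measure under
  the choice \<open>z\<close> of hit points is dominated by the kernel times \<open>H\<close>, first
  on sets and then in integrals.\<close>

lemma projection_integral_bound:
  fixes F S :: "'a::euclidean_space set" and z :: "'a \<Rightarrow> 'a" and h :: "'a \<Rightarrow> ennreal"
  assumes dim: "2 \<le> DIM('a)" and F: "closed F" "x \<notin> F"
    and sH [measurable_cong]: "sets H = sets borel"
    and H: "\<And>E. E \<in> sets borel \<Longrightarrow> emeasure H E = hausdorff_outer (real DIM('a) - 1) (E \<inter> F)"
    and [measurable]: "S \<in> sets borel" "z \<in> borel_measurable borel" "h \<in> borel_measurable borel"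
    and z: "\<And>v. v \<in> S \<Longrightarrow> 1 \<le> norm v \<and> norm v \<le> 2 \<and> z v \<in> F \<and> (\<exists>t>0. z v = x + t *\<^sub>R v)"
  shows "(\<integral>\<^sup>+v. indicator S v * h (z v) \<partial>lborel) \<le>
    ennreal (proj_kernel_const TYPE('a)) * (\<integral>\<^sup>+y. h y * ennreal (dist x y powr (1 - real DIM('a))) \<partial>H)"
proof (cases "F = {}")
  case True
  then have "S = {}" using z by blast
  then show ?thesis by simp
next
  case False
  let ?n = "DIM('a)"
  define r where "r = infdist x F"
  have r: "0 < r" using F False by (simp add: r_def infdist_pos_not_in_closed)
  define k where "k y = ennreal (proj_kernel_const TYPE('a)) * ennreal (dist x y powr (1 - real ?n))" for y
  have [measurable]: "k \<in> borel_measurable borel" unfolding k_def by measurable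
  define \<nu> where "\<nu> = distr (density lborel (indicator S)) borel z"
  have \<nu>: "emeasure \<nu> E = emeasure lborel (S \<inter> z -` E)" if [measurable]: "E \<in> sets borel" for E
  proof -
    have [measurable]: "z -` E \<in> sets borel" using measurable_sets_borel[of z borel E] by simp
    have "emeasure \<nu> E = (\<integral>\<^sup>+v. indicator S v * indicator (z -` E) v \<partial>lborel)"
      unfolding \<nu>_def by (simp add: emeasure_distr emeasure_density)
    also have "... = (\<integral>\<^sup>+v. indicator (S \<inter> z -` E) v \<partial>lborel)" by (intro nn_integral_cong) (auto simp: indicator_def)
    also have "... = emeasure lborel (S \<inter> z -` E)"
      by (rule nn_integral_indicator) (simp add: measurable_sets_borel[of z borel, simplified])
    finally show ?thesis .
  qed
  have le: "emeasure \<nu> E \<le> emeasure (density H k) E" if E [measurable]: "E \<in> sets borel" for E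
  proof -
    \<comment> \<open>The shells start at the distance r of x from \<open>F\<close>; it is positive
      as \<open>F\<close> is closed, and no point of \<open>F\<close> is closer, so the shells
      exhaust \<open>F\<close>.\<close>
    define Ek where "Ek j = {y \<in> E \<inter> F. r * 2 ^ j \<le> dist x y \<and> dist x y < r * 2 ^ Suc j}" for j :: nat
    have [measurable]: "F \<in> sets borel" using F by (intro borel_closed)
    have [measurable]: "Ek j \<in> sets borel" for j unfolding Ek_def by measurable
    have disj: "disjoint_family Ek"
    proof (rule disjoint_family_on_def[THEN iffD2, rule_format])
      have *: "Ek i \<inter> Ek j = {}" if "i < j" for i j
      proof -
        have "(2::real) ^ Suc i \<le> 2 ^ j" using that by (intro power_increasing) auto
        then have "r * 2 ^ Suc i \<le> r * 2 ^ j" using r by simp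
        then show ?thesis by (auto simp: Ek_def)
      qed
      fix i j :: nat assume "i \<noteq> j"
      with * show "Ek i \<inter> Ek j = {}" by (metis Int_commute nat_neq_iff)
    qed
    have un: "E \<inter> F = (\<Union>j. Ek j)"
    proof (intro antisym subsetI)
      fix y assume y: "y \<in> E \<inter> F"
      then have "r \<le> dist x y" unfolding r_def by (intro infdist_le) auto
      then have one: "1 \<le> dist x y / r" using r by simp
      define j where "j = nat \<lfloor>log 2 (dist x y / r)\<rfloor>"
      have l0: "0 \<le> log 2 (dist x y / r)" using one by simp
      then have "real j \<le> log 2 (dist x y / r)" "log 2 (dist x y / r) < real (Suc j)"
        unfolding j_def by (auto simp: of_nat_nat) linarith
      then have "2 powr real j \<le> dist x y / r" "dist x y / r < 2 powr real (Suc j)"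
        using one by (auto simp: le_log_iff log_less_iff)
      then have "2 ^ j \<le> dist x y / r" "dist x y / r < 2 ^ Suc j" by (simp_all add: powr_realpow del: power_Suc of_nat_Suc)
      then have "y \<in> Ek j" using y r by (auto simp: Ek_def field_simps)
      then show "y \<in> (\<Union>j. Ek j)" by blast
    qed (auto simp: Ek_def)
    have one: "emeasure \<nu> (Ek j) \<le> emeasure (density H k) (Ek j)" for j
    proof -
      let ?R = "r * 2 ^ j"
      have R: "0 < ?R" using r by simp
      have "emeasure \<nu> (Ek j) = emeasure lborel (S \<inter> z -` Ek j)" by (rule \<nu>) simp
      also have "... \<le> ennreal (proj_const TYPE('a) * (4 / ?R) ^ (?n - 1) / hausdorff_const (real ?n - 1))
         * hausdorff_outer (real ?n - 1) (Ek j)"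
      proof (rule projection_measure_bound[OF R _ dim, where x = x])
        show "?R \<le> dist x y" if "y \<in> Ek j" for y using that by (simp add: Ek_def)
        show "S \<inter> z -` Ek j \<in> sets borel" using measurable_sets_borel[of z borel "Ek j"] by simp
        show "1 \<le> norm v \<and> norm v \<le> 2 \<and> (\<exists>t>0. x + t *\<^sub>R v \<in> Ek j)" if "v \<in> S \<inter> z -` Ek j" for v
          using that z[of v] by auto
      qed
      also have "hausdorff_outer (real ?n - 1) (Ek j) = emeasure H (Ek j)"
        by (subst H) (auto simp: Ek_def intro!: arg_cong[where f = "hausdorff_outer _"])
      also have "ennreal (proj_const TYPE('a) * (4 / ?R) ^ (?n - 1) / hausdorff_const (real ?n - 1)) * emeasure H (Ek j)
        = (\<integral>\<^sup>+y. ennreal (proj_const TYPE('a) * (4 / ?R) ^ (?n - 1) / hausdorff_const (real ?n - 1)) * indicator (Ek j) y \<partial>H)"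
        by (subst nn_integral_cmult_indicator) (auto simp: sH)
      also have "... \<le> (\<integral>\<^sup>+y. k y * indicator (Ek j) y \<partial>H)"
      proof (rule nn_integral_mono, goal_cases)
        case (1 y)
        show ?case
        proof (cases "y \<in> Ek j")
          case True
          then have y: "?R \<le> dist x y" "dist x y < 2 * ?R" by (auto simp: Ek_def)
          have d: "0 < dist x y" using y R by linarith
          have "4 / ?R \<le> 8 / dist x y" using y R d by (simp add: field_simps)
          then have "(4 / ?R) ^ (?n - 1) \<le> (8 / dist x y) ^ (?n - 1)" using R by (intro power_mono) auto
          also have "... = 8 ^ (?n - 1) * dist x y powr (1 - real ?n)"
          proof -
            have "dist x y powr (1 - real ?n) = 1 / dist x y ^ (?n - 1)"
              using d dim by (simp add: powr_realpow[symmetric] of_nat_diff powr_minus_divide[symmetric])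
            then show ?thesis by (simp add: power_divide)
          qed
          finally have "proj_const TYPE('a) * (4 / ?R) ^ (?n - 1) / hausdorff_const (real ?n - 1)
            \<le> proj_const TYPE('a) * (8 ^ (?n - 1) * dist x y powr (1 - real ?n)) / hausdorff_const (real ?n - 1)"
            using proj_const_pos[where 'a='a] hausdorff_const_pos[of "real ?n - 1"] dim
            by (intro divide_right_mono mult_left_mono) auto
          then show ?thesis using True proj_kernel_const_pos[OF dim]
            by (simp add: k_def ennreal_mult[symmetric] proj_kernel_const_def ennreal_leI mult_ac)
        qed auto
      qed
      also have "... = emeasure (density H k) (Ek j)" by (subst emeasure_density) auto
      finally show ?thesis .
    qed
    have "emeasure \<nu> E = emeasure \<nu> (E \<inter> F)"
      using F z by (subst (1 2) \<nu>) (auto intro!: arg_cong[where f = "emeasure lborel"])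
    also have "... = (\<Sum>j. emeasure \<nu> (Ek j))" unfolding un by (rule suminf_emeasure[symmetric]) (auto simp: disj \<nu>_def)
    also have "... \<le> (\<Sum>j. emeasure (density H k) (Ek j))" by (intro suminf_le one) auto
    also have "... = emeasure (density H k) (E \<inter> F)" unfolding un by (rule suminf_emeasure) (auto simp: disj sH)
    also have "... \<le> emeasure (density H k) E" by (intro emeasure_mono) (auto simp: sH)
    finally show ?thesis .
  qed
  have "(\<integral>\<^sup>+v. indicator S v * h (z v) \<partial>lborel) = (\<integral>\<^sup>+y. h y \<partial>\<nu>)"
    unfolding \<nu>_def by (subst nn_integral_distr, measurable) (simp add: nn_integral_density)
  also have "... \<le> (\<integral>\<^sup>+y. h y \<partial>density H k)"
  proof (rule nn_integral_mono_measure)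
    show "sets \<nu> = sets (density H k)" by (simp add: \<nu>_def sH)
    show "\<nu> \<le> density H k" using le by (subst le_measure) (auto simp: \<nu>_def sH le_fun_def emeasure_notin_sets, (metis emeasure_notin_sets le sets_distr zero_le \<nu>_def)?)
  qed
  also have "... = (\<integral>\<^sup>+y. ennreal (proj_kernel_const TYPE('a)) * (h y * ennreal (dist x y powr (1 - real ?n))) \<partial>H)"
    by (subst nn_integral_density) (auto simp: k_def mult_ac intro!: nn_integral_cong)
  also have "... = ennreal (proj_kernel_const TYPE('a)) * (\<integral>\<^sup>+y. h y * ennreal (dist x y powr (1 - real ?n)) \<partial>H)"
    by (rule nn_integral_cmult) measurable
  finally show ?thesis .
qed

section \<open>Explicit test functions that approximate indicators of boxes\<close>

section \<open>Smooth product bumps\<close>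

text \<open>Smoothness of all orders, witnessed by a set of functions closed under differentiation.\<close>

definition smooth1 :: "(real \<Rightarrow> real) \<Rightarrow> bool" where
  "smooth1 f \<longleftrightarrow> (\<exists>S. f \<in> S \<and> (\<forall>g\<in>S. \<exists>g'\<in>S. \<forall>t. (g has_real_derivative g' t) (at t)))"

lemma smooth1_deriv:
  assumes "smooth1 f"
  obtains f' where "smooth1 f'" "\<forall>t. (f has_real_derivative f' t) (at t)"
proof -
  from assms obtain S where S: "f \<in> S" "\<forall>g\<in>S. \<exists>g'\<in>S. \<forall>t. (g has_real_derivative g' t) (at t)"
    unfolding smooth1_def by blast
  then obtain f' where f': "f' \<in> S" "\<forall>t. (f has_real_derivative f' t) (at t)" by blast
  then have "smooth1 f'" unfolding smooth1_def using S by blast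
  with f' show ?thesis by (intro that) auto
qed

lemma smooth1_continuous:
  assumes "smooth1 f"
  shows "continuous_on UNIV f"
proof -
  obtain f' where f': "smooth1 f'" "\<forall>t. (f has_real_derivative f' t) (at t)" by (rule smooth1_deriv[OF assms])
  then show ?thesis by (intro continuous_at_imp_continuous_on ballI DERIV_isCont[OF f'(2)[rule_format]])
qed

text \<open>Polynomials in 1/t times e^(-1/t): a family that contains the standard flat function (P
  = 1) and is closed under differentiation.\<close>

definition flat_exp :: "real poly \<Rightarrow> real \<Rightarrow> real" where
  "flat_exp P t = (if 0 < t then poly P (1 / t) * exp (- (1 / t)) else 0)"

lemma poly_exp_decay: "((\<lambda>z. poly P z * exp (- z)) \<longlongrightarrow> (0::real)) at_top"
proof (induction P)
  case 0
  then show ?case by simp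
next
  case (pCons a P)
  have "((\<lambda>z. z ^ i * exp (- z)) \<longlongrightarrow> (0::real)) at_top" for i
    using tendsto_power_div_exp_0[of i] by (simp add: exp_minus divide_inverse)
  then have "((\<lambda>z. \<Sum>i\<le>degree (pCons a P). coeff (pCons a P) i * (z ^ i * exp (- z))) \<longlongrightarrow> (\<Sum>i\<le>degree (pCons a P). coeff (pCons a P) i * 0)) at_top"
    by (intro tendsto_sum tendsto_mult_left)
  then show ?case by (simp add: poly_altdef sum_distrib_right mult.assoc)
qed

text \<open>The chain rule with (1/t)' = -1/t^2 sends P to X^2 (P - P'), where
  \<open>[:0, 0, 1:]\<close> is X^2. At 0 the right difference quotient belongs to the polynomial X
  P, and exponential decay makes it vanish.\<close>

lemma flat_exp_deriv:
  "(flat_exp P has_real_derivative flat_exp ([:0, 0, 1:] * (P - pderiv P)) t) (at t)"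
proof -
  consider "0 < t" | "t < 0" | "t = 0" by linarith
  then show ?thesis
  proof cases
    case 1
    have "((\<lambda>t. poly P (1 / t) * exp (- (1 / t))) has_real_derivative flat_exp ([:0, 0, 1:] * (P - pderiv P)) t) (at t)"
      using 1 by (auto intro!: derivative_eq_intros DERIV_chain2[OF poly_DERIV] simp: flat_exp_def field_simps power2_eq_square)
    then show ?thesis
      by (rule has_field_derivative_transform_within_open[of _ _ _ "{0<..}"]) (use 1 in \<open>auto simp: flat_exp_def\<close>)
  next
    case 2
    have "((\<lambda>t. 0) has_real_derivative 0) (at t)" by simp
    then have "(flat_exp P has_real_derivative 0) (at t)"
      by (rule has_field_derivative_transform_within_open[of _ _ _ "{..<0}"]) (use 2 in \<open>auto simp: flat_exp_def\<close>)
    then show ?thesis using 2 by (simp add: flat_exp_def)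
  next
    case 3
    have "((\<lambda>h. flat_exp P h / h) \<longlongrightarrow> 0) (at 0)"
    proof (rule filterlim_split_at)
      show "((\<lambda>h. flat_exp P h / h) \<longlongrightarrow> 0) (at_left 0)"
        by (rule tendsto_eventually) (auto simp: flat_exp_def eventually_at_filter)
      have "((\<lambda>z. poly ([:0, 1:] * P) z * exp (- z)) \<longlongrightarrow> 0) at_top" by (rule poly_exp_decay)
      then have "((\<lambda>h. poly ([:0, 1:] * P) (inverse h) * exp (- inverse h)) \<longlongrightarrow> 0) (at_right 0)"
        by (rule filterlim_compose[OF _ filterlim_inverse_at_top_right])
      then show "((\<lambda>h. flat_exp P h / h) \<longlongrightarrow> 0) (at_right 0)" by (rule Lim_transform_eventually)
          (auto simp: flat_exp_def eventually_at_filter field_simps)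
    qed
    then have "(flat_exp P has_real_derivative 0) (at 0)" by (simp add: has_field_derivative_iff flat_exp_def)
    then show ?thesis using 3 by (simp add: flat_exp_def)
  qed
qed

text \<open>The closed family that witnesses smoothness of bumps. Sums are generated because the
  product rule turns one product into two; the free constant absorbs the inner derivatives k and
  -k.\<close>

inductive_set bump_span :: "real \<Rightarrow> real \<Rightarrow> real \<Rightarrow> (real \<Rightarrow> real) set" for a b k where
  prod: "(\<lambda>t. c * (flat_exp P (k * (t - a)) * flat_exp Q (k * (b - t)))) \<in> bump_span a b k"
| add: "f \<in> bump_span a b k \<Longrightarrow> g \<in> bump_span a b k \<Longrightarrow> (\<lambda>t. f t + g t) \<in> bump_span a b k"

lemma bump_span_deriv: "f \<in> bump_span a b k \<Longrightarrow> \<exists>f'\<in>bump_span a b k. \<forall>t. (f has_real_derivative f' t) (at t)"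
proof (induction rule: bump_span.induct)
  case (prod c P Q)
  let ?P = "[:0, 0, 1:] * (P - pderiv P)" and ?Q = "[:0, 0, 1:] * (Q - pderiv Q)"
  let ?f' = "\<lambda>t. (c * k) * (flat_exp ?P (k * (t - a)) * flat_exp Q (k * (b - t))) +
       (- c * k) * (flat_exp P (k * (t - a)) * flat_exp ?Q (k * (b - t)))"
  have "?f' \<in> bump_span a b k" by (intro bump_span.intros)
  moreover have "((\<lambda>t. c * (flat_exp P (k * (t - a)) * flat_exp Q (k * (b - t)))) has_real_derivative ?f' t) (at t)" for t
    by (rule derivative_eq_intros DERIV_chain2[OF flat_exp_deriv] refl | simp add: algebra_simps)+
  ultimately show ?case by (intro bexI[of _ ?f'] allI)
next
  case (add f g)
  then obtain f' g' where "f' \<in> bump_span a b k" "g' \<in> bump_span a b k"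
    "\<And>t. (f has_real_derivative f' t) (at t)" "\<And>t. (g has_real_derivative g' t) (at t)" by blast
  then show ?case by (intro bexI[of _ "\<lambda>t. f' t + g' t"]) (auto intro!: derivative_intros bump_span.add)
qed

text \<open>For k > 0 a larger k only steepens the flanks: the function still vanishes off (a, b),
  and its values tend to the indicator of that interval.\<close>

definition bump :: "real \<Rightarrow> real \<Rightarrow> real \<Rightarrow> real \<Rightarrow> real" where
  "bump a b k t = flat_exp [:1:] (k * (t - a)) * flat_exp [:1:] (k * (b - t))"

lemma smooth1_bump: "smooth1 (bump a b k)"
proof -
  have "bump a b k = (\<lambda>t. 1 * (flat_exp [:1:] (k * (t - a)) * flat_exp [:1:] (k * (b - t))))"
    by (simp add: bump_def fun_eq_iff)
  then have "bump a b k \<in> bump_span a b k" by (metis bump_span.prod)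
  then show ?thesis unfolding smooth1_def using bump_span_deriv by blast
qed

lemma bump_bounds: "0 \<le> bump a b k t" "bump a b k t \<le> 1"
proof -
  have "0 \<le> flat_exp [:1:] t \<and> flat_exp [:1:] t \<le> 1" for t by (simp add: flat_exp_def)
  then show "0 \<le> bump a b k t" "bump a b k t \<le> 1" unfolding bump_def by (auto intro: mult_le_one)
qed

lemma bump_outside: "0 < k \<Longrightarrow> t \<notin> {a<..<b} \<Longrightarrow> bump a b k t = 0"
  by (auto simp: bump_def flat_exp_def mult_less_0_iff zero_less_mult_iff)

lemma bump_tendsto_indicator:
  "(\<lambda>k. bump a b (real (Suc k)) t) \<longlonglongrightarrow> indicator {a<..<b} t"
proof (cases "t \<in> {a<..<b}")
  case True
  have "(\<lambda>k. flat_exp [:1:] (real (Suc k) * d)) \<longlonglongrightarrow> 1" if "0 < d" for d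
  proof -
    have "(\<lambda>k. exp (- (1 / d * (1 / real (Suc k))))) \<longlonglongrightarrow> exp (- (1 / d * 0))"
      by (intro tendsto_intros LIMSEQ_Suc[OF lim_1_over_n])
    moreover have "flat_exp [:1:] (real (Suc k) * d) = exp (- (1 / d * (1 / real (Suc k))))" for k
      using that by (auto simp: flat_exp_def field_simps intro!: add_pos_nonneg)
    ultimately show ?thesis by simp
  qed
  then have "(\<lambda>k. bump a b (real (Suc k)) t) \<longlonglongrightarrow> 1 * 1" unfolding bump_def using True by (intro tendsto_mult) auto
  then show ?thesis using True by simp
next
  case False
  then show ?thesis by (simp add: bump_outside)
qed

definition tensor :: "('n::finite \<Rightarrow> real \<Rightarrow> real) \<Rightarrow> real^'n \<Rightarrow> real" where
  "tensor \<psi> x = (\<Prod>i\<in>UNIV. \<psi> i (x $ i))"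

lemma tensor_line:
  "tensor \<psi> (x + t *\<^sub>R axis i 1) = \<psi> i (x $ i + t) * (\<Prod>j\<in>UNIV - {i}. \<psi> j (x $ j))" unfolding tensor_def
  by (subst prod.remove[of _ i]) (auto simp: axis_def intro!: prod.cong)

lemma tensor_fun_upd:
  "tensor (\<psi>(i := f)) x = f (x $ i) * (\<Prod>j\<in>UNIV - {i}. \<psi> j (x $ j))"
  unfolding tensor_def by (subst prod.remove[of _ i]) (auto intro!: prod.cong)

lemma tensor_partial:
  assumes "\<And>t. (\<psi> i has_real_derivative \<psi>' t) (at t)"
  shows "((\<lambda>t. tensor \<psi> (x + t *\<^sub>R axis i 1)) has_real_derivative tensor (\<psi>(i := \<psi>')) x) (at 0)"
  unfolding tensor_line tensor_fun_upd by (rule derivative_eq_intros DERIV_chain2[OF assms] refl | simp)+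

lemma pdiff_tensor:
  assumes "\<And>t. (\<psi> i has_real_derivative \<psi>' t) (at t)"
  shows "pdiff i (tensor \<psi>) = tensor (\<psi>(i := \<psi>'))"
  unfolding pdiff_def using DERIV_imp_deriv[OF tensor_partial[of \<psi> i \<psi>', OF assms]] by (simp add: fun_eq_iff)

lemma tensor_continuous:
  assumes "\<And>i. continuous_on UNIV (\<psi> i)"
  shows "continuous_on UNIV (tensor \<psi>)"
proof -
  have "continuous_on UNIV (\<lambda>x. \<psi> i (x $ i))" for i
    by (rule continuous_on_compose2[OF assms, of UNIV "\<lambda>x. x $ i"]) (auto intro: continuous_intros)
  then show ?thesis unfolding tensor_def by (intro continuous_on_prod)
qed

lemma tensor_deriv:
  assumes \<psi>: "\<And>i t. (\<psi> i has_real_derivative \<psi>' i t) (at t)"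
  shows "((\<lambda>s. tensor \<psi> (x + s *\<^sub>R v)) has_real_derivative (\<Sum>i\<in>UNIV. v $ i * tensor (\<psi>(i := \<psi>' i)) (x + s *\<^sub>R v))) (at s)"
proof -
  have "((\<lambda>s. \<Prod>i\<in>UNIV. \<psi> i (x $ i + s * v $ i)) has_field_derivative
      (\<Sum>i\<in>UNIV. (\<psi>' i (x $ i + s * v $ i) * v $ i) * (\<Prod>j\<in>UNIV - {i}. \<psi> j (x $ j + s * v $ j)))) (at s)"
    by (rule has_field_derivative_prod) (rule derivative_eq_intros DERIV_chain2[OF \<psi>] refl | simp)+
  then show ?thesis by (simp add: tensor_fun_upd) (simp add: tensor_def mult_ac)
qed

text \<open>Differentiating in one coordinate replaces one factor, so every iterated partial
  derivative is again a tensor of smooth one-variable functions. This is the reason for taking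
  products as test functions.\<close>

lemma smooth_fun_tensor:
  assumes "\<And>i. smooth1 (\<psi> i)"
  shows "smooth_fun (tensor \<psi>)"
proof -
  have *: "\<exists>\<psi>'. (\<forall>i. smooth1 (\<psi>' i)) \<and> iter_pdiff is (tensor \<psi>) = tensor \<psi>'" for "is"
  proof (induction "is")
    case Nil
    then show ?case using assms by auto
  next
    case (Cons i "is")
    then obtain \<psi>' where \<psi>': "\<And>i. smooth1 (\<psi>' i)" "iter_pdiff is (tensor \<psi>) = tensor \<psi>'" by blast
    obtain f' where f': "smooth1 f'" "\<forall>t. (\<psi>' i has_real_derivative f' t) (at t)"
      by (rule smooth1_deriv[OF \<psi>'(1)[of i]])
    have "iter_pdiff (i # is) (tensor \<psi>) = tensor (\<psi>'(i := f'))"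
      using pdiff_tensor[of \<psi>' i f', OF f'(2)[rule_format]] \<psi>'(2) by simp
    moreover have "\<forall>j. smooth1 ((\<psi>'(i := f')) j)" using \<psi>'(1) f'(1) by auto
    ultimately show ?case by blast
  qed
  show ?thesis unfolding smooth_fun_def
  proof (intro allI conjI)
    fix "is"
    obtain \<psi>' where \<psi>': "\<And>i. smooth1 (\<psi>' i)" "iter_pdiff is (tensor \<psi>) = tensor \<psi>'" using * by blast
    show "continuous_on UNIV (iter_pdiff is (tensor \<psi>))"
      unfolding \<psi>'(2) using \<psi>'(1) by (intro tensor_continuous smooth1_continuous)
    fix i x
    obtain f' where f': "smooth1 f'" "\<forall>t. (\<psi>' i has_real_derivative f' t) (at t)"
      by (rule smooth1_deriv[OF \<psi>'(1)[of i]])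
    show "(\<lambda>t. iter_pdiff is (tensor \<psi>) (x + t *\<^sub>R axis i 1)) differentiable (at 0)"
      unfolding \<psi>'(2) using tensor_partial[of \<psi>' i f' x, OF f'(2)[rule_format]] real_differentiable_def by blast
  qed
qed

definition box_bump :: "real^'n::finite \<Rightarrow> real^'n \<Rightarrow> nat \<Rightarrow> real^'n \<Rightarrow> real" where
  "box_bump a b k = tensor (\<lambda>i. bump (a $ i) (b $ i) (real (Suc k)))"

lemma box_bump_bounds: "0 \<le> box_bump a b k x" "box_bump a b k x \<le> 1"
  unfolding box_bump_def tensor_def by (auto intro!: prod_nonneg prod_le_1 bump_bounds)

lemma box_bump_outside:
  assumes "x \<notin> box a b"
  shows "box_bump a b k x = 0"
proof -
  obtain i where "x $ i \<notin> {a $ i<..<b $ i}" using assms by (auto simp: mem_box_cart)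
  then have "bump (a $ i) (b $ i) (real (Suc k)) (x $ i) = 0" by (intro bump_outside) auto
  then show ?thesis unfolding box_bump_def tensor_def by (auto simp: prod_zero_iff)
qed

lemma box_bump_tendsto: "(\<lambda>k. box_bump a b k x) \<longlonglongrightarrow> indicator (box a b) x"
proof -
  have "(\<lambda>k. box_bump a b k x) \<longlonglongrightarrow> (\<Prod>i\<in>UNIV. indicator {a $ i<..<b $ i} (x $ i))"
    unfolding box_bump_def tensor_def by (intro tendsto_prod bump_tendsto_indicator)
  also have "(\<Prod>i\<in>UNIV. indicator {a $ i<..<b $ i} (x $ i)) = (indicator (box a b) x :: real)"
    by (auto simp: indicator_def mem_box_cart prod_zero_iff intro!: prod.neutral)
  finally show ?thesis .
qed

lemma continuous_box_bump: "continuous_on UNIV (box_bump a b k)"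
  unfolding box_bump_def by (intro tensor_continuous smooth1_continuous smooth1_bump)

lemma test_fun_box_bump:
  assumes "cbox (a + c) (b + c) \<subseteq> U"
  shows "test_fun U (\<lambda>x. box_bump a b k (x - c))"
proof -
  have eq: "(\<lambda>x. box_bump a b k (x - c)) = box_bump (a + c) (b + c) k"
    by (simp add: fun_eq_iff box_bump_def tensor_def bump_def algebra_simps)
  have "smooth_fun (box_bump (a + c) (b + c) k)" unfolding box_bump_def by (intro smooth_fun_tensor smooth1_bump)
  then show ?thesis unfolding test_fun_def eq using assms box_subset_cbox[of "a + c" "b + c"]
    by (auto intro!: exI[of _ "cbox (a + c) (b + c)"] box_bump_outside)
qed

section \<open>The fundamental theorem of calculus for weak derivatives, on almost every translate
  of a segment\<close>

section \<open>Weak derivatives along segments\<close>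

text \<open>The measures with densities the positive and the negative part of \<open>F\<close> agree
  on boxes, an intersection-stable generator, and so coincide; evaluating them where
  \<open>F\<close> is positive, and where it is negative, gives the claim.\<close>

lemma AE_zero_if_box_integrals_zero:
  fixes F :: "'a::euclidean_space \<Rightarrow> real"
  assumes F: "integrable lborel F" and zero: "\<And>a b. (\<integral>x. indicator (box a b) x * F x \<partial>lborel) = 0"
  shows "AE x in lborel. F x = 0"
proof -
  have [measurable]: "F \<in> borel_measurable borel" using borel_measurable_integrable[OF F] by simp
  define P where "P = density lborel (\<lambda>x. ennreal (F x))"
  define N where "N = density lborel (\<lambda>x. ennreal (- F x))"
  have fin: "(\<integral>\<^sup>+x. ennreal \<bar>F x\<bar> \<partial>lborel) < \<infinity>" using F by (simp add: integrable_iff_bounded)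
  have le: "(\<integral>\<^sup>+x. ennreal (G x) \<partial>lborel) < \<infinity>" if "\<And>x. G x \<le> \<bar>F x\<bar>" for G
    using nn_integral_mono[of lborel "\<lambda>x. ennreal (G x)" "\<lambda>x. ennreal \<bar>F x\<bar>"] that fin
    by (auto intro: ennreal_leI le_less_trans)
  have box: "emeasure P (box a b) = emeasure N (box a b)" for a b :: 'a
  proof -
    let ?G = "\<lambda>x. indicator (box a b) x * F x"
    have int: "integrable lborel ?G"
      using integrable_real_mult_indicator[OF _ F, of "box a b"] by (simp add: mult.commute)
    have "?G x \<le> \<bar>F x\<bar>" "- ?G x \<le> \<bar>F x\<bar>" for x by (auto simp: indicator_def)
    then have f1: "(\<integral>\<^sup>+x. ennreal (?G x) \<partial>lborel) < \<infinity>" and f2: "(\<integral>\<^sup>+x. ennreal (- ?G x) \<partial>lborel) < \<infinity>"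
      using le[of ?G] le[of "\<lambda>x. - ?G x"] by blast+
    have "enn2real (\<integral>\<^sup>+x. ennreal (?G x) \<partial>lborel) = enn2real (\<integral>\<^sup>+x. ennreal (- ?G x) \<partial>lborel)"
      using zero[of a b] real_lebesgue_integral_def[OF int] by simp
    moreover have "X = Y" if "enn2real X = enn2real Y" "X < \<infinity>" "Y < \<infinity>" for X Y using that by (cases X; cases Y) auto
    ultimately have "(\<integral>\<^sup>+x. ennreal (?G x) \<partial>lborel) = (\<integral>\<^sup>+x. ennreal (- ?G x) \<partial>lborel)" using f1 f2 by blast
    moreover have "emeasure P (box a b) = (\<integral>\<^sup>+x. ennreal (?G x) \<partial>lborel)"
      unfolding P_def by (subst emeasure_density) (auto intro!: nn_integral_cong simp: indicator_def)
    moreover have "emeasure N (box a b) = (\<integral>\<^sup>+x. ennreal (- ?G x) \<partial>lborel)"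
      unfolding N_def by (subst emeasure_density) (auto intro!: nn_integral_cong simp: indicator_def)
    ultimately show ?thesis by simp
  qed
  have PN: "P = N"
  proof (rule measure_eqI_generator_eq)
    let ?E = "range (\<lambda>(a, b). box a b::'a set)"
    show "Int_stable ?E" by (auto simp: Int_stable_def box_Int_box)
    show "?E \<subseteq> Pow UNIV" "sets P = sigma_sets UNIV ?E" "sets N = sigma_sets UNIV ?E"
      by (simp_all add: borel_eq_box P_def N_def)
    let ?A = "\<lambda>n::nat. box (- (real n *\<^sub>R One)) (real n *\<^sub>R One) :: 'a set"
    show "range ?A \<subseteq> ?E" "(\<Union>i. ?A i) = UNIV" unfolding UN_box_eq_UNIV by auto
    show "emeasure P (?A i) \<noteq> \<infinity>" for i
    proof -
      have "emeasure P (?A i) \<le> emeasure P UNIV" by (intro emeasure_mono) (auto simp: P_def)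
      also have "... = (\<integral>\<^sup>+x. ennreal (F x) \<partial>lborel)" unfolding P_def by (subst emeasure_density) auto
      also have "... < \<infinity>" by (rule le) simp
      finally show ?thesis by simp
    qed
    show "emeasure P X = emeasure N X" if "X \<in> ?E" for X using that box by auto
  qed
  have z: "AE x in lborel. \<not> 0 < G x" if [measurable]: "G \<in> borel_measurable borel"
    and G: "density lborel (\<lambda>x. ennreal (G x)) = density lborel (\<lambda>x. ennreal (- G x))" for G :: "'a \<Rightarrow> real"
  proof -
    have "(\<integral>\<^sup>+x. ennreal (G x) * indicator {x. 0 < G x} x \<partial>lborel) = emeasure (density lborel (\<lambda>x. ennreal (G x))) {x. 0 < G x}"
      by (subst emeasure_density) auto
    also have "... = (\<integral>\<^sup>+x. ennreal (- G x) * indicator {x. 0 < G x} x \<partial>lborel)"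
      unfolding G by (subst emeasure_density) auto
    also have "... = (\<integral>\<^sup>+(x::'a). 0 \<partial>lborel)" by (intro nn_integral_cong) (auto simp: indicator_def ennreal_neg)
    finally have "AE x in lborel. ennreal (G x) * indicator {x. 0 < G x} x = 0" by (simp add: nn_integral_0_iff_AE)
    then show ?thesis by eventually_elim (auto simp: indicator_def)
  qed
  have "AE x in lborel. \<not> 0 < F x" "AE x in lborel. \<not> 0 < - F x"
    using PN z[of F] z[of "\<lambda>x. - F x"] by (simp_all add: P_def N_def)
  then show ?thesis by eventually_elim auto
qed

lemma integrable_pair_bounded:
  fixes U :: "'a::euclidean_space \<Rightarrow> real" and h :: "'a \<times> real \<Rightarrow> real"
  assumes U: "integrable lborel U" and [measurable]: "h \<in> borel_measurable (borel \<Otimes>\<^sub>M borel)"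
    and h: "\<And>y s. \<bar>h (y, s)\<bar> \<le> B * indicator {0..1} s"
  shows "integrable (lborel \<Otimes>\<^sub>M lborel) (\<lambda>(y, s). U y * h (y, s))"
proof (rule integrableI_bounded)
  have [measurable]: "U \<in> borel_measurable borel" using borel_measurable_integrable[OF U] by simp
  show "(\<lambda>(y, s). U y * h (y, s)) \<in> borel_measurable (lborel \<Otimes>\<^sub>M lborel)" by measurable
  have B: "0 \<le> B" using h[of undefined 0] abs_ge_zero[of "h (undefined, 0)"] by simp
  have "(\<integral>\<^sup>+p. ennreal (norm (case p of (y, s) \<Rightarrow> U y * h (y, s))) \<partial>(lborel \<Otimes>\<^sub>M lborel)) =
    (\<integral>\<^sup>+y. (\<integral>\<^sup>+s. ennreal \<bar>U y * h (y, s)\<bar> \<partial>lborel) \<partial>lborel)" by (subst lborel.nn_integral_fst[symmetric]) auto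
  also have "... \<le> (\<integral>\<^sup>+y. (\<integral>\<^sup>+s. ennreal (\<bar>U y\<bar> * B) * indicator {0..1::real} s \<partial>lborel) \<partial>lborel)"
  proof (intro nn_integral_mono)
    fix y s
    have "\<bar>U y * h (y, s)\<bar> \<le> \<bar>U y\<bar> * (B * indicator {0..1} s)" unfolding abs_mult by (intro mult_left_mono h) auto
    then show "ennreal \<bar>U y * h (y, s)\<bar> \<le> ennreal (\<bar>U y\<bar> * B) * indicator {0..1} s"
      by (auto simp: indicator_def intro!: ennreal_leI split: if_splits)
  qed
  also have "... = (\<integral>\<^sup>+y. ennreal (\<bar>U y\<bar> * B) \<partial>lborel)"
    by (intro nn_integral_cong, subst nn_integral_cmult_indicator) auto
  also have "... = (\<integral>\<^sup>+y. ennreal \<bar>U y\<bar> \<partial>lborel) * ennreal B" using B by (simp add: ennreal_mult'' nn_integral_multc)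
  also have "... < \<infinity>" using U by (auto simp: integrable_iff_bounded ennreal_mult_less_top)
  finally show "(\<integral>\<^sup>+p. ennreal (norm (case p of (y, s) \<Rightarrow> U y * h (y, s))) \<partial>(lborel \<Otimes>\<^sub>M lborel)) < \<infinity>" .
qed

lemma lborel_integral_shift:
  fixes f :: "'a::euclidean_space \<Rightarrow> real"
  assumes [measurable]: "f \<in> borel_measurable borel"
  shows "(\<integral>y. f y \<partial>lborel) = (\<integral>x. f (x + c) \<partial>lborel)"
proof -
  have "(\<integral>y. f y \<partial>lborel) = (\<integral>y. f y \<partial>(distr lborel borel ((+) c)))" by (simp add: lborel_distr_plus)
  also have "... = (\<integral>x. f (c + x) \<partial>lborel)" by (rule integral_distr) auto
  finally show ?thesis by (simp add: add.commute)
qed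

lemma lborel_nn_integral_shift:
  fixes f :: "'a::euclidean_space \<Rightarrow> ennreal"
  assumes [measurable]: "f \<in> borel_measurable borel"
  shows "(\<integral>\<^sup>+y. f y \<partial>lborel) = (\<integral>\<^sup>+x. f (x + c) \<partial>lborel)"
proof -
  have "(\<integral>\<^sup>+y. f y \<partial>lborel) = (\<integral>\<^sup>+y. f y \<partial>(distr lborel borel ((+) c)))" by (simp add: lborel_distr_plus)
  also have "... = (\<integral>\<^sup>+x. f (c + x) \<partial>lborel)" by (rule nn_integral_distr) auto
  finally show ?thesis by (simp add: add.commute)
qed

lemma box_bump_derivs:
  fixes a b :: "real^'n::finite"
  obtains D where "\<And>i. continuous_on UNIV (D i)" "\<And>i. pdiff i (box_bump a b k) = D i"
    "\<And>x v s. ((\<lambda>s. box_bump a b k (x + s *\<^sub>R v)) has_real_derivative (\<Sum>i\<in>UNIV. v $ i * D i (x + s *\<^sub>R v))) (at s)"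
    "\<And>i x. x \<notin> cbox a b \<Longrightarrow> D i x = 0"
proof -
  let ?\<psi> = "\<lambda>i. bump (a $ i) (b $ i) (real (Suc k))"
  have "\<exists>f'. smooth1 f' \<and> (\<forall>t. (?\<psi> i has_real_derivative f' t) (at t))" for i
    using smooth1_deriv[OF smooth1_bump] by blast
  then have "\<forall>i. \<exists>f'. smooth1 f' \<and> (\<forall>t. (?\<psi> i has_real_derivative f' t) (at t))" by blast
  from choice[OF this] obtain \<psi>' where \<psi>': "\<And>i. smooth1 (\<psi>' i)"
    "\<And>i t. (?\<psi> i has_real_derivative \<psi>' i t) (at t)" by blast
  define D where "D i = tensor (?\<psi>(i := \<psi>' i))" for i
  have pd: "pdiff i (box_bump a b k) = D i" for i unfolding box_bump_def D_def by (rule pdiff_tensor) (rule \<psi>'(2))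
  show ?thesis
  proof (rule that[of D])
    show "continuous_on UNIV (D i)" for i
      unfolding D_def using \<psi>'(1) by (intro tensor_continuous) (auto intro: smooth1_continuous smooth1_bump)
    show "pdiff i (box_bump a b k) = D i" for i by (rule pd)
    show "((\<lambda>s. box_bump a b k (x + s *\<^sub>R v)) has_real_derivative (\<Sum>i\<in>UNIV. v $ i * D i (x + s *\<^sub>R v))) (at s)" for x v s
      unfolding box_bump_def D_def by (rule tensor_deriv) (rule \<psi>'(2))
    show "D i x = 0" if x: "x \<notin> cbox a b" for i x
    proof -
      have "open ((\<lambda>t. x + t *\<^sub>R axis i 1) -` (- cbox a b))"
        by (intro open_vimage open_Compl closed_cbox continuous_intros)
      moreover have "0 \<in> (\<lambda>t. x + t *\<^sub>R axis i 1) -` (- cbox a b)" using x by simp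
      ultimately have "((\<lambda>t. box_bump a b k (x + t *\<^sub>R axis i 1)) has_real_derivative 0) (at 0)"
      proof (rule has_field_derivative_transform_within_open[rotated 1])
        show "((\<lambda>t. 0) has_real_derivative 0) (at 0)" by simp
        show "0 = box_bump a b k (x + t *\<^sub>R axis i 1)" if "t \<in> (\<lambda>t. x + t *\<^sub>R axis i 1) -` (- cbox a b)" for t
          using that box_subset_cbox[of a b] by (intro box_bump_outside[symmetric]) auto
      qed
      then have "pdiff i (box_bump a b k) x = 0" unfolding pdiff_def by (rule DERIV_imp_deriv)
      then show ?thesis by (simp add: pd)
    qed
  qed
qed

lemma pdiff_shift: "pdiff i (\<lambda>x. f (x - c)) x = pdiff i f (x - c)"
  by (simp add: pdiff_def add_diff_eq[symmetric] diff_add_eq)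

lemma loc_integrable_lborel:
  fixes f :: "real^'n::finite \<Rightarrow> real"
  assumes "loc_integrable U f" "compact K" "K \<subseteq> U" and [measurable]: "f \<in> borel_measurable borel"
  shows "integrable lborel (\<lambda>x. indicator K x * f x)"
proof -
  have [measurable]: "K \<in> sets borel" using assms(2) by (intro borel_closed compact_imp_closed)
  have "integrable lebesgue (\<lambda>x. indicator K x * f x)"
    using assms(1-3) unfolding loc_integrable_def set_integrable_def by auto
  then show ?thesis by (subst (asm) integrable_completion) auto
qed

context
  fixes U :: "(real^'n::finite) set" and u :: "real^'n \<Rightarrow> real" and w :: "'n \<Rightarrow> real^'n \<Rightarrow> real"
    and v :: "real^'n"
  assumes um [measurable]: "u \<in> borel_measurable borel" and wm [measurable]: "\<And>i. w i \<in> borel_measurable borel"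
    and weak: "\<And>i. weak_pd U u i (w i)"
begin

text \<open>The difference of the bump and its translate by v is an integral of directional
  derivatives of the intermediate translates by s v. Each of these is a test function, so the weak
  derivative can be used for every s separately. The compact \<open>K\<close> contains all
  translated supports, so local integrability suffices.\<close>

lemma weak_identity_bump:
  assumes K: "compact K" "K \<subseteq> U" and seg: "\<And>y s. y \<in> cbox a b \<Longrightarrow> s \<in> {0..1} \<Longrightarrow> y + s *\<^sub>R v \<in> K"
  shows "(\<integral>y. indicator K y * u y * (box_bump a b k (y - v) - box_bump a b k y) \<partial>lborel) =
    (\<integral>s. indicator {0..1} s * (\<integral>y. (indicator K y * (\<Sum>i\<in>UNIV. v $ i * w i y)) * box_bump a b k (y - s *\<^sub>R v) \<partial>lborel) \<partial>lborel)"
proof -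
  let ?\<phi> = "box_bump a b k"
  define Z where "Z y = indicator K y * u y" for y
  obtain D where D: "\<And>i. continuous_on UNIV (D i)" "\<And>i. pdiff i ?\<phi> = D i"
    "\<And>x v s. ((\<lambda>s. ?\<phi> (x + s *\<^sub>R v)) has_real_derivative (\<Sum>i\<in>UNIV. v $ i * D i (x + s *\<^sub>R v))) (at s)"
    "\<And>i x. x \<notin> cbox a b \<Longrightarrow> D i x = 0" by (rule box_bump_derivs[of a b k]) blast
  have [measurable]: "D i \<in> borel_measurable borel" for i using D(1) by (intro borel_measurable_continuous_onI)
  have [measurable]: "?\<phi> \<in> borel_measurable borel" by (intro borel_measurable_continuous_onI continuous_box_bump)
  have [measurable]: "K \<in> sets borel" using K by (intro borel_closed compact_imp_closed)
  have [measurable]: "Z \<in> borel_measurable borel" unfolding Z_def by measurable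
  have Ui: "integrable lborel Z"
    unfolding Z_def using weak K um by (intro loc_integrable_lborel[of U]) (auto simp: weak_pd_def)
  have wi: "integrable lborel (\<lambda>y. indicator K y * w i y)" for i
    using weak K by (intro loc_integrable_lborel[of U]) (auto simp: weak_pd_def)
  have inK: "y \<in> K" if "y - s *\<^sub>R v \<in> cbox a b" "s \<in> {0..1}" for y s using seg[OF that] by simp
  have step: "(\<integral>y. Z y * D i (y - s *\<^sub>R v) \<partial>lborel) = - (\<integral>y. indicator K y * w i y * ?\<phi> (y - s *\<^sub>R v) \<partial>lborel)"
    if s: "s \<in> {0..1}" for i s
  proof -
    have "cbox (a + s *\<^sub>R v) (b + s *\<^sub>R v) \<subseteq> U"
    proof
      fix y assume "y \<in> cbox (a + s *\<^sub>R v) (b + s *\<^sub>R v)"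
      then have "y - s *\<^sub>R v \<in> cbox a b" by (auto simp: mem_box_cart algebra_simps)
      then show "y \<in> U" using inK s K by blast
    qed
    then have "test_fun U (\<lambda>x. ?\<phi> (x - s *\<^sub>R v))" by (rule test_fun_box_bump)
    then have "(LINT x:U|lebesgue. u x * pdiff i (\<lambda>x. ?\<phi> (x - s *\<^sub>R v)) x) = - (LINT x:U|lebesgue. w i x * ?\<phi> (x - s *\<^sub>R v))"
      using weak[of i] by (auto simp: weak_pd_def)
    moreover have "(LINT x:U|lebesgue. u x * pdiff i (\<lambda>x. ?\<phi> (x - s *\<^sub>R v)) x) = (\<integral>y. Z y * D i (y - s *\<^sub>R v) \<partial>lebesgue)"
      unfolding set_lebesgue_integral_def pdiff_shift D(2) Z_def
    proof (rule Bochner_Integration.integral_cong[OF refl])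
      fix y show "indicat_real U y *\<^sub>R (u y * D i (y - s *\<^sub>R v)) = indicat_real K y * u y * D i (y - s *\<^sub>R v)"
        using inK[OF _ s, of y] D(4)[of "y - s *\<^sub>R v" i] K by (cases "y - s *\<^sub>R v \<in> cbox a b") auto
    qed
    moreover have "(LINT x:U|lebesgue. w i x * ?\<phi> (x - s *\<^sub>R v)) = (\<integral>y. indicator K y * w i y * ?\<phi> (y - s *\<^sub>R v) \<partial>lebesgue)"
      unfolding set_lebesgue_integral_def
    proof (rule Bochner_Integration.integral_cong[OF refl])
      fix y show "indicat_real U y *\<^sub>R (w i y * ?\<phi> (y - s *\<^sub>R v)) = indicat_real K y * w i y * ?\<phi> (y - s *\<^sub>R v)"
        using inK[OF _ s, of y] box_bump_outside[of "y - s *\<^sub>R v" a b k] K box_subset_cbox[of a b]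
        by (cases "y - s *\<^sub>R v \<in> cbox a b") auto
    qed
    ultimately show ?thesis by (simp add: integral_completion)
  qed
  have "\<exists>B. \<forall>x. \<bar>D i x\<bar> \<le> B" for i
  proof -
    have "compact (D i ` cbox a b)" by (intro compact_continuous_image continuous_on_subset[OF D(1)]) auto
    then obtain B where "\<forall>x\<in>cbox a b. \<bar>D i x\<bar> \<le> B" by (auto dest!: compact_imp_bounded simp: bounded_iff)
    then have "\<bar>D i x\<bar> \<le> max B 0" for x using D(4)[of x i] by (cases "x \<in> cbox a b") (auto intro: max.coboundedI1)
    then show ?thesis by blast
  qed
  then have "\<forall>i. \<exists>B. \<forall>x. \<bar>D i x\<bar> \<le> B" by blast
  from choice[OF this] obtain Bd where Bd: "\<And>i x. \<bar>D i x\<bar> \<le> Bd i" by blast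
  define h where "h = (\<lambda>(y, s). indicator {0..1} s * (- (\<Sum>i\<in>UNIV. v $ i * D i (y - s *\<^sub>R v))))"
  have [measurable]: "h \<in> borel_measurable (borel \<Otimes>\<^sub>M borel)" unfolding h_def by measurable
  have hb: "\<bar>h (y, s)\<bar> \<le> (\<Sum>i\<in>UNIV. \<bar>v $ i\<bar> * Bd i) * indicator {0..1} s" for y s
  proof -
    have "\<bar>\<Sum>i\<in>UNIV. v $ i * D i (y - s *\<^sub>R v)\<bar> \<le> (\<Sum>i\<in>UNIV. \<bar>v $ i\<bar> * Bd i)"
      by (rule order_trans[OF sum_abs], rule sum_mono) (simp add: abs_mult mult_left_mono Bd)
    then show ?thesis by (simp add: h_def indicator_def)
  qed
  have ftc: "?\<phi> (y - v) - ?\<phi> y = (\<integral>s. h (y, s) \<partial>lborel)" for y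
  proof -
    have "(\<integral>s. (\<Sum>i\<in>UNIV. (- v) $ i * D i (y + s *\<^sub>R (- v))) * indicator {0..1} s \<partial>lborel) = ?\<phi> (y + 1 *\<^sub>R (- v)) - ?\<phi> (y + 0 *\<^sub>R (- v))"
    proof (rule integral_FTC_Icc_real)
      show "DERIV (\<lambda>s. ?\<phi> (y + s *\<^sub>R (- v))) s :> (\<Sum>i\<in>UNIV. (- v) $ i * D i (y + s *\<^sub>R (- v)))" for s by (rule D(3))
      have "continuous_on UNIV (\<lambda>s. D i (y + s *\<^sub>R (- v)))" for i
        by (rule continuous_on_compose2[OF D(1), of UNIV "\<lambda>s. y + s *\<^sub>R (- v)"]) (auto intro!: continuous_intros)
      then have "continuous_on UNIV (\<lambda>s. \<Sum>i\<in>UNIV. (- v) $ i * D i (y + s *\<^sub>R (- v)))"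
        by (intro continuous_on_sum continuous_on_mult_left)
      then show "isCont (\<lambda>s. \<Sum>i\<in>UNIV. (- v) $ i * D i (y + s *\<^sub>R (- v))) s" for s
        by (simp add: continuous_on_eq_continuous_at)
    qed auto
    moreover have "(\<integral>s. h (y, s) \<partial>lborel) = (\<integral>s. (\<Sum>i\<in>UNIV. (- v) $ i * D i (y + s *\<^sub>R (- v))) * indicator {0..1} s \<partial>lborel)"
      by (intro Bochner_Integration.integral_cong) (auto simp: h_def sum_negf indicator_def)
    ultimately show ?thesis by simp
  qed
  have int2: "integrable (lborel \<Otimes>\<^sub>M lborel) (\<lambda>(y, s). Z y * h (y, s))"
    by (rule integrable_pair_bounded[OF Ui _ hb]) measurable
  have "(\<integral>y. Z y * (?\<phi> (y - v) - ?\<phi> y) \<partial>lborel) = (\<integral>y. (\<integral>s. Z y * h (y, s) \<partial>lborel) \<partial>lborel)" unfolding ftc by simp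
  also have "... = (\<integral>s. (\<integral>y. Z y * h (y, s) \<partial>lborel) \<partial>lborel)"
    by (rule lborel_pair.Fubini_integral[symmetric]) (rule int2)
  also have "... = (\<integral>s. indicator {0..1} s * (\<integral>y. (indicator K y * (\<Sum>i\<in>UNIV. v $ i * w i y)) * ?\<phi> (y - s *\<^sub>R v) \<partial>lborel) \<partial>lborel)"
  proof (rule Bochner_Integration.integral_cong[OF refl])
    fix s :: real
    show "(\<integral>y. Z y * h (y, s) \<partial>lborel) = indicator {0..1} s * (\<integral>y. (indicator K y * (\<Sum>i\<in>UNIV. v $ i * w i y)) * ?\<phi> (y - s *\<^sub>R v) \<partial>lborel)"
    proof (cases "s \<in> {0..1}")
      case True
      have i1: "integrable lborel (\<lambda>y. Z y * D i (y - s *\<^sub>R v))" for i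
        by (rule Bochner_Integration.integrable_bound[OF integrable_mult_right[OF integrable_abs[OF Ui], of "Bd i"]])
          (auto simp: abs_mult mult.commute[of "\<bar>Z _\<bar>"] intro!: mult_right_mono order_trans[OF Bd] abs_ge_self)
      have i2: "integrable lborel (\<lambda>y. indicator K y * w i y * ?\<phi> (y - s *\<^sub>R v))" for i
      proof (rule Bochner_Integration.integrable_bound[OF wi[of i]])
        show "AE y in lborel. norm (indicator K y * w i y * ?\<phi> (y - s *\<^sub>R v)) \<le> norm (indicator K y * w i y)"
          using box_bump_bounds[of a b k] by (intro AE_I2) (auto simp: abs_mult indicator_def intro!: mult_left_le)
      qed measurable
      have "(\<integral>y. Z y * h (y, s) \<partial>lborel) = (\<integral>y. (\<Sum>i\<in>UNIV. - (v $ i) * (Z y * D i (y - s *\<^sub>R v))) \<partial>lborel)"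
        using True by (intro Bochner_Integration.integral_cong) (auto simp: h_def sum_distrib_left sum_negf mult_ac)
      also have "... = (\<Sum>i\<in>UNIV. - (v $ i) * (\<integral>y. Z y * D i (y - s *\<^sub>R v) \<partial>lborel))"
        using i1 by (subst Bochner_Integration.integral_sum) (auto simp: sum_negf)
      also have "... = (\<Sum>i\<in>UNIV. v $ i * (\<integral>y. indicator K y * w i y * ?\<phi> (y - s *\<^sub>R v) \<partial>lborel))"
        by (simp add: step[OF True])
      also have "... = (\<integral>y. (\<Sum>i\<in>UNIV. v $ i * (indicator K y * w i y * ?\<phi> (y - s *\<^sub>R v))) \<partial>lborel)"
        using i2 by (subst Bochner_Integration.integral_sum) auto
      also have "... = (\<integral>y. (indicator K y * (\<Sum>i\<in>UNIV. v $ i * w i y)) * ?\<phi> (y - s *\<^sub>R v) \<partial>lborel)"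
        by (intro Bochner_Integration.integral_cong) (auto simp: sum_distrib_left sum_distrib_right mult_ac)
      finally show ?thesis using True by simp
    qed (simp add: h_def)
  qed
  finally show ?thesis unfolding Z_def .
qed

text \<open>Letting the bumps tend to the indicator replaces test functions by boxes, which detect
  whether a function vanishes almost everywhere.\<close>

lemma weak_identity_box:
  assumes K: "compact K" "K \<subseteq> U" and seg: "\<And>y s. y \<in> cbox a b \<Longrightarrow> s \<in> {0..1} \<Longrightarrow> y + s *\<^sub>R v \<in> K"
  shows "(\<integral>y. indicator K y * u y * (indicator (box a b) (y - v) - indicator (box a b) y) \<partial>lborel) =
    (\<integral>s. indicator {0..1} s * (\<integral>y. (indicator K y * (\<Sum>i\<in>UNIV. v $ i * w i y)) * indicator (box a b) (y - s *\<^sub>R v) \<partial>lborel) \<partial>lborel)"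
proof -
  define Z where "Z y = indicator K y * u y" for y
  define W where "W y = indicator K y * (\<Sum>i\<in>UNIV. v $ i * w i y)" for y
  let ?I = "\<lambda>k s. \<integral>y. W y * box_bump a b k (y - s *\<^sub>R v) \<partial>lborel"
  have [measurable]: "K \<in> sets borel" using K by (intro borel_closed compact_imp_closed)
  have [measurable]: "box_bump a b k \<in> borel_measurable borel" for k by (intro borel_measurable_continuous_onI continuous_box_bump)
  have [measurable]: "Z \<in> borel_measurable borel" "W \<in> borel_measurable borel" unfolding Z_def W_def by measurable
  have Ui: "integrable lborel Z"
    unfolding Z_def using weak K um by (intro loc_integrable_lborel[of U]) (auto simp: weak_pd_def)
  have wi: "integrable lborel (\<lambda>y. indicator K y * w i y)" for i
    using weak K by (intro loc_integrable_lborel[of U]) (auto simp: weak_pd_def)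
  have "integrable lborel (\<lambda>y. \<Sum>i\<in>UNIV. v $ i * (indicator K y * w i y))" using wi by auto
  then have Wi: "integrable lborel W" by (simp add: W_def[abs_def] sum_distrib_left mult_ac)
  have ab: "\<bar>box_bump a b k x\<bar> \<le> 1" for k x using box_bump_bounds[of a b k x] by simp
  have "(\<lambda>k. \<integral>y. Z y * (box_bump a b k (y - v) - box_bump a b k y) \<partial>lborel) \<longlonglongrightarrow>
    (\<integral>y. Z y * (indicator (box a b) (y - v) - indicator (box a b) y) \<partial>lborel)"
  proof (rule integral_dominated_convergence[where w = "\<lambda>y. 2 * \<bar>Z y\<bar>"])
    show "AE y in lborel. (\<lambda>k. Z y * (box_bump a b k (y - v) - box_bump a b k y)) \<longlonglongrightarrow> Z y * (indicator (box a b) (y - v) - indicator (box a b) y)"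
      by (intro AE_I2 tendsto_mult_left tendsto_diff box_bump_tendsto)
    show "AE y in lborel. norm (Z y * (box_bump a b k (y - v) - box_bump a b k y)) \<le> 2 * \<bar>Z y\<bar>" for k
    proof (intro AE_I2)
      fix y
      have "\<bar>box_bump a b k (y - v) - box_bump a b k y\<bar> \<le> 2" using ab[of k "y - v"] ab[of k y] by linarith
      then show "norm (Z y * (box_bump a b k (y - v) - box_bump a b k y)) \<le> 2 * \<bar>Z y\<bar>"
        by (simp add: abs_mult mult.commute[of 2] mult_left_mono)
    qed
  qed (use Ui in auto)
  moreover have "(\<lambda>k. \<integral>s. indicator {0..1} s * ?I k s \<partial>lborel) \<longlonglongrightarrow>
     (\<integral>s. indicator {0..1} s * (\<integral>y. W y * indicator (box a b) (y - s *\<^sub>R v) \<partial>lborel) \<partial>lborel)"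
  proof (rule integral_dominated_convergence[where w = "\<lambda>s. indicator {0..1} s * (\<integral>y. \<bar>W y\<bar> \<partial>lborel)"])
    have dom: "\<bar>W y * box_bump a b k (y - s *\<^sub>R v)\<bar> \<le> \<bar>W y\<bar>" for k y s
      using ab[of k "y - s *\<^sub>R v"] by (simp add: abs_mult mult_left_le)
    show "AE s in lborel. (\<lambda>k. indicator {0..1} s * ?I k s) \<longlonglongrightarrow>
       indicator {0..1} s * (\<integral>y. W y * indicator (box a b) (y - s *\<^sub>R v) \<partial>lborel)"
    proof (intro AE_I2 tendsto_mult_left)
      fix s
      show "(\<lambda>k. ?I k s) \<longlonglongrightarrow> (\<integral>y. W y * indicator (box a b) (y - s *\<^sub>R v) \<partial>lborel)"
        by (rule integral_dominated_convergence[where w = "\<lambda>y. \<bar>W y\<bar>"])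
          (use Wi dom in \<open>auto intro!: AE_I2 tendsto_mult_left box_bump_tendsto\<close>)
    qed
    show "AE s in lborel. norm (indicator {0..1} s * ?I k s) \<le> indicator {0..1} s * (\<integral>y. \<bar>W y\<bar> \<partial>lborel)" for k
    proof (intro AE_I2)
      fix s :: real
      have "\<bar>?I k s\<bar> \<le> (\<integral>y. \<bar>W y * box_bump a b k (y - s *\<^sub>R v)\<bar> \<partial>lborel)" by (rule integral_abs_bound)
      also have "... \<le> (\<integral>y. \<bar>W y\<bar> \<partial>lborel)"
      proof (rule integral_mono)
        show "integrable lborel (\<lambda>y. \<bar>W y * box_bump a b k (y - s *\<^sub>R v)\<bar>)"
          by (rule Bochner_Integration.integrable_bound[OF Wi]) (use dom in auto)
      qed (use Wi dom in auto)
      finally show "norm (indicator {0..1} s * ?I k s) \<le> indicator {0..1} s * (\<integral>y. \<bar>W y\<bar> \<partial>lborel)"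
        by (simp add: abs_mult mult_left_mono)
    qed
    show "integrable lborel (\<lambda>s. indicator {0..1::real} s * (\<integral>y. \<bar>W y\<bar> \<partial>lborel))" by simp
  qed measurable
  moreover have "(\<integral>y. Z y * (box_bump a b k (y - v) - box_bump a b k y) \<partial>lborel) =
    (\<integral>s. indicator {0..1} s * ?I k s \<partial>lborel)" for k unfolding Z_def W_def by (rule weak_identity_bump[OF K seg])
  ultimately show ?thesis unfolding Z_def W_def by (intro LIMSEQ_unique) auto
qed

text \<open>Translating the box identity onto the starting points shows that the defect in the
  fundamental theorem of calculus has zero integral over every subbox, hence vanishes almost
  everywhere.\<close>

lemma weak_segment_box:
  assumes K: "compact K" "K \<subseteq> U" and seg: "\<And>y s. y \<in> cbox a b \<Longrightarrow> s \<in> {0..1} \<Longrightarrow> y + s *\<^sub>R v \<in> K"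
  shows "AE x in lborel. x \<in> box a b \<longrightarrow>
    integrable lborel (\<lambda>s. indicator {0..1} s * (\<Sum>i\<in>UNIV. v $ i * w i (x + s *\<^sub>R v))) \<and>
    u (x + v) - u x = (\<integral>s. indicator {0..1} s * (\<Sum>i\<in>UNIV. v $ i * w i (x + s *\<^sub>R v)) \<partial>lborel)"
proof -
  define Z where "Z y = indicator K y * u y" for y
  define W where "W y = indicator K y * (\<Sum>i\<in>UNIV. v $ i * w i y)" for y
  let ?W = "\<lambda>x s. indicator {0..1} s * W (x + s *\<^sub>R v)"
  have [measurable]: "K \<in> sets borel" using K by (intro borel_closed compact_imp_closed)
  have [measurable]: "Z \<in> borel_measurable borel" "W \<in> borel_measurable borel" unfolding Z_def W_def by measurable
  have Ui: "integrable lborel Z"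
    unfolding Z_def using weak K um by (intro loc_integrable_lborel[of U]) (auto simp: weak_pd_def)
  have wi: "integrable lborel (\<lambda>y. indicator K y * w i y)" for i
    using weak K by (intro loc_integrable_lborel[of U]) (auto simp: weak_pd_def)
  have "integrable lborel (\<lambda>y. \<Sum>i\<in>UNIV. v $ i * (indicator K y * w i y))" using wi by auto
  then have Wi: "integrable lborel W" by (simp add: W_def[abs_def] sum_distrib_left mult_ac)
  have pair: "integrable (lborel \<Otimes>\<^sub>M lborel) (\<lambda>(x, s). indicator E x * ?W x s)"
    if [measurable]: "E \<in> sets borel" for E
  proof (rule integrableI_bounded)
    show "(\<lambda>(x, s). indicator E x * ?W x s) \<in> borel_measurable (lborel \<Otimes>\<^sub>M lborel)" by measurable
    have "(\<integral>\<^sup>+p. ennreal (norm (case p of (x, s) \<Rightarrow> indicator E x * ?W x s)) \<partial>(lborel \<Otimes>\<^sub>M lborel))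
      = (\<integral>\<^sup>+s. (\<integral>\<^sup>+x. ennreal \<bar>indicator E x * ?W x s\<bar> \<partial>lborel) \<partial>lborel)"
      by (subst lborel_pair.nn_integral_snd[symmetric]) (auto simp: split_beta')
    also have "... \<le> (\<integral>\<^sup>+s. (\<integral>\<^sup>+x. indicator {0..1} s * ennreal \<bar>W (x + s *\<^sub>R v)\<bar> \<partial>lborel) \<partial>lborel)"
      by (intro nn_integral_mono) (auto simp: indicator_def)
    also have "... = (\<integral>\<^sup>+s. indicator {0..1::real} s * (\<integral>\<^sup>+x. ennreal \<bar>W x\<bar> \<partial>lborel) \<partial>lborel)"
      by (intro nn_integral_cong, subst nn_integral_cmult, measurable)
        (use lborel_nn_integral_shift[of "\<lambda>x. ennreal \<bar>W x\<bar>"] in simp)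
    also have "... = (\<integral>\<^sup>+x. ennreal \<bar>W x\<bar> \<partial>lborel)" by (subst nn_integral_multc) auto
    also have "... < \<infinity>" using Wi by (simp add: integrable_iff_bounded)
    finally show "(\<integral>\<^sup>+p. ennreal (norm (case p of (x, s) \<Rightarrow> indicator E x * ?W x s)) \<partial>(lborel \<Otimes>\<^sub>M lborel)) < \<infinity>" .
  qed
  \<comment> \<open>The defect is formed with the functions cut off to \<open>K\<close>, which are
    integrable on the whole space. For starting points in the box the cut-off is invisible, because
    their segments stay in \<open>K\<close>.\<close>
  define T where "T x = Z (x + v) - Z x - (\<integral>s. ?W x s \<partial>lborel)" for x
  have Tm [measurable]: "T \<in> borel_measurable borel" unfolding T_def by measurable
  have iUv: "integrable lborel (\<lambda>x. indicator E x * Z (x + v))" if [measurable]: "E \<in> sets borel" for E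
  proof -
    have "integrable (distr lborel borel ((+) v)) Z" using Ui by (simp add: lborel_distr_plus)
    then have "integrable lborel (\<lambda>x. Z (x + v))" by (subst (asm) integrable_distr_eq) (auto simp: add.commute)
    from integrable_real_mult_indicator[OF _ this, of E] show ?thesis by (simp add: mult.commute)
  qed
  have iU: "integrable lborel (\<lambda>x. indicator E x * Z x)" if [measurable]: "E \<in> sets borel" for E
    using integrable_real_mult_indicator[OF _ Ui, of E] by (simp add: mult.commute)
  have iW: "integrable lborel (\<lambda>x. indicator E x * (\<integral>s. ?W x s \<partial>lborel))" if [measurable]: "E \<in> sets borel" for E
    using lborel_pair.integrable_fst'[OF pair[OF that]] by simp
  have boxzero: "(\<integral>x. indicator (box c d) x * T x \<partial>lborel) = 0" if sub: "\<And>y. y \<in> cbox c d \<Longrightarrow> y \<in> cbox a b" for c d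
  proof -
    let ?B = "box c d"
    have id: "(\<integral>y. Z y * (indicator ?B (y - v) - indicator ?B y) \<partial>lborel) =
      (\<integral>s. indicator {0..1} s * (\<integral>y. W y * indicator ?B (y - s *\<^sub>R v) \<partial>lborel) \<partial>lborel)"
      unfolding Z_def W_def by (rule weak_identity_box[OF K]) (use seg sub in auto)
    have "(\<integral>y. W y * indicator ?B (y - s *\<^sub>R v) \<partial>lborel) = (\<integral>x. W (x + s *\<^sub>R v) * indicator ?B x \<partial>lborel)" for s
      by (subst lborel_integral_shift[where c = "s *\<^sub>R v"]) auto
    then have "(\<integral>s. indicator {0..1} s * (\<integral>y. W y * indicator ?B (y - s *\<^sub>R v) \<partial>lborel) \<partial>lborel)
      = (\<integral>s. (\<integral>x. indicator ?B x * ?W x s \<partial>lborel) \<partial>lborel)"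
      by (simp add: mult_ac integral_mult_right_zero[symmetric] del: integral_mult_right_zero)
    also have "... = (\<integral>x. (\<integral>s. indicator ?B x * ?W x s \<partial>lborel) \<partial>lborel)"
      by (rule lborel_pair.Fubini_integral) (rule pair, simp)
    finally have r: "(\<integral>s. indicator {0..1} s * (\<integral>y. W y * indicator ?B (y - s *\<^sub>R v) \<partial>lborel) \<partial>lborel)
      = (\<integral>x. indicator ?B x * (\<integral>s. ?W x s \<partial>lborel) \<partial>lborel)" by simp
    have sh: "integrable lborel (\<lambda>y. Z y * indicator ?B (y - v))"
      by (rule Bochner_Integration.integrable_bound[OF Ui]) (auto simp: indicator_def)
    have "(\<integral>y. Z y * (indicator ?B (y - v) - indicator ?B y) \<partial>lborel) =
      (\<integral>y. Z y * indicator ?B (y - v) \<partial>lborel) - (\<integral>x. indicator ?B x * Z x \<partial>lborel)"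
      using sh iU[of ?B] by (subst Bochner_Integration.integral_diff[symmetric]) (auto simp: algebra_simps)
    also have "(\<integral>y. Z y * indicator ?B (y - v) \<partial>lborel) = (\<integral>x. indicator ?B x * Z (x + v) \<partial>lborel)"
      by (subst lborel_integral_shift[where c = v]) (auto simp: mult.commute)
    finally have l: "(\<integral>y. Z y * (indicator ?B (y - v) - indicator ?B y) \<partial>lborel) =
      (\<integral>x. indicator ?B x * Z (x + v) \<partial>lborel) - (\<integral>x. indicator ?B x * Z x \<partial>lborel)" .
    have "(\<integral>x. indicator ?B x * T x \<partial>lborel) = (\<integral>x. indicator ?B x * Z (x + v) - indicator ?B x * Z x -
       indicator ?B x * (\<integral>s. ?W x s \<partial>lborel) \<partial>lborel)"
      by (intro Bochner_Integration.integral_cong) (auto simp: T_def algebra_simps)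
    also have "... = (\<integral>x. indicator ?B x * Z (x + v) \<partial>lborel) - (\<integral>x. indicator ?B x * Z x \<partial>lborel) -
      (\<integral>x. indicator ?B x * (\<integral>s. ?W x s \<partial>lborel) \<partial>lborel)"
      using iUv[of ?B] iU[of ?B] iW[of ?B] by (subst Bochner_Integration.integral_diff) auto
    also have "... = 0" using id l r by simp
    finally show ?thesis .
  qed
  have "AE x in lborel. indicator (box a b) x * T x = 0"
  proof (rule AE_zero_if_box_integrals_zero)
    have "integrable lborel (\<lambda>x. indicator (box a b) x * Z (x + v) - indicator (box a b) x * Z x -
       indicator (box a b) x * (\<integral>s. ?W x s \<partial>lborel))"
      using iUv[of "box a b"] iU[of "box a b"] iW[of "box a b"] by (intro Bochner_Integration.integrable_diff) auto
    then show "integrable lborel (\<lambda>x. indicator (box a b) x * T x)" by (simp add: T_def algebra_simps)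
    fix c d
    \<comment> \<open>Arbitrary test boxes reduce to subboxes of \<open>box a b\<close>, as the
      intersection of two boxes is a box.\<close>
    obtain c' d' where cd: "box c d \<inter> box a b = box c' d'" by (simp add: box_Int_box)
    have "(\<integral>x. indicator (box c d) x * (indicator (box a b) x * T x) \<partial>lborel) = (\<integral>x. indicator (box c' d') x * T x \<partial>lborel)"
      unfolding cd[symmetric] by (intro Bochner_Integration.integral_cong) (auto simp: indicator_def)
    also have "... = 0"
    proof (cases "box c' d' = {}")
      case False
      show ?thesis
      proof (rule boxzero)
        fix y assume "y \<in> cbox c' d'"
        then have "y \<in> closure (box c' d')" using False by (simp add: closure_box)
        also have "... \<subseteq> closure (cbox a b)" using cd box_subset_cbox[of a b] by (intro closure_mono) blast
        finally show "y \<in> cbox a b" by simp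
      qed
    qed simp
    finally show "(\<integral>x. indicator (box c d) x * (indicator (box a b) x * T x) \<partial>lborel) = 0" .
  qed
  moreover have "AE x in lborel. integrable lborel (\<lambda>s. indicator (box a b) x * ?W x s)"
    using lborel_pair.AE_integrable_fst'[OF pair[of "box a b"]] by simp
  ultimately show ?thesis
  proof eventually_elim
    case (elim x)
    show ?case
    proof
      assume x: "x \<in> box a b"
      then have xc: "x \<in> cbox a b" using box_subset_cbox by blast
      have W: "?W x s = indicator {0..1} s * (\<Sum>i\<in>UNIV. v $ i * w i (x + s *\<^sub>R v))" for s
        using seg[OF xc, of s] by (auto simp: W_def indicator_def)
      have "Z (x + v) = u (x + v)" "Z x = u x" using seg[OF xc, of 1] seg[OF xc, of 0] by (auto simp: Z_def)
      then show "integrable lborel (\<lambda>s. indicator {0..1} s * (\<Sum>i\<in>UNIV. v $ i * w i (x + s *\<^sub>R v))) \<and>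
        u (x + v) - u x = (\<integral>s. indicator {0..1} s * (\<Sum>i\<in>UNIV. v $ i * w i (x + s *\<^sub>R v)) \<partial>lborel)"
        using elim x unfolding T_def W by simp
    qed
  qed
qed

text \<open>For fixed v the starting points whose segment stays in \<open>U\<close> form an open
  set, a countable union of closed boxes with negligible faces. The exceptional null set depends on
  v.\<close>

lemma weak_segment:
  assumes op: "open U"
  shows "AE x in lborel. stays U x v 1 \<longrightarrow>
    integrable lborel (\<lambda>s. indicator {0..1} s * (\<Sum>i\<in>UNIV. v $ i * w i (x + s *\<^sub>R v))) \<and>
    u (x + v) - u x = (\<integral>s. indicator {0..1} s * (\<Sum>i\<in>UNIV. v $ i * w i (x + s *\<^sub>R v)) \<partial>lborel)" (is "AE x in lborel. _ \<longrightarrow> ?P x")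
proof -
  let ?O = "{x. stays U x v 1}"
  have "open ((\<lambda>x. (x, v)) -` {p. stays U (fst p) (snd p) 1})" by (intro open_vimage open_stays op continuous_intros)
  then have "open ?O" by (simp add: vimage_def)
  then obtain \<D> where \<D>: "countable \<D>" "\<D> \<subseteq> Pow ?O" "\<And>X. X \<in> \<D> \<Longrightarrow> \<exists>a b. X = cbox a b" "\<Union>\<D> = ?O"
    by (rule open_countable_Union_open_cbox) blast
  have "AE x in lborel. x \<in> X \<longrightarrow> ?P x" if X: "X \<in> \<D>" for X
  proof -
    obtain a b where ab: "X = cbox a b" using \<D>(3)[OF X] by blast
    define K where "K = (\<lambda>p. fst p + snd p *\<^sub>R v) ` (cbox a b \<times> {0..1})"
    have "compact K" unfolding K_def by (intro compact_continuous_image compact_Times continuous_intros) auto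
    moreover have "K \<subseteq> U" using X \<D>(2) unfolding K_def ab stays_def by force
    moreover have "y + s *\<^sub>R v \<in> K" if "y \<in> cbox a b" "s \<in> {0..1}" for y s
      unfolding K_def using that by (auto intro!: image_eqI[of _ _ "(y, s)"])
    ultimately have 1: "AE x in lborel. x \<in> box a b \<longrightarrow> ?P x" by (rule weak_segment_box)
    have "cbox a b - box a b \<in> null_sets lborel"
      using negligible_frontier_interval[of a b] by (simp add: negligible_iff_null_sets null_sets_completion_iff)
    then have "AE x in lborel. x \<notin> cbox a b - box a b" by (rule AE_not_in)
    with 1 show ?thesis unfolding ab by eventually_elim auto
  qed
  then have "AE x in lborel. \<forall>X\<in>\<D>. x \<in> X \<longrightarrow> ?P x" by (subst AE_ball_countable[OF \<D>(1)]) blast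
  then show ?thesis by eventually_elim (use \<D>(4) in blast)
qed

end

section \<open>Second order Taylor bounds up to the exit point\<close>

section \<open>Taylor estimate along rays\<close>

definition ray_int :: "('a::euclidean_space \<Rightarrow> ennreal) \<Rightarrow> 'a \<Rightarrow> 'a \<Rightarrow> ennreal" where
  "ray_int F x v = (\<integral>\<^sup>+s. indicator {0<..} s * F (x + s *\<^sub>R v) \<partial>lborel)"

text \<open>Extension by zero lets ray integrals run over the whole half-line, wherever the ray
  leaves or re-enters the domain.\<close>

definition hess_dens :: "(real^'n::finite) set \<Rightarrow> (real^'n \<Rightarrow> real^'n^'n) \<Rightarrow> real^'n \<Rightarrow> ennreal" where
  "hess_dens U H y = indicator U y * ennreal (norm (H y))"

lemma ray_int_measurable [measurable]:
  assumes [measurable]: "F \<in> borel_measurable borel" "f \<in> borel_measurable M" "h \<in> borel_measurable M"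
  shows "(\<lambda>p. ray_int F (f p) (h p)) \<in> borel_measurable M"
  unfolding ray_int_def by measurable

text \<open>The norm of \<open>real^'n^'n\<close> is the Euclidean norm of all entries, so
  Cauchy-Schwarz in each row and then over the rows suffices.\<close>

lemma bilinear_form_bound:
  fixes A :: "real^'n::finite^'n" and v w :: "real^'n"
  shows "\<bar>\<Sum>i\<in>UNIV. w $ i * (\<Sum>j\<in>UNIV. v $ j * A $ i $ j)\<bar> \<le> norm w * norm v * norm A"
proof -
  have row: "\<bar>\<Sum>j\<in>UNIV. v $ j * A $ i $ j\<bar> \<le> norm v * norm (A $ i)" for i
    using Cauchy_Schwarz_ineq2[of v "A $ i"] by (simp add: inner_vec_def)
  have "\<bar>\<Sum>i\<in>UNIV. w $ i * (\<Sum>j\<in>UNIV. v $ j * A $ i $ j)\<bar> \<le> (\<Sum>i\<in>UNIV. \<bar>w $ i\<bar> * (norm v * norm (A $ i)))"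
    by (rule order_trans[OF sum_abs], rule sum_mono) (simp add: abs_mult mult_left_mono row)
  also have "... = norm v * (\<Sum>i\<in>UNIV. \<bar>w $ i\<bar> * \<bar>norm (A $ i)\<bar>)" by (simp add: sum_distrib_left mult_ac)
  also have "... \<le> norm v * (L2_set (\<lambda>i. w $ i) UNIV * L2_set (\<lambda>i. norm (A $ i)) UNIV)"
    by (intro mult_left_mono L2_set_mult_ineq) auto
  also have "... = norm w * norm v * norm A" by (simp add: norm_vec_def L2_set_def)
  finally show ?thesis .
qed

lemma ray_int_scaled:
  fixes F :: "'a::euclidean_space \<Rightarrow> ennreal"
  assumes [measurable]: "F \<in> borel_measurable borel" and s: "0 < s"
  shows "(\<integral>\<^sup>+\<sigma>. indicator {0<..1} \<sigma> * (ennreal s * F (x + (\<sigma> * s) *\<^sub>R v)) \<partial>lborel) \<le> ray_int F x v"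
proof -
  have "(\<integral>\<^sup>+\<sigma>. indicator {0<..1} \<sigma> * (ennreal s * F (x + (\<sigma> * s) *\<^sub>R v)) \<partial>lborel) \<le>
     (\<integral>\<^sup>+\<sigma>. ennreal s * (indicator {0<..} (0 + s * \<sigma>) * F (x + (0 + s * \<sigma>) *\<^sub>R v)) \<partial>lborel)"
    using s by (intro nn_integral_mono) (auto simp: indicator_def mult.commute)
  also have "... = ennreal s * (\<integral>\<^sup>+\<sigma>. indicator {0<..} (0 + s * \<sigma>) * F (x + (0 + s * \<sigma>) *\<^sub>R v) \<partial>lborel)"
    by (rule nn_integral_cmult) measurable
  also have "... = ray_int F x v" unfolding ray_int_def using s by (subst nn_integral_real_affine[of _ s 0]) auto
  finally show ?thesis .
qed

lemma stays_scale: "0 \<le> s \<Longrightarrow> stays U x v s \<Longrightarrow> stays U x (s *\<^sub>R v) 1"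
  unfolding stays_def by (auto simp: mult_left_le_one_le)

text \<open>Here v is fixed and (x, s) varies. For s \<ge> 0, staying up to time s with velocity v
  is staying up to time 1 with velocity s v, an open condition; for negative s the condition is
  vacuous.\<close>

lemma stays_measurable:
  fixes U :: "'a::euclidean_space set"
  assumes "open U"
  shows "Measurable.pred (borel \<Otimes>\<^sub>M borel) (\<lambda>p. stays U (fst p) v (snd p))"
proof -
  have "open ((\<lambda>p::'a \<times> real. (fst p, snd p *\<^sub>R v)) -` {q. stays U (fst q) (snd q) 1})"
    by (intro open_vimage open_stays assms continuous_intros)
  then have o: "{p. stays U (fst p) (snd p *\<^sub>R v) 1} \<in> sets (borel :: ('a \<times> real) measure)"
    by (auto simp: vimage_def intro: borel_open)
  have "stays U x v s \<longleftrightarrow> s < 0 \<or> stays U x (s *\<^sub>R v) 1" for x s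
  proof (cases "s < 0")
    case False
    have "stays U x v s" if st: "stays U x (s *\<^sub>R v) 1" unfolding stays_def
    proof
      fix t assume t: "t \<in> {0..s}"
      show "x + t *\<^sub>R v \<in> U"
      proof (cases "s = 0")
        case True
        then show ?thesis using st t by (auto simp: stays_def)
      next
        case nz: False
        then have "t / s \<in> {0..1}" using t False by (auto simp: field_simps)
        then have "x + (t / s) *\<^sub>R (s *\<^sub>R v) \<in> U" using st unfolding stays_def by blast
        then show ?thesis using nz by simp
      qed
    qed
    then show ?thesis using False stays_scale[of s U x v] by auto
  qed (auto simp: stays_def)
  then have "{p. stays U (fst p) v (snd p)} = {p. snd p < 0} \<union> {p. stays U (fst p) (snd p *\<^sub>R v) 1}" by auto
  also have "... \<in> sets (borel :: ('a \<times> real) measure)"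
    by (intro sets.Un o borel_open open_Collect_less continuous_intros)
  finally have "{p. stays U (fst p) v (snd p)} \<in> sets (borel \<Otimes>\<^sub>M borel)" by (simp add: borel_prod[symmetric])
  then show ?thesis by (simp add: pred_def space_pair_measure)
qed

context
  fixes U :: "(real^'n::finite) set" and u :: "real^'n \<Rightarrow> real" and G :: "real^'n \<Rightarrow> real^'n"
    and H :: "real^'n \<Rightarrow> real^'n^'n"
  assumes op: "open U" and um [measurable]: "u \<in> borel_measurable borel"
    and Gm [measurable]: "G \<in> borel_measurable borel" and Hm [measurable]: "H \<in> borel_measurable borel"
    and wu: "\<And>i. weak_pd U u i (\<lambda>x. G x $ i)" and wG: "\<And>i j. weak_pd U (\<lambda>x. G x $ i) j (\<lambda>x. H x $ i $ j)"
begin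

lemma component_measurable [measurable]:
  "(\<lambda>x. G x $ i) \<in> borel_measurable borel" "(\<lambda>x. H x $ i $ j) \<in> borel_measurable borel"
proof -
  have "continuous_on UNIV (\<lambda>y::real^'n. y $ i)" by (intro continuous_intros)
  from borel_measurable_continuous_on[OF this Gm] show "(\<lambda>x. G x $ i) \<in> borel_measurable borel" .
  have "continuous_on UNIV (\<lambda>y::real^'n^'n. y $ i $ j)" by (intro continuous_intros)
  from borel_measurable_continuous_on[OF this Hm] show "(\<lambda>x. H x $ i $ j) \<in> borel_measurable borel" .
qed

lemma hess_dens_measurable [measurable]: "hess_dens U H \<in> borel_measurable borel"
proof -
  have [measurable]: "U \<in> sets borel" using op by (rule borel_open)
  show ?thesis unfolding hess_dens_def by measurable
qed

lemma gradient_segment: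
  "AE x in lborel. stays U x v 1 \<longrightarrow> (\<forall>i.
    integrable lborel (\<lambda>s. indicator {0..1} s * (\<Sum>j\<in>UNIV. v $ j * H (x + s *\<^sub>R v) $ i $ j)) \<and>
    G (x + v) $ i - G x $ i = (\<integral>s. indicator {0..1} s * (\<Sum>j\<in>UNIV. v $ j * H (x + s *\<^sub>R v) $ i $ j) \<partial>lborel))"
proof -
  have "AE x in lborel. \<forall>i\<in>UNIV. stays U x v 1 \<longrightarrow>
    integrable lborel (\<lambda>s. indicator {0..1} s * (\<Sum>j\<in>UNIV. v $ j * H (x + s *\<^sub>R v) $ i $ j)) \<and>
    G (x + v) $ i - G x $ i = (\<integral>s. indicator {0..1} s * (\<Sum>j\<in>UNIV. v $ j * H (x + s *\<^sub>R v) $ i $ j) \<partial>lborel)"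
    by (rule AE_finite_allI, simp) (rule weak_segment[OF _ _ _ op]; (rule wG | measurable))
  then show ?thesis by eventually_elim auto
qed

text \<open>The increment w is tested against itself: |w|^2 is an integral of bilinear forms bounded
  by |w| |v| |H|, and one factor |w| is divided out. Estimating the components one by one would cost
  a dimensional factor.\<close>

lemma gradient_difference_norm:
  "AE x in lborel. stays U x v 1 \<longrightarrow> ennreal (norm (G (x + v) - G x)) \<le>
     ennreal (norm v) * (\<integral>\<^sup>+s. indicator {0<..1} s * ennreal (norm (H (x + s *\<^sub>R v))) \<partial>lborel)"
  using gradient_segment[of v]
proof eventually_elim
  case (elim x)
  show ?case
  proof
    assume st: "stays U x v 1"
    let ?f = "\<lambda>i s. indicator {0..1} s * (\<Sum>j\<in>UNIV. v $ j * H (x + s *\<^sub>R v) $ i $ j)"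
    let ?w = "G (x + v) - G x"
    let ?q = "\<lambda>s. indicator {0..1} s * (\<Sum>i\<in>UNIV. ?w $ i * (\<Sum>j\<in>UNIV. v $ j * H (x + s *\<^sub>R v) $ i $ j))"
    let ?I = "\<integral>\<^sup>+s. indicator {0<..1} s * ennreal (norm (H (x + s *\<^sub>R v))) \<partial>lborel"
    have int: "\<And>i. integrable lborel (?f i)" and eq: "\<And>i. ?w $ i = (\<integral>s. ?f i s \<partial>lborel)" using elim st by auto
    have sum: "(\<Sum>i\<in>UNIV. ?w $ i * ?f i s) = ?q s" for s by (simp add: sum_distrib_left mult_ac)
    have "(norm ?w)\<^sup>2 = (\<Sum>i\<in>UNIV. ?w $ i * ?w $ i)" by (simp add: dot_square_norm[symmetric] inner_vec_def)
    also have "... = (\<Sum>i\<in>UNIV. ?w $ i * (\<integral>s. ?f i s \<partial>lborel))" by (simp only: eq[symmetric])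
    also have "... = (\<integral>s. (\<Sum>i\<in>UNIV. ?w $ i * ?f i s) \<partial>lborel)"
      using int by (subst Bochner_Integration.integral_sum) auto
    also have "... = (\<integral>s. ?q s \<partial>lborel)" by (simp only: sum)
    finally have e: "(norm ?w)\<^sup>2 = (\<integral>s. ?q s \<partial>lborel)" .
    have "integrable lborel (\<lambda>s. \<Sum>i\<in>UNIV. ?w $ i * ?f i s)"
      using int by (intro Bochner_Integration.integrable_sum integrable_mult_right)
    then have "integrable lborel ?q" by (simp only: sum)
    then have "ennreal ((norm ?w)\<^sup>2) \<le> (\<integral>\<^sup>+s. ennreal \<bar>?q s\<bar> \<partial>lborel)"
      using integral_norm_bound_ennreal[of lborel ?q] e[symmetric] by simp
    also have "... \<le> (\<integral>\<^sup>+s. ennreal (norm ?w * norm v) * (indicator {0<..1} s * ennreal (norm (H (x + s *\<^sub>R v)))) \<partial>lborel)"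
    proof (rule nn_integral_mono_AE, goal_cases)
      case 1
      have "AE s in lborel. s \<noteq> (0::real)" by (rule AE_lborel_singleton)
      then show ?case
      proof eventually_elim
        case (elim s)
        show ?case using elim bilinear_form_bound[of ?w v "H (x + s *\<^sub>R v)"]
          by (auto simp: indicator_def ennreal_mult'[symmetric] intro!: ennreal_leI)
      qed
    qed
    also have "... = ennreal (norm ?w * norm v) * ?I" by (rule nn_integral_cmult) measurable
    finally have le: "ennreal ((norm ?w)\<^sup>2) \<le> ennreal (norm ?w * norm v) * ?I" .
    show "ennreal (norm ?w) \<le> ennreal (norm v) * ?I"
    proof (cases "?w = 0")
      case False
      have "ennreal (norm ?w) * ennreal (norm ?w) \<le> ennreal (norm ?w) * (ennreal (norm v) * ?I)"
        using le by (simp add: power2_eq_square ennreal_mult mult.assoc)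
      then show ?thesis using False by (simp add: ennreal_mult_le_mult_iff)
    qed simp
  qed
qed

lemma gradient_increment_bound:
  assumes s: "0 < s"
  shows "AE x in lborel. stays U x v s \<longrightarrow>
    ennreal \<bar>v \<bullet> G (x + s *\<^sub>R v) - v \<bullet> G x\<bar> \<le> ennreal ((norm v)\<^sup>2) * ray_int (hess_dens U H) x v"
  using gradient_segment[of "s *\<^sub>R v"]
proof eventually_elim
  case (elim x)
  show ?case
  proof
    assume st: "stays U x v s"
    let ?f = "\<lambda>i \<sigma>. indicator {0..1} \<sigma> * (\<Sum>j\<in>UNIV. (s *\<^sub>R v) $ j * H (x + \<sigma> *\<^sub>R s *\<^sub>R v) $ i $ j)"
    let ?q = "\<lambda>\<sigma>. indicator {0..1} \<sigma> * (s * (\<Sum>i\<in>UNIV. v $ i * (\<Sum>j\<in>UNIV. v $ j * H (x + (\<sigma> * s) *\<^sub>R v) $ i $ j)))"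
    have int: "\<And>i. integrable lborel (?f i)" and eq: "\<And>i. G (x + s *\<^sub>R v) $ i - G x $ i = (\<integral>\<sigma>. ?f i \<sigma> \<partial>lborel)"
      using elim stays_scale[of s U x v] st s by auto
    have sum: "(\<Sum>i\<in>UNIV. v $ i * ?f i \<sigma>) = ?q \<sigma>" for \<sigma> by (simp add: sum_distrib_left mult_ac)
    have "v \<bullet> G (x + s *\<^sub>R v) - v \<bullet> G x = (\<Sum>i\<in>UNIV. v $ i * (G (x + s *\<^sub>R v) $ i - G x $ i))"
      by (simp add: inner_vec_def sum_subtractf right_diff_distrib)
    also have "... = (\<Sum>i\<in>UNIV. v $ i * (\<integral>\<sigma>. ?f i \<sigma> \<partial>lborel))" by (simp only: eq)
    also have "... = (\<integral>\<sigma>. (\<Sum>i\<in>UNIV. v $ i * ?f i \<sigma>) \<partial>lborel)" using int by (subst Bochner_Integration.integral_sum) auto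
    also have "... = (\<integral>\<sigma>. ?q \<sigma> \<partial>lborel)" by (simp only: sum)
    finally have "v \<bullet> G (x + s *\<^sub>R v) - v \<bullet> G x = (\<integral>\<sigma>. ?q \<sigma> \<partial>lborel)" .
    moreover have "integrable lborel (\<lambda>\<sigma>. \<Sum>i\<in>UNIV. v $ i * ?f i \<sigma>)"
      using int by (intro Bochner_Integration.integrable_sum integrable_mult_right)
    then have "integrable lborel ?q" by (simp only: sum)
    ultimately have "ennreal \<bar>v \<bullet> G (x + s *\<^sub>R v) - v \<bullet> G x\<bar> \<le> (\<integral>\<^sup>+\<sigma>. ennreal \<bar>?q \<sigma>\<bar> \<partial>lborel)"
      using integral_norm_bound_ennreal[of lborel ?q] by simp
    also have "... \<le> (\<integral>\<^sup>+\<sigma>. ennreal ((norm v)\<^sup>2) * (indicator {0<..1} \<sigma> * (ennreal s * hess_dens U H (x + (\<sigma> * s) *\<^sub>R v))) \<partial>lborel)"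
    proof (rule nn_integral_mono_AE, goal_cases)
      case 1
      have "AE \<sigma> in lborel. \<sigma> \<noteq> (0::real)" by (rule AE_lborel_singleton)
      then show ?case
      proof eventually_elim
        case (elim \<sigma>)
        show ?case
        proof (cases "\<sigma> \<in> {0..1}")
          case True
          then have "x + (\<sigma> * s) *\<^sub>R v \<in> U" using st s by (auto simp: stays_def mult_left_le_one_le)
          moreover have "\<bar>?q \<sigma>\<bar> \<le> (norm v)\<^sup>2 * (s * norm (H (x + (\<sigma> * s) *\<^sub>R v)))"
            using True s bilinear_form_bound[of v v "H (x + (\<sigma> * s) *\<^sub>R v)"]
            by (simp add: abs_mult power2_eq_square mult.left_commute[of _ s] mult_left_mono)
          ultimately show ?thesis using True elim s by (simp add: hess_dens_def ennreal_mult'[symmetric] ennreal_leI)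
        qed auto
      qed
    qed
    also have "... = ennreal ((norm v)\<^sup>2) * (\<integral>\<^sup>+\<sigma>. indicator {0<..1} \<sigma> * (ennreal s * hess_dens U H (x + (\<sigma> * s) *\<^sub>R v)) \<partial>lborel)"
      by (rule nn_integral_cmult) measurable
    also have "... \<le> ennreal ((norm v)\<^sup>2) * ray_int (hess_dens U H) x v" by (intro mult_left_mono ray_int_scaled s) auto
    finally show "ennreal \<bar>v \<bullet> G (x + s *\<^sub>R v) - v \<bullet> G x\<bar> \<le> ennreal ((norm v)\<^sup>2) * ray_int (hess_dens U H) x v" .
  qed
qed

text \<open>The bound for the increment of v . G is inserted into the first order formula for
  \<open>u\<close>. It is known for each time t at almost every x; Fubini turns this into almost
  every t for almost every x. No Taylor weight is kept, as the whole ray integral dominates every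
  increment.\<close>

lemma taylor_segment:
  assumes s: "0 < s"
  shows "AE x in lborel. stays U x v s \<longrightarrow>
    ennreal \<bar>u (x + s *\<^sub>R v) - u x - s * (v \<bullet> G x)\<bar> \<le> ennreal (s * (norm v)\<^sup>2) * ray_int (hess_dens U H) x v"
proof -
  let ?D = "ray_int (hess_dens U H)"
  let ?P = "\<lambda>x t. 0 < t \<and> stays U x v t \<longrightarrow> ennreal \<bar>v \<bullet> G (x + t *\<^sub>R v) - v \<bullet> G x\<bar> \<le> ennreal ((norm v)\<^sup>2) * ?D x v"
  note [measurable] = stays_measurable[OF op, of v]
  have "AE x in lborel. AE t in lborel. ?P x t"
  proof (subst lborel_pair.AE_commute)
    show "{p \<in> space (lborel \<Otimes>\<^sub>M lborel). ?P (fst p) (snd p)} \<in> sets (lborel \<Otimes>\<^sub>M lborel)" by measurable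
    show "AE t in lborel. AE x in lborel. ?P x t"
    proof (rule AE_I2)
      fix t :: real
      show "AE x in lborel. ?P x t"
      proof (cases "0 < t")
        case True
        from gradient_increment_bound[OF True, of v] show ?thesis by eventually_elim auto
      qed auto
    qed
  qed
  moreover have "AE x in lborel. stays U x (s *\<^sub>R v) 1 \<longrightarrow>
    integrable lborel (\<lambda>\<sigma>. indicator {0..1} \<sigma> * (\<Sum>i\<in>UNIV. (s *\<^sub>R v) $ i * G (x + \<sigma> *\<^sub>R s *\<^sub>R v) $ i)) \<and>
    u (x + s *\<^sub>R v) - u x = (\<integral>\<sigma>. indicator {0..1} \<sigma> * (\<Sum>i\<in>UNIV. (s *\<^sub>R v) $ i * G (x + \<sigma> *\<^sub>R s *\<^sub>R v) $ i) \<partial>lborel)"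
    by (rule weak_segment[OF _ _ _ op]; (rule wu | measurable))
  ultimately show ?thesis
  proof eventually_elim
    case (elim x)
    show ?case
    proof
      assume st: "stays U x v s"
      let ?f = "\<lambda>\<sigma>. indicator {0..1} \<sigma> * (s * (v \<bullet> G (x + (\<sigma> * s) *\<^sub>R v)))"
      let ?c = "\<lambda>\<sigma>::real. indicator {0..1} \<sigma> * (s * (v \<bullet> G x))"
      have f: "indicator {0..1} \<sigma> * (\<Sum>i\<in>UNIV. (s *\<^sub>R v) $ i * G (x + \<sigma> *\<^sub>R s *\<^sub>R v) $ i) = ?f \<sigma>" for \<sigma>
        by (simp add: inner_vec_def sum_distrib_left mult_ac)
      have int: "integrable lborel ?f" and eq: "u (x + s *\<^sub>R v) - u x = (\<integral>\<sigma>. ?f \<sigma> \<partial>lborel)"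
        using elim(2) stays_scale[of s U x v] st s unfolding f by auto
      have ic: "integrable lborel ?c" by simp
      have "(\<integral>\<sigma>. ?c \<sigma> \<partial>lborel) = s * (v \<bullet> G x)" by simp
      then have "u (x + s *\<^sub>R v) - u x - s * (v \<bullet> G x) = (\<integral>\<sigma>. ?f \<sigma> - ?c \<sigma> \<partial>lborel)" using eq int ic by simp
      then have "ennreal \<bar>u (x + s *\<^sub>R v) - u x - s * (v \<bullet> G x)\<bar> \<le> (\<integral>\<^sup>+\<sigma>. ennreal \<bar>?f \<sigma> - ?c \<sigma>\<bar> \<partial>lborel)"
        using integral_norm_bound_ennreal[OF Bochner_Integration.integrable_diff[OF int ic]] by simp
      also have "... \<le> (\<integral>\<^sup>+\<sigma>. ennreal (s * (norm v)\<^sup>2) * ?D x v * indicator {0..1::real} \<sigma> \<partial>lborel)"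
      proof (rule nn_integral_mono_AE, goal_cases)
        case 1
        have "AE \<sigma> in lborel. ?P x (0 + s * \<sigma>)"
        proof (rule AE_borel_affine)
          have [measurable]: "(\<lambda>t. (x, t)) \<in> borel \<rightarrow>\<^sub>M borel \<Otimes>\<^sub>M borel" by measurable
          have [measurable]: "Measurable.pred borel (\<lambda>t. stays U x v t)"
            using measurable_compose[OF \<open>(\<lambda>t. (x, t)) \<in> borel \<rightarrow>\<^sub>M borel \<Otimes>\<^sub>M borel\<close> stays_measurable[OF op, of v]] by simp
          show "Measurable.pred borel (?P x)" by measurable
        qed (use s elim(1) in auto)
        moreover have "AE \<sigma> in lborel. \<sigma> \<noteq> (0::real)" by (rule AE_lborel_singleton)
        ultimately show ?case
        proof eventually_elim
          case (elim \<sigma>)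
          show ?case
          proof (cases "\<sigma> \<in> {0..1}")
            case True
            then have t: "0 < s * \<sigma>" "s * \<sigma> \<le> s" using elim(2) s by (auto simp: mult_left_le)
            then have "stays U x v (s * \<sigma>)" using st stays_antimono by blast
            with elim(1) t have b: "ennreal \<bar>v \<bullet> G (x + (s * \<sigma>) *\<^sub>R v) - v \<bullet> G x\<bar> \<le> ennreal ((norm v)\<^sup>2) * ?D x v" by simp
            have "ennreal \<bar>?f \<sigma> - ?c \<sigma>\<bar> = ennreal s * ennreal \<bar>v \<bullet> G (x + (s * \<sigma>) *\<^sub>R v) - v \<bullet> G x\<bar>"
              using True s by (simp add: ennreal_mult[symmetric] abs_mult_pos right_diff_distrib[symmetric] abs_mult mult.commute)
            also have "... \<le> ennreal s * (ennreal ((norm v)\<^sup>2) * ?D x v)" by (rule mult_left_mono[OF b]) simp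
            finally show ?thesis using True s by (simp add: ennreal_mult mult.assoc)
          qed auto
        qed
      qed
      also have "... = ennreal (s * (norm v)\<^sup>2) * ?D x v" by (subst nn_integral_cmult_indicator) auto
      finally show "ennreal \<bar>u (x + s *\<^sub>R v) - u x - s * (v \<bullet> G x)\<bar> \<le> ennreal (s * (norm v)\<^sup>2) * ?D x v" .
    qed
  qed
qed

text \<open>The exit time varies with x, whereas the segment estimate has one null set per time.
  Rational times are countable and approach the exit time from below, where the ray is still in the
  domain; continuity of \<open>u\<close> up to the closure carries the bound to the exit point. The
  exchange of quantifiers then allows x to be fixed before v.\<close>

lemma taylor_exit:
  assumes cont: "continuous_on (closure U) u"
  shows "AE x in lborel. AE v in lborel. leaves U x v \<longrightarrow>
    ennreal \<bar>u (exit_point U x v) - u x - exit_time U x v * (v \<bullet> G x)\<bar> \<le>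
      ennreal (exit_time U x v * (norm v)\<^sup>2) * ray_int (hess_dens U H) x v" (is "AE x in lborel. AE v in lborel. ?P x v")
proof (subst lborel_pair.AE_commute)
  have [measurable]: "(\<lambda>p. exit_time U (fst p) (snd p)) \<in> borel_measurable (borel \<Otimes>\<^sub>M borel)"
    "(\<lambda>p. exit_point U (fst p) (snd p)) \<in> borel_measurable (borel \<Otimes>\<^sub>M borel)"
    "Measurable.pred (borel \<Otimes>\<^sub>M borel) (\<lambda>p. leaves U (fst p) (snd p))"
    using exit_time_measurable[OF op] exit_point_measurable[OF op] leaves_measurable[OF op]
    by (auto simp: pred_def space_pair_measure)
  show "{p \<in> space (lborel \<Otimes>\<^sub>M lborel). ?P (fst p) (snd p)} \<in> sets (lborel \<Otimes>\<^sub>M lborel)" by measurable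
  show "AE v in lborel. AE x in lborel. ?P x v"
  proof (rule AE_I2, goal_cases)
    case (1 v)
    let ?D = "ray_int (hess_dens U H)"
    have "AE x in lborel. \<forall>s\<in>{q\<in>\<rat>. 0 < q}. stays U x v s \<longrightarrow>
      ennreal \<bar>u (x + s *\<^sub>R v) - u x - s * (v \<bullet> G x)\<bar> \<le> ennreal (s * (norm v)\<^sup>2) * ?D x v"
      using taylor_segment countable_rat by (subst AE_ball_countable) (auto intro: countable_Collect)
    then show ?case
    proof eventually_elim
      case (elim x)
      show ?case
      proof
        assume lv: "leaves U x v"
        let ?\<tau> = "exit_time U x v"
        have pos: "0 < ?\<tau>" by (rule exit_time_pos[OF lv op])
        have "\<exists>q\<in>\<rat>. max 0 (?\<tau> - 1 / real (Suc k)) < q \<and> q < ?\<tau>" for k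
          using Rats_dense_in_real[of "max 0 (?\<tau> - 1 / real (Suc k))" ?\<tau>] pos by auto
        then have "\<forall>k. \<exists>q. q \<in> \<rat> \<and> max 0 (?\<tau> - 1 / real (Suc k)) < q \<and> q < ?\<tau>" by blast
        from choice[OF this] obtain q where q: "\<And>k. q k \<in> \<rat>" "\<And>k. max 0 (?\<tau> - 1 / real (Suc k)) < q k" "\<And>k. q k < ?\<tau>"
          by blast
        have qlim: "q \<longlonglongrightarrow> ?\<tau>"
        proof (rule tendsto_sandwich[of "\<lambda>k. ?\<tau> - 1 / real (Suc k)" _ _ "\<lambda>_. ?\<tau>"])
          have "(\<lambda>k. ?\<tau> - 1 / real (Suc k)) \<longlonglongrightarrow> ?\<tau> - 0" by (intro tendsto_intros LIMSEQ_Suc[OF lim_1_over_n])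
          then show "(\<lambda>k. ?\<tau> - 1 / real (Suc k)) \<longlonglongrightarrow> ?\<tau>" by simp
        qed (use q in \<open>auto intro!: always_eventually less_imp_le simp: max_less_iff_conj\<close>)
        have qpos: "0 < q k" for k using q(2)[of k] by simp
        have inO: "x + q k *\<^sub>R v \<in> U" for k using qpos[of k] q(3)[of k] by (intro segment_before_exit[OF lv op]) auto
        have bd: "ennreal \<bar>u (x + q k *\<^sub>R v) - u x - q k * (v \<bullet> G x)\<bar> \<le> ennreal (?\<tau> * (norm v)\<^sup>2) * ?D x v" for k
        proof -
          have "stays U x v (q k)" using stays_iff[OF lv op, of "q k"] qpos[of k] q(3)[of k] by simp
          then have "ennreal \<bar>u (x + q k *\<^sub>R v) - u x - q k * (v \<bullet> G x)\<bar> \<le> ennreal (q k * (norm v)\<^sup>2) * ?D x v"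
            using elim q(1)[of k] qpos[of k] by blast
          also have "... \<le> ennreal (?\<tau> * (norm v)\<^sup>2) * ?D x v"
            using q(3)[of k] by (intro mult_right_mono ennreal_leI) (auto intro: less_imp_le)
          finally show ?thesis .
        qed
        have "(\<lambda>k. x + q k *\<^sub>R v) \<longlonglongrightarrow> exit_point U x v" unfolding exit_point_def by (intro tendsto_intros qlim)
        moreover have "exit_point U x v \<in> closure U" using exit_point_frontier[OF lv op] by (simp add: frontier_def)
        ultimately have "(\<lambda>k. u (x + q k *\<^sub>R v)) \<longlonglongrightarrow> u (exit_point U x v)"
          using inO closure_subset[of U] by (intro continuous_on_tendsto_compose[OF cont]) (auto intro!: always_eventually)
        then have lim: "(\<lambda>k. ennreal \<bar>u (x + q k *\<^sub>R v) - u x - q k * (v \<bullet> G x)\<bar>) \<longlonglongrightarrow>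
          ennreal \<bar>u (exit_point U x v) - u x - ?\<tau> * (v \<bullet> G x)\<bar>" by (intro tendsto_intros qlim)
        show "ennreal \<bar>u (exit_point U x v) - u x - ?\<tau> * (v \<bullet> G x)\<bar> \<le> ennreal (?\<tau> * (norm v)\<^sup>2) * ?D x v"
          by (rule LIMSEQ_le_const2[OF lim]) (use bd in blast)
      qed
    qed
  qed
qed

end

section \<open>The gradient bounded by two potentials and a free level\<close>

section \<open>Pointwise estimate for the gradient\<close>

lemma lborel_distr_neg: "distr lborel borel (\<lambda>x. - x) = (lborel :: 'a::euclidean_space measure)"
  by (subst (2) lborel_affine[of "-1" 0]) (auto simp: density_1)

lemma AE_lborel_neg:
  fixes P :: "'a::euclidean_space \<Rightarrow> bool"
  assumes "AE v in lborel. P v"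
  shows "AE v in lborel. P (- v)"
proof -
  have "AE v in distr lborel borel (\<lambda>x::'a. - x). P v" unfolding lborel_distr_neg by (rule assms)
  then show ?thesis by (rule AE_distrD[rotated]) auto
qed

lemma nn_integral_lborel_neg:
  fixes f :: "'a::euclidean_space \<Rightarrow> ennreal"
  assumes [measurable]: "f \<in> borel_measurable borel"
  shows "(\<integral>\<^sup>+v. f (- v) \<partial>lborel) = (\<integral>\<^sup>+v. f v \<partial>lborel)"
proof -
  have "(\<integral>\<^sup>+v. f v \<partial>lborel) = (\<integral>\<^sup>+v. f v \<partial>(distr lborel borel (\<lambda>x::'a. - x)))" by (simp add: lborel_distr_neg)
  also have "... = (\<integral>\<^sup>+v. f (- v) \<partial>lborel)" by (rule nn_integral_distr) auto
  finally show ?thesis by simp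
qed

lemma exit_point_section_measurable:
  fixes U :: "'a::euclidean_space set"
  assumes "open U"
  shows "exit_point U x \<in> borel_measurable borel"
proof -
  have "(\<lambda>v. (\<lambda>p. exit_point U (fst p) (snd p)) (x, v)) \<in> borel_measurable borel"
    by (rule measurable_compose[OF measurable_Pair1' exit_point_measurable[OF assms]]) simp
  then show ?thesis by (simp only: fst_conv snd_conv)
qed

lemma leaves_section_measurable:
  fixes U :: "'a::euclidean_space set"
  assumes "open U"
  shows "{v. leaves U x v} \<in> sets borel"
proof -
  have "Pair x -` {p. leaves U (fst p) (snd p)} \<in> sets borel" by (rule sets_Pair1[OF leaves_measurable[OF assms]])
  then show ?thesis by (simp only: vimage_def mem_Collect_eq fst_conv snd_conv)
qed

text \<open>Averaging directions over an annulus instead of the sphere reduces polar coordinates to linear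
  changes of variables.\<close>

definition annulus :: "'a::real_normed_vector set" where
  "annulus = {v. 1 \<le> norm v \<and> norm v \<le> 2}"

lemma annulus_measurable [measurable]: "annulus \<in> sets (borel :: 'a::euclidean_space measure)"
proof -
  have "annulus = cball 0 2 - ball (0::'a) 1" by (auto simp: annulus_def)
  moreover have "cball 0 2 - ball (0::'a) 1 \<in> sets borel" by (intro sets.Diff) auto
  ultimately show ?thesis by metis
qed

lemma emeasure_annulus: "emeasure lborel (annulus :: 'a::euclidean_space set) \<le> ennreal (unit_ball_vol (real DIM('a)) * 2 ^ DIM('a))"
proof -
  have "emeasure lborel (annulus :: 'a set) \<le> emeasure lborel (cball (0::'a) 2)"
    by (intro emeasure_mono) (auto simp: annulus_def)
  then show ?thesis by (simp add: emeasure_cball)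
qed

text \<open>The ball of radius 1/2 about (3/2) z/|z| lies in the annulus, and on it the component of
  v along z/|z| is at least 1. Its volume is the constant on the left.\<close>

lemma annulus_inner_lower_bound:
  fixes z :: "'a::euclidean_space"
  shows "ennreal (norm z * (unit_ball_vol (real DIM('a)) * (1/2) ^ DIM('a))) \<le>
    (\<integral>\<^sup>+v. indicator annulus v * ennreal \<bar>v \<bullet> z\<bar> \<partial>lborel)"
proof (cases "z = 0")
  case False
  define e where "e = (1 / norm z) *\<^sub>R z"
  have e: "norm e = 1" "z = norm z *\<^sub>R e" using False by (auto simp: e_def)
  let ?B = "ball ((3/2) *\<^sub>R e) (1/2)"
  have B: "v \<in> annulus \<and> norm z \<le> \<bar>v \<bullet> z\<bar>" if v: "v \<in> ?B" for v
  proof -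
    have d: "norm (v - (3/2) *\<^sub>R e) < 1/2" using v by (simp add: dist_norm norm_minus_commute)
    have "norm v \<le> norm ((3/2) *\<^sub>R e) + norm (v - (3/2) *\<^sub>R e)" using norm_triangle_ineq[of "(3/2) *\<^sub>R e" "v - (3/2) *\<^sub>R e"] by simp
    moreover have "norm ((3/2) *\<^sub>R e) \<le> norm v + norm (v - (3/2) *\<^sub>R e)"
      using norm_triangle_ineq[of v "(3/2) *\<^sub>R e - v"] by (simp add: norm_minus_commute)
    ultimately have "v \<in> annulus" using d e by (simp add: annulus_def)
    have "\<bar>(v - (3/2) *\<^sub>R e) \<bullet> e\<bar> \<le> 1/2" using Cauchy_Schwarz_ineq2[of "v - (3/2) *\<^sub>R e" e] d e by simp
    moreover have "(v - (3/2) *\<^sub>R e) \<bullet> e = v \<bullet> e - 3/2" using e by (simp add: inner_diff_left dot_square_norm)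
    ultimately have "1 \<le> v \<bullet> e" by linarith
    then have "norm z * 1 \<le> norm z * (v \<bullet> e)" by (intro mult_left_mono) auto
    also have "norm z * (v \<bullet> e) = v \<bullet> z" using e(2) by (metis inner_scaleR_right)
    finally show ?thesis using \<open>v \<in> annulus\<close> by simp
  qed
  have "ennreal (norm z * (unit_ball_vol (real DIM('a)) * (1/2) ^ DIM('a))) = ennreal (norm z) * emeasure lborel ?B"
    by (simp add: emeasure_ball ennreal_mult)
  also have "... = (\<integral>\<^sup>+v. ennreal (norm z) * indicator ?B v \<partial>lborel)"
    by (rule nn_integral_cmult_indicator[symmetric]) simp
  also have "... \<le> (\<integral>\<^sup>+v. indicator annulus v * ennreal \<bar>v \<bullet> z\<bar> \<partial>lborel)"
    using B by (intro nn_integral_mono) (auto simp: indicator_def intro!: ennreal_leI)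
  finally show ?thesis .
qed simp

text \<open>The value b = u(x) drops out of the difference of the two Taylor formulas. The boundary
  increment carries the same factor \<tau>1 + \<tau>2 as the derivative y, and the weights
  \<tau>1/(\<tau>1+\<tau>2), \<tau>2/(\<tau>1+\<tau>2) of the remainders are at most 1, so no exit
  time survives.\<close>

lemma two_sided_taylor_bound:
  fixes a1 a2 b y \<tau>1 \<tau>2 c d1 d2 m :: real
  assumes "0 < \<tau>1" "0 < \<tau>2" "\<bar>a1 - b - \<tau>1 * y\<bar> \<le> \<tau>1 * c * d1" "\<bar>a2 - b + \<tau>2 * y\<bar> \<le> \<tau>2 * c * d2"
    "\<bar>a1 - a2\<bar> \<le> (\<tau>1 + \<tau>2) * m" "0 \<le> c" "0 \<le> d1" "0 \<le> d2"
  shows "\<bar>y\<bar> \<le> m + c * (d1 + d2)"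
proof -
  have "(\<tau>1 + \<tau>2) * \<bar>y\<bar> = \<bar>(\<tau>1 + \<tau>2) * y\<bar>" using assms by (simp add: abs_mult)
  also have "(\<tau>1 + \<tau>2) * y = (a1 - a2) - (a1 - b - \<tau>1 * y) + (a2 - b + \<tau>2 * y)" by (simp add: algebra_simps)
  also have "\<bar>...\<bar> \<le> (\<tau>1 + \<tau>2) * m + \<tau>1 * c * d1 + \<tau>2 * c * d2" using assms(3-5) by linarith
  also have "... \<le> (\<tau>1 + \<tau>2) * m + (\<tau>1 + \<tau>2) * (c * (d1 + d2))"
  proof -
    have "\<tau>1 * (c * d1) \<le> (\<tau>1 + \<tau>2) * (c * d1)" "\<tau>2 * (c * d2) \<le> (\<tau>1 + \<tau>2) * (c * d2)"
      using assms by (auto intro!: mult_right_mono)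
    then show ?thesis by (simp add: algebra_simps)
  qed
  also have "... = (\<tau>1 + \<tau>2) * (m + c * (d1 + d2))" by (simp add: algebra_simps)
  finally show ?thesis using assms by (simp add: mult_le_cancel_left_pos)
qed

text \<open>The Riesz potential of order one, with respect to an arbitrary measure: Lebesgue measure
  for the Hessian, the boundary measure for the upper gradient. On the diagonal the kernel is 0, not
  infinite, by the convention for \<open>powr\<close>.\<close>

definition riesz :: "'a::euclidean_space measure \<Rightarrow> ('a \<Rightarrow> ennreal) \<Rightarrow> 'a \<Rightarrow> ennreal" where
  "riesz M f x = (\<integral>\<^sup>+y. f y * ennreal (dist x y powr (1 - real DIM('a))) \<partial>M)"

text \<open>The full value |g| is kept above the level, not |g| - s; its integral is then controlled
  by Chebyshev's inequality, in the power scale as in the exponential one.\<close>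

definition excess :: "real \<Rightarrow> ('a \<Rightarrow> real) \<Rightarrow> 'a \<Rightarrow> ennreal" where
  "excess s g y = ennreal \<bar>g y\<bar> * indicator {y. s < \<bar>g y\<bar>} y"

lemma excess_measurable [measurable]: "g \<in> borel_measurable M \<Longrightarrow> excess s g \<in> borel_measurable M"
proof -
  assume [measurable]: "g \<in> borel_measurable M"
  have "excess s g = (\<lambda>y. if s < \<bar>g y\<bar> then ennreal \<bar>g y\<bar> else 0)" by (auto simp: excess_def fun_eq_iff)
  moreover have "(\<lambda>y. if s < \<bar>g y\<bar> then ennreal \<bar>g y\<bar> else 0) \<in> borel_measurable M" by measurable
  ultimately show ?thesis by simp
qed

lemma le_level_plus_excess: "0 \<le> s \<Longrightarrow> ennreal \<bar>g y\<bar> \<le> ennreal s + excess s g y"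
  by (auto simp: excess_def indicator_def not_less intro!: ennreal_leI)

lemma riesz_measurable [measurable]:
  assumes "sets M = sets borel" "sigma_finite_measure M" and [measurable]: "f \<in> borel_measurable borel"
  shows "riesz M f \<in> borel_measurable borel"
proof -
  interpret sigma_finite_measure M by fact
  note [measurable_cong] = assms(1)
  show ?thesis unfolding riesz_def by measurable
qed

lemma riesz_lborel_measurable [measurable]: "f \<in> borel_measurable borel \<Longrightarrow> riesz lborel f \<in> borel_measurable borel"
  by (rule riesz_measurable) (auto simp: sigma_finite_lborel)

text \<open>The numerator adds up the mass of the annulus multiplying the level, the projection
  constant and the ray constant, each doubled because v and -v both contribute; the denominator is
  the volume in \<open>annulus_inner_lower_bound\<close>.\<close>

definition pointwise_const :: "'a::euclidean_space itself \<Rightarrow> real" where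
  "pointwise_const _ = (4 * (unit_ball_vol (real DIM('a)) * 2 ^ DIM('a)) + 4 * proj_kernel_const TYPE('a) + 8 * 2 ^ DIM('a)) /
     (unit_ball_vol (real DIM('a)) * (1/2) ^ DIM('a))"

lemma pointwise_const_pos: "2 \<le> DIM('a::euclidean_space) \<Longrightarrow> 0 < pointwise_const TYPE('a)" unfolding pointwise_const_def
  using proj_kernel_const_pos[where 'a='a] unit_ball_vol_pos[of "real DIM('a)"]
  by (intro divide_pos_pos mult_pos_pos add_pos_pos) auto

context
  fixes U :: "(real^'n::finite) set" and u :: "real^'n \<Rightarrow> real" and G :: "real^'n \<Rightarrow> real^'n"
    and H :: "real^'n \<Rightarrow> real^'n^'n" and Hb :: "(real^'n) measure" and g :: "real^'n \<Rightarrow> real" and N :: "(real^'n) set"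
  assumes op: "open U" and um [measurable]: "u \<in> borel_measurable borel"
    and Gm [measurable]: "G \<in> borel_measurable borel" and Hm [measurable]: "H \<in> borel_measurable borel"
    and wu: "\<And>i. weak_pd U u i (\<lambda>x. G x $ i)" and wG: "\<And>i j. weak_pd U (\<lambda>x. G x $ i) j (\<lambda>x. H x $ i $ j)"
    and cont: "continuous_on (closure U) u" and fin: "emeasure lborel U < \<infinity>" and dim: "2 \<le> CARD('n)"
    and sHb [measurable_cong]: "sets Hb = sets borel"
    and Hb: "\<And>E. E \<in> sets borel \<Longrightarrow> emeasure Hb E = hausdorff_outer (real CARD('n) - 1) (E \<inter> frontier U)"
    and gm [measurable]: "g \<in> borel_measurable borel"
    and Nm [measurable]: "N \<in> sets borel" and N0: "emeasure Hb N = 0"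
    and haj: "\<And>x y. x \<in> frontier U - N \<Longrightarrow> y \<in> frontier U - N \<Longrightarrow> \<bar>u x - u y\<bar> \<le> dist x y * (g x + g y)"
begin

lemma pointwise_at:
  assumes x: "x \<in> U" and s: "0 \<le> s"
    and taylor: "AE v in lborel. leaves U x v \<longrightarrow>
      ennreal \<bar>u (exit_point U x v) - u x - exit_time U x v * (v \<bullet> G x)\<bar> \<le>
      ennreal (exit_time U x v * (norm v)\<^sup>2) * ray_int (hess_dens U H) x v"
  shows "ennreal (norm (G x)) \<le> ennreal (pointwise_const TYPE(real^'n)) *
    (riesz lborel (hess_dens U H) x + ennreal s + riesz Hb (excess s g) x)"
proof -
  let ?n = "DIM(real^'n)" and ?D = "ray_int (hess_dens U H) x" and ?Cp = "proj_kernel_const TYPE(real^'n)"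
  let ?w = "unit_ball_vol (real DIM(real^'n))"
  let ?e = "exit_point U x" and ?\<tau> = "exit_time U x"
  have n2: "2 \<le> ?n" using dim by simp
  have [measurable]: "hess_dens U H \<in> borel_measurable borel" using hess_dens_measurable[OF op um Gm Hm wu wG] .
  have [measurable]: "?e \<in> borel_measurable borel" by (rule exit_point_section_measurable[OF op])
  define S where "S = {v \<in> annulus. leaves U x v}"
  have "{v. leaves U x v} \<in> sets borel" by (rule leaves_section_measurable[OF op])
  moreover have "S = annulus \<inter> {v. leaves U x v}" by (auto simp: S_def)
  ultimately have [measurable]: "S \<in> sets borel" by simp
  have xF: "x \<notin> frontier U" using x op by (simp add: frontier_def interior_open)
  have proj: "(\<integral>\<^sup>+v. indicator S v * h (?e v) \<partial>lborel) \<le> ennreal ?Cp * riesz Hb h x"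
    if [measurable]: "h \<in> borel_measurable borel" for h unfolding riesz_def
  proof (rule projection_integral_bound[OF n2 frontier_closed xF sHb])
    show "emeasure Hb E = hausdorff_outer (real DIM(real^'n) - 1) (E \<inter> frontier U)" if "E \<in> sets borel" for E
      using Hb[OF that] by simp
    show "1 \<le> norm v \<and> norm v \<le> 2 \<and> ?e v \<in> frontier U \<and> (\<exists>t>0. ?e v = x + t *\<^sub>R v)" if "v \<in> S" for v
      using that exit_point_frontier[OF _ op, of x v] exit_time_pos[OF _ op, of x v]
      by (auto simp: S_def annulus_def exit_point_def)
  qed measurable
  \<comment> \<open>A boundary null set is not seen from x: its potential vanishes, so by the
    projection bound almost no direction exits through \<open>N\<close>. Thus the Hajlasz inequality
    is available at both exit points of almost every line.\<close>
  have "riesz Hb (indicator N) x = 0"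
  proof -
    have "AE y in Hb. y \<notin> N" using N0 Nm sHb by (intro AE_not_in null_setsI) auto
    then have "AE y in Hb. indicator N y * ennreal (dist x y powr (1 - real DIM(real^'n))) = 0" by eventually_elim auto
    then show ?thesis unfolding riesz_def by (subst nn_integral_0_iff_AE) auto
  qed
  then have "(\<integral>\<^sup>+v. indicator S v * indicator N (?e v) \<partial>lborel) = 0" using proj[of "indicator N"] by simp
  then have "AE v in lborel. indicator S v * indicator N (?e v) = (0::ennreal)"
    by (subst (asm) nn_integral_0_iff_AE) auto
  then have AEN: "AE v in lborel. v \<in> S \<longrightarrow> ?e v \<notin> N" by eventually_elim (auto simp: indicator_def split: if_splits)
  have AEl: "AE v in lborel. leaves U x v" by (rule AE_leaves[OF op fin x])
  define \<psi> where "\<psi> v = indicator S v * ennreal (2 * \<bar>g (?e v)\<bar>)" for v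
  define \<delta> where "\<delta> v = indicator annulus v * (4 * ?D v)" for v
  have [measurable]: "\<psi> \<in> borel_measurable borel" "\<delta> \<in> borel_measurable borel" unfolding \<psi>_def \<delta>_def by measurable
  have "AE v in lborel. indicator annulus v * ennreal \<bar>v \<bullet> G x\<bar> \<le> (\<psi> v + \<psi> (- v)) + (\<delta> v + \<delta> (- v))"
    using AEl AE_lborel_neg[OF AEl] AEN AE_lborel_neg[OF AEN] taylor AE_lborel_neg[OF taylor]
  proof eventually_elim
    case (elim v)
    show ?case
    proof (cases "v \<in> annulus")
      case True
      then have mv: "- v \<in> annulus" by (simp add: annulus_def)
      have nv: "1 \<le> norm v" "norm v \<le> 2" using True by (auto simp: annulus_def)
      have S: "v \<in> S" "- v \<in> S" using True mv elim by (auto simp: S_def)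
      have lv: "leaves U x v" "leaves U x (- v)" using elim by auto
      have e: "?e v \<in> frontier U - N" "?e (- v) \<in> frontier U - N" using elim S exit_point_frontier[OF _ op] lv by auto
      have tp: "0 < ?\<tau> v" "0 < ?\<tau> (- v)" using lv exit_time_pos[OF _ op] by auto
      show ?thesis
      proof (cases "?D v = \<infinity> \<or> ?D (- v) = \<infinity>")
        case True
        then have "\<delta> v = \<infinity> \<or> \<delta> (- v) = \<infinity>" using \<open>v \<in> annulus\<close> mv by (elim disjE) (simp_all add: \<delta>_def ennreal_mult_top)
        then have "\<psi> v + \<psi> (- v) + (\<delta> v + \<delta> (- v)) = \<infinity>" by (elim disjE) simp_all
        then show ?thesis by (metis infinity_ennreal_def top_greatest)
      next
        case False
        then obtain d1 d2 where d: "?D v = ennreal d1" "0 \<le> d1" "?D (- v) = ennreal d2" "0 \<le> d2"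
          by (cases "?D v"; cases "?D (- v)") auto
        let ?m = "norm v * (\<bar>g (?e v)\<bar> + \<bar>g (?e (- v))\<bar>)"
        have "\<bar>v \<bullet> G x\<bar> \<le> ?m + (norm v)\<^sup>2 * (d1 + d2)"
        proof (rule two_sided_taylor_bound[OF tp])
          have "ennreal \<bar>u (?e v) - u x - ?\<tau> v * (v \<bullet> G x)\<bar> \<le> ennreal (?\<tau> v * (norm v)\<^sup>2 * d1)"
            using elim(5) lv d tp by (simp add: ennreal_mult[symmetric])
          then show "\<bar>u (?e v) - u x - ?\<tau> v * (v \<bullet> G x)\<bar> \<le> ?\<tau> v * (norm v)\<^sup>2 * d1"
            using tp d by (subst (asm) ennreal_le_iff) auto
          have "ennreal \<bar>u (?e (- v)) - u x + ?\<tau> (- v) * (v \<bullet> G x)\<bar> \<le> ennreal (?\<tau> (- v) * (norm v)\<^sup>2 * d2)"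
            using elim(6) lv d tp by (simp add: ennreal_mult[symmetric])
          then show "\<bar>u (?e (- v)) - u x + ?\<tau> (- v) * (v \<bullet> G x)\<bar> \<le> ?\<tau> (- v) * (norm v)\<^sup>2 * d2"
            using tp d by (subst (asm) ennreal_le_iff) auto
          have "\<bar>u (?e v) - u (?e (- v))\<bar> \<le> dist (?e v) (?e (- v)) * (g (?e v) + g (?e (- v)))" by (rule haj[OF e])
          \<comment> \<open>Both exit points lie on one line on opposite sides of x, so their
            distance is exactly the sum of the exit times times |v|, the factor that cancels in
            \<open>two_sided_taylor_bound\<close>.\<close>
          also have "dist (?e v) (?e (- v)) = (?\<tau> v + ?\<tau> (- v)) * norm v"
          proof -
            have "?e v - ?e (- v) = (?\<tau> v + ?\<tau> (- v)) *\<^sub>R v" by (simp add: exit_point_def algebra_simps)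
            then show ?thesis using tp by (simp add: dist_norm)
          qed
          also have "(?\<tau> v + ?\<tau> (- v)) * norm v * (g (?e v) + g (?e (- v))) \<le> (?\<tau> v + ?\<tau> (- v)) * norm v * (\<bar>g (?e v)\<bar> + \<bar>g (?e (- v))\<bar>)"
            using tp by (intro mult_left_mono) auto
          finally show "\<bar>u (?e v) - u (?e (- v))\<bar> \<le> (?\<tau> v + ?\<tau> (- v)) * ?m" by (simp add: mult.assoc)
        qed (use d in auto)
        also have "... \<le> 2 * (\<bar>g (?e v)\<bar> + \<bar>g (?e (- v))\<bar>) + 4 * (d1 + d2)"
        proof (intro add_mono mult_right_mono)
          show "(norm v)\<^sup>2 \<le> 4" using power_mono[OF nv(2), of 2] by simp
        qed (use d nv in auto)
        finally have "ennreal \<bar>v \<bullet> G x\<bar> \<le> ennreal ((2 * \<bar>g (?e v)\<bar> + 2 * \<bar>g (?e (- v))\<bar>) + (4 * d1 + 4 * d2))"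
          by (intro ennreal_leI) simp
        also have "... = (\<psi> v + \<psi> (- v)) + (\<delta> v + \<delta> (- v))"
          using S True mv \<open>v \<in> annulus\<close> d by (simp add: \<psi>_def \<delta>_def ennreal_plus ennreal_mult)
        finally show ?thesis using \<open>v \<in> annulus\<close> by simp
      qed
    qed simp
  qed
  then have "(\<integral>\<^sup>+v. indicator annulus v * ennreal \<bar>v \<bullet> G x\<bar> \<partial>lborel) \<le> (\<integral>\<^sup>+v. (\<psi> v + \<psi> (- v)) + (\<delta> v + \<delta> (- v)) \<partial>lborel)"
    by (rule nn_integral_mono_AE)
  also have "... = 2 * (\<integral>\<^sup>+v. \<psi> v \<partial>lborel) + 2 * (\<integral>\<^sup>+v. \<delta> v \<partial>lborel)"
    by (simp add: nn_integral_add nn_integral_lborel_neg mult_2)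
  also have "... \<le> 2 * (ennreal (2 * s * (?w * 2 ^ ?n)) + ennreal (2 * ?Cp) * riesz Hb (excess s g) x) +
      2 * (ennreal (4 * 2 ^ ?n) * riesz lborel (hess_dens U H) x)"
  proof (intro add_mono mult_left_mono)
    have "(\<integral>\<^sup>+v. \<psi> v \<partial>lborel) \<le> (\<integral>\<^sup>+v. ennreal (2 * s) * indicator annulus v + 2 * (indicator S v * excess s g (?e v)) \<partial>lborel)"
    proof (rule nn_integral_mono, goal_cases)
      case (1 v)
      have "ennreal (2 * \<bar>g (?e v)\<bar>) = 2 * ennreal \<bar>g (?e v)\<bar>" by (simp add: ennreal_mult)
      also have "... \<le> 2 * (ennreal s + excess s g (?e v))" by (intro mult_left_mono le_level_plus_excess s) auto
      finally show ?case using s by (auto simp: \<psi>_def S_def indicator_def distrib_left ennreal_mult)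
    qed
    also have "... = ennreal (2 * s) * emeasure lborel (annulus :: (real^'n) set) + 2 * (\<integral>\<^sup>+v. indicator S v * excess s g (?e v) \<partial>lborel)"
      by (simp add: nn_integral_add nn_integral_cmult nn_integral_cmult_indicator)
    also have "... \<le> ennreal (2 * s) * ennreal (?w * 2 ^ ?n) + 2 * (ennreal ?Cp * riesz Hb (excess s g) x)"
      by (intro add_mono mult_left_mono emeasure_annulus proj) auto
    also have "... = ennreal (2 * s * (?w * 2 ^ ?n)) + ennreal (2 * ?Cp) * riesz Hb (excess s g) x"
      using s proj_kernel_const_pos[OF n2] by (simp add: ennreal_mult mult.assoc)
    finally show "(\<integral>\<^sup>+v. \<psi> v \<partial>lborel) \<le> ennreal (2 * s * (?w * 2 ^ ?n)) + ennreal (2 * ?Cp) * riesz Hb (excess s g) x" .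
    have "(\<integral>\<^sup>+v. \<delta> v \<partial>lborel) = 4 * (\<integral>\<^sup>+v. indicator annulus v * ?D v \<partial>lborel)"
      unfolding \<delta>_def by (subst nn_integral_cmult[symmetric]) (auto intro!: nn_integral_cong simp: mult_ac)
    also have "... \<le> 4 * (ennreal (2 ^ ?n) * riesz lborel (hess_dens U H) x)"
      unfolding riesz_def ray_int_def annulus_def by (intro mult_left_mono cone_integral_annulus) auto
    finally show "(\<integral>\<^sup>+v. \<delta> v \<partial>lborel) \<le> ennreal (4 * 2 ^ ?n) * riesz lborel (hess_dens U H) x"
      by (simp add: ennreal_mult mult.assoc)
  qed auto
  finally have main: "ennreal (norm (G x) * (?w * (1/2) ^ ?n)) \<le>
     2 * (ennreal (2 * s * (?w * 2 ^ ?n)) + ennreal (2 * ?Cp) * riesz Hb (excess s g) x) +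
      2 * (ennreal (4 * 2 ^ ?n) * riesz lborel (hess_dens U H) x)"
    using annulus_inner_lower_bound[of "G x"] by (rule order_trans[rotated])
  let ?I = "riesz lborel (hess_dens U H) x" and ?J = "riesz Hb (excess s g) x"
  let ?c = "?w * (1/2) ^ ?n" and ?A = "4 * (?w * 2 ^ ?n)" and ?B = "8 * (2::real) ^ ?n"
  have w: "0 < ?w" by (rule unit_ball_vol_pos) simp
  have c: "0 < ?c" using w by simp
  have Cp: "0 < ?Cp" by (rule proj_kernel_const_pos[OF n2])
  show ?thesis
  proof (cases "?I = \<infinity> \<or> ?J = \<infinity>")
    case True
    then show ?thesis using pointwise_const_pos[OF n2] by (auto simp: ennreal_mult_top)
  next
    case False
    then obtain i j where ij: "?I = ennreal i" "0 \<le> i" "?J = ennreal j" "0 \<le> j" by (cases ?I; cases ?J) auto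
    have "ennreal (norm (G x) * ?c) \<le> ennreal (2 * (2 * s * (?w * 2 ^ ?n) + 2 * ?Cp * j) + 2 * (4 * 2 ^ ?n * i))"
      using main w Cp s ij by (simp add: ennreal_mult[symmetric] ennreal_plus[symmetric] numeral_mult_ennreal del: ennreal_plus)
    then have "norm (G x) * ?c \<le> 2 * (2 * s * (?w * 2 ^ ?n) + 2 * ?Cp * j) + 2 * (4 * 2 ^ ?n * i)"
      using w Cp s ij by (subst (asm) ennreal_le_iff) (auto intro!: add_nonneg_nonneg mult_nonneg_nonneg)
    also have "... = ?A * s + 4 * ?Cp * j + ?B * i" by (simp add: algebra_simps)
    also have "... \<le> (?A + 4 * ?Cp + ?B) * s + (?A + 4 * ?Cp + ?B) * j + (?A + 4 * ?Cp + ?B) * i"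
      using w Cp s ij by (intro add_mono mult_right_mono) auto
    also have "... = (?A + 4 * ?Cp + ?B) * (i + s + j)" by (simp add: algebra_simps)
    finally have "norm (G x) \<le> (?A + 4 * ?Cp + ?B) / ?c * (i + s + j)" using c by (simp add: pos_le_divide_eq)
    then have "norm (G x) \<le> pointwise_const TYPE(real^'n) * (i + s + j)" by (simp only: pointwise_const_def)
    then have "ennreal (norm (G x)) \<le> ennreal (pointwise_const TYPE(real^'n) * (i + s + j))" by (rule ennreal_leI)
    also have "... = ennreal (pointwise_const TYPE(real^'n)) * (?I + ennreal s + ?J)"
      using ij s pointwise_const_pos[OF n2] by (simp add: ennreal_mult)
    finally show ?thesis .
  qed
qed

text \<open>The null set is that of the Taylor formula and does not involve s, so the level may be
  chosen after the point.\<close>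

theorem pointwise_gradient_bound:
  "AE x\<in>U in lborel. (\<forall>s\<ge>0. ennreal (norm (G x)) \<le> ennreal (pointwise_const TYPE(real^'n)) *
    (riesz lborel (hess_dens U H) x + ennreal s + riesz Hb (excess s g) x))"
  using taylor_exit[OF op um Gm Hm wu wG cont]
proof eventually_elim
  case (elim x)
  then show ?case using pointwise_at by blast
qed

end

section \<open>Convergence and measurability of ball averages of the gradient\<close>

section \<open>The precise representative\<close>

definition ball_avg :: "('a::euclidean_space \<Rightarrow> 'b::euclidean_space) \<Rightarrow> 'a \<Rightarrow> real \<Rightarrow> 'b" where
  "ball_avg G x \<rho> = (1 / measure lborel (ball x \<rho>)) *\<^sub>R (\<integral>y. indicator (ball x \<rho>) y *\<^sub>R G y \<partial>lborel)"

lemma measure_lborel_ball_pos: "0 < \<rho> \<Longrightarrow> 0 < measure lborel (ball (x::'a::euclidean_space) \<rho>)"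
  by (simp add: measure_def emeasure_ball unit_ball_vol_pos zero_less_mult_iff enn2real_positive_iff)

lemma ball_avg_diff:
  fixes G :: "'a::euclidean_space \<Rightarrow> 'b::euclidean_space"
  assumes \<rho>: "0 < \<rho>" and int: "integrable lborel (\<lambda>y. indicator (ball x0 \<rho>) y *\<^sub>R G y)"
  shows "ennreal (norm (ball_avg G x0 \<rho> - c)) * emeasure lborel (ball x0 \<rho>) \<le>
    (\<integral>\<^sup>+y. indicator (ball x0 \<rho>) y * ennreal (norm (G y - c)) \<partial>lborel)"
proof -
  let ?B = "ball x0 \<rho>" and ?m = "measure lborel (ball x0 \<rho>)"
  have m: "0 < ?m" using \<rho> by (rule measure_lborel_ball_pos)
  have fin: "emeasure lborel ?B < \<infinity>" using \<rho> by (simp add: emeasure_ball)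
  have ic: "integrable lborel (\<lambda>y. indicator ?B y *\<^sub>R c)" using fin by (intro integrable_indicator) auto
  have "?m *\<^sub>R (ball_avg G x0 \<rho> - c) = (\<integral>y. indicator ?B y *\<^sub>R G y \<partial>lborel) - (\<integral>y. indicator ?B y *\<^sub>R c \<partial>lborel)"
  proof -
    have "(\<integral>y. indicator ?B y *\<^sub>R c \<partial>lborel) = ?m *\<^sub>R c"
      by (subst Bochner_Integration.integral_scaleR_left) (use fin in auto)
    then show ?thesis using m by (simp add: ball_avg_def scaleR_diff_right)
  qed
  also have "... = (\<integral>y. indicator ?B y *\<^sub>R (G y - c) \<partial>lborel)"
    using int ic by (subst Bochner_Integration.integral_diff[symmetric]) (auto simp: scaleR_diff_right)
  finally have eq: "?m *\<^sub>R (ball_avg G x0 \<rho> - c) = (\<integral>y. indicator ?B y *\<^sub>R (G y - c) \<partial>lborel)" .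
  have "ennreal (norm (ball_avg G x0 \<rho> - c)) * emeasure lborel ?B = ennreal (norm (?m *\<^sub>R (ball_avg G x0 \<rho> - c)))"
    using m fin by (simp add: emeasure_eq_ennreal_measure ennreal_mult mult.commute)
  also have "... \<le> (\<integral>\<^sup>+y. ennreal (norm (indicator ?B y *\<^sub>R (G y - c))) \<partial>lborel)"
    unfolding eq using Bochner_Integration.integrable_diff[OF int ic]
    by (intro integral_norm_bound_ennreal) (simp add: scaleR_diff_right)
  also have "... = (\<integral>\<^sup>+y. indicator ?B y * ennreal (norm (G y - c)) \<partial>lborel)"
    by (intro nn_integral_cong) (auto simp: indicator_def)
  finally show ?thesis .
qed

lemma ball_avg_bound:
  fixes G :: "'a::euclidean_space \<Rightarrow> 'b::euclidean_space"
  assumes \<rho>: "0 < \<rho>" and int: "integrable lborel (\<lambda>y. indicator (ball x0 \<rho>) y *\<^sub>R G y)"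
    and bd: "(\<integral>\<^sup>+y. indicator (ball x0 \<rho>) y * ennreal (norm (G y - c)) \<partial>lborel) \<le> K * emeasure lborel (ball x0 \<rho>)"
  shows "ennreal (norm (ball_avg G x0 \<rho> - c)) \<le> K"
proof -
  have eq: "emeasure lborel (ball x0 \<rho>) = ennreal (unit_ball_vol (real DIM('a)) * \<rho> ^ DIM('a))"
    using \<rho> by (simp add: emeasure_ball)
  have "0 < unit_ball_vol (real DIM('a)) * \<rho> ^ DIM('a)" using \<rho> by (intro mult_pos_pos unit_ball_vol_pos) auto
  then have ne: "emeasure lborel (ball x0 \<rho>) \<noteq> 0" "emeasure lborel (ball x0 \<rho>) \<noteq> top"
    unfolding eq by (metis ennreal_eq_0_iff not_le) simp
  have "emeasure lborel (ball x0 \<rho>) * ennreal (norm (ball_avg G x0 \<rho> - c)) \<le> emeasure lborel (ball x0 \<rho>) * K"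
    using order_trans[OF ball_avg_diff[OF \<rho> int] bd] by (simp add: mult.commute)
  then show ?thesis using ne by (simp add: ennreal_mult_le_mult_iff)
qed

text \<open>Tonelli reduces the claim to ball averages of the kernel. The centre must not carry mass
  of \<open>M\<close>, since at y = x0 the kernel is 0 by convention while its average is
  positive.\<close>

lemma riesz_ball_average:
  fixes M :: "'a::euclidean_space measure"
  assumes sM [measurable_cong]: "sets M = sets borel" and sf: "sigma_finite_measure M" and [measurable]: "f \<in> borel_measurable borel"
    and ne: "AE y in M. y \<noteq> x0" and \<rho>: "0 < \<rho>" and dim: "2 \<le> DIM('a)"
  shows "(\<integral>\<^sup>+x. indicator (ball x0 \<rho>) x * riesz M f x \<partial>lborel) \<le>
    (ennreal (real DIM('a) * 2 ^ DIM('a)) * riesz M f x0) * emeasure lborel (ball x0 \<rho>)"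
proof -
  interpret sigma_finite_measure M by fact
  interpret pair_sigma_finite lborel M ..
  have [measurable]: "ball x0 \<rho> \<in> sets borel" by simp
  let ?k = "\<lambda>x y::'a. ennreal (dist x y powr (1 - real DIM('a)))" and ?C = "real DIM('a) * 2 ^ DIM('a)"
  have "(\<integral>\<^sup>+x. indicator (ball x0 \<rho>) x * riesz M f x \<partial>lborel) =
    (\<integral>\<^sup>+x. (\<integral>\<^sup>+y. indicator (ball x0 \<rho>) x * (f y * ?k x y) \<partial>M) \<partial>lborel)"
    unfolding riesz_def by (intro nn_integral_cong) (simp add: nn_integral_cmult)
  also have "... = (\<integral>\<^sup>+y. (\<integral>\<^sup>+x. indicator (ball x0 \<rho>) x * (f y * ?k x y) \<partial>lborel) \<partial>M)"
  proof (rule Fubini'[symmetric])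
    have eq: "sets (lborel \<Otimes>\<^sub>M M) = sets (borel \<Otimes>\<^sub>M borel)" by (intro sets_pair_measure_cong) (auto simp: sM)
    have [measurable]: "ball x0 \<rho> \<in> sets borel" by simp
    show "(\<lambda>(x, y). indicator (ball x0 \<rho>) x * (f y * ?k x y)) \<in> borel_measurable (lborel \<Otimes>\<^sub>M M)"
      by (subst measurable_cong_sets[OF eq refl]) measurable
  qed
  also have "... \<le> (\<integral>\<^sup>+y. (ennreal ?C * emeasure lborel (ball x0 \<rho>)) * (f y * ?k x0 y) \<partial>M)"
  proof (rule nn_integral_mono_AE, goal_cases)
    case 1
    show ?case using ne
    proof eventually_elim
      case (elim y)
      have "(\<integral>\<^sup>+x. indicator (ball x0 \<rho>) x * (f y * ?k x y) \<partial>lborel) = f y * (\<integral>\<^sup>+x. ?k x y * indicator (ball x0 \<rho>) x \<partial>lborel)"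
        by (subst nn_integral_cmult[symmetric]) (auto simp: mult_ac)
      also have "... \<le> f y * (ennreal (?C * dist x0 y powr (1 - real DIM('a))) * emeasure lborel (ball x0 \<rho>))"
        by (intro mult_left_mono kernel_ball_average dim \<rho> elim) auto
      finally show ?case by (simp add: ennreal_mult mult_ac)
    qed
  qed
  also have "... = (ennreal ?C * emeasure lborel (ball x0 \<rho>)) * riesz M f x0"
    unfolding riesz_def by (rule nn_integral_cmult) measurable
  finally show ?thesis by (simp add: mult_ac)
qed

text \<open>Existence of the limit is a Cauchy condition on rational radii; where it fails, \<open>Lim\<close> has the
  constant junk value \<open>THE L. False\<close>.\<close>

lemma measurable_Lim_at_right:
  fixes A :: "'a \<Rightarrow> real \<Rightarrow> 'b::euclidean_space"
  assumes Am [measurable]: "\<And>\<rho>. (\<lambda>x. A x \<rho>) \<in> borel_measurable M"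
    and approx: "\<And>x. x \<in> space M \<Longrightarrow> \<exists>r>0. \<forall>\<rho>\<in>{0<..<r}. \<forall>e>0. \<exists>q\<in>\<rat>. 0 < q \<and> q < \<rho> \<and> dist (A x q) (A x \<rho>) < e"
  shows "(\<lambda>x. Lim (at_right 0) (A x)) \<in> borel_measurable M"
proof -
  define E where "E = {x \<in> space M. \<forall>m::nat. \<exists>j::nat. \<forall>q\<in>\<rat>. \<forall>r\<in>\<rat>. 0 < q \<and> q < 1 / real (Suc j) \<and> 0 < r \<and> r < 1 / real (Suc j) \<longrightarrow>
      dist (A x q) (A x r) \<le> 1 / real (Suc m)}"
  have [measurable]: "E \<in> sets M"
    unfolding E_def by (intro sets.sets_Collect_countable_All sets.sets_Collect_countable_Ex sets.sets_Collect_countable_All'[OF _ countable_rat]) measurable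
  have conv: "\<exists>L. (A x \<longlongrightarrow> L) (at_right 0)" if x: "x \<in> E" for x
  proof -
    have xs: "x \<in> space M" using x by (simp add: E_def)
    obtain r where r: "0 < r" "\<And>\<rho> e. \<rho> \<in> {0<..<r} \<Longrightarrow> 0 < e \<Longrightarrow> \<exists>q\<in>\<rat>. 0 < q \<and> q < \<rho> \<and> dist (A x q) (A x \<rho>) < e"
      using approx[OF xs] by blast
    have cauchy: "\<exists>d>0. \<forall>\<rho> \<sigma>. 0 < \<rho> \<and> \<rho> < d \<and> 0 < \<sigma> \<and> \<sigma> < d \<longrightarrow> dist (A x \<rho>) (A x \<sigma>) < e" if e: "0 < e" for e
    proof -
      obtain m where m: "1 / real (Suc m) < e / 3" using nat_approx_posE[of "e / 3"] e by auto
      obtain j where j: "\<And>q r. q \<in> \<rat> \<Longrightarrow> r \<in> \<rat> \<Longrightarrow> 0 < q \<Longrightarrow> q < 1 / real (Suc j) \<Longrightarrow> 0 < r \<Longrightarrow> r < 1 / real (Suc j) \<Longrightarrow>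
        dist (A x q) (A x r) \<le> 1 / real (Suc m)" using x unfolding E_def by blast
      show ?thesis
      proof (intro exI[of _ "min r (1 / real (Suc j))"] conjI allI impI)
        show "0 < min r (1 / real (Suc j))" using r by simp
        fix \<rho> \<sigma> assume a: "0 < \<rho> \<and> \<rho> < min r (1 / real (Suc j)) \<and> 0 < \<sigma> \<and> \<sigma> < min r (1 / real (Suc j))"
        \<comment> \<open>The hypothesis \<open>approx\<close> replaces the two radii by rational
          ones, to which the countable condition in \<open>E\<close> applies.\<close>
        then obtain q where q: "q \<in> \<rat>" "0 < q" "q < \<rho>" "dist (A x q) (A x \<rho>) < e / 3" using r(2)[of \<rho> "e / 3"] e by auto
        obtain q' where q': "q' \<in> \<rat>" "0 < q'" "q' < \<sigma>" "dist (A x q') (A x \<sigma>) < e / 3" using r(2)[of \<sigma> "e / 3"] e a by auto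
        have "dist (A x q) (A x q') \<le> 1 / real (Suc m)" using q q' a by (intro j) auto
        moreover have "dist (A x \<rho>) (A x \<sigma>) \<le> dist (A x \<rho>) (A x q) + dist (A x q) (A x q') + dist (A x q') (A x \<sigma>)"
          using dist_triangle[of "A x \<rho>" "A x \<sigma>" "A x q"] dist_triangle[of "A x q" "A x \<sigma>" "A x q'"] by linarith
        ultimately show "dist (A x \<rho>) (A x \<sigma>) < e" using m q(4) q'(4) by (simp add: dist_commute)
      qed
    qed
    have "cauchy_filter (filtermap (A x) (at_right 0))" unfolding cauchy_filter_metric_filtermap
    proof (intro allI impI)
      fix e :: real assume "0 < e"
      from cauchy[OF this] obtain d where d: "0 < d" "\<forall>\<rho> \<sigma>. 0 < \<rho> \<and> \<rho> < d \<and> 0 < \<sigma> \<and> \<sigma> < d \<longrightarrow> dist (A x \<rho>) (A x \<sigma>) < e" by blast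
      have "eventually (\<lambda>\<rho>. \<rho> \<in> {0<..<d}) (at_right 0)" using d(1) by (rule eventually_at_right_real)
      then show "\<exists>P. eventually P (at_right 0) \<and> (\<forall>\<rho> \<sigma>. P \<rho> \<and> P \<sigma> \<longrightarrow> dist (A x \<rho>) (A x \<sigma>) < e)" using d(2) by (intro exI conjI) auto
    qed
    from cauchy_filter_complete_converges[OF this complete_UNIV]
    have "\<exists>L. (A x \<longlongrightarrow> L) (at_right 0)" by (auto simp: filterlim_def filtermap_bot_iff)
    then show ?thesis by blast
  qed
  have nconv: "x \<in> E" if x: "x \<in> space M" and L: "(A x \<longlongrightarrow> L) (at_right 0)" for x L unfolding E_def
  proof (intro CollectI conjI x allI)
    fix m :: nat
    have "eventually (\<lambda>\<rho>. dist (A x \<rho>) L < 1 / real (Suc m) / 2) (at_right 0)" using L by (rule tendstoD) simp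
    then obtain b where b: "0 < b" "\<And>\<rho>. 0 < \<rho> \<Longrightarrow> \<rho> < b \<Longrightarrow> dist (A x \<rho>) L < 1 / real (Suc m) / 2"
      unfolding eventually_at_right_field by auto
    obtain j where j: "1 / real (Suc j) < b" using nat_approx_posE[OF b(1)] by auto
    show "\<exists>j. \<forall>q\<in>\<rat>. \<forall>r\<in>\<rat>. 0 < q \<and> q < 1 / real (Suc j) \<and> 0 < r \<and> r < 1 / real (Suc j) \<longrightarrow> dist (A x q) (A x r) \<le> 1 / real (Suc m)"
    proof (intro exI[of _ j] ballI impI)
      fix q r assume "0 < q \<and> q < 1 / real (Suc j) \<and> 0 < r \<and> r < 1 / real (Suc j)"
      then have "dist (A x q) L < 1 / real (Suc m) / 2" "dist (A x r) L < 1 / real (Suc m) / 2"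
        by (intro b(2); use j in linarith)+
      then show "dist (A x q) (A x r) \<le> 1 / real (Suc m)" using dist_triangle2[of "A x q" "A x r" L] by linarith
    qed
  qed
  have "(\<lambda>x. if x \<in> E then lim (\<lambda>k. A x (1 / real (Suc k))) else (THE L. False)) \<in> borel_measurable M"
    by (intro measurable_If borel_measurable_lim_metric borel_measurable_const Am) simp
  moreover have "Lim (at_right 0) (A x) = (if x \<in> E then lim (\<lambda>k. A x (1 / real (Suc k))) else (THE L. False))"
    if x: "x \<in> space M" for x
  proof (cases "x \<in> E")
    case True
    then obtain L where L: "(A x \<longlongrightarrow> L) (at_right 0)" using conv by blast
    then have "Lim (at_right 0) (A x) = L" by (intro tendsto_Lim) auto
    moreover have "filterlim (\<lambda>k. 1 / real (Suc k)) (at_right 0) sequentially"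
      unfolding filterlim_at using LIMSEQ_Suc[OF lim_1_over_n] by auto
    then have "(\<lambda>k. A x (1 / real (Suc k))) \<longlonglongrightarrow> L" by (rule filterlim_compose[OF L])
    then have "lim (\<lambda>k. A x (1 / real (Suc k))) = L" by (rule limI)
    ultimately show ?thesis using True by simp
  next
    case False
    then have "(\<lambda>L. (A x \<longlongrightarrow> L) (at_right 0)) = (\<lambda>L. False)" using nconv[OF x] by blast
    then show ?thesis using False unfolding t2_space_class.Lim_def by simp
  qed
  ultimately show ?thesis by (simp cong: measurable_cong)
qed

text \<open>Open balls with radii increasing to \<rho> exhaust the open ball, so dominated
  convergence makes the averages continuous from the left.\<close>

lemma ball_avg_left_approx:
  fixes G :: "'a::euclidean_space \<Rightarrow> 'b::euclidean_space"
  assumes [measurable]: "G \<in> borel_measurable borel"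
    and int: "integrable lborel (\<lambda>y. indicator (ball x \<rho>) y *\<^sub>R G y)" and \<rho>: "0 < \<rho>" and e: "0 < e"
  shows "\<exists>q\<in>\<rat>. 0 < q \<and> q < \<rho> \<and> dist (ball_avg G x q) (ball_avg G x \<rho>) < e"
proof -
  have "\<exists>q\<in>\<rat>. max 0 (\<rho> - 1 / real (Suc k)) < q \<and> q < \<rho>" for k
    using Rats_dense_in_real[of "max 0 (\<rho> - 1 / real (Suc k))" \<rho>] \<rho> by auto
  then have "\<forall>k. \<exists>q. q \<in> \<rat> \<and> max 0 (\<rho> - 1 / real (Suc k)) < q \<and> q < \<rho>" by blast
  from choice[OF this] obtain q where q: "\<And>k. q k \<in> \<rat>" "\<And>k. max 0 (\<rho> - 1 / real (Suc k)) < q k" "\<And>k. q k < \<rho>" by blast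
  have qlim: "q \<longlonglongrightarrow> \<rho>"
  proof (rule tendsto_sandwich[of "\<lambda>k. \<rho> - 1 / real (Suc k)" _ _ "\<lambda>_. \<rho>"])
    have "(\<lambda>k. \<rho> - 1 / real (Suc k)) \<longlonglongrightarrow> \<rho> - 0" by (intro tendsto_intros LIMSEQ_Suc[OF lim_1_over_n])
    then show "(\<lambda>k. \<rho> - 1 / real (Suc k)) \<longlonglongrightarrow> \<rho>" by simp
  qed (use q in \<open>auto intro!: always_eventually less_imp_le simp: max_less_iff_conj\<close>)
  have q0: "0 < q k" for k using q(2)[of k] by simp
  have "(\<lambda>k. \<integral>y. indicator (ball x (q k)) y *\<^sub>R G y \<partial>lborel) \<longlonglongrightarrow> (\<integral>y. indicator (ball x \<rho>) y *\<^sub>R G y \<partial>lborel)"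
  proof (rule integral_dominated_convergence[where w = "\<lambda>y. norm (indicator (ball x \<rho>) y *\<^sub>R G y)"])
    show "AE y in lborel. (\<lambda>k. indicator (ball x (q k)) y *\<^sub>R G y) \<longlonglongrightarrow> indicator (ball x \<rho>) y *\<^sub>R G y"
    proof (intro AE_I2 tendsto_scaleR tendsto_const)
      fix y
      show "(\<lambda>k. indicat_real (ball x (q k)) y) \<longlonglongrightarrow> indicat_real (ball x \<rho>) y"
      proof (cases "y \<in> ball x \<rho>")
        case True
        then have "eventually (\<lambda>k. dist x y < q k) sequentially" using qlim by (intro order_tendstoD) auto
        then have "eventually (\<lambda>k. indicat_real (ball x (q k)) y = indicat_real (ball x \<rho>) y) sequentially"
          by (rule eventually_mono) (use True in \<open>simp add: indicator_def\<close>)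
        then show ?thesis by (rule tendsto_eventually)
      next
        case False
        then have "y \<notin> ball x (q k)" for k using q(3)[of k] by auto
        then show ?thesis using False by simp
      qed
    qed
    show "AE y in lborel. norm (indicator (ball x (q k)) y *\<^sub>R G y) \<le> norm (indicator (ball x \<rho>) y *\<^sub>R G y)" for k
      using q(3)[of k] by (intro AE_I2) (auto simp: indicator_def)
    have [measurable]: "ball x r \<in> sets borel" for r by simp
    show "(\<lambda>y. indicator (ball x \<rho>) y *\<^sub>R G y) \<in> borel_measurable lborel"
      "(\<lambda>y. indicator (ball x (q k)) y *\<^sub>R G y) \<in> borel_measurable lborel" for k by measurable
    show "integrable lborel (\<lambda>y. norm (indicator (ball x \<rho>) y *\<^sub>R G y))" by (rule integrable_norm[OF int])
  qed
  moreover have "(\<lambda>k. measure lborel (ball x (q k))) \<longlonglongrightarrow> measure lborel (ball x \<rho>)"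
  proof -
    have "measure lborel (ball x r) = unit_ball_vol (real DIM('a)) * r ^ DIM('a)" if "0 \<le> r" for r
      using that by (simp add: measure_def emeasure_ball)
    then show ?thesis using q0 \<rho> qlim by (simp add: less_imp_le tendsto_intros)
  qed
  ultimately have "(\<lambda>k. ball_avg G x (q k)) \<longlonglongrightarrow> ball_avg G x \<rho>"
    unfolding ball_avg_def using measure_lborel_ball_pos[OF \<rho>, of x] by (intro tendsto_intros) auto
  from tendstoD[OF this e] obtain k where "dist (ball_avg G x (q k)) (ball_avg G x \<rho>) < e"
    by (auto simp: eventually_sequentially)
  then show ?thesis using q q0 by blast
qed

lemma ball_avg_measurable:
  fixes G :: "'a::euclidean_space \<Rightarrow> 'b::euclidean_space"
  assumes [measurable]: "G \<in> borel_measurable borel"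
  shows "(\<lambda>x. ball_avg G x \<rho>) \<in> borel_measurable borel"
proof -
  have "(\<lambda>x. ball_avg G x \<rho>) = (\<lambda>x. (1 / measure lborel (ball (0::'a) \<rho>)) *\<^sub>R (\<integral>y. (if dist x y < \<rho> then G y else 0) \<partial>lborel))"
  proof
    fix x :: 'a
    have "measure lborel (ball x \<rho>) = measure lborel (ball (0::'a) \<rho>)"
      by (cases "0 \<le> \<rho>") (simp_all add: measure_def emeasure_ball ball_empty)
    moreover have "(\<integral>y. indicator (ball x \<rho>) y *\<^sub>R G y \<partial>lborel) = (\<integral>y. (if dist x y < \<rho> then G y else 0) \<partial>lborel)"
      by (intro Bochner_Integration.integral_cong) (auto simp: indicator_def)
    ultimately show "ball_avg G x \<rho> = (1 / measure lborel (ball (0::'a) \<rho>)) *\<^sub>R (\<integral>y. (if dist x y < \<rho> then G y else 0) \<partial>lborel)"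
      by (simp add: ball_avg_def)
  qed
  also have "... \<in> borel_measurable borel" by measurable
  finally show ?thesis .
qed

context
  fixes U :: "(real^'n::finite) set" and u :: "real^'n \<Rightarrow> real" and G :: "real^'n \<Rightarrow> real^'n"
    and H :: "real^'n \<Rightarrow> real^'n^'n"
  assumes op: "open U" and um [measurable]: "u \<in> borel_measurable borel"
    and Gm [measurable]: "G \<in> borel_measurable borel" and Hm [measurable]: "H \<in> borel_measurable borel"
    and wu: "\<And>i. weak_pd U u i (\<lambda>x. G x $ i)" and wG: "\<And>i j. weak_pd U (\<lambda>x. G x $ i) j (\<lambda>x. H x $ i $ j)"
    and dim: "2 \<le> CARD('n)"
begin

lemma gradient_integrable_ball:
  assumes "cball x0 \<rho> \<subseteq> U"
  shows "integrable lborel (\<lambda>y. indicator (ball x0 \<rho>) y *\<^sub>R G y)"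
proof -
  have [measurable]: "ball x0 \<rho> \<in> sets borel" by simp
  have i: "integrable lborel (\<lambda>y. indicator (cball x0 \<rho>) y * G y $ i)" for i
    using wG[of i undefined] assms component_measurable(1)[OF op um Gm Hm wu wG]
    by (intro loc_integrable_lborel[of U]) (auto simp: weak_pd_def)
  have "integrable lborel (\<lambda>y. \<Sum>i\<in>UNIV. \<bar>indicator (cball x0 \<rho>) y * G y $ i\<bar>)" using i by auto
  then show ?thesis
  proof (rule Bochner_Integration.integrable_bound)
    show "(\<lambda>y. indicator (ball x0 \<rho>) y *\<^sub>R G y) \<in> borel_measurable lborel" by measurable
    show "AE y in lborel. norm (indicator (ball x0 \<rho>) y *\<^sub>R G y) \<le> norm (\<Sum>i\<in>UNIV. \<bar>indicator (cball x0 \<rho>) y * G y $ i\<bar>)"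
    proof (rule AE_I2, goal_cases)
      case (1 y)
      show ?case using norm_le_l1_cart[of "G y"] by (auto simp: indicator_def sum_nonneg)
    qed
  qed
qed

text \<open>This is (2\<rho>)^n divided by the volume of a ball of radius \<rho>.\<close>

definition osc_const :: real where
  "osc_const = 2 ^ DIM(real^'n) / unit_ball_vol (real DIM(real^'n))"

text \<open>A Poincare inequality in potential form: for x in the ball, the mean over y of |G y - G
  x| is estimated along the segments from x to y, which stay in the ball by convexity. Their length
  is at most 2\<rho>, and \<open>cone_integral_segment\<close> gives the potential.\<close>

lemma ball_oscillation:
  assumes \<rho>: "0 < \<rho>" and sub: "cball x0 \<rho> \<subseteq> U"
  shows "AE x in lborel. x \<in> ball x0 \<rho> \<longrightarrow> ennreal (norm (G x - ball_avg G x0 \<rho>)) \<le>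
    ennreal osc_const * riesz lborel (\<lambda>y. indicator (ball x0 \<rho>) y * ennreal (norm (H y))) x"
proof -
  let ?B = "ball x0 \<rho>" and ?n = "DIM(real^'n)" and ?w = "unit_ball_vol (real DIM(real^'n))"
  let ?F = "\<lambda>y. indicator ?B y * ennreal (norm (H y))"
  let ?J = "\<lambda>x v. (\<integral>\<^sup>+s. indicator {0<..1} s * ?F (x + s *\<^sub>R v) \<partial>lborel)"
  have n2: "2 \<le> ?n" using dim by simp
  have w: "0 < ?w" by (rule unit_ball_vol_pos) simp
  have unit_ball_vol_nonzero: "unit_ball_vol (real CARD('n)) \<noteq> 0"
    using unit_ball_vol_pos[of "real CARD('n)"] by (metis less_irrefl of_nat_0_le_iff)
  have [measurable]: "?B \<in> sets borel" "cball (0::real^'n) (2 * \<rho>) \<in> sets borel" by auto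
  have [measurable]: "?F \<in> borel_measurable borel" by measurable
  let ?P = "\<lambda>x v. stays U x v 1 \<longrightarrow> ennreal (norm (G (x + v) - G x)) \<le>
     ennreal (norm v) * (\<integral>\<^sup>+s. indicator {0<..1} s * ennreal (norm (H (x + s *\<^sub>R v))) \<partial>lborel)"
  have "{p. stays U (fst p) (snd p) 1} \<in> sets (borel :: ((real^'n) \<times> (real^'n)) measure)"
    using open_stays[OF op] by (rule borel_open)
  then have [measurable]: "Measurable.pred (borel \<Otimes>\<^sub>M borel) (\<lambda>p. stays U (fst p) (snd p) 1)"
    by (simp add: pred_def space_pair_measure borel_prod[symmetric])
  have "AE x in lborel. AE v in lborel. ?P x v"
  proof (subst lborel_pair.AE_commute)
    show "{p \<in> space (lborel \<Otimes>\<^sub>M lborel). ?P (fst p) (snd p)} \<in> sets (lborel \<Otimes>\<^sub>M lborel)" by measurable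
    show "AE v in lborel. AE x in lborel. ?P x v" by (rule AE_I2, rule gradient_difference_norm[OF op um Gm Hm wu wG])
  qed
  then show ?thesis
  proof eventually_elim
    case (elim x)
    show ?case
    proof
      assume x: "x \<in> ?B"
      have "(\<integral>\<^sup>+y. indicator ?B y * ennreal (norm (G y - G x)) \<partial>lborel) =
        (\<integral>\<^sup>+v. indicator ?B (v + x) * ennreal (norm (G (v + x) - G x)) \<partial>lborel)"
        by (rule lborel_nn_integral_shift) measurable
      also have "... \<le> (\<integral>\<^sup>+v. ennreal (2 * \<rho>) * (indicator (cball 0 (2 * \<rho>)) v * ?J x v) \<partial>lborel)"
      proof (rule nn_integral_mono_AE, goal_cases)
        case 1
        show ?case using elim
        proof eventually_elim
          case (elim v)
          show ?case
          proof (cases "x + v \<in> ?B")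
            case True
            have seg: "x + s *\<^sub>R v \<in> ?B" if "s \<in> {0..1}" for s
            proof -
              have "(1 - s) *\<^sub>R x + s *\<^sub>R (x + v) \<in> ?B" using x True that by (intro convexD[OF convex_ball]) auto
              then show ?thesis by (simp add: algebra_simps)
            qed
            have "stays U x v 1" unfolding stays_def using seg sub by (meson ball_subset_cball subset_iff)
            with elim have "ennreal (norm (G (x + v) - G x)) \<le> ennreal (norm v) * (\<integral>\<^sup>+s. indicator {0<..1} s * ennreal (norm (H (x + s *\<^sub>R v))) \<partial>lborel)" by simp
            also have "(\<integral>\<^sup>+s. indicator {0<..1} s * ennreal (norm (H (x + s *\<^sub>R v))) \<partial>lborel) = ?J x v"
            proof (rule nn_integral_cong, goal_cases)
              case (1 s)
              show ?case using seg[of s] by (cases "s \<in> {0<..1}") auto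
            qed
            finally have 1: "ennreal (norm (G (x + v) - G x)) \<le> ennreal (norm v) * ?J x v" .
            have "norm v = dist (x + v) x" by (simp add: dist_norm)
            also have "... \<le> dist (x + v) x0 + dist x0 x" by (rule dist_triangle)
            finally have nv: "norm v \<le> 2 * \<rho>" using x True by (simp add: dist_commute)
            have "ennreal (norm v) * ?J x v \<le> ennreal (2 * \<rho>) * ?J x v"
              using nv by (intro mult_right_mono ennreal_leI) auto
            then have "ennreal (norm (G (x + v) - G x)) \<le> ennreal (2 * \<rho>) * ?J x v" by (rule order_trans[OF 1])
            moreover have "indicator ?B (v + x) = (1::ennreal)" "indicator (cball 0 (2 * \<rho>)) v = (1::ennreal)"
              using True nv by (simp_all add: add.commute)
            ultimately show ?thesis by (simp only: mult_1 add.commute[of v x])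
          next
            case False
            then have "indicator ?B (v + x) = (0::ennreal)" by (simp add: add.commute)
            then show ?thesis by simp
          qed
        qed
      qed
      also have "... = ennreal (2 * \<rho>) * (\<integral>\<^sup>+v. indicator (cball 0 (2 * \<rho>)) v * ?J x v \<partial>lborel)"
        by (rule nn_integral_cmult) measurable
      also have "... \<le> ennreal (2 * \<rho>) * (ennreal ((2 * \<rho>) ^ (?n - 1)) * riesz lborel ?F x)"
        unfolding riesz_def using \<rho> n2 by (intro mult_left_mono cone_integral_segment) auto
      also have "... = (ennreal osc_const * riesz lborel ?F x) * emeasure lborel ?B"
      proof -
        have "(2 * \<rho>) * (2 * \<rho>) ^ (?n - 1) = (2 * \<rho>) ^ ?n" using n2 by (metis Suc_diff_1 less_le_trans pos2 power_Suc)
        also have "... = osc_const * (?w * \<rho> ^ ?n)" using unit_ball_vol_nonzero by (simp add: osc_const_def power_mult_distrib)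
        finally have e: "(2 * \<rho>) * (2 * \<rho>) ^ (?n - 1) = osc_const * (?w * \<rho> ^ ?n)" .
        have o: "0 \<le> osc_const" using w by (simp add: osc_const_def)
        have "ennreal (2 * \<rho>) * (ennreal ((2 * \<rho>) ^ (?n - 1)) * riesz lborel ?F x) = ennreal ((2 * \<rho>) * (2 * \<rho>) ^ (?n - 1)) * riesz lborel ?F x"
          using \<rho> by (subst ennreal_mult) (auto simp: mult.assoc)
        also have "... = ennreal osc_const * ennreal (?w * \<rho> ^ ?n) * riesz lborel ?F x"
          unfolding e using o w \<rho> by (subst ennreal_mult) auto
        also have "ennreal (?w * \<rho> ^ ?n) = emeasure lborel ?B" using \<rho> by (simp add: emeasure_ball)
        finally show ?thesis by (simp only: mult_ac)
      qed
      finally have "ennreal (norm (ball_avg G x0 \<rho> - G x)) \<le> ennreal osc_const * riesz lborel ?F x"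
        by (rule ball_avg_bound[OF \<rho> gradient_integrable_ball[OF sub]])
      then show "ennreal (norm (G x - ball_avg G x0 \<rho>)) \<le> ennreal osc_const * riesz lborel ?F x"
        by (simp add: norm_minus_commute)
    qed
  qed
qed

text \<open>The oscillation bound for the large ball is averaged over the small one; averaging moves
  the potential to the centre at the cost of a factor n 2^n that does not depend on
  \<sigma>.\<close>

lemma ball_avg_increment:
  assumes "0 < \<sigma>" "\<sigma> \<le> \<rho>" and sub: "cball x0 \<rho> \<subseteq> U"
  shows "ennreal (norm (ball_avg G x0 \<sigma> - ball_avg G x0 \<rho>)) \<le>
    ennreal osc_const * (ennreal (real DIM(real^'n) * 2 ^ DIM(real^'n)) *
      riesz lborel (\<lambda>y. indicator (ball x0 \<rho>) y * ennreal (norm (H y))) x0)"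
proof (rule ball_avg_bound[OF assms(1)])
  let ?F = "\<lambda>y. indicator (ball x0 \<rho>) y * ennreal (norm (H y))"
  have [measurable]: "ball x0 r \<in> sets borel" for r by auto
  have [measurable]: "?F \<in> borel_measurable borel" by measurable
  have rm [measurable]: "riesz lborel ?F \<in> borel_measurable borel" by (rule riesz_measurable) (auto simp: sigma_finite_lborel)
  have \<rho>: "0 < \<rho>" using assms by simp
  have sb: "cball x0 \<sigma> \<subseteq> cball x0 \<rho>" using assms(2) by (rule subset_cball)
  show "integrable lborel (\<lambda>y. indicator (ball x0 \<sigma>) y *\<^sub>R G y)" using sb sub by (intro gradient_integrable_ball) blast
  have "(\<integral>\<^sup>+y. indicator (ball x0 \<sigma>) y * ennreal (norm (G y - ball_avg G x0 \<rho>)) \<partial>lborel) \<le>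
    (\<integral>\<^sup>+y. ennreal osc_const * (indicator (ball x0 \<sigma>) y * riesz lborel ?F y) \<partial>lborel)"
  proof (rule nn_integral_mono_AE, goal_cases)
    case 1
    show ?case using ball_oscillation[OF \<rho> sub]
    proof eventually_elim
      case (elim y)
      then show ?case using assms(2) by (auto simp: indicator_def)
    qed
  qed
  also have "... = ennreal osc_const * (\<integral>\<^sup>+y. indicator (ball x0 \<sigma>) y * riesz lborel ?F y \<partial>lborel)"
    by (rule nn_integral_cmult) measurable
  also have "... \<le> ennreal osc_const * ((ennreal (real DIM(real^'n) * 2 ^ DIM(real^'n)) * riesz lborel ?F x0) * emeasure lborel (ball x0 \<sigma>))"
    using dim assms(1) by (intro mult_left_mono riesz_ball_average sigma_finite_lborel AE_lborel_singleton) auto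
  finally show "(\<integral>\<^sup>+y. indicator (ball x0 \<sigma>) y * ennreal (norm (G y - ball_avg G x0 \<rho>)) \<partial>lborel) \<le>
    ennreal osc_const * (ennreal (real DIM(real^'n) * 2 ^ DIM(real^'n)) * riesz lborel ?F x0) * emeasure lborel (ball x0 \<sigma>)"
    by (simp only: mult_ac)
qed

text \<open>Finiteness of the potential at x0 makes the Hessian times the kernel the density of a
  finite measure without mass at x0, so its values on shrinking balls tend to 0. These values bound
  the increments of the averages, which therefore satisfy a Cauchy condition.\<close>

lemma ball_avg_converges:
  assumes x0: "x0 \<in> U" and fin: "riesz lborel (hess_dens U H) x0 < \<infinity>"
  shows "\<exists>L. (ball_avg G x0 \<longlongrightarrow> L) (at_right 0)"
proof -
  let ?C = "ennreal osc_const * ennreal (real DIM(real^'n) * 2 ^ DIM(real^'n))"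
  let ?F = "\<lambda>\<rho> y. indicator (ball x0 \<rho>) y * ennreal (norm (H y))"
  have [measurable]: "hess_dens U H \<in> borel_measurable borel" using hess_dens_measurable[OF op um Gm Hm wu wG] .
  obtain r where r: "0 < r" "cball x0 r \<subseteq> U" using op x0 open_contains_cball by blast
  define \<nu> where "\<nu> = density lborel (\<lambda>y. hess_dens U H y * ennreal (dist x0 y powr (1 - real DIM(real^'n))))"
  have \<nu>fin: "emeasure \<nu> E < \<infinity>" if "E \<in> sets borel" for E
  proof -
    have "emeasure \<nu> E \<le> emeasure \<nu> UNIV" using that by (intro emeasure_mono) (auto simp: \<nu>_def)
    also have "... = riesz lborel (hess_dens U H) x0" unfolding \<nu>_def riesz_def by (subst emeasure_density) auto
    finally show ?thesis using fin by simp
  qed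
  have \<nu>F: "riesz lborel (?F \<rho>) x0 = emeasure \<nu> (ball x0 \<rho>)" if "\<rho> \<le> r" for \<rho>
  proof -
    have "ball x0 \<rho> \<subseteq> U" using that r(2) by (meson ball_subset_cball subset_ball subset_trans)
    moreover have "emeasure \<nu> (ball x0 \<rho>) = (\<integral>\<^sup>+y. hess_dens U H y * ennreal (dist x0 y powr (1 - real DIM(real^'n))) * indicator (ball x0 \<rho>) y \<partial>lborel)"
      unfolding \<nu>_def by (rule emeasure_density) auto
    ultimately show ?thesis unfolding riesz_def by (auto intro!: nn_integral_cong simp: hess_dens_def indicator_def)
  qed
  have small: "\<exists>\<rho>>0. \<rho> \<le> r \<and> ?C * emeasure \<nu> (ball x0 \<rho>) < ennreal e" if e: "0 < e" for e
  proof -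
    define A where "A k = ball x0 (r / real (Suc k))" for k
    have dec: "decseq A" unfolding A_def using r by (intro decseq_SucI subset_ball) (simp add: frac_le)
    have Ab: "A k \<in> sets borel" for k by (simp add: A_def)
    have "(\<lambda>k. emeasure \<nu> (A k)) \<longlonglongrightarrow> emeasure \<nu> (\<Inter>k. A k)"
    proof (rule Lim_emeasure_decseq[OF _ dec])
      show "range A \<subseteq> sets \<nu>" using Ab by (auto simp: \<nu>_def)
      show "emeasure \<nu> (A k) \<noteq> \<infinity>" for k using \<nu>fin[OF Ab[of k]] by (simp add: less_top)
    qed
    also have "(\<Inter>k. A k) = {x0}"
    proof (intro antisym subsetI)
      fix y assume y: "y \<in> (\<Inter>k. A k)"
      show "y \<in> {x0}"
      proof (rule ccontr)
        assume "y \<notin> {x0}"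
        then have "0 < dist x0 y / r" using r by simp
        then obtain k where "1 / real (Suc k) < dist x0 y / r" using nat_approx_posE by metis
        then have "r / real (Suc k) < dist x0 y" using r by (simp add: field_simps)
        moreover have "y \<in> A k" using y by blast
        ultimately show False by (simp add: A_def)
      qed
    qed (use r in \<open>auto simp: A_def\<close>)
    also have "emeasure \<nu> {x0} = 0"
    proof -
      have "emeasure \<nu> {x0} = (\<integral>\<^sup>+y. hess_dens U H y * ennreal (dist x0 y powr (1 - real DIM(real^'n))) * indicator {x0} y \<partial>lborel)"
        unfolding \<nu>_def by (subst emeasure_density) auto
      also have "... = (\<integral>\<^sup>+(y::real^'n). 0 \<partial>lborel)" by (intro nn_integral_cong) (auto simp: indicator_def)
      finally show ?thesis by simp
    qed
    finally have "(\<lambda>k. ?C * emeasure \<nu> (A k)) \<longlonglongrightarrow> ?C * 0" by (intro ennreal_tendsto_cmult) (auto simp: ennreal_mult_less_top)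
    then have "(\<lambda>k. ?C * emeasure \<nu> (A k)) \<longlonglongrightarrow> 0" by simp
    then have "eventually (\<lambda>k. ?C * emeasure \<nu> (A k) < ennreal e) sequentially" using e by (intro order_tendstoD) auto
    then obtain k where "?C * emeasure \<nu> (A k) < ennreal e" by (auto simp: eventually_sequentially)
    moreover have "r / real (Suc k) \<le> r" using r by (simp add: field_simps)
    ultimately show ?thesis using r by (intro exI[of _ "r / real (Suc k)"]) (auto simp: A_def)
  qed
  have inc: "norm (ball_avg G x0 \<sigma> - ball_avg G x0 \<rho>) < e"
    if "0 < \<sigma>" "\<sigma> \<le> \<rho>" "\<rho> \<le> r" "?C * emeasure \<nu> (ball x0 \<rho>) < ennreal e" "0 < e" for \<sigma> \<rho> e
  proof -
    have "cball x0 \<rho> \<subseteq> U" using r(2) that(3) by (meson subset_cball subset_trans)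
    from ball_avg_increment[OF that(1,2) this]
    have "ennreal (norm (ball_avg G x0 \<sigma> - ball_avg G x0 \<rho>)) < ennreal e"
      using that(4) by (simp add: \<nu>F[OF that(3)] mult.assoc)
    then show ?thesis using that(5) by (simp add: ennreal_less_iff)
  qed
  have cauchy: "\<exists>d>0. d \<le> r \<and> (\<forall>\<sigma>. 0 < \<sigma> \<and> \<sigma> \<le> d \<longrightarrow> norm (ball_avg G x0 \<sigma> - ball_avg G x0 d) < e)" if e: "0 < e" for e
    using small[OF e] inc e by blast
  have "Cauchy (\<lambda>k. ball_avg G x0 (1 / real (Suc k)))"
  proof (rule metric_CauchyI)
    fix e :: real assume "0 < e"
    then have "0 < e / 2" by simp
    from cauchy[OF this] obtain d where d: "0 < d" "\<forall>\<sigma>. 0 < \<sigma> \<and> \<sigma> \<le> d \<longrightarrow> norm (ball_avg G x0 \<sigma> - ball_avg G x0 d) < e / 2" by blast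
    obtain K where K: "1 / real (Suc K) < d" using nat_approx_posE[OF d(1)] by auto
    have b: "norm (ball_avg G x0 (1 / real (Suc k)) - ball_avg G x0 d) < e / 2" if "K \<le> k" for k
    proof -
      have "1 / real (Suc k) \<le> 1 / real (Suc K)" using that by (intro divide_left_mono) auto
      then show ?thesis using K d(2) by simp
    qed
    show "\<exists>K. \<forall>m\<ge>K. \<forall>n\<ge>K. dist (ball_avg G x0 (1 / real (Suc m))) (ball_avg G x0 (1 / real (Suc n))) < e"
    proof (intro exI[of _ K] allI impI)
      fix m n assume "K \<le> m" "K \<le> n"
      from b[OF this(1)] b[OF this(2)]
      show "dist (ball_avg G x0 (1 / real (Suc m))) (ball_avg G x0 (1 / real (Suc n))) < e"
        using dist_triangle_half_l[of "ball_avg G x0 (1 / real (Suc m))" "ball_avg G x0 d" e "ball_avg G x0 (1 / real (Suc n))"]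
        by (simp add: dist_norm)
    qed
  qed
  then obtain L where L: "(\<lambda>k. ball_avg G x0 (1 / real (Suc k))) \<longlonglongrightarrow> L" by (auto simp: Cauchy_convergent_iff convergent_def)
  have "(ball_avg G x0 \<longlongrightarrow> L) (at_right 0)"
  proof (rule tendstoI)
    fix e :: real assume e: "0 < e"
    then have "0 < e / 3" by simp
    from cauchy[OF this] obtain d where d: "0 < d" "\<forall>\<sigma>. 0 < \<sigma> \<and> \<sigma> \<le> d \<longrightarrow> norm (ball_avg G x0 \<sigma> - ball_avg G x0 d) < e / 3" by blast
    have "eventually (\<lambda>k. 1 / real (Suc k) < d) sequentially"
      using LIMSEQ_Suc[OF lim_1_over_n] d(1) by (rule order_tendstoD)
    moreover have "eventually (\<lambda>k. dist (ball_avg G x0 (1 / real (Suc k))) L < e / 3) sequentially"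
      using L e by (intro tendstoD) auto
    ultimately have "eventually (\<lambda>k. 1 / real (Suc k) < d \<and> dist (ball_avg G x0 (1 / real (Suc k))) L < e / 3) sequentially"
      by eventually_elim auto
    then obtain k where k: "1 / real (Suc k) < d" "dist (ball_avg G x0 (1 / real (Suc k))) L < e / 3"
      by (auto simp: eventually_sequentially)
    then have kd: "norm (ball_avg G x0 (1 / real (Suc k)) - ball_avg G x0 d) < e / 3" using d(2) by simp
    have "eventually (\<lambda>\<rho>. \<rho> \<in> {0<..<d}) (at_right 0)" using d(1) by (rule eventually_at_right_real)
    then show "eventually (\<lambda>\<rho>. dist (ball_avg G x0 \<rho>) L < e) (at_right 0)"
    proof eventually_elim
      case (elim \<rho>)
      then have "dist (ball_avg G x0 \<rho>) (ball_avg G x0 d) < e / 3" using d(2) by (simp add: dist_norm)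
      moreover have "dist (ball_avg G x0 d) L \<le> dist (ball_avg G x0 d) (ball_avg G x0 (1 / real (Suc k))) + dist (ball_avg G x0 (1 / real (Suc k))) L"
        by (rule dist_triangle)
      moreover have "dist (ball_avg G x0 \<rho>) L \<le> dist (ball_avg G x0 \<rho>) (ball_avg G x0 d) + dist (ball_avg G x0 d) L"
        by (rule dist_triangle)
      ultimately show ?case using k(2) kd by (simp add: dist_norm norm_minus_commute)
    qed
  qed
  then show ?thesis by blast
qed

end

section \<open>Replacing almost everywhere defined data by Borel functions\<close>

section \<open>Borel representatives\<close>

lemma borel_imp_lebesgue_measurable: "f \<in> borel_measurable borel \<Longrightarrow> f \<in> borel_measurable lebesgue"
  by (rule measurable_completion) simp

text \<open>Local integrability speaks only of compact subsets of \<open>U\<close>; a compact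
  exhaustion writes the cut-off function as a pointwise limit.\<close>

lemma loc_integrable_measurable:
  fixes f :: "real^'n::finite \<Rightarrow> real"
  assumes "open U" "loc_integrable U f"
  shows "(\<lambda>x. indicator U x * f x) \<in> borel_measurable lebesgue"
proof -
  obtain C :: "nat \<Rightarrow> (real^'n) set" where C: "\<And>n. compact (C n)" "\<And>n. C n \<subseteq> U"
    "\<And>n. C n \<subseteq> interior (C (Suc n))" "\<Union>(range C) = U" using open_Union_compact_subsets[OF assms(1)] by metis
  have inc: "incseq C" using C(3) interior_subset by (intro incseq_SucI) blast
  show ?thesis
  proof (rule borel_measurable_LIMSEQ_real)
    show "(\<lambda>x. indicator (C n) x * f x) \<in> borel_measurable lebesgue" for n
      using assms(2) C(1,2)[of n] unfolding loc_integrable_def set_integrable_def by (auto dest!: borel_measurable_integrable)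
    fix x :: "real^'n"
    show "(\<lambda>n. indicator (C n) x * f x) \<longlonglongrightarrow> indicator U x * f x"
    proof (cases "x \<in> U")
      case True
      then obtain k where "x \<in> C k" using C(4) by blast
      then have "x \<in> C n" if "k \<le> n" for n using that inc by (meson incseqD subsetD)
      then have "eventually (\<lambda>n. indicator (C n) x * f x = indicator U x * f x) sequentially"
        using True by (auto simp: eventually_sequentially intro!: exI[of _ k])
      then show ?thesis by (rule tendsto_eventually)
    next
      case False
      then have "x \<notin> C n" for n using C(2) by blast
      then show ?thesis using False by simp
    qed
  qed
qed

text \<open>Weak derivatives come as Lebesgue measurable functions, unconstrained off
  \<open>U\<close>, whereas the Tonelli arguments on product spaces are carried out with Borel
  functions.\<close>

lemma loc_integrable_borel_rep:
  fixes f :: "real^'n::finite \<Rightarrow> real"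
  assumes "open U" "loc_integrable U f"
  obtains f' where "f' \<in> borel_measurable borel" "AE x\<in>U in lborel. f x = f' x"
proof -
  from completion_ex_borel_measurable_real[OF loc_integrable_measurable[OF assms]]
  obtain f' where f': "f' \<in> borel_measurable lborel" "AE x in lborel. indicator U x * f x = f' x" by blast
  show ?thesis
  proof
    show "f' \<in> borel_measurable borel" using f'(1) by simp
    show "AE x\<in>U in lborel. f x = f' x" using f'(2) by eventually_elim auto
  qed
qed

lemma loc_integrable_cong_AE:
  fixes f :: "real^'n::finite \<Rightarrow> real"
  assumes "loc_integrable U f" and [measurable]: "f' \<in> borel_measurable borel" and ae: "AE x\<in>U in lborel. f x = f' x"
  shows "loc_integrable U f'"
  unfolding loc_integrable_def set_integrable_def
proof (intro allI impI)
  fix K assume K: "compact K \<and> K \<subseteq> U"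
  then have [measurable]: "K \<in> sets borel" by (auto intro: borel_closed compact_imp_closed)
  have i: "integrable lebesgue (\<lambda>x. indicator K x *\<^sub>R f x)" using assms(1) K by (auto simp: loc_integrable_def set_integrable_def)
  have "AE x in lebesgue. indicator K x *\<^sub>R f x = indicator K x *\<^sub>R f' x"
    using AE_completion[OF ae] K by (auto elim!: eventually_mono simp: indicator_def)
  moreover have "(\<lambda>x. indicator K x *\<^sub>R f' x) \<in> borel_measurable lebesgue"
    by (rule borel_imp_lebesgue_measurable) measurable
  ultimately show "integrable lebesgue (\<lambda>x. indicator K x *\<^sub>R f' x)"
    using i integrable_cong_AE[of "\<lambda>x. indicator K x *\<^sub>R f x" lebesgue "\<lambda>x. indicator K x *\<^sub>R f' x"]
      borel_measurable_integrable[OF i] by blast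
qed

lemma smooth_fun_measurable:
  assumes "smooth_fun \<phi>"
  shows "\<phi> \<in> borel_measurable borel" "pdiff i \<phi> \<in> borel_measurable borel"
proof -
  have "continuous_on UNIV (iter_pdiff [] \<phi>)" "continuous_on UNIV (iter_pdiff [i] \<phi>)"
    using assms unfolding smooth_fun_def by blast+
  then show "\<phi> \<in> borel_measurable borel" "pdiff i \<phi> \<in> borel_measurable borel"
    by (auto intro: borel_measurable_continuous_onI)
qed

lemma set_integral_cong_AE_borel:
  fixes f f' \<phi> :: "real^'n::finite \<Rightarrow> real"
  assumes "open U" "loc_integrable U f" and [measurable]: "f' \<in> borel_measurable borel" "\<phi> \<in> borel_measurable borel"
    and ae: "AE x\<in>U in lborel. f x = f' x"
  shows "(LINT x:U|lebesgue. f x * \<phi> x) = (LINT x:U|lebesgue. f' x * \<phi> x)"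
  unfolding set_lebesgue_integral_def
proof (rule integral_cong_AE)
  have [measurable]: "U \<in> sets borel" using assms(1) by (rule borel_open)
  have m: "(\<lambda>x. indicator U x * f x) \<in> borel_measurable lebesgue" by (rule loc_integrable_measurable[OF assms(1,2)])
  have \<phi>: "\<phi> \<in> borel_measurable lebesgue" by (rule borel_imp_lebesgue_measurable) fact
  have "(\<lambda>x. (indicator U x * f x) * \<phi> x) \<in> borel_measurable lebesgue" by (rule borel_measurable_times[OF m \<phi>])
  then show "(\<lambda>x. indicator U x *\<^sub>R (f x * \<phi> x)) \<in> borel_measurable lebesgue" by (simp add: mult.assoc)
  show "(\<lambda>x. indicator U x *\<^sub>R (f' x * \<phi> x)) \<in> borel_measurable lebesgue"
    by (rule borel_imp_lebesgue_measurable) measurable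
  show "AE x in lebesgue. indicator U x *\<^sub>R (f x * \<phi> x) = indicator U x *\<^sub>R (f' x * \<phi> x)"
    using AE_completion[OF ae] by eventually_elim (auto simp: indicator_def)
qed

lemma weak_pd_cong_AE:
  fixes u u' g g' :: "real^'n::finite \<Rightarrow> real"
  assumes op: "open U" and w: "weak_pd U u i g" and m: "u' \<in> borel_measurable borel" "g' \<in> borel_measurable borel"
    and ae: "AE x\<in>U in lborel. u x = u' x" "AE x\<in>U in lborel. g x = g' x"
  shows "weak_pd U u' i g'"
  unfolding weak_pd_def
proof (intro conjI allI impI)
  have l: "loc_integrable U u" "loc_integrable U g" using w by (auto simp: weak_pd_def)
  show "loc_integrable U u'" by (rule loc_integrable_cong_AE[OF l(1) m(1) ae(1)])
  show "loc_integrable U g'" by (rule loc_integrable_cong_AE[OF l(2) m(2) ae(2)])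
  fix \<phi> assume \<phi>: "test_fun U \<phi>"
  then have s: "smooth_fun \<phi>" by (simp add: test_fun_def)
  have "(LINT x:U|lebesgue. u' x * pdiff i \<phi> x) = (LINT x:U|lebesgue. u x * pdiff i \<phi> x)"
    by (rule set_integral_cong_AE_borel[OF op l(1) m(1) smooth_fun_measurable(2)[OF s] ae(1), symmetric])
  also have "... = - (LINT x:U|lebesgue. g x * \<phi> x)" using w \<phi> by (simp add: weak_pd_def)
  also have "(LINT x:U|lebesgue. g x * \<phi> x) = (LINT x:U|lebesgue. g' x * \<phi> x)"
    by (rule set_integral_cong_AE_borel[OF op l(2) m(2) smooth_fun_measurable(1)[OF s] ae(2)])
  finally show "(LINT x:U|lebesgue. u' x * pdiff i \<phi> x) = - (LINT x:U|lebesgue. g' x * \<phi> x)" .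
qed

text \<open>Small balls about x lie in \<open>U\<close>, so for small radii the averages of the
  given gradient and of its Borel version are equal. The two sides then agree also where no limit
  exists.\<close>

lemma prec_rep_eq_Lim_ball_avg:
  fixes G0 G :: "real^'n::finite \<Rightarrow> real^'n"
  assumes op: "open U" and x: "x \<in> U" and l: "\<And>i. loc_integrable U (\<lambda>x. G0 x $ i)"
    and [measurable]: "G \<in> borel_measurable borel" and ae: "AE x\<in>U in lborel. G0 x = G x"
  shows "prec_rep G0 x = Lim (at_right 0) (ball_avg G x)"
  unfolding prec_rep_def
proof (rule Lim_cong[OF _ refl])
  obtain r where r: "0 < r" "ball x r \<subseteq> U" using op x open_contains_ball by blast
  have "eventually (\<lambda>\<rho>. \<rho> \<in> {0<..<r}) (at_right 0)" using r(1) by (rule eventually_at_right_real)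
  then show "eventually (\<lambda>\<rho>. (1 / measure lebesgue (ball x \<rho>)) *\<^sub>R (LINT y:ball x \<rho>|lebesgue. G0 y) = ball_avg G x \<rho>) (at_right 0)"
  proof eventually_elim
    case (elim \<rho>)
    let ?B = "ball x \<rho>"
    have [measurable]: "?B \<in> sets borel" by simp
    have sub: "?B \<subseteq> U" using elim r(2) by (meson greaterThanLessThan_iff less_imp_le subset_ball subset_trans)
    have "(LINT y:?B|lebesgue. G0 y) = (\<integral>y. indicator ?B y *\<^sub>R G y \<partial>lebesgue)" unfolding set_lebesgue_integral_def
    proof (rule integral_cong_AE)
      show "(\<lambda>y. indicator ?B y *\<^sub>R G0 y) \<in> borel_measurable lebesgue"
      proof (subst borel_measurable_euclidean_space, intro ballI)
        fix b :: "real^'n" assume "b \<in> Basis"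
        then obtain i where b: "b = axis i 1" by (auto simp: Basis_vec_def)
        have "(\<lambda>y. indicator ?B y * (indicator U y * G0 y $ i)) \<in> borel_measurable lebesgue"
          by (rule borel_measurable_times[OF borel_imp_lebesgue_measurable loc_integrable_measurable[OF op l]]) measurable
        moreover have "indicator ?B y * (indicator U y * G0 y $ i) = (indicator ?B y *\<^sub>R G0 y) \<bullet> b" for y
          using sub by (auto simp: indicator_def b inner_axis)
        ultimately show "(\<lambda>y. (indicator ?B y *\<^sub>R G0 y) \<bullet> b) \<in> borel_measurable lebesgue" by simp
      qed
      show "(\<lambda>y. indicator ?B y *\<^sub>R G y) \<in> borel_measurable lebesgue" by (rule borel_imp_lebesgue_measurable) measurable
      show "AE y in lebesgue. indicator ?B y *\<^sub>R G0 y = indicator ?B y *\<^sub>R G y"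
        using AE_completion[OF ae] by eventually_elim (use sub in \<open>auto simp: indicator_def\<close>)
    qed
    also have "... = (\<integral>y. indicator ?B y *\<^sub>R G y \<partial>lborel)" by (rule integral_completion) measurable
    finally show ?case by (simp add: ball_avg_def)
  qed
qed

section \<open>From weak derivatives and upper gradients to Borel functions and two pointwise
  bounds\<close>

section \<open>The reduced problem\<close>

text \<open>The additional factor n 2^n is the price of averaging the potentials over balls in the
  passage to the precise representative.\<close>

definition grad_const :: "'a::euclidean_space itself \<Rightarrow> real" where
  "grad_const _ = pointwise_const TYPE('a) * (real DIM('a) * 2 ^ DIM('a))"

lemma grad_const_pos: "2 \<le> DIM('a::euclidean_space) \<Longrightarrow> 0 < grad_const TYPE('a)"
  unfolding grad_const_def using pointwise_const_pos[where 'a='a] by simp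

text \<open>An interface: the norm estimates see only Borel functions \<open>F\<close> and
  \<open>g\<close>, a finite boundary measure on the whole space, and two bounds. The almost
  everywhere bound concerns the given gradient; the other holds at every single point of finite
  potential, as a measure singular to Lebesgue measure requires.\<close>

theorem gradient_reduction:
  fixes U :: "(real^'n::finite) set"
  assumes dim: "2 \<le> CARD('n)" and dom: "admissible_domain U" and wgh: "weak_grad_hess U u G0 H0"
    and cb: "Cb_closure U u" and ug: "hajlasz_ug (bdry_measure U) u g0"
  obtains F g :: "real^'n \<Rightarrow> real" and Hb :: "(real^'n) measure" where
    "F \<in> borel_measurable borel" "\<And>x. 0 \<le> F x" "\<And>x. x \<notin> U \<Longrightarrow> F x = 0"
    "AE x\<in>U in lborel. norm (H0 x) = F x"
    "g \<in> borel_measurable borel" "sets Hb = sets borel" "finite_measure Hb"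
    "\<And>P. (AE y in bdry_measure U. P (g0 y)) \<Longrightarrow> AE y in Hb. P (g y)"
    "\<And>\<Phi>. \<Phi> \<in> borel_measurable borel \<Longrightarrow> (\<integral>\<^sup>+y. \<Phi> (g0 y) \<partial>bdry_measure U) = (\<integral>\<^sup>+y. \<Phi> (g y) \<partial>Hb)"
    "AE x\<in>U in lborel. (\<forall>s\<ge>0. ennreal (norm (G0 x)) \<le> ennreal (pointwise_const TYPE(real^'n)) *
      (riesz lborel (\<lambda>y. ennreal (F y)) x + ennreal s + riesz Hb (excess s g) x))"
    "\<And>x s. x \<in> U \<Longrightarrow> riesz lborel (\<lambda>y. ennreal (F y)) x < \<infinity> \<Longrightarrow> 0 \<le> s \<Longrightarrow>
      ennreal (norm (prec_rep G0 x)) \<le> ennreal (grad_const TYPE(real^'n)) *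
        (riesz lborel (\<lambda>y. ennreal (F y)) x + ennreal s + riesz Hb (excess s g) x)"
    "(\<lambda>x. norm (prec_rep G0 x)) \<in> borel_measurable (restrict_space borel U)"
proof -
  let ?s = "real CARD('n) - 1" and ?F = "frontier U"
  have op: "open U" and finL: "emeasure lebesgue U < \<infinity>" and finH: "hausdorff_outer ?s ?F < \<infinity>"
    using dom by (auto simp: admissible_domain_def)
  have [measurable]: "U \<in> sets borel" using op by (rule borel_open)
  have [measurable]: "?F \<in> sets borel" "closure U \<in> sets borel" by auto
  have fin: "emeasure lborel U < \<infinity>" using finL by simp
  have wpu: "weak_pd U u i (\<lambda>x. G0 x $ i)" and wpG: "weak_pd U (\<lambda>x. G0 x $ i) j (\<lambda>x. H0 x $ i $ j)" for i j
    using wgh by (auto simp: weak_grad_hess_def)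
  have cont: "continuous_on (closure U) u" using cb by (simp add: Cb_closure_def)

  have rep: "\<exists>f'. f' \<in> borel_measurable borel \<and> (AE x\<in>U in lborel. f x = f' x)" if "loc_integrable U f" for f
    using loc_integrable_borel_rep[OF op that] by blast
  have "\<forall>i. \<exists>f'. f' \<in> borel_measurable borel \<and> (AE x\<in>U in lborel. G0 x $ i = f' x)"
    using rep wpu unfolding weak_pd_def by blast
  from choice[OF this] obtain Gc where Gc: "\<And>i. Gc i \<in> borel_measurable borel"
    "\<And>i. AE x\<in>U in lborel. G0 x $ i = Gc i x" by blast
  have "\<forall>p. \<exists>f'. f' \<in> borel_measurable borel \<and> (AE x\<in>U in lborel. H0 x $ fst p $ snd p = f' x)"
    using rep wpG unfolding weak_pd_def by blast
  from choice[OF this] obtain Hc where Hc: "\<And>p. Hc p \<in> borel_measurable borel"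
    "\<And>p. AE x\<in>U in lborel. H0 x $ fst p $ snd p = Hc p x" by blast
  \<comment> \<open>Cutting off with the closure, not with the open set, preserves the boundary
    values while making the function Borel.\<close>
  define u1 where "u1 x = indicator (closure U) x * u x" for x
  define G1 where "G1 x = (\<chi> i. Gc i x)" for x
  define H1 where "H1 x = (\<chi> i j. Hc (i, j) x)" for x
  have G1m [measurable]: "G1 \<in> borel_measurable borel"
  proof (subst borel_measurable_euclidean_space, intro ballI)
    fix b :: "real^'n" assume "b \<in> Basis"
    then obtain i where "b = axis i 1" by (auto simp: Basis_vec_def)
    then have "(\<lambda>x. G1 x \<bullet> b) = Gc i" by (auto simp: G1_def inner_axis)
    then show "(\<lambda>x. G1 x \<bullet> b) \<in> borel_measurable borel" using Gc(1) by simp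
  qed
  have H1m [measurable]: "H1 \<in> borel_measurable borel"
  proof (subst borel_measurable_euclidean_space, intro ballI)
    fix b :: "real^'n^'n" assume "b \<in> Basis"
    then obtain i j where "b = axis i (axis j 1)" by (auto simp: Basis_vec_def)
    then have "(\<lambda>x. H1 x \<bullet> b) = Hc (i, j)" by (auto simp: H1_def inner_axis)
    then show "(\<lambda>x. H1 x \<bullet> b) \<in> borel_measurable borel" using Hc(1) by simp
  qed
  have u1m [measurable]: "u1 \<in> borel_measurable borel"
    using borel_measurable_continuous_on_indicator[OF _ cont] by (simp add: u1_def[abs_def])
  have aeG: "AE x\<in>U in lborel. G0 x = G1 x"
  proof -
    have "AE x in lborel. \<forall>i\<in>UNIV. x \<in> U \<longrightarrow> G0 x $ i = Gc i x" by (rule AE_finite_allI) (auto simp: Gc)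
    then show ?thesis by eventually_elim (auto simp: G1_def vec_eq_iff)
  qed
  have aeH: "AE x\<in>U in lborel. H0 x = H1 x"
  proof -
    have "AE x in lborel. \<forall>p\<in>UNIV. x \<in> U \<longrightarrow> H0 x $ fst p $ snd p = Hc p x" by (rule AE_finite_allI) (auto simp: Hc)
    then show ?thesis by eventually_elim (auto simp: H1_def vec_eq_iff)
  qed
  have aeu: "AE x\<in>U in lborel. u x = u1 x" using closure_subset[of U] by (intro AE_I2) (auto simp: u1_def)
  have wu1: "weak_pd U u1 i (\<lambda>x. G1 x $ i)" for i
    using Gc by (intro weak_pd_cong_AE[OF op wpu _ _ aeu]) (auto simp: G1_def)
  have wG1: "weak_pd U (\<lambda>x. G1 x $ i) j (\<lambda>x. H1 x $ i $ j)" for i j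
    using Gc Hc(1)[of "(i, j)"] Hc(2)[of "(i, j)"] by (intro weak_pd_cong_AE[OF op wpG]) (auto simp: G1_def H1_def)
  have cont1: "continuous_on (closure U) u1" using cont by (rule continuous_on_eq) (simp add: u1_def)

  \<comment> \<open>A density on the whole space instead of the restricted measure:
    \<open>Hb\<close> then has the Borel sets of the space, and potentials need no restricted
    spaces.\<close>
  define Hb where "Hb = density (hausdorff_measure ?s) (indicator ?F :: real^'n \<Rightarrow> ennreal)"
  define g where "g y = indicator ?F y * g0 y" for y
  have sHb: "sets Hb = sets borel" by (simp add: Hb_def)
  have emHb: "emeasure Hb E = hausdorff_outer ?s (E \<inter> ?F)" if "E \<in> sets borel" for E
  proof -
    have "emeasure Hb E = (\<integral>\<^sup>+y. indicator ?F y * indicator E y \<partial>hausdorff_measure ?s)"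
      unfolding Hb_def using that by (subst emeasure_density) auto
    also have "... = (\<integral>\<^sup>+y. indicator (E \<inter> ?F) y \<partial>hausdorff_measure ?s)"
      by (intro nn_integral_cong) (auto simp: indicator_def)
    also have "... = emeasure (hausdorff_measure ?s) (E \<inter> ?F)" using that by (subst nn_integral_indicator) auto
    also have "... = hausdorff_outer ?s (E \<inter> ?F)" using that by (intro emeasure_hausdorff_measure) auto
    finally show ?thesis .
  qed
  have g0m: "g0 \<in> borel_measurable (bdry_measure U)" using ug by (simp add: hajlasz_ug_def)
  have gm [measurable]: "g \<in> borel_measurable borel"
  proof -
    have "(\<lambda>x. indicator ?F x *\<^sub>R g0 x) \<in> borel_measurable (hausdorff_measure ?s)"
      using g0m unfolding bdry_measure_def by (subst (asm) borel_measurable_restrict_space_iff) auto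
    then show ?thesis by (simp add: g_def[abs_def] measurable_cong_sets[OF sets_hausdorff_measure refl])
  qed
  have fHb: "finite_measure Hb"
    using emHb[of UNIV] finH sets_eq_imp_space_eq[OF sHb] by (intro finite_measureI) (auto simp: less_top)
  obtain N where N: "N \<in> null_sets (bdry_measure U)"
    "\<forall>x \<in> space (bdry_measure U) - N. \<forall>y \<in> space (bdry_measure U) - N. \<bar>u x - u y\<bar> \<le> dist x y * (g0 x + g0 y)"
    using ug by (auto simp: hajlasz_ug_def)
  have spb: "space (bdry_measure U) = ?F" by (simp add: bdry_measure_def space_restrict_space)
  have Nb: "N \<in> sets borel" "N \<subseteq> ?F" "emeasure (hausdorff_measure ?s) N = 0"
  proof -
    have "N \<in> null_sets (hausdorff_measure ?s)" "N \<subseteq> ?F"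
      using N(1) unfolding bdry_measure_def by (auto simp: null_sets_restrict_space)
    then show "N \<in> sets borel" "N \<subseteq> ?F" "emeasure (hausdorff_measure ?s) N = 0" by auto
  qed
  have N0: "emeasure Hb N = 0"
    using Nb emHb[OF Nb(1)] emeasure_hausdorff_measure[OF Nb(1), of ?s] by (simp add: Int_absorb2)
  have haj: "\<bar>u1 x - u1 y\<bar> \<le> dist x y * (g x + g y)" if "x \<in> ?F - N" "y \<in> ?F - N" for x y
    using N(2) that by (auto simp: spb g_def u1_def frontier_def)
  define Fd where "Fd y = indicator U y * norm (H1 y)" for y
  have Fe: "(\<lambda>y. ennreal (Fd y)) = hess_dens U H1" by (auto simp: Fd_def hess_dens_def indicator_def fun_eq_iff)
  have n2: "2 \<le> DIM(real^'n)" using dim by simp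
  interpret fHb: finite_measure Hb by fact
  let ?K = "ennreal (pointwise_const TYPE(real^'n))" and ?A = "ennreal (real DIM(real^'n) * 2 ^ DIM(real^'n))"
  have pw: "AE x\<in>U in lborel. (\<forall>s\<ge>0. ennreal (norm (G1 x)) \<le>
      ?K * (riesz lborel (hess_dens U H1) x + ennreal s + riesz Hb (excess s g) x))"
    by (rule pointwise_gradient_bound[OF op u1m G1m H1m wu1 wG1 cont1 fin dim sHb _ gm Nb(1) N0])
      (use emHb haj in blast)+
  have aeF: "AE y in Hb. y \<in> ?F"
  proof -
    have "- ?F \<in> null_sets Hb" using emHb[of "- ?F"] sHb by (intro null_setsI) auto
    from AE_not_in[OF this] show ?thesis by eventually_elim auto
  qed
  have KA: "ennreal (grad_const TYPE(real^'n)) = ?K * ?A"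
    unfolding grad_const_def using pointwise_const_pos[OF n2] by (subst ennreal_mult) auto
  have A1: "1 \<le> ?A"
  proof -
    have "1 * 1 \<le> real DIM(real^'n) * 2 ^ DIM(real^'n)" using n2 by (intro mult_mono one_le_power) auto
    then show ?thesis by (simp add: ennreal_leI[of 1, simplified])
  qed
  have precLim: "prec_rep G0 x = Lim (at_right 0) (ball_avg G1 x)" if "x \<in> U" for x
    using wpu by (intro prec_rep_eq_Lim_ball_avg[OF op that _ G1m aeG]) (auto simp: weak_pd_def)
  note intG = gradient_integrable_ball[OF op u1m G1m H1m wu1 wG1 dim]
  show ?thesis
  proof (rule that[of Fd g Hb])
    show "Fd \<in> borel_measurable borel" unfolding Fd_def by measurable
    show "0 \<le> Fd x" for x by (simp add: Fd_def)
    show "Fd x = 0" if "x \<notin> U" for x using that by (simp add: Fd_def)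
    show "AE x\<in>U in lborel. norm (H0 x) = Fd x" using aeH by eventually_elim (auto simp: Fd_def)
    show "g \<in> borel_measurable borel" "sets Hb = sets borel" "finite_measure Hb" by fact+
    show "AE y in Hb. P (g y)" if "AE y in bdry_measure U. P (g0 y)" for P
    proof -
      have "AE y in hausdorff_measure ?s. y \<in> ?F \<longrightarrow> P (g0 y)"
        using that unfolding bdry_measure_def by (subst (asm) AE_restrict_space_iff) auto
      then have "AE y in Hb. y \<in> ?F \<longrightarrow> P (g0 y)" unfolding Hb_def by (subst AE_density) auto
      with aeF show ?thesis by eventually_elim (auto simp: g_def)
    qed
    show "(\<integral>\<^sup>+y. \<Phi> (g0 y) \<partial>bdry_measure U) = (\<integral>\<^sup>+y. \<Phi> (g y) \<partial>Hb)" if [measurable]: "\<Phi> \<in> borel_measurable borel" for \<Phi>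
    proof -
      have "(\<integral>\<^sup>+y. \<Phi> (g0 y) \<partial>bdry_measure U) = (\<integral>\<^sup>+y. \<Phi> (g0 y) * indicator ?F y \<partial>hausdorff_measure ?s)"
        unfolding bdry_measure_def by (subst nn_integral_restrict_space) auto
      also have "... = (\<integral>\<^sup>+y. indicator ?F y * \<Phi> (g y) \<partial>hausdorff_measure ?s)"
        by (intro nn_integral_cong) (auto simp: g_def indicator_def)
      also have "... = (\<integral>\<^sup>+y. \<Phi> (g y) \<partial>Hb)" unfolding Hb_def by (subst nn_integral_density) auto
      finally show ?thesis .
    qed
    show "AE x\<in>U in lborel. (\<forall>s\<ge>0. ennreal (norm (G0 x)) \<le> ennreal (pointwise_const TYPE(real^'n)) *
      (riesz lborel (\<lambda>y. ennreal (Fd y)) x + ennreal s + riesz Hb (excess s g) x))"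
      using pw aeG unfolding Fe by eventually_elim auto
    show "ennreal (norm (prec_rep G0 x)) \<le> ennreal (grad_const TYPE(real^'n)) *
        (riesz lborel (\<lambda>y. ennreal (Fd y)) x + ennreal s + riesz Hb (excess s g) x)"
      if x: "x \<in> U" and I: "riesz lborel (\<lambda>y. ennreal (Fd y)) x < \<infinity>" and s: "0 \<le> s" for x s
    proof -
      let ?I = "riesz lborel (hess_dens U H1)" and ?J = "riesz Hb (excess s g)"
      have hm [measurable]: "hess_dens U H1 \<in> borel_measurable borel" unfolding Fe[symmetric] Fd_def by measurable
      have em [measurable]: "excess s g \<in> borel_measurable borel" by measurable
      have [measurable]: "?I \<in> borel_measurable borel" "?J \<in> borel_measurable borel"
        by (rule riesz_measurable; simp add: sigma_finite_lborel sHb fHb.sigma_finite_measure_axioms em hm)+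
      obtain L where L: "(ball_avg G1 x \<longlongrightarrow> L) (at_right 0)"
        using ball_avg_converges[OF op u1m G1m H1m wu1 wG1 dim x] I unfolding Fe by blast
      then have pr: "prec_rep G0 x = L" unfolding precLim[OF x] by (intro tendsto_Lim) auto
      obtain r where r: "0 < r" "cball x r \<subseteq> U" using op x open_contains_cball by blast
      have xF: "x \<notin> ?F" using x op by (simp add: frontier_def interior_open)
      \<comment> \<open>The almost everywhere bound is averaged over a small ball about x. Both
        potentials average to at most n 2^n times their values at the centre (x, being interior,
        carries no boundary mass), and the level is enlarged by the same factor, which is at least
        1.\<close>
      have bd: "ennreal (norm (ball_avg G1 x \<rho> - 0)) \<le> ?K * (?A * (?I x + ennreal s + ?J x))" if \<rho>: "0 < \<rho>" "\<rho> < r" for \<rho>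
      proof (rule ball_avg_bound[OF \<rho>(1)])
        let ?B = "ball x \<rho>"
        have [measurable]: "?B \<in> sets borel" by simp
        have sub: "cball x \<rho> \<subseteq> U" using r(2) \<rho> by (meson less_imp_le subset_cball subset_trans)
        have subB: "?B \<subseteq> U" using sub ball_subset_cball by blast
        show "integrable lborel (\<lambda>y. indicator ?B y *\<^sub>R G1 y)" by (rule intG[OF sub])
        have "(\<integral>\<^sup>+y. indicator ?B y * ennreal (norm (G1 y - 0)) \<partial>lborel) \<le>
          (\<integral>\<^sup>+y. ?K * (indicator ?B y * ?I y + ennreal s * indicator ?B y + indicator ?B y * ?J y) \<partial>lborel)"
        proof (rule nn_integral_mono_AE, goal_cases)
          case 1
          show ?case using pw
          proof eventually_elim
            case (elim y)
            then show ?case using s subB by (auto simp: indicator_def)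
          qed
        qed
        also have "... = ?K * ((\<integral>\<^sup>+y. indicator ?B y * ?I y \<partial>lborel) + ennreal s * emeasure lborel ?B + (\<integral>\<^sup>+y. indicator ?B y * ?J y \<partial>lborel))"
          by (simp add: nn_integral_cmult nn_integral_add)
        also have "... \<le> ?K * ((?A * ?I x) * emeasure lborel ?B + (?A * ennreal s) * emeasure lborel ?B + (?A * ?J x) * emeasure lborel ?B)"
        proof (intro mult_left_mono add_mono)
          show "(\<integral>\<^sup>+y. indicator ?B y * ?I y \<partial>lborel) \<le> (?A * ?I x) * emeasure lborel ?B"
            by (rule riesz_ball_average[OF _ sigma_finite_lborel hm _ \<rho>(1) n2]) (auto intro: AE_lborel_singleton)
          show "(\<integral>\<^sup>+y. indicator ?B y * ?J y \<partial>lborel) \<le> (?A * ?J x) * emeasure lborel ?B"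
            using aeF xF by (intro riesz_ball_average[OF sHb fHb.sigma_finite_measure_axioms em _ \<rho>(1) n2]) (auto elim!: eventually_mono)
          show "ennreal s * emeasure lborel ?B \<le> (?A * ennreal s) * emeasure lborel ?B"
            using mult_right_mono[OF A1, of "ennreal s"] by (intro mult_right_mono) auto
        qed auto
        also have "... = ?K * (?A * (?I x + ennreal s + ?J x)) * emeasure lborel ?B"
          by (simp only: distrib_left distrib_right mult_ac)
        finally show "(\<integral>\<^sup>+y. indicator ?B y * ennreal (norm (G1 y - 0)) \<partial>lborel) \<le> ?K * (?A * (?I x + ennreal s + ?J x)) * emeasure lborel ?B" .
      qed
      have "((\<lambda>\<rho>. ennreal (norm (ball_avg G1 x \<rho> - 0))) \<longlongrightarrow> ennreal (norm (L - 0))) (at_right 0)"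
        by (intro tendsto_intros L)
      moreover have "eventually (\<lambda>\<rho>. ennreal (norm (ball_avg G1 x \<rho> - 0)) \<le> ?K * (?A * (?I x + ennreal s + ?J x))) (at_right 0)"
        using eventually_at_right_real[OF r(1)] by eventually_elim (use bd in auto)
      ultimately have "ennreal (norm (L - 0)) \<le> ?K * (?A * (?I x + ennreal s + ?J x))" by (rule tendsto_upperbound) simp
      then show ?thesis unfolding pr KA Fe by (simp add: mult.assoc)
    qed
    show "(\<lambda>x. norm (prec_rep G0 x)) \<in> borel_measurable (restrict_space borel U)"
    proof -
      have "(\<lambda>x. Lim (at_right 0) (ball_avg G1 x)) \<in> borel_measurable (restrict_space borel U)"
      proof (rule measurable_Lim_at_right)
        show "(\<lambda>x. ball_avg G1 x \<rho>) \<in> borel_measurable (restrict_space borel U)" for \<rho>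
          using ball_avg_measurable[OF G1m] by (rule measurable_restrict_space1)
        fix x assume "x \<in> space (restrict_space borel U)"
        then have x: "x \<in> U" by (simp add: space_restrict_space)
        obtain r where r: "0 < r" "cball x r \<subseteq> U" using op x open_contains_cball by blast
        show "\<exists>r>0. \<forall>\<rho>\<in>{0<..<r}. \<forall>e>0. \<exists>q\<in>\<rat>. 0 < q \<and> q < \<rho> \<and> dist (ball_avg G1 x q) (ball_avg G1 x \<rho>) < e"
        proof (intro exI[of _ r] conjI r(1) ballI allI impI)
          fix \<rho> e :: real assume \<rho>: "\<rho> \<in> {0<..<r}" and e: "0 < e"
          then have "cball x \<rho> \<subseteq> U" using r(2) by (meson greaterThanLessThan_iff less_imp_le subset_cball subset_trans)
          from ball_avg_left_approx[OF G1m intG[OF this] _ e] \<rho>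
          show "\<exists>q\<in>\<rat>. 0 < q \<and> q < \<rho> \<and> dist (ball_avg G1 x q) (ball_avg G1 x \<rho>) < e" by auto
        qed
      qed
      then have "(\<lambda>x. norm (Lim (at_right 0) (ball_avg G1 x))) \<in> borel_measurable (restrict_space borel U)"
        by (rule measurable_compose[OF _ borel_measurable_norm])
      then show ?thesis
        by (subst measurable_cong[where g = "\<lambda>x. norm (Lim (at_right 0) (ball_avg G1 x))"]) (auto simp: precLim space_restrict_space)
    qed
  qed
qed

section \<open>Duality, Hedberg-type truncation and sup bounds for potentials\<close>

section \<open>Integral inequalities for Riesz potentials\<close>

text \<open>Real upper bounds \<open>P\<close> and \<open>S\<close> stand in for the two integrals,
  so finiteness is built in. A vanishing bound is treated apart, because Young's inequality is
  applied after normalisation.\<close>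

lemma nn_integral_Holder:
  fixes f g :: "'a \<Rightarrow> real"
  assumes [measurable]: "f \<in> borel_measurable M" "g \<in> borel_measurable M"
    and pq: "1 < p" "1 < q" "1 / p + 1 / q = 1" and f0: "\<And>x. 0 \<le> f x" and g0: "\<And>x. 0 \<le> g x"
    and P: "0 \<le> P" "(\<integral>\<^sup>+x. ennreal (f x powr p) \<partial>M) \<le> ennreal P"
    and S: "0 \<le> S" "(\<integral>\<^sup>+x. ennreal (g x powr q) \<partial>M) \<le> ennreal S"
  shows "(\<integral>\<^sup>+x. ennreal (f x * g x) \<partial>M) \<le> ennreal (P powr (1 / p) * S powr (1 / q))"
proof (cases "P = 0 \<or> S = 0")
  case True
  have z: "AE x in M. h x = 0" if [measurable]: "h \<in> borel_measurable M" and "(\<integral>\<^sup>+x. ennreal (h x powr r) \<partial>M) \<le> ennreal 0" for h :: "'a \<Rightarrow> real" and r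
  proof -
    have "(\<integral>\<^sup>+x. ennreal (h x powr r) \<partial>M) = 0" using that(2) by simp
    then have "AE x in M. ennreal (h x powr r) = 0" by (subst (asm) nn_integral_0_iff_AE) auto
    then show ?thesis by eventually_elim (auto simp: ennreal_eq_0_iff powr_def split: if_splits)
  qed
  have "AE x in M. f x = 0 \<or> g x = 0" using True
  proof
    assume "P = 0"
    then have "AE x in M. f x = 0" using z[of f p] P by simp
    then show ?thesis by eventually_elim auto
  next
    assume "S = 0"
    then have "AE x in M. g x = 0" using z[of g q] S by simp
    then show ?thesis by eventually_elim auto
  qed
  then have "AE x in M. ennreal (f x * g x) = 0" by eventually_elim auto
  then have "(\<integral>\<^sup>+x. ennreal (f x * g x) \<partial>M) = 0" by (subst nn_integral_0_iff_AE) auto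
  then show ?thesis by simp
next
  case False
  then have P0: "0 < P" and S0: "0 < S" using P S by auto
  define C where "C = P powr (1 / p) * S powr (1 / q)"
  have C: "0 < C" using P0 S0 by (simp add: C_def)
  have pw: "f x * g x \<le> C / (p * P) * f x powr p + C / (q * S) * g x powr q" for x
  proof -
    have "f x / P powr (1 / p) * (g x / S powr (1 / q)) \<le> (f x / P powr (1 / p)) powr p / p + (g x / S powr (1 / q)) powr q / q"
      by (rule Youngs_inequality) (use pq f0 g0 in auto)
    also have "(f x / P powr (1 / p)) powr p = f x powr p / P" using f0[of x] P0 pq by (simp add: powr_divide powr_powr)
    also have "(g x / S powr (1 / q)) powr q = g x powr q / S" using g0[of x] S0 pq by (simp add: powr_divide powr_powr)
    finally have "C * (f x / P powr (1 / p) * (g x / S powr (1 / q))) \<le> C * (f x powr p / P / p + g x powr q / S / q)"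
      using C by (intro mult_left_mono) auto
    moreover have "C * (f x / P powr (1 / p) * (g x / S powr (1 / q))) = f x * g x" using P0 S0 by (simp add: C_def)
    ultimately show ?thesis by (simp add: distrib_left mult_ac)
  qed
  have "(\<integral>\<^sup>+x. ennreal (f x * g x) \<partial>M) \<le> (\<integral>\<^sup>+x. ennreal (C / (p * P)) * ennreal (f x powr p) + ennreal (C / (q * S)) * ennreal (g x powr q) \<partial>M)"
  proof (rule nn_integral_mono, goal_cases)
    case (1 x)
    have "ennreal (f x * g x) \<le> ennreal (C / (p * P) * f x powr p + C / (q * S) * g x powr q)" by (rule ennreal_leI[OF pw])
    also have "... = ennreal (C / (p * P)) * ennreal (f x powr p) + ennreal (C / (q * S)) * ennreal (g x powr q)"
      using C P0 S0 pq by (simp add: ennreal_mult[symmetric] ennreal_plus[symmetric] del: ennreal_plus)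
    finally show ?case .
  qed
  also have "... = ennreal (C / (p * P)) * (\<integral>\<^sup>+x. ennreal (f x powr p) \<partial>M) + ennreal (C / (q * S)) * (\<integral>\<^sup>+x. ennreal (g x powr q) \<partial>M)"
    by (simp add: nn_integral_add nn_integral_cmult)
  also have "... \<le> ennreal (C / (p * P)) * ennreal P + ennreal (C / (q * S)) * ennreal S"
    by (intro add_mono mult_left_mono P S) auto
  also have "... = ennreal (C / p + C / q)"
    using C P0 S0 pq by (simp add: ennreal_mult[symmetric] ennreal_plus[symmetric] del: ennreal_plus)
  also have "C / p + C / q = C * (1 / p + 1 / q)" by (simp only: distrib_left times_divide_eq_right mult_1_right)
  finally show ?thesis unfolding pq(3) by (simp add: C_def)
qed

text \<open>The constant of \<open>kernel_integral_bound\<close> at the kernel exponent a = n -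
  1.\<close>

definition dual_const :: "nat \<Rightarrow> real \<Rightarrow> real \<Rightarrow> real" where
  "dual_const n \<alpha> K = \<alpha> / (\<alpha> - (real n - 1)) * K powr ((real n - 1) / \<alpha>)"

lemma dual_const_pos: "2 \<le> n \<Longrightarrow> real n - 1 < \<alpha> \<Longrightarrow> 0 < K \<Longrightarrow> 0 < dual_const n \<alpha> K"
  unfolding dual_const_def by (intro mult_pos_pos divide_pos_pos) auto

text \<open>Tonelli moves the kernel from \<open>f\<close> onto the indicator of \<open>E\<close>,
  where its integral is bounded uniformly in y. This is the dual form of a weak type estimate from
  L^1(N) to the exponent \<alpha>/(n-1); as \<open>N\<close> is arbitrary, it serves Lebesgue and
  boundary measure alike.\<close>

lemma riesz_dual:
  fixes M N :: "'a::euclidean_space measure"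
  assumes dim: "2 \<le> DIM('a)" and sM [measurable_cong]: "sets M = sets borel" and fM: "finite_measure M"
    and sN: "sets N = sets borel" and fN: "sigma_finite_measure N" and K: "0 < K" and \<alpha>: "real DIM('a) - 1 < \<alpha>"
    and gr: "\<And>y t. 0 < t \<Longrightarrow> emeasure M (cball y t) \<le> ennreal (K * t powr \<alpha>)"
    and [measurable]: "f \<in> borel_measurable borel" "E \<in> sets borel"
  shows "(\<integral>\<^sup>+x. riesz N f x * indicator E x \<partial>M) \<le>
    ennreal (dual_const DIM('a) \<alpha> K * measure M E powr (1 - 1 / (\<alpha> / (real DIM('a) - 1)))) * (\<integral>\<^sup>+y. f y \<partial>N)"
proof -
  interpret M: finite_measure M by fact
  interpret N: sigma_finite_measure N by fact
  interpret pair_sigma_finite M N ..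
  let ?n = "real DIM('a)"
  let ?C = "dual_const DIM('a) \<alpha> K * measure M E powr (1 - 1 / (\<alpha> / (?n - 1)))"
  have eq: "sets (M \<Otimes>\<^sub>M N) = sets (borel \<Otimes>\<^sub>M borel)" by (intro sets_pair_measure_cong sM sN)
  have fN': "f \<in> borel_measurable N" by (simp add: measurable_cong_sets[OF sN refl])
  have "(\<integral>\<^sup>+x. riesz N f x * indicator E x \<partial>M) = (\<integral>\<^sup>+x. (\<integral>\<^sup>+y. f y * ennreal (dist x y powr (1 - ?n)) * indicator E x \<partial>N) \<partial>M)"
    unfolding riesz_def
    by (intro nn_integral_cong, subst nn_integral_multc) (auto simp: measurable_cong_sets[OF sN refl])
  also have "... = (\<integral>\<^sup>+y. (\<integral>\<^sup>+x. f y * ennreal (dist x y powr (1 - ?n)) * indicator E x \<partial>M) \<partial>N)"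
  proof (rule Fubini'[symmetric])
    show "(\<lambda>(x, y). f y * ennreal (dist x y powr (1 - ?n)) * indicator E x) \<in> borel_measurable (M \<Otimes>\<^sub>M N)"
      by (subst measurable_cong_sets[OF eq refl]) measurable
  qed
  also have "... \<le> (\<integral>\<^sup>+y. ennreal ?C * f y \<partial>N)"
  proof (rule nn_integral_mono, goal_cases)
    case (1 y)
    have "(\<integral>\<^sup>+x. f y * ennreal (dist x y powr (1 - ?n)) * indicator E x \<partial>M) = f y * (\<integral>\<^sup>+x. ennreal (dist x y powr - (?n - 1)) * indicator E x \<partial>M)"
      by (subst nn_integral_cmult[symmetric]) (auto simp: mult.assoc)
    also have "... \<le> f y * ennreal (\<alpha> / (\<alpha> - (?n - 1)) * K powr ((?n - 1) / \<alpha>) * measure M E powr (1 - (?n - 1) / \<alpha>))"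
    proof (intro mult_left_mono kernel_integral_bound[OF sM M.sigma_finite_measure_axioms])
      show "emeasure M (E \<inter> cball y t) \<le> ennreal (K * t powr \<alpha>)" if "0 < t" for t
        using emeasure_mono[of "E \<inter> cball y t" "cball y t" M] gr[OF that, of y] sM by auto
    qed (use dim \<alpha> K in \<open>auto simp: M.emeasure_eq_measure\<close>)
    finally show ?case by (simp add: dual_const_def mult.commute)
  qed
  also have "... = ennreal ?C * (\<integral>\<^sup>+y. f y \<partial>N)" by (rule nn_integral_cmult[OF fN'])
  finally show ?thesis .
qed

lemma riesz_near:
  fixes x :: "'a::euclidean_space"
  assumes dim: "2 \<le> DIM('a)" and R: "0 < R"
  shows "(\<integral>\<^sup>+y. ennreal (dist x y powr (1 - real DIM('a))) * indicator (cball x R) y \<partial>lborel) \<le>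
    ennreal (real DIM('a) * unit_ball_vol (real DIM('a)) * R)"
proof -
  let ?n = "real DIM('a)" and ?w = "unit_ball_vol (real DIM('a))"
  have w: "0 < ?w" by (rule unit_ball_vol_pos) simp
  have "(\<integral>\<^sup>+y. ennreal (dist y x powr (- (?n - 1))) * indicator (cball x R) y \<partial>lborel)
      \<le> ennreal (?n / (?n - (?n - 1)) * ?w powr ((?n - 1) / ?n) * (?w * R powr ?n) powr (1 - (?n - 1) / ?n))"
  proof (rule kernel_integral_bound)
    show "emeasure lborel (cball x R \<inter> cball x t) \<le> ennreal (?w * t powr ?n)" if "0 < t" for t
      using emeasure_mono[of "cball x R \<inter> cball x t" "cball x t" lborel] that by (simp add: emeasure_cball powr_realpow)
  qed (use dim w R in \<open>auto simp: sigma_finite_lborel emeasure_cball powr_realpow\<close>)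
  also have "?n / (?n - (?n - 1)) * ?w powr ((?n - 1) / ?n) * (?w * R powr ?n) powr (1 - (?n - 1) / ?n) = ?n * ?w * R"
  proof -
    have e: "1 - (?n - 1) / ?n = 1 / ?n" using dim by (simp add: field_simps)
    have "?w powr ((?n - 1) / ?n) * ?w powr (1 / ?n) = ?w"
      using w dim by (subst powr_add[symmetric]) (simp add: field_simps)
    then show ?thesis using w R dim unfolding e by (simp add: powr_mult powr_powr mult_ac)
  qed
  finally show ?thesis by (simp add: dist_commute)
qed

lemma lborel_cball_growth:
  fixes y :: "'a::euclidean_space"
  assumes "0 < t"
  shows "emeasure lborel (E \<inter> cball y t) \<le> ennreal (unit_ball_vol (real DIM('a)) * t powr real DIM('a))"
proof -
  have "emeasure lborel (E \<inter> cball y t) \<le> emeasure lborel (cball y t)" by (rule emeasure_mono) auto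
  then show ?thesis using assms by (simp add: emeasure_cball powr_realpow)
qed

text \<open>Hedberg's splitting at radius R: near x the bound f \<le> l meets the local integral n w
  R of the kernel, with w the volume of the unit ball; the far part is left to Hoelder's
  inequality.\<close>

lemma riesz_near_far:
  fixes f :: "'a::euclidean_space \<Rightarrow> real"
  assumes dim: "2 \<le> DIM('a)" and R: "0 < R" and [measurable]: "f \<in> borel_measurable borel"
    and f: "\<And>y. 0 \<le> f y" "\<And>y. f y \<le> l"
  shows "riesz lborel (\<lambda>y. ennreal (f y)) x \<le> ennreal (l * (real DIM('a) * unit_ball_vol (real DIM('a)) * R)) +
    (\<integral>\<^sup>+y. ennreal (f y * (dist x y powr (1 - real DIM('a)) * indicator (- cball x R) y)) \<partial>lborel)"
proof -
  let ?n = "real DIM('a)" and ?w = "unit_ball_vol (real DIM('a))"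
  have w: "0 < ?w" by (rule unit_ball_vol_pos) simp
  have l: "0 \<le> l" using order_trans[OF f] by blast
  have [measurable]: "cball x R \<in> sets borel" by simp
  have "riesz lborel (\<lambda>y. ennreal (f y)) x \<le> (\<integral>\<^sup>+y. ennreal l * (ennreal (dist x y powr (1 - ?n)) * indicator (cball x R) y) +
     ennreal (f y * (dist x y powr (1 - ?n) * indicator (- cball x R) y)) \<partial>lborel)" unfolding riesz_def
  proof (rule nn_integral_mono, goal_cases)
    case (1 y)
    show ?case
    proof (cases "y \<in> cball x R")
      case True
      then show ?thesis using f[of y] l by (simp add: mult_right_mono ennreal_leI)
    next
      case False
      then show ?thesis using f[of y] by (simp add: ennreal_mult)
    qed
  qed
  also have "... = ennreal l * (\<integral>\<^sup>+y. ennreal (dist x y powr (1 - ?n)) * indicator (cball x R) y \<partial>lborel) +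
    (\<integral>\<^sup>+y. ennreal (f y * (dist x y powr (1 - ?n) * indicator (- cball x R) y)) \<partial>lborel)"
    by (subst nn_integral_add) (auto simp: nn_integral_cmult)
  also have "... \<le> ennreal l * ennreal (?n * ?w * R) +
    (\<integral>\<^sup>+y. ennreal (f y * (dist x y powr (1 - ?n) * indicator (- cball x R) y)) \<partial>lborel)"
    by (intro add_mono mult_left_mono riesz_near dim R) auto
  also have "ennreal l * ennreal (?n * ?w * R) = ennreal (l * (?n * ?w * R))" using l w R by (simp add: ennreal_mult)
  finally show ?thesis .
qed

text \<open>The summands belong to the near and the far part: p/(p-1) is the conjugate exponent, and
  the second summand bounds the conjugate norm of the kernel off the unit ball.\<close>

definition power_const :: "nat \<Rightarrow> real \<Rightarrow> real" where
  "power_const n p = real n * unit_ball_vol (real n) +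
     ((real n - 1) * (p / (p - 1)) * unit_ball_vol (real n) / ((real n - 1) * (p / (p - 1)) - real n)) powr ((p - 1) / p)"

lemma power_const_pos: "2 \<le> n \<Longrightarrow> 0 < power_const n p"
  unfolding power_const_def by (intro add_pos_nonneg mult_pos_pos unit_ball_vol_pos) auto

text \<open>For p < n the conjugate power of the kernel is integrable off a ball, since (n-1)p/(p-1)
  > n.\<close>

lemma riesz_truncated_power:
  fixes f :: "'a::euclidean_space \<Rightarrow> real"
  assumes dim: "2 \<le> DIM('a)" and p: "1 < p" "p < real DIM('a)" and fm [measurable]: "f \<in> borel_measurable borel"
    and f: "\<And>y. 0 \<le> f y" "\<And>y. f y \<le> l" and l: "0 < l" and Np: "0 < Np"
    and fN: "(\<integral>\<^sup>+y. ennreal (f y powr p) \<partial>lborel) \<le> ennreal Np"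
  shows "riesz lborel (\<lambda>y. ennreal (f y)) x \<le>
    ennreal (power_const DIM('a) p * Np powr (1 / real DIM('a)) * l powr (1 - p / real DIM('a)))"
proof -
  let ?n = "real DIM('a)" and ?w = "unit_ball_vol (real DIM('a))"
  define q where "q = p / (p - 1)"
  define a where "a = (?n - 1) * q"
  \<comment> \<open>Chosen to balance the near part l R against the far part \<open>Np\<close>^(1/p)
    R^(1-n/p).\<close>
  define R where "R = Np powr (1 / ?n) * l powr (- (p / ?n))"
  have w: "0 < ?w" by (rule unit_ball_vol_pos) simp
  have q: "1 < q" "1 / p + 1 / q = 1" "1 / q = (p - 1) / p" using p by (auto simp: q_def field_simps)
  have R: "0 < R" using Np l by (simp add: R_def)
  have an: "?n < a" using p dim by (simp add: a_def q_def field_simps)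
  define Sc where "Sc = a * ?w / (a - ?n)"
  have Sc: "0 < Sc" using an w dim by (simp add: Sc_def)
  have [measurable]: "cball x R \<in> sets borel" by simp
  have "(\<integral>\<^sup>+y. ennreal (f y * (dist x y powr (1 - ?n) * indicator (- cball x R) y)) \<partial>lborel) \<le>
     ennreal (Np powr (1 / p) * (Sc * R powr (?n - a)) powr (1 / q))"
  proof (rule nn_integral_Holder)
    have "(\<integral>\<^sup>+y. ennreal ((dist x y powr (1 - ?n) * indicator (- cball x R) y) powr q) \<partial>lborel) =
      (\<integral>\<^sup>+y. ennreal (dist y x powr (- a)) * indicator (- cball x R) y \<partial>lborel)"
      using q by (intro nn_integral_cong) (auto simp: indicator_def powr_powr a_def dist_commute algebra_simps)
    also have "... \<le> ennreal (a * ?w / (a - ?n) * R powr (?n - a))"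
      by (rule kernel_integral_tail[OF _ sigma_finite_lborel _ an w _ R]) (use dim lborel_cball_growth in \<open>auto simp: dist_commute\<close>)
    finally show "(\<integral>\<^sup>+y. ennreal ((dist x y powr (1 - ?n) * indicator (- cball x R) y) powr q) \<partial>lborel) \<le> ennreal (Sc * R powr (?n - a))"
      by (simp add: Sc_def)
  qed (use p q f Np fN Sc in auto)
  also have "Np powr (1 / p) * (Sc * R powr (?n - a)) powr (1 / q) = Sc powr (1 / q) * (Np powr (1 / ?n) * l powr (1 - p / ?n))"
  proof -
    have e: "(?n - a) / q = 1 - ?n / p" using p q(1) by (simp add: a_def q_def field_simps)
    have "R powr (1 - ?n / p) = Np powr (1 / ?n * (1 - ?n / p)) * l powr (- (p / ?n) * (1 - ?n / p))"
      unfolding R_def using Np l by (simp add: powr_mult powr_powr)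
    also have "1 / ?n * (1 - ?n / p) = 1 / ?n - 1 / p" using dim p by (simp add: field_simps)
    also have "- (p / ?n) * (1 - ?n / p) = 1 - p / ?n" using dim p by (simp add: field_simps)
    finally have "Np powr (1 / p) * R powr (1 - ?n / p) = Np powr (1 / p + (1 / ?n - 1 / p)) * l powr (1 - p / ?n)"
      by (simp only: powr_add mult.assoc)
    then have "Np powr (1 / p) * R powr (1 - ?n / p) = Np powr (1 / ?n) * l powr (1 - p / ?n)" by simp
    moreover have "(Sc * R powr (?n - a)) powr (1 / q) = Sc powr (1 / q) * R powr (1 - ?n / p)"
      using Sc R e by (simp add: powr_mult powr_powr)
    ultimately show ?thesis by (metis mult.left_commute)
  qed
  finally have far: "(\<integral>\<^sup>+y. ennreal (f y * (dist x y powr (1 - ?n) * indicator (- cball x R) y)) \<partial>lborel) \<le>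
     ennreal (Sc powr (1 / q) * (Np powr (1 / ?n) * l powr (1 - p / ?n)))" .
  have lR: "l * R = Np powr (1 / ?n) * l powr (1 - p / ?n)"
  proof -
    have "l powr (1 - p / ?n) = l * l powr (- (p / ?n))" using l powr_add[of l 1 "- (p / ?n)"] by simp
    then show ?thesis by (simp add: R_def mult_ac)
  qed
  have "riesz lborel (\<lambda>y. ennreal (f y)) x \<le> ennreal (l * (?n * ?w * R)) + ennreal (Sc powr (1 / q) * (Np powr (1 / ?n) * l powr (1 - p / ?n)))"
    by (rule order_trans[OF riesz_near_far[OF dim R fm f]], rule add_left_mono[OF far])
  also have "l * (?n * ?w * R) = (?n * ?w) * (Np powr (1 / ?n) * l powr (1 - p / ?n))" by (simp add: lR[symmetric])
  also have "ennreal ((?n * ?w) * (Np powr (1 / ?n) * l powr (1 - p / ?n))) + ennreal (Sc powr (1 / q) * (Np powr (1 / ?n) * l powr (1 - p / ?n)))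
     = ennreal ((?n * ?w + Sc powr (1 / q)) * (Np powr (1 / ?n) * l powr (1 - p / ?n)))"
    using w by (subst ennreal_plus[symmetric]) (auto simp: distrib_right)
  also have "?n * ?w + Sc powr (1 / q) = power_const DIM('a) p"
    unfolding power_const_def Sc_def a_def q(3) by (simp add: q_def)
  finally show ?thesis by (simp add: mult.assoc)
qed

definition log_const :: "nat \<Rightarrow> real \<Rightarrow> real" where
  "log_const n L = real n * unit_ball_vol (real n) + (real n * unit_ball_vol (real n) + L) powr ((real n - 1) / real n)"

lemma log_const_pos: "2 \<le> n \<Longrightarrow> 0 < log_const n L"
  unfolding log_const_def by (intro add_pos_nonneg mult_pos_pos unit_ball_vol_pos) auto

text \<open>At the critical exponent the conjugate power of the kernel is |x - y|^(-n), with a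
  logarithmic integral near the pole; the volume of \<open>U\<close> bounds the part beyond radius
  1.\<close>

lemma riesz_truncated_log:
  fixes f :: "'a::euclidean_space \<Rightarrow> real"
  assumes dim: "2 \<le> DIM('a)" and fm [measurable]: "f \<in> borel_measurable borel"
    and f: "\<And>y. 0 \<le> f y" "\<And>y. f y \<le> l" and l: "1 \<le> l"
    and fN: "(\<integral>\<^sup>+y. ennreal (f y powr real DIM('a)) \<partial>lborel) \<le> 1"
    and Um [measurable]: "U \<in> sets borel" and supp: "\<And>y. y \<notin> U \<Longrightarrow> f y = 0"
    and L: "0 \<le> L" "emeasure lborel U \<le> ennreal L"
  shows "riesz lborel (\<lambda>y. ennreal (f y)) x \<le>
    ennreal (log_const DIM('a) L * (1 + ln l) powr ((real DIM('a) - 1) / real DIM('a)))"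
proof -
  let ?n = "real DIM('a)" and ?w = "unit_ball_vol (real DIM('a))"
  define q where "q = ?n / (?n - 1)"
  \<comment> \<open>With this radius the near part is bounded by a constant, and the logarithm of
    1/R in the far part is ln l.\<close>
  define R where "R = 1 / l"
  have w: "0 < ?w" by (rule unit_ball_vol_pos) simp
  have q: "1 < q" "1 / ?n + 1 / q = 1" "1 / q = (?n - 1) / ?n" using dim by (auto simp: q_def field_simps)
  have R: "0 < R" "R \<le> 1" using l by (auto simp: R_def)
  have [measurable]: "cball x R \<in> sets borel" by simp
  have ln0: "0 \<le> ln l" using l by simp
  define S where "S = ?n * ?w * ln l + L"
  have S0: "0 \<le> S" using w ln0 L by (simp add: S_def)
  have "(\<integral>\<^sup>+y. ennreal (f y * (dist x y powr (1 - ?n) * indicator (- cball x R) y)) \<partial>lborel) =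
    (\<integral>\<^sup>+y. ennreal (f y * (dist x y powr (1 - ?n) * indicator (U - cball x R) y)) \<partial>lborel)"
    using supp by (intro nn_integral_cong) (auto simp: indicator_def)
  also have "... \<le> ennreal (1 powr (1 / ?n) * S powr (1 / q))"
  proof (rule nn_integral_Holder)
    have "(\<integral>\<^sup>+y. ennreal ((dist x y powr (1 - ?n) * indicator (U - cball x R) y) powr q) \<partial>lborel) =
      (\<integral>\<^sup>+y. ennreal (dist y x powr (- ?n)) * indicator (U - cball x R) y \<partial>lborel)"
    proof (rule nn_integral_cong, goal_cases)
      case (1 y)
      have "(1 - ?n) * q = - ?n" using dim by (simp add: q_def field_simps)
      then show ?case using q by (auto simp: indicator_def powr_powr dist_commute)
    qed
    also have "... \<le> ennreal (?n * ?w * ln (1 / R) + L)"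
    proof (rule kernel_integral_log[OF _ sigma_finite_lborel _ w _ R])
      show "emeasure lborel (U - cball x R) \<le> ennreal L" by (rule order_trans[OF emeasure_mono L(2)]) auto
    qed (use dim lborel_cball_growth L in \<open>auto simp: dist_commute\<close>)
    finally show "(\<integral>\<^sup>+y. ennreal ((dist x y powr (1 - ?n) * indicator (U - cball x R) y) powr q) \<partial>lborel) \<le> ennreal S"
      by (simp add: S_def R_def)
  qed (use dim q f fN S0 in auto)
  also have "1 powr (1 / ?n) * S powr (1 / q) \<le> (?n * ?w + L) powr ((?n - 1) / ?n) * (1 + ln l) powr ((?n - 1) / ?n)"
  proof -
    have "S \<le> (?n * ?w + L) * (1 + ln l)" using w ln0 L dim by (simp add: S_def algebra_simps)
    then have "S powr ((?n - 1) / ?n) \<le> ((?n * ?w + L) * (1 + ln l)) powr ((?n - 1) / ?n)"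
      using S0 dim by (intro powr_mono2) auto
    then show ?thesis using w L ln0 by (simp add: q(3) powr_mult)
  qed
  finally have far: "(\<integral>\<^sup>+y. ennreal (f y * (dist x y powr (1 - ?n) * indicator (- cball x R) y)) \<partial>lborel) \<le>
     ennreal ((?n * ?w + L) powr ((?n - 1) / ?n) * (1 + ln l) powr ((?n - 1) / ?n))" by (simp add: ennreal_leI)
  have "riesz lborel (\<lambda>y. ennreal (f y)) x \<le> ennreal (l * (?n * ?w * R)) + ennreal ((?n * ?w + L) powr ((?n - 1) / ?n) * (1 + ln l) powr ((?n - 1) / ?n))"
    by (rule order_trans[OF riesz_near_far[OF dim R(1) fm f]], rule add_left_mono[OF far])
  also have "l * (?n * ?w * R) \<le> ?n * ?w * (1 + ln l) powr ((?n - 1) / ?n)"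
  proof -
    have "1 \<le> (1 + ln l) powr ((?n - 1) / ?n)" using ln0 dim by (intro ge_one_powr_ge_zero) auto
    then have "?n * ?w * 1 \<le> ?n * ?w * (1 + ln l) powr ((?n - 1) / ?n)" using w by (intro mult_left_mono) auto
    then show ?thesis using l by (simp add: R_def)
  qed
  then have "ennreal (l * (?n * ?w * R)) + ennreal ((?n * ?w + L) powr ((?n - 1) / ?n) * (1 + ln l) powr ((?n - 1) / ?n)) \<le>
    ennreal (?n * ?w * (1 + ln l) powr ((?n - 1) / ?n)) + ennreal ((?n * ?w + L) powr ((?n - 1) / ?n) * (1 + ln l) powr ((?n - 1) / ?n))"
    by (intro add_right_mono ennreal_leI)
  also have "... = ennreal (log_const DIM('a) L * (1 + ln l) powr ((?n - 1) / ?n))"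
    using w by (subst ennreal_plus[symmetric]) (auto simp: log_const_def distrib_right)
  finally show ?thesis .
qed

definition sup_const :: "nat \<Rightarrow> real \<Rightarrow> real" where
  "sup_const n p = (real n / (real n - (real n - 1) * (p / (p - 1))) *
     unit_ball_vol (real n) powr ((real n - 1) * (p / (p - 1)) / real n)) powr ((p - 1) / p)"

text \<open>For p > n one has (n-1)p/(p-1) < n, so the kernel itself has a finite conjugate norm
  over \<open>U\<close>, bounded uniformly in x by \<open>kernel_integral_bound\<close>.\<close>

lemma riesz_sup_bound:
  fixes f :: "'a::euclidean_space \<Rightarrow> real"
  assumes dim: "2 \<le> DIM('a)" and p: "real DIM('a) < p" and fm [measurable]: "f \<in> borel_measurable borel"
    and f: "\<And>y. 0 \<le> f y" and Np: "0 \<le> Np" and fN: "(\<integral>\<^sup>+y. ennreal (f y powr p) \<partial>lborel) \<le> ennreal Np"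
    and Um [measurable]: "U \<in> sets borel" and supp: "\<And>y. y \<notin> U \<Longrightarrow> f y = 0"
    and L: "0 \<le> L" "emeasure lborel U \<le> ennreal L"
  shows "riesz lborel (\<lambda>y. ennreal (f y)) x \<le> ennreal (sup_const DIM('a) p * (L powr (1 / real DIM('a) - 1 / p) * Np powr (1 / p)))"
proof -
  let ?n = "real DIM('a)" and ?w = "unit_ball_vol (real DIM('a))"
  define q where "q = p / (p - 1)"
  define a where "a = (?n - 1) * q"
  have p1: "1 < p" using p dim by simp
  have w: "0 < ?w" by (rule unit_ball_vol_pos) simp
  have q: "1 < q" "1 / p + 1 / q = 1" "1 / q = (p - 1) / p" using p1 by (auto simp: q_def field_simps)
  have an: "a < ?n" using p p1 dim by (simp add: a_def q_def field_simps)
  have a0: "0 < a" using dim q by (simp add: a_def)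
  define c where "c = ?n / (?n - a) * ?w powr (a / ?n)"
  have c: "0 < c" unfolding c_def
  proof (intro mult_pos_pos divide_pos_pos)
    show "0 < ?w powr (a / ?n)" unfolding powr_gt_zero using w by linarith
  qed (use an dim in auto)
  have "riesz lborel (\<lambda>y. ennreal (f y)) x = (\<integral>\<^sup>+y. ennreal (f y * (dist x y powr (1 - ?n) * indicator U y)) \<partial>lborel)"
    unfolding riesz_def using supp f by (intro nn_integral_cong) (auto simp: indicator_def ennreal_mult)
  also have "... \<le> ennreal (Np powr (1 / p) * (c * L powr (1 - a / ?n)) powr (1 / q))"
  proof (rule nn_integral_Holder)
    have "(\<integral>\<^sup>+y. ennreal ((dist x y powr (1 - ?n) * indicator U y) powr q) \<partial>lborel) =
      (\<integral>\<^sup>+y. ennreal (dist y x powr (- a)) * indicator U y \<partial>lborel)"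
      using q by (intro nn_integral_cong) (auto simp: indicator_def powr_powr a_def dist_commute algebra_simps)
    also have "... \<le> ennreal (c * L powr (1 - a / ?n))" unfolding c_def
      by (rule kernel_integral_bound[OF _ sigma_finite_lborel a0 an w _ L]) (use lborel_cball_growth in auto)
    finally show "(\<integral>\<^sup>+y. ennreal ((dist x y powr (1 - ?n) * indicator U y) powr q) \<partial>lborel) \<le> ennreal (c * L powr (1 - a / ?n))" .
  qed (use p1 q f fN Np c in auto)
  also have "Np powr (1 / p) * (c * L powr (1 - a / ?n)) powr (1 / q) = sup_const DIM('a) p * (L powr (1 / ?n - 1 / p) * Np powr (1 / p))"
  proof -
    have "(1 - a / ?n) * (1 / q) = 1 / ?n - 1 / p" using dim p1 q(1) by (simp add: a_def q_def field_simps)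
    then have "(c * L powr (1 - a / ?n)) powr (1 / q) = c powr (1 / q) * L powr (1 / ?n - 1 / p)"
      using c by (simp add: powr_mult powr_powr)
    moreover have "c powr (1 / q) = sup_const DIM('a) p" unfolding c_def a_def sup_const_def q(3) by (simp add: q_def)
    ultimately show ?thesis by (simp add: mult_ac)
  qed
  finally show ?thesis .
qed

lemma riesz_split_level:
  fixes f :: "'a::euclidean_space \<Rightarrow> real"
  assumes [measurable]: "f \<in> borel_measurable borel" and f: "\<And>y. 0 \<le> f y"
  shows "riesz lborel (\<lambda>y. ennreal (f y)) x = riesz lborel (\<lambda>y. ennreal (if f y \<le> l then f y else 0)) x + riesz lborel (excess l f) x"
proof -
  have "ennreal (f y) = ennreal (if f y \<le> l then f y else 0) + excess l f y" for y
    using f[of y] by (auto simp: excess_def)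
  then show ?thesis
    unfolding riesz_def by (subst nn_integral_add[symmetric]) (auto simp: distrib_right intro!: nn_integral_cong)
qed

section \<open>Exponential moments, tails and the Luxemburg modular\<close>

section \<open>Exponential Orlicz norms\<close>

lemma exp_shift_nonneg: "0 \<le> exp_shift \<gamma>" by (simp add: exp_shift_def)

lemma young_exp_mono: "0 < \<gamma> \<Longrightarrow> 0 \<le> s \<Longrightarrow> s \<le> t \<Longrightarrow> young_exp \<gamma> s \<le> young_exp \<gamma> t"
  unfolding young_exp_def using exp_shift_nonneg[of \<gamma>] by (auto intro!: powr_mono2)

lemma young_exp_measurable [measurable]: "young_exp \<gamma> \<in> borel_measurable borel"
  unfolding young_exp_def[abs_def] by measurable

text \<open>A dilation makes the modular small. Up to a threshold \<tau> continuity at 0 keeps the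
  values below \<epsilon>; beyond it, half of the rate \<eta> dominates the dilated Young function
  and the other half pays for the factor \<epsilon>.\<close>

lemma young_exp_scaling:
  assumes \<gamma>: "0 < \<gamma>" and \<epsilon>: "0 < \<epsilon>" and \<eta>: "0 < \<eta>"
  shows "\<exists>m>0. \<forall>t\<ge>0. young_exp \<gamma> (t / m) \<le> \<epsilon> * exp (\<eta> * t powr \<gamma>)"
proof -
  define \<delta> where "\<delta> = (\<eta> / 2) powr (1 / \<gamma>)"
  \<comment> \<open>For t beyond \<tau>, the second entry ensures that the shift is at most \<delta>
    t/2, and the third that \<eta> t^\<gamma>/2 \<ge> - ln \<epsilon>.\<close>
  define \<tau> where "\<tau> = max 1 (max (2 * exp_shift \<gamma> / \<delta>) ((max 0 (- 2 * ln \<epsilon> / \<eta>)) powr (1 / \<gamma>)))"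
  have \<delta>: "0 < \<delta>" using \<eta> by (simp add: \<delta>_def)
  have d\<gamma>: "\<delta> powr \<gamma> = \<eta> / 2" using \<eta> \<gamma> by (simp add: \<delta>_def powr_powr)
  have \<tau>: "1 \<le> \<tau>" "2 * exp_shift \<gamma> / \<delta> \<le> \<tau>" "(max 0 (- 2 * ln \<epsilon> / \<eta>)) powr (1 / \<gamma>) \<le> \<tau>" by (auto simp: \<tau>_def)
  have "((\<lambda>s. young_exp \<gamma> s) \<longlongrightarrow> young_exp \<gamma> 0) (at_right 0)"
  proof -
    have "((\<lambda>s. (s + exp_shift \<gamma>) powr \<gamma>) \<longlongrightarrow> (0 + exp_shift \<gamma>) powr \<gamma>) (at_right 0)"
    proof (rule tendsto_powr')
      have "eventually (\<lambda>s::real. 0 < s) (at_right 0)" by (rule eventually_at_right_less)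
      then have "eventually (\<lambda>s. 0 \<le> s + exp_shift \<gamma>) (at_right 0)"
        by eventually_elim (use exp_shift_nonneg[of \<gamma>] in linarith)
      then show "0 + exp_shift \<gamma> \<noteq> 0 \<or> 0 < \<gamma> \<and> (\<forall>\<^sub>F s in at_right 0. 0 \<le> s + exp_shift \<gamma>)" using \<gamma> by simp
    qed (rule tendsto_add tendsto_ident_at tendsto_const)+
    from tendsto_diff[OF tendsto_exp[OF this] tendsto_const[of "exp (exp_shift \<gamma> powr \<gamma>)"]]
    show ?thesis by (simp add: young_exp_def)
  qed
  then have "eventually (\<lambda>s. young_exp \<gamma> s < \<epsilon>) (at_right 0)"
    using \<epsilon> by (intro order_tendstoD) (auto simp: young_exp_def)
  then obtain b where b: "0 < b" "\<And>s. 0 < s \<Longrightarrow> s < b \<Longrightarrow> young_exp \<gamma> s < \<epsilon>" unfolding eventually_at_right_field by auto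
  define m where "m = max (2 / \<delta>) (2 * \<tau> / b)"
  have m: "0 < m" "2 / \<delta> \<le> m" "2 * \<tau> / b \<le> m" using \<delta> by (auto simp: m_def less_max_iff_disj)
  show ?thesis
  proof (intro exI[of _ m] conjI m(1) allI impI)
    fix t :: real assume t: "0 \<le> t"
    show "young_exp \<gamma> (t / m) \<le> \<epsilon> * exp (\<eta> * t powr \<gamma>)"
    proof (cases "t \<le> \<tau>")
      case True
      have "young_exp \<gamma> (t / m) \<le> young_exp \<gamma> (\<tau> / m)" using True t m \<gamma> by (intro young_exp_mono) (auto simp: divide_right_mono)
      also have "... \<le> \<epsilon>"
      proof (rule less_imp_le, rule b(2))
        show "0 < \<tau> / m" using \<tau> m by simp
        have "2 * \<tau> \<le> m * b" using m b by (simp add: field_simps)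
        then show "\<tau> / m < b" using \<tau> m by (simp add: field_simps)
      qed
      also have "... \<le> \<epsilon> * exp (\<eta> * t powr \<gamma>)" using \<epsilon> \<eta> by simp
      finally show ?thesis .
    next
      case False
      then have t1: "1 < t" "2 * exp_shift \<gamma> / \<delta> \<le> t" "(max 0 (- 2 * ln \<epsilon> / \<eta>)) powr (1 / \<gamma>) \<le> t" using \<tau> by auto
      have "t / m \<le> t / (2 / \<delta>)" using m \<delta> t by (intro divide_left_mono) auto
      moreover have "exp_shift \<gamma> \<le> \<delta> * t / 2" using t1(2) \<delta> by (simp add: field_simps)
      moreover have "t / (2 / \<delta>) = \<delta> * t / 2" by simp
      ultimately have "t / m + exp_shift \<gamma> \<le> \<delta> * t" by linarith
      then have "(t / m + exp_shift \<gamma>) powr \<gamma> \<le> (\<delta> * t) powr \<gamma>"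
        using t m exp_shift_nonneg[of \<gamma>] \<gamma> by (intro powr_mono2) auto
      also have "... = \<eta> / 2 * t powr \<gamma>" using \<delta> t by (simp add: powr_mult d\<gamma>)
      finally have "young_exp \<gamma> (t / m) \<le> exp (\<eta> / 2 * t powr \<gamma>)"
        unfolding young_exp_def by (smt (verit) exp_gt_zero exp_le_cancel_iff)
      also have "... \<le> \<epsilon> * exp (\<eta> * t powr \<gamma>)"
      proof -
        have "((max 0 (- 2 * ln \<epsilon> / \<eta>)) powr (1 / \<gamma>)) powr \<gamma> \<le> t powr \<gamma>" using t1(3) \<gamma> by (intro powr_mono2) auto
        then have "- 2 * ln \<epsilon> / \<eta> \<le> t powr \<gamma>" using \<gamma> by (simp add: powr_powr)
        then have "\<eta> / 2 * t powr \<gamma> \<le> ln \<epsilon> + \<eta> * t powr \<gamma>" using \<eta> by (simp add: field_simps)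
        then have "exp (\<eta> / 2 * t powr \<gamma>) \<le> exp (ln \<epsilon> + \<eta> * t powr \<gamma>)" by simp
        then show ?thesis using \<epsilon> by (simp add: exp_add)
      qed
      finally show ?thesis .
    qed
  qed
qed

text \<open>Half of the exponent t^\<beta> outweighs both the linear factor and the subtracted
  constant c of the Young function, since t + c \<le> exp(t^\<beta>/2) for large t.\<close>

lemma young_exp_superlinear:
  assumes \<beta>: "0 < \<beta>"
  shows "\<exists>s0\<ge>1. \<forall>t\<ge>s0. t * exp (t powr \<beta> / 2) \<le> young_exp \<beta> t"
proof -
  define c where "c = exp (exp_shift \<beta> powr \<beta>)"
  define s0 where "s0 = max 1 (max c ((2 powr (\<beta> / 2) * 4 / \<beta>) powr (2 / \<beta>)))"
  have c1: "1 \<le> c" by (simp add: c_def)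
  show ?thesis
  proof (intro exI[of _ s0] conjI allI impI)
    show "1 \<le> s0" by (simp add: s0_def)
    fix t assume "s0 \<le> t"
    then have t: "1 \<le> t" "c \<le> t" "(2 powr (\<beta> / 2) * 4 / \<beta>) powr (2 / \<beta>) \<le> t" by (auto simp: s0_def)
    have "ln (t + c) \<le> (t + c) powr (\<beta> / 2) / (\<beta> / 2)" using t c1 \<beta> by (intro ln_powr_bound) auto
    also have "... \<le> (2 * t) powr (\<beta> / 2) / (\<beta> / 2)" using t c1 \<beta> by (intro divide_right_mono powr_mono2) auto
    also have "... = (2 powr (\<beta> / 2) * 4 / \<beta>) * t powr (\<beta> / 2) / 2" using t by (simp add: powr_mult)
    also have "... \<le> t powr (\<beta> / 2) * t powr (\<beta> / 2) / 2"
    proof -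
      have "((2 powr (\<beta> / 2) * 4 / \<beta>) powr (2 / \<beta>)) powr (\<beta> / 2) \<le> t powr (\<beta> / 2)" using t \<beta> by (intro powr_mono2) auto
      then have "2 powr (\<beta> / 2) * 4 / \<beta> \<le> t powr (\<beta> / 2)" using \<beta> by (simp add: powr_powr)
      then show ?thesis by (intro divide_right_mono mult_right_mono) auto
    qed
    also have "t powr (\<beta> / 2) * t powr (\<beta> / 2) / 2 = t powr \<beta> / 2" by (simp add: powr_add[symmetric])
    finally have "exp (ln (t + c)) \<le> exp (t powr \<beta> / 2)" by simp
    then have tc: "t + c \<le> exp (t powr \<beta> / 2)" using t c1 by simp
    have "t * exp (t powr \<beta> / 2) + c \<le> (t + c) * exp (t powr \<beta> / 2)" using c1 by (simp add: distrib_right)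
    also have "... \<le> exp (t powr \<beta> / 2) * exp (t powr \<beta> / 2)" using tc by (intro mult_right_mono) auto
    also have "... = exp (t powr \<beta>)" by (simp add: exp_add[symmetric])
    also have "... \<le> exp ((t + exp_shift \<beta>) powr \<beta>)" using t \<beta> exp_shift_nonneg[of \<beta>] by (auto intro!: powr_mono2)
    finally show "t * exp (t powr \<beta> / 2) \<le> young_exp \<beta> t" by (simp add: young_exp_def c_def)
  qed
qed

text \<open>The exponential moment at half the rate, decomposed by the integer part j of
  \<psi>^\<gamma>, is dominated by a geometric series of ratio exp(-\<eta>/2); a dilation then
  brings the modular below 1. The constant is chosen before the measure and the function, as
  uniformity requires.\<close>

lemma exponential_tail_imp_young_exp:
  assumes pos: "0 < D" "0 < \<eta>" "0 < \<gamma>" "0 \<le> m" "0 \<le> s0"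
  shows "\<exists>C>0. \<forall>(M :: 'a measure) \<psi>. finite_measure M \<and> measure M (space M) \<le> m \<and> \<psi> \<in> borel_measurable M \<and> (\<forall>x. 0 \<le> \<psi> x) \<and>
    (\<forall>s\<ge>s0. emeasure M {x \<in> space M. s \<le> \<psi> x} \<le> ennreal (D * exp (- (\<eta> * s powr \<gamma>)))) \<longrightarrow>
    (\<integral>\<^sup>+x. ennreal (young_exp \<gamma> (\<psi> x / C)) \<partial>M) \<le> 1"
proof -
  \<comment> \<open>Enlarging the prefactor by the total mass extends the tail bound to the levels
    below \<open>s0\<close>.\<close>
  define D' where "D' = max D (m * exp (\<eta> * s0 powr \<gamma>))"
  define B where "B = exp (\<eta> / 2) * (D' / (1 - exp (- (\<eta> / 2))))"
  have D': "0 < D'" using pos by (simp add: D'_def less_max_iff_disj)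
  have r: "0 < exp (- (\<eta> / 2))" "exp (- (\<eta> / 2)) < 1" using pos by auto
  have B: "0 < B" using D' r by (simp add: B_def)
  obtain C where C: "0 < C" "\<And>t. 0 \<le> t \<Longrightarrow> young_exp \<gamma> (t / C) \<le> (1 / B) * exp (\<eta> / 2 * t powr \<gamma>)"
    using young_exp_scaling[of \<gamma> "1 / B" "\<eta> / 2"] pos B by auto
  show ?thesis
  proof (intro exI[of _ C] conjI C(1) allI impI)
    fix M :: "'a measure" and \<psi> :: "'a \<Rightarrow> real"
    assume H: "finite_measure M \<and> measure M (space M) \<le> m \<and> \<psi> \<in> borel_measurable M \<and> (\<forall>x. 0 \<le> \<psi> x) \<and>
      (\<forall>s\<ge>s0. emeasure M {x \<in> space M. s \<le> \<psi> x} \<le> ennreal (D * exp (- (\<eta> * s powr \<gamma>))))"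
    then interpret finite_measure M by blast
  let ?E = "\<lambda>j. {x \<in> space M. real j powr (1 / \<gamma>) \<le> \<psi> x}"
    have [measurable]: "\<psi> \<in> borel_measurable M" and \<psi>0: "\<And>x. 0 \<le> \<psi> x" using H by auto
    have tail: "emeasure M {x \<in> space M. s \<le> \<psi> x} \<le> ennreal (D' * exp (- (\<eta> * s powr \<gamma>)))" if s: "0 \<le> s" for s
    proof (cases "s0 \<le> s")
      case True
      have "emeasure M {x \<in> space M. s \<le> \<psi> x} \<le> ennreal (D * exp (- (\<eta> * s powr \<gamma>)))" using H True by blast
      also have "... \<le> ennreal (D' * exp (- (\<eta> * s powr \<gamma>)))" by (intro ennreal_leI mult_right_mono) (auto simp: D'_def)
      finally show ?thesis .
    next
      case False
      then have "\<eta> * s powr \<gamma> \<le> \<eta> * s0 powr \<gamma>" using pos s by (intro mult_left_mono powr_mono2) auto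
      then have "m * 1 \<le> m * (exp (\<eta> * s0 powr \<gamma>) * exp (- (\<eta> * s powr \<gamma>)))"
        using pos by (intro mult_left_mono) (auto simp: exp_add[symmetric])
      also have "... \<le> D' * exp (- (\<eta> * s powr \<gamma>))" unfolding mult.assoc[symmetric] by (intro mult_right_mono) (auto simp: D'_def)
      finally have "m \<le> D' * exp (- (\<eta> * s powr \<gamma>))" by simp
      moreover have "emeasure M {x \<in> space M. s \<le> \<psi> x} \<le> ennreal m"
        using H emeasure_space[of M "{x \<in> space M. s \<le> \<psi> x}"] by (auto simp: emeasure_eq_measure ennreal_leI intro: order_trans)
      ultimately show ?thesis by (meson ennreal_leI order_trans)
    qed
    have "(\<integral>\<^sup>+x. ennreal (exp (\<eta> / 2 * \<psi> x powr \<gamma>)) \<partial>M) \<le>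
      (\<integral>\<^sup>+x. (\<Sum>j. ennreal (exp (\<eta> / 2) * exp (\<eta> / 2 * real j)) * indicator (?E j) x) \<partial>M)"
    proof (rule nn_integral_mono, goal_cases)
      case x: (1 x)
      define j where "j = nat \<lfloor>\<psi> x powr \<gamma>\<rfloor>"
      have j: "real j \<le> \<psi> x powr \<gamma>" "\<psi> x powr \<gamma> \<le> real j + 1" unfolding j_def by (auto simp: of_nat_nat)
      have "real j powr (1 / \<gamma>) \<le> (\<psi> x powr \<gamma>) powr (1 / \<gamma>)" using j pos by (intro powr_mono2) auto
      also have "... = \<psi> x" using pos \<psi>0[of x] by (simp add: powr_powr)
      finally have jx: "real j powr (1 / \<gamma>) \<le> \<psi> x" .
      have "\<eta> / 2 * \<psi> x powr \<gamma> \<le> \<eta> / 2 * (real j + 1)" using j pos by (intro mult_left_mono) auto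
      then have "exp (\<eta> / 2 * \<psi> x powr \<gamma>) \<le> exp (\<eta> / 2) * exp (\<eta> / 2 * real j)" by (simp add: exp_add[symmetric] algebra_simps)
      then have "ennreal (exp (\<eta> / 2 * \<psi> x powr \<gamma>)) \<le> ennreal (exp (\<eta> / 2) * exp (\<eta> / 2 * real j)) * indicator (?E j) x"
        using jx x by (simp add: ennreal_leI)
      also have "... \<le> (\<Sum>j. ennreal (exp (\<eta> / 2) * exp (\<eta> / 2 * real j)) * indicator (?E j) x)"
        using sum_le_suminf[of "\<lambda>j. ennreal (exp (\<eta> / 2) * exp (\<eta> / 2 * real j)) * indicator (?E j) x" "{j}"]
        by (simp only: sum.insert finite.intros empty_iff not_False_eq_True sum.empty add_0_right finite_insert) simp
      finally show ?case .
    qed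
    also have "... = (\<Sum>j. ennreal (exp (\<eta> / 2) * exp (\<eta> / 2 * real j)) * emeasure M (?E j))"
      by (subst nn_integral_suminf) (auto simp: nn_integral_cmult_indicator)
    also have "... \<le> (\<Sum>j. ennreal (exp (\<eta> / 2) * D' * exp (- (\<eta> / 2)) ^ j))"
    proof (intro suminf_le)
      fix j
      have "emeasure M (?E j) \<le> ennreal (D' * exp (- (\<eta> * (real j powr (1 / \<gamma>)) powr \<gamma>)))" by (rule tail) simp
      also have "(real j powr (1 / \<gamma>)) powr \<gamma> = real j" using pos by (simp add: powr_powr)
      finally have "ennreal (exp (\<eta> / 2) * exp (\<eta> / 2 * real j)) * emeasure M (?E j) \<le>
        ennreal (exp (\<eta> / 2) * exp (\<eta> / 2 * real j)) * ennreal (D' * exp (- (\<eta> * real j)))" by (rule mult_left_mono) simp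
      also have "... = ennreal (exp (\<eta> / 2) * D' * (exp (\<eta> / 2 * real j) * exp (- (\<eta> * real j))))"
        using D' by (subst ennreal_mult[symmetric]) (auto simp: mult_ac)
      also have "exp (\<eta> / 2 * real j) * exp (- (\<eta> * real j)) = exp (- (\<eta> / 2)) ^ j"
        by (simp add: exp_add[symmetric] exp_of_nat_mult[symmetric])
      finally show "ennreal (exp (\<eta> / 2) * exp (\<eta> / 2 * real j)) * emeasure M (?E j) \<le> ennreal (exp (\<eta> / 2) * D' * exp (- (\<eta> / 2)) ^ j)" .
    qed auto
    also have "... = ennreal (\<Sum>j. exp (\<eta> / 2) * D' * exp (- (\<eta> / 2)) ^ j)"
      using r D' by (intro suminf_ennreal2 summable_mult summable_geometric) auto
    also have "(\<Sum>j. exp (\<eta> / 2) * D' * exp (- (\<eta> / 2)) ^ j) = B"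
      using r by (subst suminf_mult) (auto intro!: summable_geometric simp: suminf_geometric B_def)
    finally have expB: "(\<integral>\<^sup>+x. ennreal (exp (\<eta> / 2 * \<psi> x powr \<gamma>)) \<partial>M) \<le> ennreal B" .
    have "(\<integral>\<^sup>+x. ennreal (young_exp \<gamma> (\<psi> x / C)) \<partial>M) \<le> (\<integral>\<^sup>+x. ennreal (1 / B) * ennreal (exp (\<eta> / 2 * \<psi> x powr \<gamma>)) \<partial>M)"
    proof (rule nn_integral_mono, goal_cases)
      case (1 x)
      show ?case using C(2)[OF \<psi>0[of x]] B by (simp add: ennreal_mult[symmetric] ennreal_leI)
    qed
    also have "... = ennreal (1 / B) * (\<integral>\<^sup>+x. ennreal (exp (\<eta> / 2 * \<psi> x powr \<gamma>)) \<partial>M)" by (rule nn_integral_cmult) simp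
    also have "... \<le> ennreal (1 / B) * ennreal B" by (rule mult_left_mono[OF expB]) simp
    also have "... = 1" using B by (simp add: ennreal_mult[symmetric])
    finally show "(\<integral>\<^sup>+x. ennreal (young_exp \<gamma> (\<psi> x / C)) \<partial>M) \<le> 1" .
  qed
qed

text \<open>An exponential Chebyshev bound: above the level s, superlinearity of the Young function
  bounds |g| by exp(-s^\<beta>/2) times its value.\<close>

lemma excess_integral_young_exp:
  fixes g :: "'a \<Rightarrow> real"
  assumes [measurable]: "g \<in> borel_measurable N" and s0: "\<And>t. s0 \<le> t \<Longrightarrow> t * exp (t powr \<beta> / 2) \<le> young_exp \<beta> t"
    and s: "1 \<le> s0" "s0 \<le> s" and \<beta>: "0 < \<beta>" and g: "(\<integral>\<^sup>+y. ennreal (young_exp \<beta> \<bar>g y\<bar>) \<partial>N) \<le> 1"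
  shows "(\<integral>\<^sup>+y. excess s g y \<partial>N) \<le> ennreal (exp (- (s powr \<beta> / 2)))"
proof -
  have "(\<integral>\<^sup>+y. excess s g y \<partial>N) \<le> (\<integral>\<^sup>+y. ennreal (exp (- (s powr \<beta> / 2))) * ennreal (young_exp \<beta> \<bar>g y\<bar>) \<partial>N)"
  proof (rule nn_integral_mono, goal_cases)
    case (1 y)
    show ?case
    proof (cases "s < \<bar>g y\<bar>")
      case True
      have "exp (s powr \<beta> / 2) \<le> exp (\<bar>g y\<bar> powr \<beta> / 2)" using True s \<beta> by (auto intro!: powr_mono2)
      then have "\<bar>g y\<bar> * exp (s powr \<beta> / 2) \<le> \<bar>g y\<bar> * exp (\<bar>g y\<bar> powr \<beta> / 2)" by (rule mult_left_mono) simp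
      also have "... \<le> young_exp \<beta> \<bar>g y\<bar>" using True s by (intro s0) auto
      finally have "\<bar>g y\<bar> \<le> exp (- (s powr \<beta> / 2)) * young_exp \<beta> \<bar>g y\<bar>" by (simp add: exp_minus field_simps)
      then show ?thesis using True by (simp add: excess_def ennreal_mult'[symmetric] ennreal_leI)
    qed (simp add: excess_def)
  qed
  also have "... = ennreal (exp (- (s powr \<beta> / 2))) * (\<integral>\<^sup>+y. ennreal (young_exp \<beta> \<bar>g y\<bar>) \<partial>N)"
    by (rule nn_integral_cmult) measurable
  also have "... \<le> ennreal (exp (- (s powr \<beta> / 2))) * 1" by (rule mult_left_mono[OF g]) simp
  finally show ?thesis by simp
qed

section \<open>Power and exponential estimates for functions bounded by potentials\<close>

section \<open>Norm estimates from the pointwise bound\<close>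

text \<open>Centres range over the whole space, not only over the domain, because kernels centred at
  boundary points are integrated against \<open>M\<close>.\<close>

definition growth_measure :: "'a::euclidean_space measure \<Rightarrow> real \<Rightarrow> real \<Rightarrow> bool" where
  "growth_measure M \<alpha> K \<longleftrightarrow> finite_measure M \<and> sets M = sets borel \<and>
     (\<forall>y. \<forall>t>0. emeasure M (cball y t) \<le> ennreal (K * t powr \<alpha>))"

text \<open>Below, \<open>\<phi>\<close> is the length of the gradient, \<open>F\<close> that of the Hessian extended by zero,
  \<open>g\<close> an upper gradient of the boundary values and \<open>N\<close> the boundary measure.\<close>

definition riesz_bounded :: "'a::euclidean_space measure \<Rightarrow> 'a measure \<Rightarrow> ('a \<Rightarrow> real) \<Rightarrow> ('a \<Rightarrow> real) \<Rightarrow> real \<Rightarrow> ('a \<Rightarrow> real) \<Rightarrow> bool" where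
  "riesz_bounded M N F g c \<phi> \<longleftrightarrow> sets N = sets borel \<and> finite_measure N \<and> F \<in> borel_measurable borel \<and> (\<forall>y. 0 \<le> F y) \<and>
     g \<in> borel_measurable borel \<and> \<phi> \<in> borel_measurable borel \<and> (\<forall>x. 0 \<le> \<phi> x) \<and>
     (AE x in M. riesz lborel (\<lambda>y. ennreal (F y)) x < \<infinity> \<longrightarrow> (\<forall>s\<ge>0. ennreal (\<phi> x) \<le>
       ennreal c * (riesz lborel (\<lambda>y. ennreal (F y)) x + ennreal s + riesz N (excess s g) x)))"

text \<open>Duality with \<open>E\<close> the whole space: an integrable density has an integrable
  potential.\<close>

lemma riesz_AE_finite:
  fixes M N :: "'a::euclidean_space measure"
  assumes dim: "2 \<le> DIM('a)" and M: "growth_measure M \<alpha> K" and K: "0 < K" and \<alpha>: "real DIM('a) - 1 < \<alpha>"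
    and sN: "sets N = sets borel" and fN: "sigma_finite_measure N"
    and [measurable]: "f \<in> borel_measurable borel" and f: "(\<integral>\<^sup>+y. f y \<partial>N) < \<infinity>"
  shows "AE x in M. riesz N f x < \<infinity>"
proof -
  have sM [measurable_cong]: "sets M = sets borel" using M by (simp add: growth_measure_def)
  have [measurable]: "riesz N f \<in> borel_measurable borel" by (rule riesz_measurable[OF sN fN]) simp
  have "(\<integral>\<^sup>+x. riesz N f x * indicator UNIV x \<partial>M) \<le>
    ennreal (dual_const DIM('a) \<alpha> K * measure M UNIV powr (1 - 1 / (\<alpha> / (real DIM('a) - 1)))) * (\<integral>\<^sup>+y. f y \<partial>N)"
    using M by (intro riesz_dual[OF dim _ _ sN fN K \<alpha>]) (auto simp: growth_measure_def)
  also have "... < \<infinity>" using f by (simp add: ennreal_mult_less_top)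
  finally have "(\<integral>\<^sup>+x. riesz N f x \<partial>M) \<noteq> \<infinity>" by simp
  then have "AE x in M. riesz N f x \<noteq> \<infinity>" by (intro nn_integral_PInf_AE) auto
  then show ?thesis by eventually_elim (simp add: less_top)
qed

lemma riesz_AE_zero: "AE y in N. f y = 0 \<Longrightarrow> riesz N f x = 0"
  unfolding riesz_def by (subst nn_integral_cong_AE[where v = "\<lambda>_. 0"]) auto

text \<open>Hoelder's inequality against the constant 1 on a finite measure; it produces the powers
  of the total mass in (i).\<close>

lemma nn_integral_powr_exponent_mono:
  fixes \<psi> :: "'a \<Rightarrow> real"
  assumes fM: "finite_measure M" and [measurable]: "\<psi> \<in> borel_measurable M" and \<psi>: "\<And>x. 0 \<le> \<psi> x"
    and q: "0 < q" "q \<le> Q" and z: "0 \<le> z" and Z: "(\<integral>\<^sup>+x. ennreal (\<psi> x powr Q) \<partial>M) \<le> ennreal (z powr Q)"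
  shows "(\<integral>\<^sup>+x. ennreal (\<psi> x powr q) \<partial>M) \<le> ennreal ((measure M (space M) powr (1 / q - 1 / Q) * z) powr q)"
proof -
  interpret finite_measure M by fact
  let ?m = "measure M (space M)"
  consider "?m = 0" | "q = Q" "?m \<noteq> 0" | "q < Q" using q by linarith
  then show ?thesis
  proof cases
    case 1
    then have "space M \<in> null_sets M" by (simp add: null_sets_def emeasure_eq_measure)
    then have "AE x in M. \<psi> x = 0" by (rule AE_I') auto
    then have "AE x in M. ennreal (\<psi> x powr q) = 0" by eventually_elim simp
    then have "(\<integral>\<^sup>+x. ennreal (\<psi> x powr q) \<partial>M) = 0" by (subst nn_integral_0_iff_AE) auto
    then show ?thesis by simp
  next
    case 2
    then show ?thesis using Z z by simp
  next
    case 3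
    have "(\<integral>\<^sup>+x. ennreal (\<psi> x powr q * 1) \<partial>M) \<le>
      ennreal ((z powr Q) powr (1 / (Q / q)) * ?m powr (1 / (Q / (Q - q))))"
    proof (rule nn_integral_Holder)
      show "1 / (Q / q) + 1 / (Q / (Q - q)) = 1" using 3 q by (simp add: field_simps)
      show "(\<integral>\<^sup>+x. ennreal ((\<psi> x powr q) powr (Q / q)) \<partial>M) \<le> ennreal (z powr Q)" using Z q by (simp add: powr_powr)
      show "(\<integral>\<^sup>+x. ennreal (1 powr (Q / (Q - q))) \<partial>M) \<le> ennreal ?m" by (simp add: emeasure_eq_measure)
    qed (use 3 q z in auto)
    also have "(z powr Q) powr (1 / (Q / q)) * ?m powr (1 / (Q / (Q - q))) = (?m powr (1 / q - 1 / Q) * z) powr q"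
    proof -
      have "(1 / q - 1 / Q) * q = (Q - q) / Q" using 3 q by (simp add: field_simps)
      then show ?thesis using 3 q z by (simp add: powr_powr powr_mult mult.commute)
    qed
    finally show ?thesis by simp
  qed
qed

text \<open>Of the factor 4, one 2 comes from b1 + b2 \<le> 2 max(b1, b2), the other from 2 \<le>
  2^q.\<close>

lemma nn_integral_powr_sum_bound:
  fixes \<phi> \<psi>1 \<psi>2 :: "'a \<Rightarrow> real"
  assumes [measurable]: "\<phi> \<in> borel_measurable M" "\<psi>1 \<in> borel_measurable M" "\<psi>2 \<in> borel_measurable M"
    and nn: "\<And>x. 0 \<le> \<phi> x" "\<And>x. 0 \<le> \<psi>1 x" "\<And>x. 0 \<le> \<psi>2 x"
    and bd: "AE x in M. \<phi> x \<le> c * (\<psi>1 x + \<psi>2 x)" and c: "0 \<le> c" and q: "1 \<le> q" and z: "0 \<le> z1" "0 \<le> z2"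
    and 1: "(\<integral>\<^sup>+x. ennreal (\<psi>1 x powr q) \<partial>M) \<le> ennreal (z1 powr q)"
    and 2: "(\<integral>\<^sup>+x. ennreal (\<psi>2 x powr q) \<partial>M) \<le> ennreal (z2 powr q)"
  shows "(\<integral>\<^sup>+x. ennreal (\<phi> x powr q) \<partial>M) \<le> ennreal ((4 * c * (z1 + z2)) powr q)"
proof -
  let ?d = "(2 * c) powr q"
  have pw: "a \<le> c * (b1 + b2) \<Longrightarrow> 0 \<le> a \<Longrightarrow> 0 \<le> b1 \<Longrightarrow> 0 \<le> b2 \<Longrightarrow> a powr q \<le> ?d * (b1 powr q + b2 powr q)" for a b1 b2
  proof -
    assume a: "a \<le> c * (b1 + b2)" "0 \<le> a" "0 \<le> b1" "0 \<le> b2"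
    have "c * (b1 + b2) \<le> c * (2 * max b1 b2)" using c by (intro mult_left_mono) auto
    then have "a powr q \<le> (2 * c * max b1 b2) powr q" using a q by (intro powr_mono2) auto
    also have "... = ?d * max b1 b2 powr q" using a c by (simp add: powr_mult)
    also have "... \<le> ?d * (b1 powr q + b2 powr q)" by (intro mult_left_mono) (auto simp: max_def)
    finally show ?thesis .
  qed
  have "(\<integral>\<^sup>+x. ennreal (\<phi> x powr q) \<partial>M) \<le> (\<integral>\<^sup>+x. ennreal ?d * (ennreal (\<psi>1 x powr q) + ennreal (\<psi>2 x powr q)) \<partial>M)"
  proof (rule nn_integral_mono_AE, goal_cases)
    case 1
    show ?case using bd
    proof eventually_elim
      case (elim x)
      have "ennreal (\<phi> x powr q) \<le> ennreal (?d * (\<psi>1 x powr q + \<psi>2 x powr q))"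
        using pw[OF elim nn] by (rule ennreal_leI)
      then show ?case by (simp add: ennreal_mult)
    qed
  qed
  also have "... = ennreal ?d * ((\<integral>\<^sup>+x. ennreal (\<psi>1 x powr q) \<partial>M) + (\<integral>\<^sup>+x. ennreal (\<psi>2 x powr q) \<partial>M))"
    by (simp add: nn_integral_cmult nn_integral_add)
  also have "... \<le> ennreal ?d * (ennreal (z1 powr q) + ennreal (z2 powr q))" by (intro mult_left_mono add_mono 1 2) simp
  also have "... = ennreal (?d * (z1 powr q + z2 powr q))" by (simp add: ennreal_mult)
  also have "... \<le> ennreal ((4 * c * (z1 + z2)) powr q)"
  proof (rule ennreal_leI)
    have "z1 powr q \<le> (z1 + z2) powr q" "z2 powr q \<le> (z1 + z2) powr q" using z q by (auto intro!: powr_mono2)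
    then have "z1 powr q + z2 powr q \<le> 2 * (z1 + z2) powr q" by linarith
    also have "... \<le> 2 powr q * (z1 + z2) powr q" using powr_mono[of 1 q 2] q by (intro mult_right_mono) auto
    finally have "?d * (z1 powr q + z2 powr q) \<le> ?d * (2 powr q * (z1 + z2) powr q)" by (rule mult_left_mono) simp
    also have "... = (2 * c * (2 * (z1 + z2))) powr q"
      using c z powr_mult[of "2 * c" "2 * (z1 + z2)" q] powr_mult[of 2 "z1 + z2" q] by (simp only: mult_nonneg_nonneg add_nonneg_nonneg zero_le_numeral)
    finally show "?d * (z1 powr q + z2 powr q) \<le> (4 * c * (z1 + z2)) powr q" by (simp add: algebra_simps)
  qed
  finally show ?thesis .
qed

text \<open>At level l the truncated density has a potential of at most A l^(1-p/n), and the excess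
  is handled by duality; interpolation with \<theta> = 1 - p/n yields the trace exponent
  p\<alpha>/(n-p).\<close>

lemma riesz_strong_type:
  assumes dim: "2 \<le> DIM('a::euclidean_space)" and p: "1 < p" "p < real DIM('a)" and \<alpha>: "real DIM('a) - 1 < \<alpha>" and K: "0 < K"
  shows "\<exists>C>0. \<forall>(M::'a measure) F h. growth_measure M \<alpha> K \<longrightarrow> F \<in> borel_measurable borel \<longrightarrow> (\<forall>y. 0 \<le> F y) \<longrightarrow>
    0 \<le> h \<longrightarrow> (\<integral>\<^sup>+y. ennreal (F y powr p) \<partial>lborel) \<le> ennreal (h powr p) \<longrightarrow>
    (AE x in M. riesz lborel (\<lambda>y. ennreal (F y)) x < \<infinity>) \<and>
    (\<integral>\<^sup>+x. ennreal (enn2real (riesz lborel (\<lambda>y. ennreal (F y)) x) powr (p * \<alpha> / (real DIM('a) - p))) \<partial>M)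
      \<le> ennreal ((C * h) powr (p * \<alpha> / (real DIM('a) - p)))"
proof -
  let ?n = "real DIM('a)"
  define Q where "Q = p * \<alpha> / (?n - p)"
  define \<theta> where "\<theta> = 1 - p / ?n"
  define \<kappa> where "\<kappa> = \<alpha> / (?n - 1)"
  define a where "a = power_const DIM('a) p"
  define B where "B = dual_const DIM('a) \<alpha> K"
  define Z where "Z = (2 * a) powr Q * (\<theta> * Q) * (B / a) powr \<kappa> / (p - 1)"
  have n: "1 < ?n" using dim by simp
  have \<alpha>0: "0 < \<alpha>" using \<alpha> n by linarith
  have Q0: "0 < Q" using p \<alpha>0 by (simp add: Q_def)
  have \<theta>: "0 < \<theta>" using p n by (simp add: \<theta>_def)
  have \<kappa>: "1 < \<kappa>" using \<alpha> n by (simp add: \<kappa>_def)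
  have Q\<theta>: "Q * \<theta> = p * \<alpha> / ?n" using p n by (simp add: Q_def \<theta>_def field_simps)
  have \<theta>p: "\<theta> + p - 1 = (?n - 1) * (p / ?n)" using n by (simp add: \<theta>_def field_simps)
  have a: "0 < a" unfolding a_def by (rule power_const_pos[OF dim])
  have B: "0 < B" unfolding B_def by (rule dual_const_pos[OF dim \<alpha> K])
  have Z: "0 < Z" using a B \<theta> Q0 p by (simp add: Z_def)
  show ?thesis
  proof (intro exI[of _ "Z powr (1 / Q)"] conjI[of "0 < _"] allI impI)
    show "0 < Z powr (1 / Q)" using Z by simp
    fix M :: "'a measure" and F :: "'a \<Rightarrow> real" and h :: real
    assume M: "growth_measure M \<alpha> K" and Fm [measurable]: "F \<in> borel_measurable borel" and "\<forall>y. 0 \<le> F y"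
      and h: "0 \<le> h" and FN: "(\<integral>\<^sup>+y. ennreal (F y powr p) \<partial>lborel) \<le> ennreal (h powr p)"
    then have F0: "\<And>y. 0 \<le> F y" by blast
    define Np where "Np = h powr p"
    have FN': "(\<integral>\<^sup>+y. ennreal (\<bar>F y\<bar> powr p) \<partial>lborel) \<le> ennreal Np" using FN F0 by (simp add: Np_def)
    let ?I = "riesz lborel (\<lambda>y. ennreal (F y))"
    have sM [measurable_cong]: "sets M = sets borel" and fM: "finite_measure M" using M by (auto simp: growth_measure_def)
    have "(AE x in M. ?I x < \<infinity>) \<and> (\<integral>\<^sup>+x. ennreal (enn2real (?I x) powr Q) \<partial>M) \<le> ennreal (Z * Np powr (Q / p))"
    proof (cases "Np = 0")
      \<comment> \<open>The radius in the truncation bound needs a positive \<open>Np\<close>; if it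
        is zero, the potential vanishes identically.\<close>
      case True
      then have "(\<integral>\<^sup>+y. ennreal (F y powr p) \<partial>lborel) = 0" using FN by (simp add: Np_def)
      then have "AE y in lborel. ennreal (F y powr p) = 0" by (subst (asm) nn_integral_0_iff_AE) auto
      then have "AE y in lborel. ennreal (F y) = 0" by eventually_elim (auto simp: ennreal_eq_0_iff powr_def split: if_splits)
      then have "?I x = 0" for x by (rule riesz_AE_zero)
      then show ?thesis by simp
    next
      case False
      then have Np: "0 < Np" by (simp add: Np_def)
      define A where "A = a * Np powr (1 / ?n)"
      have A: "0 < A" using a Np by (simp add: A_def)
      have bd: "?I x \<le> ennreal (A * l powr \<theta>) + riesz lborel (excess l F) x" if l: "0 < l" for l x
      proof -
        have "riesz lborel (\<lambda>y. ennreal (if F y \<le> l then F y else 0)) x \<le> ennreal (a * Np powr (1 / ?n) * l powr (1 - p / ?n))"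
          unfolding a_def
        proof (rule riesz_truncated_power[OF dim p _ _ _ l Np])
          have "(\<integral>\<^sup>+y. ennreal ((if F y \<le> l then F y else 0) powr p) \<partial>lborel) \<le> (\<integral>\<^sup>+y. ennreal (F y powr p) \<partial>lborel)"
            by (intro nn_integral_mono ennreal_leI) simp
          then show "(\<integral>\<^sup>+y. ennreal ((if F y \<le> l then F y else 0) powr p) \<partial>lborel) \<le> ennreal Np" using FN by (auto simp: Np_def)
        qed (use F0 l in auto)
        then show ?thesis unfolding riesz_split_level[OF Fm F0, of x l] A_def \<theta>_def by (rule add_right_mono)
      qed
      have ex: "(\<integral>\<^sup>+y. excess l F y \<partial>lborel) \<le> ennreal (l powr (1 - p) * Np)" if "0 < l" for l
        unfolding excess_def by (rule truncated_integral_bound) (use that p Np FN' in auto)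
      have "AE x in M. riesz lborel (excess 1 F) x < \<infinity>"
      proof (rule riesz_AE_finite[OF dim _ K \<alpha>])
        show "(\<integral>\<^sup>+y. excess 1 F y \<partial>lborel) < \<infinity>" using ex[of 1] by (simp add: order_le_less_trans)
      qed (use M in \<open>auto simp: sigma_finite_lborel\<close>)
      then have fin: "AE x in M. ?I x < \<infinity>"
      proof eventually_elim
        case (elim x)
        then have "ennreal (A * 1 powr \<theta>) + riesz lborel (excess 1 F) x < \<infinity>" by simp
        with bd[of 1 x] show ?case by (simp add: order_le_less_trans)
      qed
      have "(\<integral>\<^sup>+x. ennreal (enn2real (?I x) powr Q) \<partial>M) \<le> ennreal ((2 * A) powr Q * (\<theta> * Q) * (B / A) powr \<kappa> * Np powr \<kappa> / (p - 1))"
      proof (rule strong_type_interpolation[where f = F and J = "\<lambda>l. riesz lborel (excess l F)", OF fM sigma_finite_lborel])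
        show "AE x in M. ennreal (enn2real (?I x)) \<le> ennreal (A * l powr \<theta>) + riesz lborel (excess l F) x" if "0 < l" for l
          using fin
        proof eventually_elim
          case (elim x)
          then show ?case using bd[OF that, of x] by simp
        qed
        show "(\<integral>\<^sup>+x. riesz lborel (excess l F) x * indicator E x \<partial>M) \<le> ennreal (B * measure M E powr (1 - 1 / \<kappa>)) *
           (\<integral>\<^sup>+y. ennreal \<bar>F y\<bar> * indicator {y. l < \<bar>F y\<bar>} y \<partial>lborel)" if "E \<in> sets M" for l E
          unfolding B_def \<kappa>_def excess_def[symmetric]
          by (rule riesz_dual[OF dim sM fM _ sigma_finite_lborel K \<alpha>]) (use M that sM in \<open>auto simp: growth_measure_def\<close>)
        show "Q * \<theta> = \<kappa> * (\<theta> + p - 1)" unfolding Q\<theta> using n by (simp add: \<kappa>_def \<theta>p)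
      qed (use A B \<kappa> p \<theta> Np FN' in auto)
      also have "(2 * A) powr Q * (\<theta> * Q) * (B / A) powr \<kappa> * Np powr \<kappa> / (p - 1) = Z * Np powr (Q / p)"
      proof -
        \<comment> \<open>The powers of \<open>Np\<close> combine to Q/p, as homogeneity in
          \<open>F\<close> demands.\<close>
        have "1 / ?n * Q + (- (1 / ?n * \<kappa>) + \<kappa>) = 1 / ?n * Q + \<kappa> * ((?n - 1) / ?n)" using n by (simp add: field_simps)
        also have "\<kappa> * ((?n - 1) / ?n) = \<alpha> / ?n" using n by (simp add: \<kappa>_def)
        also have "1 / ?n * Q + \<alpha> / ?n = Q / p" using p n by (simp add: Q_def field_simps)
        finally have e: "1 / ?n * Q + (- (1 / ?n * \<kappa>) + \<kappa>) = Q / p" .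
        have e1: "(2 * A) powr Q = (2 * a) powr Q * Np powr (1 / ?n * Q)"
          using a Np by (simp add: A_def powr_mult powr_powr)
        have e2: "(B / A) powr \<kappa> = (B / a) powr \<kappa> * Np powr (- (1 / ?n * \<kappa>))"
          using a Np B by (simp add: A_def powr_mult powr_powr powr_divide powr_minus field_simps)
        have "(2 * A) powr Q * (\<theta> * Q) * (B / A) powr \<kappa> * Np powr \<kappa> / (p - 1) =
          Z * (Np powr (1 / ?n * Q) * (Np powr (- (1 / ?n * \<kappa>)) * Np powr \<kappa>))" unfolding e1 e2 Z_def by simp
        also have "... = Z * Np powr (Q / p)" by (simp only: powr_add[symmetric] e)
        finally show ?thesis .
      qed
      finally show ?thesis using fin by blast
    qed
    moreover have "Z * Np powr (Q / p) = (Z powr (1 / Q) * h) powr Q"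
      using Z Q0 h p by (simp add: powr_mult powr_powr Np_def)
    ultimately show "(AE x in M. ?I x < \<infinity>) \<and> (\<integral>\<^sup>+x. ennreal (enn2real (?I x) powr (p * \<alpha> / (?n - p))) \<partial>M) \<le>
        ennreal ((Z powr (1 / Q) * h) powr (p * \<alpha> / (?n - p)))" unfolding Q_def[symmetric] by auto
  qed
qed

text \<open>Here the bounded part is the level itself, so the interpolation runs with A = \<theta> =
  1 and the exponent is r \<kappa>, \<kappa> = \<alpha>/(n-1).\<close>

lemma boundary_riesz_strong_type:
  fixes M N :: "'a::euclidean_space measure"
  assumes dim: "2 \<le> DIM('a)" and r: "1 < r" and \<alpha>: "real DIM('a) - 1 < \<alpha>" and K: "0 < K"
  defines "C \<equiv> (2 powr (r * (\<alpha> / (real DIM('a) - 1))) * (r * (\<alpha> / (real DIM('a) - 1))) *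
      dual_const DIM('a) \<alpha> K powr (\<alpha> / (real DIM('a) - 1)) / (r - 1)) powr (1 / (r * (\<alpha> / (real DIM('a) - 1))))"
  assumes M: "growth_measure M \<alpha> K" and sN: "sets N = sets borel" and fN: "finite_measure N"
    and gm [measurable]: "g \<in> borel_measurable borel" and z: "0 \<le> z" "(\<integral>\<^sup>+y. ennreal (\<bar>g y\<bar> powr r) \<partial>N) \<le> ennreal (z powr r)"
    and \<psi>m: "\<psi> \<in> borel_measurable M" and \<psi>0: "\<And>x. 0 \<le> \<psi> x"
    and bd: "\<And>s. 0 < s \<Longrightarrow> AE x in M. ennreal (\<psi> x) \<le> ennreal s + riesz N (excess s g) x"
  shows "(\<integral>\<^sup>+x. ennreal (\<psi> x powr (r * \<alpha> / (real DIM('a) - 1))) \<partial>M) \<le> ennreal ((C * z) powr (r * \<alpha> / (real DIM('a) - 1)))"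
proof -
  let ?n = "real DIM('a)"
  define \<kappa> where "\<kappa> = \<alpha> / (?n - 1)"
  define B where "B = dual_const DIM('a) \<alpha> K"
  define Z where "Z = 2 powr (r * \<kappa>) * (r * \<kappa>) * B powr \<kappa> / (r - 1)"
  have n: "1 < ?n" using dim by simp
  have \<kappa>: "1 < \<kappa>" using \<alpha> n by (simp add: \<kappa>_def)
  have B: "0 < B" unfolding B_def by (rule dual_const_pos[OF dim \<alpha> K])
  have Z: "0 < Z" using B \<kappa> r by (simp add: Z_def)
  have sf: "sigma_finite_measure N" using fN by (simp add: finite_measure_def)
  have sM [measurable_cong]: "sets M = sets borel" and fM: "finite_measure M" using M by (auto simp: growth_measure_def)
  have [measurable]: "riesz N (excess l g) \<in> borel_measurable borel" for l by (rule riesz_measurable[OF sN sf]) simp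
  have "(\<integral>\<^sup>+x. ennreal (\<psi> x powr (r * \<kappa>)) \<partial>M) \<le> ennreal ((2 * 1) powr (r * \<kappa>) * (1 * (r * \<kappa>)) * (B / 1) powr \<kappa> * (z powr r) powr \<kappa> / (r - 1))"
  proof (rule strong_type_interpolation[where f = g and J = "\<lambda>l. riesz N (excess l g)", OF fM sf])
    show "AE x in M. ennreal (\<psi> x) \<le> ennreal (1 * l powr 1) + riesz N (excess l g) x" if "0 < l" for l
      using bd[OF that] that by simp
    show "(\<integral>\<^sup>+x. riesz N (excess l g) x * indicator E x \<partial>M) \<le> ennreal (B * measure M E powr (1 - 1 / \<kappa>)) *
       (\<integral>\<^sup>+y. ennreal \<bar>g y\<bar> * indicator {y. l < \<bar>g y\<bar>} y \<partial>N)" if "E \<in> sets M" for l E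
      unfolding B_def \<kappa>_def excess_def[symmetric]
      by (rule riesz_dual[OF dim sM fM sN sf K \<alpha>]) (use M that sM in \<open>auto simp: growth_measure_def\<close>)
    show "g \<in> borel_measurable N" by (simp add: measurable_cong_sets[OF sN refl])
  qed (use B \<kappa> r z \<psi>0 \<psi>m in auto)
  also have "(2 * 1) powr (r * \<kappa>) * (1 * (r * \<kappa>)) * (B / 1) powr \<kappa> * (z powr r) powr \<kappa> / (r - 1) = (Z powr (1 / (r * \<kappa>)) * z) powr (r * \<kappa>)"
    using Z \<kappa> r z by (simp add: powr_mult powr_powr) (simp add: Z_def)
  finally show ?thesis unfolding C_def Z_def B_def \<kappa>_def by simp
qed

lemma ennreal_excess_part:
  assumes "ennreal \<phi> \<le> ennreal a + X" "0 \<le> a"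
  shows "ennreal (max 0 (\<phi> - a)) \<le> X"
proof -
  have "ennreal (max 0 (\<phi> - a)) = ennreal \<phi> - ennreal a" using assms(2) by (simp add: ennreal_minus max_def ennreal_neg)
  also have "... \<le> X" using assms(1) by (simp add: ennreal_minus_le_iff)
  finally show ?thesis .
qed

lemma gradient_power_estimate:
  assumes dim: "2 \<le> DIM('a::euclidean_space)" and p: "1 < p" "p < real DIM('a)" and r: "1 < r"
    and \<alpha>: "real DIM('a) - 1 < \<alpha>" and K: "0 < K" and c: "0 < c"
  defines "q \<equiv> min (p * \<alpha> / (real DIM('a) - p)) (r * \<alpha> / (real DIM('a) - 1))"
  shows "\<exists>C>0. \<forall>(M::'a measure) N F g \<phi> h z. growth_measure M \<alpha> K \<longrightarrow> riesz_bounded M N F g c \<phi> \<longrightarrow>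
    0 \<le> h \<longrightarrow> (\<integral>\<^sup>+y. ennreal (F y powr p) \<partial>lborel) \<le> ennreal (h powr p) \<longrightarrow>
    0 \<le> z \<longrightarrow> (\<integral>\<^sup>+y. ennreal (\<bar>g y\<bar> powr r) \<partial>N) \<le> ennreal (z powr r) \<longrightarrow>
    (\<integral>\<^sup>+x. ennreal (\<phi> x powr q) \<partial>M) \<le> ennreal ((C * (measure M UNIV powr (1 / q - 1 / (p * \<alpha> / (real DIM('a) - p))) * h +
       measure M UNIV powr (1 / q - 1 / (r * \<alpha> / (real DIM('a) - 1))) * z)) powr q)"
proof -
  let ?n = "real DIM('a)"
  define Q1 where "Q1 = p * \<alpha> / (?n - p)"
  define Q2 where "Q2 = r * \<alpha> / (?n - 1)"
  have n: "1 < ?n" using dim by simp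
  \<comment> \<open>That \<alpha> > n - 1 puts both exponents above 1, hence also q, as the estimate
    for sums requires.\<close>
  have Q1: "1 \<le> Q1"
  proof -
    have "?n - p \<le> p * (?n - 1)" using p n by (simp add: algebra_simps)
    also have "... \<le> p * \<alpha>" using p \<alpha> by (intro mult_left_mono) auto
    finally show ?thesis using p by (simp add: Q1_def)
  qed
  have Q2: "1 \<le> Q2"
  proof -
    have "1 * (?n - 1) \<le> r * \<alpha>" using r \<alpha> n by (intro mult_mono) auto
    then show ?thesis using n by (simp add: Q2_def)
  qed
  obtain C1 where C1: "0 < C1" and st: "\<And>(M::'a measure) F h. growth_measure M \<alpha> K \<Longrightarrow> F \<in> borel_measurable borel \<Longrightarrow> (\<forall>y. 0 \<le> F y) \<Longrightarrow>
    0 \<le> h \<Longrightarrow> (\<integral>\<^sup>+y. ennreal (F y powr p) \<partial>lborel) \<le> ennreal (h powr p) \<Longrightarrow>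
    (AE x in M. riesz lborel (\<lambda>y. ennreal (F y)) x < \<infinity>) \<and>
    (\<integral>\<^sup>+x. ennreal (enn2real (riesz lborel (\<lambda>y. ennreal (F y)) x) powr Q1) \<partial>M) \<le> ennreal ((C1 * h) powr Q1)"
    using riesz_strong_type[OF dim p \<alpha> K] unfolding Q1_def by meson
  define C2 where "C2 = (2 powr (r * (\<alpha> / (?n - 1))) * (r * (\<alpha> / (?n - 1))) *
      dual_const DIM('a) \<alpha> K powr (\<alpha> / (?n - 1)) / (r - 1)) powr (1 / (r * (\<alpha> / (?n - 1))))"
  have C2: "0 \<le> C2" by (simp add: C2_def)
  define C where "C = C1 + C2"
  have C: "0 < C" "C1 \<le> C" "C2 \<le> C" using C1 C2 by (auto simp: C_def)
  show ?thesis
  proof (intro exI[of _ "4 * c * C"] conjI allI impI)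
    show "0 < 4 * c * C" using c C by simp
    fix M N :: "'a measure" and F g \<phi> :: "'a \<Rightarrow> real" and h z :: real
    let ?I = "riesz lborel (\<lambda>y. ennreal (F y))"
    assume M: "growth_measure M \<alpha> K" and rb: "riesz_bounded M N F g c \<phi>" and h: "0 \<le> h" and z: "0 \<le> z"
      and FN: "(\<integral>\<^sup>+y. ennreal (F y powr p) \<partial>lborel) \<le> ennreal (h powr p)"
      and gN: "(\<integral>\<^sup>+y. ennreal (\<bar>g y\<bar> powr r) \<partial>N) \<le> ennreal (z powr r)"
    have sM [measurable_cong]: "sets M = sets borel" and fM: "finite_measure M" using M by (auto simp: growth_measure_def)
    have spM: "space M = UNIV" using sets_eq_imp_space_eq[OF sM] by simp
    have [measurable]: "F \<in> borel_measurable borel" "\<phi> \<in> borel_measurable borel" "g \<in> borel_measurable borel"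
      and sN: "sets N = sets borel" and fN: "finite_measure N" and F0: "\<forall>y. 0 \<le> F y" and \<phi>0: "\<And>x. 0 \<le> \<phi> x"
      and bd: "AE x in M. ?I x < \<infinity> \<longrightarrow> (\<forall>s\<ge>0. ennreal (\<phi> x) \<le> ennreal c * (?I x + ennreal s + riesz N (excess s g) x))"
      using rb by (auto simp: riesz_bounded_def)
    have q: "1 \<le> q" "q \<le> Q1" "q \<le> Q2" using Q1 Q2 by (auto simp: q_def Q1_def Q2_def)
    let ?m1 = "measure M UNIV powr (1 / q - 1 / Q1)" and ?m2 = "measure M UNIV powr (1 / q - 1 / Q2)"
    define \<psi>1 where "\<psi>1 x = enn2real (?I x)" for x
    \<comment> \<open>The part of \<phi>/c not covered by the Hessian potential. It satisfies the
      boundary inequality at every level, so the two potentials can be estimated separately, each at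
      its own exponent.\<close>
    define \<psi>2 where "\<psi>2 x = max 0 (\<phi> x / c - \<psi>1 x)" for x
    have [measurable]: "\<psi>1 \<in> borel_measurable borel" unfolding \<psi>1_def by measurable
    have [measurable]: "\<psi>2 \<in> borel_measurable borel" unfolding \<psi>2_def by measurable
    have fin: "AE x in M. ?I x < \<infinity>" and I1: "(\<integral>\<^sup>+x. ennreal (\<psi>1 x powr Q1) \<partial>M) \<le> ennreal ((C1 * h) powr Q1)"
      using st[of M F h] M F0 h FN unfolding \<psi>1_def by auto
    have I2: "(\<integral>\<^sup>+x. ennreal (\<psi>2 x powr Q2) \<partial>M) \<le> ennreal ((C2 * z) powr Q2)" unfolding C2_def Q2_def
    proof (rule boundary_riesz_strong_type[OF dim r \<alpha> K])
      fix s :: real assume s: "0 < s"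
      from bd fin show "AE x in M. ennreal (\<psi>2 x) \<le> ennreal s + riesz N (excess s g) x"
      proof eventually_elim
        case (elim x)
        have "ennreal c * ennreal (\<phi> x / c) = ennreal (\<phi> x)" using c \<phi>0 by (simp add: ennreal_mult[symmetric])
        also have "... \<le> ennreal c * (?I x + ennreal s + riesz N (excess s g) x)" using elim s by simp
        finally have "ennreal (\<phi> x / c) \<le> ?I x + ennreal s + riesz N (excess s g) x" using c by (simp add: ennreal_mult_le_mult_iff)
        also have "?I x = ennreal (\<psi>1 x)" using elim by (simp add: \<psi>1_def)
        finally show ?case unfolding \<psi>2_def by (intro ennreal_excess_part) (auto simp: \<psi>1_def add.assoc)
      qed
    qed (use M sN fN z gN in \<open>auto simp: \<psi>2_def[symmetric]\<close>, simp add: \<psi>2_def)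
    have "(\<integral>\<^sup>+x. ennreal (\<phi> x powr q) \<partial>M) \<le>
      ennreal ((4 * c * (?m1 * (C1 * h) + ?m2 * (C2 * z))) powr q)"
    proof (rule nn_integral_powr_sum_bound)
      show "(\<integral>\<^sup>+x. ennreal (\<psi>1 x powr q) \<partial>M) \<le> ennreal ((?m1 * (C1 * h)) powr q)"
        using nn_integral_powr_exponent_mono[OF fM _ _ _ q(2) _ I1] q C1 h by (simp add: spM \<psi>1_def)
      show "(\<integral>\<^sup>+x. ennreal (\<psi>2 x powr q) \<partial>M) \<le> ennreal ((?m2 * (C2 * z)) powr q)"
        using nn_integral_powr_exponent_mono[OF fM _ _ _ q(3) _ I2] q C2 z by (simp add: spM \<psi>2_def)
      show "AE x in M. \<phi> x \<le> c * (\<psi>1 x + \<psi>2 x)"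
      proof (rule AE_I2, goal_cases)
        case (1 x)
        have "\<phi> x / c \<le> \<psi>1 x + \<psi>2 x" by (auto simp: \<psi>2_def)
        then show ?case using c by (simp add: field_simps)
      qed
    qed (use \<phi>0 q c C1 C2 h z in \<open>auto simp: \<psi>1_def \<psi>2_def\<close>)
    also have "... \<le> ennreal ((4 * c * C * (?m1 * h + ?m2 * z)) powr q)"
    proof (rule ennreal_leI, rule powr_mono2)
      have "?m1 * (C1 * h) \<le> ?m1 * (C * h)" "?m2 * (C2 * z) \<le> ?m2 * (C * z)"
        using C h z by (auto intro!: mult_left_mono mult_right_mono)
      then have "4 * c * (?m1 * (C1 * h) + ?m2 * (C2 * z)) \<le> 4 * c * (?m1 * (C * h) + ?m2 * (C * z))"
        using c by (intro mult_left_mono) auto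
      then show "4 * c * (?m1 * (C1 * h) + ?m2 * (C2 * z)) \<le> 4 * c * C * (?m1 * h + ?m2 * z)"
        by (simp add: algebra_simps)
    qed (use q c C1 C2 h z in auto)
    finally show "(\<integral>\<^sup>+x. ennreal (\<phi> x powr q) \<partial>M) \<le> ennreal ((4 * c * C *
      (measure M UNIV powr (1 / q - 1 / (p * \<alpha> / (?n - p))) * h + measure M UNIV powr (1 / q - 1 / (r * \<alpha> / (?n - 1))) * z)) powr q)"
      unfolding Q1_def Q2_def .
  qed
qed

text \<open>The weak type bound is used at a single truncation level depending on s: logarithmic
  growth of the truncated potential, set against power decay of the excess, gives an exponential
  tail.\<close>

lemma riesz_exponential_tail:
  fixes M :: "'a::euclidean_space measure"
  assumes dim: "2 \<le> DIM('a)" and M: "growth_measure M \<alpha> K" and K: "0 < K" and \<alpha>: "real DIM('a) - 1 < \<alpha>"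
    and Fm [measurable]: "F \<in> borel_measurable borel" and F0: "\<And>y. 0 \<le> F y"
    and FN: "(\<integral>\<^sup>+y. ennreal (F y powr real DIM('a)) \<partial>lborel) \<le> 1"
    and Um: "U \<in> sets borel" and supp: "\<And>y. y \<notin> U \<Longrightarrow> F y = 0" and L: "0 \<le> L" "emeasure lborel U \<le> ennreal L"
  shows "AE x in M. riesz lborel (\<lambda>y. ennreal (F y)) x < \<infinity>"
    and "4 * log_const DIM('a) L \<le> s \<Longrightarrow> emeasure M {x \<in> space M. s \<le> 2 * enn2real (riesz lborel (\<lambda>y. ennreal (F y)) x)} \<le>
      ennreal ((dual_const DIM('a) \<alpha> K / log_const DIM('a) L) powr (\<alpha> / (real DIM('a) - 1)) * exp \<alpha> *
        exp (- (\<alpha> * (s / (4 * log_const DIM('a) L)) powr (real DIM('a) / (real DIM('a) - 1)))))"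
proof -
  let ?n = "real DIM('a)" and ?I = "riesz lborel (\<lambda>y. ennreal (F y))"
  define A where "A = log_const DIM('a) L"
  define B where "B = dual_const DIM('a) \<alpha> K"
  define \<kappa> where "\<kappa> = \<alpha> / (?n - 1)"
  have n: "1 < ?n" using dim by simp
  have \<kappa>: "1 < \<kappa>" using \<alpha> n by (simp add: \<kappa>_def)
  have A: "0 < A" unfolding A_def by (rule log_const_pos[OF dim])
  have B: "0 < B" unfolding B_def by (rule dual_const_pos[OF dim \<alpha> K])
  have sM [measurable_cong]: "sets M = sets borel" and fM: "finite_measure M" using M by (auto simp: growth_measure_def)
  have bd: "?I x \<le> ennreal (A * (1 + ln l) powr ((?n - 1) / ?n)) + riesz lborel (excess l F) x" if l: "1 \<le> l" for l x
  proof -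
    have "riesz lborel (\<lambda>y. ennreal (if F y \<le> l then F y else 0)) x \<le> ennreal (A * (1 + ln l) powr ((?n - 1) / ?n))"
      unfolding A_def
    proof (rule riesz_truncated_log[OF dim _ _ _ l _ Um _ L])
      have "(\<integral>\<^sup>+y. ennreal ((if F y \<le> l then F y else 0) powr ?n) \<partial>lborel) \<le> (\<integral>\<^sup>+y. ennreal (F y powr ?n) \<partial>lborel)"
        by (intro nn_integral_mono ennreal_leI) simp
      then show "(\<integral>\<^sup>+y. ennreal ((if F y \<le> l then F y else 0) powr ?n) \<partial>lborel) \<le> 1" using FN by auto
    qed (use F0 l supp in auto)
    then show ?thesis unfolding riesz_split_level[OF Fm F0, of x l] by (rule add_right_mono)
  qed
  have ex: "(\<integral>\<^sup>+y. excess l F y \<partial>lborel) \<le> ennreal (l powr (1 - ?n))" if "1 \<le> l" for l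
    using truncated_integral_bound[of F lborel l ?n 1] that n FN F0 by (simp add: excess_def)
  have "AE x in M. riesz lborel (excess 1 F) x < \<infinity>"
  proof (rule riesz_AE_finite[OF dim M K \<alpha>])
    show "(\<integral>\<^sup>+y. excess 1 F y \<partial>lborel) < \<infinity>" using ex[of 1] by (simp add: order_le_less_trans)
  qed (auto simp: sigma_finite_lborel)
  then show fin: "AE x in M. ?I x < \<infinity>"
  proof eventually_elim
    case (elim x)
    then have "ennreal (A * (1 + ln 1) powr ((?n - 1) / ?n)) + riesz lborel (excess 1 F) x < \<infinity>" by simp
    with bd[of 1 x] show ?case by (simp add: order_le_less_trans)
  qed
  assume s: "4 * log_const DIM('a) L \<le> s"
  define \<tau> where "\<tau> = s / (4 * A)"
  have \<tau>: "1 \<le> \<tau>" using s A by (simp add: \<tau>_def A_def)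
  \<comment> \<open>The level makes the bound for the truncated part equal to A \<tau>, that is 1 +
    ln l = \<tau>^(n/(n-1)). The excess contributes l^(1-n), and (n-1)\<kappa> = \<alpha> turns this
    into exp(-\<alpha> \<tau>^(n/(n-1))) up to a constant.\<close>
  define l where "l = exp (\<tau> powr (?n / (?n - 1)) - 1)"
  have "1 \<le> \<tau> powr (?n / (?n - 1))" using \<tau> n by (intro ge_one_powr_ge_zero) auto
  then have l: "1 \<le> l" by (simp add: l_def)
  have lt: "(1 + ln l) powr ((?n - 1) / ?n) = \<tau>" using \<tau> n by (simp add: l_def powr_powr)
  have "emeasure M {x \<in> space M. 2 * (A * \<tau>) \<le> enn2real (?I x)} \<le> ennreal ((B * l powr (1 - ?n) / (A * \<tau>)) powr \<kappa>)"
  proof (rule weak_type_level[OF fM _ _ _ _ \<kappa>])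
    show "AE x in M. ennreal (enn2real (?I x)) \<le> ennreal (A * \<tau>) + riesz lborel (excess l F) x" using fin
    proof eventually_elim
      case (elim x)
      then show ?case using bd[OF l, of x] by (simp add: lt)
    qed
    show "(\<integral>\<^sup>+x. riesz lborel (excess l F) x * indicator E x \<partial>M) \<le> ennreal (B * measure M E powr (1 - 1 / \<kappa>) * l powr (1 - ?n))"
      if "E \<in> sets M" for E
    proof -
      have "(\<integral>\<^sup>+x. riesz lborel (excess l F) x * indicator E x \<partial>M) \<le> ennreal (B * measure M E powr (1 - 1 / \<kappa>)) * (\<integral>\<^sup>+y. excess l F y \<partial>lborel)"
        unfolding B_def \<kappa>_def
        by (rule riesz_dual[OF dim sM fM _ sigma_finite_lborel K \<alpha>]) (use M that sM in \<open>auto simp: growth_measure_def\<close>)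
      also have "... \<le> ennreal (B * measure M E powr (1 - 1 / \<kappa>)) * ennreal (l powr (1 - ?n))" by (intro mult_left_mono ex l) simp
      finally show ?thesis using B by (simp add: ennreal_mult)
    qed
  qed (use A B \<tau> in auto)
  also have "(B * l powr (1 - ?n) / (A * \<tau>)) powr \<kappa> \<le> (B * l powr (1 - ?n) / A) powr \<kappa>"
    using A B \<tau> \<kappa> by (intro powr_mono2 divide_left_mono) auto
  also have "(B * l powr (1 - ?n) / A) powr \<kappa> = (B / A) powr \<kappa> * l powr ((1 - ?n) * \<kappa>)"
    using A B l by (simp add: powr_mult powr_divide powr_powr)
  also have "(1 - ?n) * \<kappa> = - \<alpha>" using n by (simp add: \<kappa>_def field_simps)
  also have "l powr (- \<alpha>) = exp \<alpha> * exp (- (\<alpha> * \<tau> powr (?n / (?n - 1))))"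
    by (simp add: l_def powr_def exp_add[symmetric] algebra_simps)
  finally have "emeasure M {x \<in> space M. 2 * (A * \<tau>) \<le> enn2real (?I x)} \<le>
    ennreal ((B / A) powr \<kappa> * (exp \<alpha> * exp (- (\<alpha> * \<tau> powr (?n / (?n - 1))))))" by (simp add: ennreal_leI)
  moreover have "{x \<in> space M. 2 * (A * \<tau>) \<le> enn2real (?I x)} = {x \<in> space M. s \<le> 2 * enn2real (?I x)}"
    using A by (auto simp: \<tau>_def)
  ultimately show "emeasure M {x \<in> space M. s \<le> 2 * enn2real (?I x)} \<le>
      ennreal ((dual_const DIM('a) \<alpha> K / log_const DIM('a) L) powr (\<alpha> / (?n - 1)) * exp \<alpha> *
        exp (- (\<alpha> * (s / (4 * log_const DIM('a) L)) powr (?n / (?n - 1)))))"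
    by (simp add: A_def B_def \<kappa>_def \<tau>_def mult.assoc)
qed

text \<open>The truncation level is s itself: exponential integrability makes the excess of
  \<open>g\<close> exponentially small, and duality transfers this to the level set of
  \<psi>.\<close>

lemma boundary_exponential_tail:
  fixes M N :: "'a::euclidean_space measure"
  assumes dim: "2 \<le> DIM('a)" and M: "growth_measure M \<alpha> K" and K: "0 < K" and \<alpha>: "real DIM('a) - 1 < \<alpha>"
    and sN: "sets N = sets borel" and fN: "finite_measure N"
    and gm [measurable]: "g \<in> borel_measurable borel" and gN: "(\<integral>\<^sup>+y. ennreal (young_exp \<beta> \<bar>g y\<bar>) \<partial>N) \<le> 1" and \<beta>: "0 < \<beta>"
    and s0: "\<And>t. s0 \<le> t \<Longrightarrow> t * exp (t powr \<beta> / 2) \<le> young_exp \<beta> t" and s: "1 \<le> s0" "s0 \<le> s"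
    and \<psi>m: "\<psi> \<in> borel_measurable M"
    and bd: "AE x in M. ennreal (\<psi> x) \<le> ennreal s + riesz N (excess s g) x"
  shows "emeasure M {x \<in> space M. 2 * s \<le> \<psi> x} \<le> ennreal (dual_const DIM('a) \<alpha> K powr (\<alpha> / (real DIM('a) - 1)) *
    exp (- (\<alpha> / (real DIM('a) - 1) / 2 * s powr \<beta>)))"
proof -
  let ?n = "real DIM('a)"
  define B where "B = dual_const DIM('a) \<alpha> K"
  define \<kappa> where "\<kappa> = \<alpha> / (?n - 1)"
  define T where "T = exp (- (s powr \<beta> / 2))"
  have n: "1 < ?n" using dim by simp
  have \<kappa>: "1 < \<kappa>" using \<alpha> n by (simp add: \<kappa>_def)
  have B: "0 < B" unfolding B_def by (rule dual_const_pos[OF dim \<alpha> K])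
  have T: "0 < T" by (simp add: T_def)
  have sf: "sigma_finite_measure N" using fN by (simp add: finite_measure_def)
  have sM [measurable_cong]: "sets M = sets borel" and fM: "finite_measure M" using M by (auto simp: growth_measure_def)
  have [measurable]: "riesz N (excess s g) \<in> borel_measurable borel" by (rule riesz_measurable[OF sN sf]) simp
  have "emeasure M {x \<in> space M. 2 * s \<le> \<psi> x} \<le> ennreal ((B * T / s) powr \<kappa>)"
  proof (rule weak_type_level[OF fM \<psi>m _ bd _ \<kappa>])
    show "(\<integral>\<^sup>+x. riesz N (excess s g) x * indicator E x \<partial>M) \<le> ennreal (B * measure M E powr (1 - 1 / \<kappa>) * T)" if "E \<in> sets M" for E
    proof -
      have "(\<integral>\<^sup>+x. riesz N (excess s g) x * indicator E x \<partial>M) \<le> ennreal (B * measure M E powr (1 - 1 / \<kappa>)) * (\<integral>\<^sup>+y. excess s g y \<partial>N)"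
        unfolding B_def \<kappa>_def
        by (rule riesz_dual[OF dim sM fM sN sf K \<alpha>]) (use M that sM in \<open>auto simp: growth_measure_def\<close>)
      also have "... \<le> ennreal (B * measure M E powr (1 - 1 / \<kappa>)) * ennreal T" unfolding T_def
        by (intro mult_left_mono excess_integral_young_exp[OF _ s0 s \<beta> gN]) (auto simp: measurable_cong_sets[OF sN refl])
      finally show ?thesis using B T by (simp add: ennreal_mult)
    qed
  qed (use B T s in auto)
  also have "(B * T / s) powr \<kappa> \<le> (B * T / 1) powr \<kappa>" using B T s \<kappa> by (intro powr_mono2 divide_left_mono) auto
  also have "(B * T / 1) powr \<kappa> = B powr \<kappa> * exp (- (\<kappa> / 2 * s powr \<beta>))"
    using B T by (simp add: powr_mult) (simp add: T_def powr_def)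
  finally show ?thesis by (simp add: B_def \<kappa>_def ennreal_leI)
qed

lemma gradient_exponential_estimate:
  assumes dim: "2 \<le> DIM('a::euclidean_space)" and \<beta>: "0 < \<beta>"
    and \<alpha>: "real DIM('a) - 1 < \<alpha>" and K: "0 < K" and L: "0 \<le> L" and m: "0 \<le> m"
  shows "\<exists>C>0. \<forall>(M::'a measure) N F g \<phi> U. growth_measure M \<alpha> K \<longrightarrow> measure M UNIV \<le> m \<longrightarrow> riesz_bounded M N F g 1 \<phi> \<longrightarrow>
    (\<integral>\<^sup>+y. ennreal (F y powr real DIM('a)) \<partial>lborel) \<le> 1 \<longrightarrow>
    U \<in> sets borel \<longrightarrow> (\<forall>y. y \<notin> U \<longrightarrow> F y = 0) \<longrightarrow> emeasure lborel U \<le> ennreal L \<longrightarrow>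
    (\<integral>\<^sup>+y. ennreal (young_exp \<beta> \<bar>g y\<bar>) \<partial>N) \<le> 1 \<longrightarrow>
    (\<integral>\<^sup>+x. ennreal (young_exp (min (real DIM('a) / (real DIM('a) - 1)) \<beta>) (\<phi> x / C)) \<partial>M) \<le> 1"
proof -
  let ?n = "real DIM('a)"
  define \<gamma> where "\<gamma> = min (?n / (?n - 1)) \<beta>"
  define A where "A = log_const DIM('a) L"
  define B where "B = dual_const DIM('a) \<alpha> K"
  define \<kappa> where "\<kappa> = \<alpha> / (?n - 1)"
  have n: "1 < ?n" using dim by simp
  have \<kappa>: "1 < \<kappa>" using \<alpha> n by (simp add: \<kappa>_def)
  have A: "0 < A" unfolding A_def by (rule log_const_pos[OF dim])
  have B: "0 < B" unfolding B_def by (rule dual_const_pos[OF dim \<alpha> K])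
  have \<gamma>: "0 < \<gamma>" "\<gamma> \<le> ?n / (?n - 1)" "\<gamma> \<le> \<beta>" using n \<beta> by (auto simp: \<gamma>_def)
  have \<alpha>0: "0 < \<alpha>" using \<alpha> n by linarith
  obtain s0 where s0: "1 \<le> s0" "\<And>t. s0 \<le> t \<Longrightarrow> t * exp (t powr \<beta> / 2) \<le> young_exp \<beta> t"
    using young_exp_superlinear[OF \<beta>] by auto
  define D where "D = (B / A) powr \<kappa> * exp \<alpha> + B powr \<kappa>"
  \<comment> \<open>Both tail exponents are lowered to \<gamma>, the smaller of them;
    \<open>s1\<close> makes the bases s/(4A) and s/4 at least 1, so that lowering the exponent only
    weakens the bounds.\<close>
  define \<eta> where "\<eta> = min (\<alpha> * (1 / (4 * A)) powr \<gamma>) (\<kappa> / 2 * (1 / 4) powr \<gamma>)"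
  define s1 where "s1 = max (4 * A) (4 * s0)"
  have D: "0 < D" using A B by (simp add: D_def add_pos_pos)
  have \<eta>: "0 < \<eta>" using A \<kappa> \<alpha>0 by (simp add: \<eta>_def)
  have s1: "0 \<le> s1" using A by (simp add: s1_def)
  obtain C where C: "0 < C" "\<And>(M :: 'a measure) \<psi>. finite_measure M \<and> measure M (space M) \<le> m \<and> \<psi> \<in> borel_measurable M \<and> (\<forall>x. 0 \<le> \<psi> x) \<and>
    (\<forall>s\<ge>s1. emeasure M {x \<in> space M. s \<le> \<psi> x} \<le> ennreal (D * exp (- (\<eta> * s powr \<gamma>)))) \<Longrightarrow>
    (\<integral>\<^sup>+x. ennreal (young_exp \<gamma> (\<psi> x / C)) \<partial>M) \<le> 1"
    using exponential_tail_imp_young_exp[where 'a = 'a, OF D \<eta> \<gamma>(1) m s1] by meson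
  show ?thesis
  proof (intro exI[of _ C] conjI C(1) allI impI)
    fix M N :: "'a measure" and F g \<phi> :: "'a \<Rightarrow> real" and U :: "'a set"
    let ?I = "riesz lborel (\<lambda>y. ennreal (F y))"
    assume gM: "growth_measure M \<alpha> K" and m: "measure M UNIV \<le> m" and rb: "riesz_bounded M N F g 1 \<phi>"
      and FN: "(\<integral>\<^sup>+y. ennreal (F y powr ?n) \<partial>lborel) \<le> 1" and gN: "(\<integral>\<^sup>+y. ennreal (young_exp \<beta> \<bar>g y\<bar>) \<partial>N) \<le> 1"
      and U: "U \<in> sets borel" "\<forall>y. y \<notin> U \<longrightarrow> F y = 0" "emeasure lborel U \<le> ennreal L"
    have sM [measurable_cong]: "sets M = sets borel" and fM: "finite_measure M" using gM by (auto simp: growth_measure_def)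
    have spM: "space M = UNIV" using sets_eq_imp_space_eq[OF sM] by simp
    have [measurable]: "F \<in> borel_measurable borel" "\<phi> \<in> borel_measurable borel" "g \<in> borel_measurable borel"
      and sN: "sets N = sets borel" and fN: "finite_measure N" and F0: "\<And>y. 0 \<le> F y" and \<phi>0: "\<And>x. 0 \<le> \<phi> x"
      and bd: "AE x in M. ?I x < \<infinity> \<longrightarrow> (\<forall>s\<ge>0. ennreal (\<phi> x) \<le> ?I x + ennreal s + riesz N (excess s g) x)"
      using rb by (auto simp: riesz_bounded_def)
    define \<psi>1 where "\<psi>1 x = enn2real (?I x)" for x
    define \<psi>2 where "\<psi>2 x = max 0 (\<phi> x - \<psi>1 x)" for x
    have [measurable]: "\<psi>1 \<in> borel_measurable borel" unfolding \<psi>1_def by measurable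
    have [measurable]: "\<psi>2 \<in> borel_measurable borel" unfolding \<psi>2_def by measurable
    have fin: "AE x in M. ?I x < \<infinity>" by (rule riesz_exponential_tail(1)[OF dim gM K \<alpha>, of F U L]) (use F0 FN U L in auto)
    have bd2: "AE x in M. ennreal (\<psi>2 x) \<le> ennreal s + riesz N (excess s g) x" if s: "0 \<le> s" for s
    proof -
      from bd fin show ?thesis
      proof eventually_elim
        case (elim x)
        then have "ennreal (\<phi> x) \<le> ?I x + ennreal s + riesz N (excess s g) x" using s by simp
        also have "?I x = ennreal (\<psi>1 x)" using elim by (simp add: \<psi>1_def)
        finally show ?case unfolding \<psi>2_def by (intro ennreal_excess_part) (auto simp: \<psi>1_def add.assoc)
      qed
    qed
    have "emeasure M {x \<in> space M. s \<le> \<phi> x} \<le> ennreal (D * exp (- (\<eta> * s powr \<gamma>)))" if s: "s1 \<le> s" for s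
    proof -
      have s4: "4 * A \<le> s" "4 * s0 \<le> s" using s by (auto simp: s1_def)
      have s_pos: "0 < s" using s4 A by linarith
      \<comment> \<open>As \<phi> is at most the sum of both parts, one of them reaches s/2; the
        factors are arranged to fit the two tail bounds.\<close>
      have "emeasure M {x \<in> space M. s \<le> \<phi> x} \<le> emeasure M ({x \<in> space M. s \<le> 2 * \<psi>1 x} \<union> {x \<in> space M. 2 * (s / 4) \<le> \<psi>2 x})"
      proof (rule emeasure_mono)
        have "s \<le> 2 * \<psi>1 x \<or> s / 2 \<le> \<psi>2 x" if "s \<le> \<phi> x" for x using that unfolding \<psi>2_def by linarith
        then show "{x \<in> space M. s \<le> \<phi> x} \<subseteq> {x \<in> space M. s \<le> 2 * \<psi>1 x} \<union> {x \<in> space M. 2 * (s / 4) \<le> \<psi>2 x}" by auto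
      qed measurable
      also have "... \<le> emeasure M {x \<in> space M. s \<le> 2 * \<psi>1 x} + emeasure M {x \<in> space M. 2 * (s / 4) \<le> \<psi>2 x}"
        by (rule emeasure_subadditive) measurable
      also have "... \<le> ennreal ((B / A) powr \<kappa> * exp \<alpha> * exp (- (\<alpha> * (s / (4 * A)) powr (?n / (?n - 1))))) +
        ennreal (B powr \<kappa> * exp (- (\<kappa> / 2 * (s / 4) powr \<beta>)))"
      proof (rule add_mono)
        show "emeasure M {x \<in> space M. s \<le> 2 * \<psi>1 x} \<le> ennreal ((B / A) powr \<kappa> * exp \<alpha> * exp (- (\<alpha> * (s / (4 * A)) powr (?n / (?n - 1)))))"
          unfolding \<psi>1_def B_def A_def \<kappa>_def
          by (rule riesz_exponential_tail(2)[OF dim gM K \<alpha>, of F U]) (use F0 FN U L s4 in \<open>auto simp: A_def\<close>)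
        show "emeasure M {x \<in> space M. 2 * (s / 4) \<le> \<psi>2 x} \<le> ennreal (B powr \<kappa> * exp (- (\<kappa> / 2 * (s / 4) powr \<beta>)))"
          unfolding B_def \<kappa>_def
          by (rule boundary_exponential_tail[OF dim gM K \<alpha>, of N g \<beta> s0]) (use sN fN gN \<beta> s0 s4 bd2 in auto)
      qed
      also have "... \<le> ennreal ((B / A) powr \<kappa> * exp \<alpha> * exp (- (\<eta> * s powr \<gamma>))) + ennreal (B powr \<kappa> * exp (- (\<eta> * s powr \<gamma>)))"
      proof (intro add_mono ennreal_leI mult_left_mono)
        have "\<eta> * s powr \<gamma> \<le> \<alpha> * (1 / (4 * A)) powr \<gamma> * s powr \<gamma>" by (intro mult_right_mono) (auto simp: \<eta>_def)
        also have "... = \<alpha> * (1 / (4 * A) * s) powr \<gamma>" using A s_pos by (simp add: powr_mult powr_divide)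
        also have "... \<le> \<alpha> * (1 / (4 * A) * s) powr (?n / (?n - 1))"
          using s4 A \<alpha>0 \<gamma> by (intro mult_left_mono powr_mono) auto
        finally show "exp (- (\<alpha> * (s / (4 * A)) powr (?n / (?n - 1)))) \<le> exp (- (\<eta> * s powr \<gamma>))" by simp
        have "\<eta> * s powr \<gamma> \<le> \<kappa> / 2 * (1 / 4) powr \<gamma> * s powr \<gamma>" by (intro mult_right_mono) (auto simp: \<eta>_def)
        also have "... = \<kappa> / 2 * (1 / 4 * s) powr \<gamma>" using s_pos by (simp add: powr_mult powr_divide)
        also have "... \<le> \<kappa> / 2 * (1 / 4 * s) powr \<beta>" using s4 s0 \<kappa> \<gamma> by (intro mult_left_mono powr_mono) auto
        finally show "exp (- (\<kappa> / 2 * (s / 4) powr \<beta>)) \<le> exp (- (\<eta> * s powr \<gamma>))" by simp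
      qed auto
      also have "... = ennreal (D * exp (- (\<eta> * s powr \<gamma>)))"
        using A B by (subst ennreal_plus[symmetric]) (auto simp: D_def distrib_right)
      finally show ?thesis .
    qed
    then show "(\<integral>\<^sup>+x. ennreal (young_exp (min (?n / (?n - 1)) \<beta>) (\<phi> x / C)) \<partial>M) \<le> 1"
      unfolding \<gamma>_def[symmetric] using m \<phi>0 fM by (intro C(2)) (auto simp: spM)
  qed
qed

section \<open>Passing from the reduced estimates to the measures and norms of the statement\<close>

lemma admissible_measure_extend:
  fixes \<mu> :: "(real^'n::finite) measure"
  assumes op: "open U" and adm: "admissible_measure U \<mu> \<alpha> C\<mu>" and C: "0 < C\<mu>"
  obtains M where "growth_measure M \<alpha> (3 powr \<alpha> * C\<mu>)" "measure M UNIV = measure \<mu> U" "AE x in M. x \<in> U"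
    "\<And>f. f \<in> borel_measurable borel \<Longrightarrow> (\<integral>\<^sup>+x. f x \<partial>M) = (\<integral>\<^sup>+x. f x \<partial>\<mu>)"
proof -
  have sp: "space \<mu> = U" and st: "sets \<mu> = sets (restrict_space borel U)" and fin: "emeasure \<mu> U < \<infinity>"
    and gr: "\<And>x r. x \<in> U \<Longrightarrow> 0 < r \<Longrightarrow> emeasure \<mu> (ball x r \<inter> U) \<le> ennreal (C\<mu> * r powr \<alpha>)"
    using adm by (auto simp: admissible_measure_def)
  have id: "(\<lambda>x. x) \<in> measurable \<mu> borel"
    by (subst measurable_cong_sets[OF st refl]) (auto intro: measurable_restrict_space1)
  define M where "M = distr \<mu> borel (\<lambda>x. x)"
  have em: "emeasure M E = emeasure \<mu> (E \<inter> U)" if "E \<in> sets borel" for E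
    using that id by (simp add: M_def emeasure_distr sp)
  have Ub: "U \<in> sets borel" using op by simp
  show thesis
  proof
    have fM: "finite_measure M" using em[of UNIV] fin by (intro finite_measureI) (auto simp: M_def)
    show "growth_measure M \<alpha> (3 powr \<alpha> * C\<mu>)" unfolding growth_measure_def
    proof (intro conjI allI impI fM)
      show "sets M = sets borel" by (simp add: M_def)
      fix y :: "real^'n" and t :: real assume t: "0 < t"
      show "emeasure M (cball y t) \<le> ennreal (3 powr \<alpha> * C\<mu> * t powr \<alpha>)"
      proof (cases "cball y t \<inter> U = {}")
        case True
        then show ?thesis by (simp add: em)
      next
        case False
        then obtain x where x: "x \<in> cball y t" "x \<in> U" by blast
        \<comment> \<open>The centre y may lie off \<open>U\<close>: a closed ball of radius t that
          meets \<open>U\<close> at x is contained in the open ball of radius 3t about x, which is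
          the source of 3^\<alpha>.\<close>
        have sub: "cball y t \<inter> U \<subseteq> ball x (3 * t) \<inter> U"
        proof
          fix z assume z: "z \<in> cball y t \<inter> U"
          have "dist x z \<le> dist x y + dist y z" by (rule dist_triangle)
          also have "... \<le> t + t" using x z by (intro add_mono) (auto simp: dist_commute)
          finally show "z \<in> ball x (3 * t) \<inter> U" using z t by simp
        qed
        have "ball x (3 * t) \<inter> U \<in> sets \<mu>" unfolding st using Ub by (auto simp: sets_restrict_space)
        then have "emeasure M (cball y t) \<le> emeasure \<mu> (ball x (3 * t) \<inter> U)" using sub by (simp add: em emeasure_mono)
        also have "... \<le> ennreal (C\<mu> * (3 * t) powr \<alpha>)" using gr x t by simp
        also have "C\<mu> * (3 * t) powr \<alpha> = 3 powr \<alpha> * C\<mu> * t powr \<alpha>" using t by (simp add: powr_mult)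
        finally show ?thesis .
      qed
    qed
    show "measure M UNIV = measure \<mu> U" using em[of UNIV] by (simp add: measure_def)
    have "emeasure M (- U) = 0" using em[of "- U"] Ub by simp
    then have "- U \<in> null_sets M" using Ub by (auto simp: null_sets_def M_def)
    then show "AE x in M. x \<in> U" by (rule AE_I') auto
    show "(\<integral>\<^sup>+x. f x \<partial>M) = (\<integral>\<^sup>+x. f x \<partial>\<mu>)" if "f \<in> borel_measurable borel" for f
      unfolding M_def using that id by (subst nn_integral_distr) auto
  qed
qed

text \<open>An estimate for every single upper gradient passes to the infimum because it is affine
  in the norm; b = 0 is separate as b is divided out.\<close>

lemma V1_seminorm_bound:
  assumes "V1_mem mem N u" and X: "\<And>g. hajlasz_ug N u g \<Longrightarrow> mem g \<Longrightarrow> X \<le> a + b * nrm g" and b: "0 \<le> b"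
  shows "X \<le> a + b * V1_seminorm mem nrm N u"
proof (cases "b = 0")
  case True
  then show ?thesis using assms by (auto simp: V1_mem_def)
next
  case False
  then have b: "0 < b" using b by simp
  have "(X - a) / b \<le> V1_seminorm mem nrm N u" unfolding V1_seminorm_def
  proof (rule cInf_greatest)
    show "{nrm g |g. hajlasz_ug N u g \<and> mem g} \<noteq> {}" using assms(1) by (auto simp: V1_mem_def)
    fix v assume "v \<in> {nrm g |g. hajlasz_ug N u g \<and> mem g}"
    then obtain g where "v = nrm g" "X \<le> a + b * v" using X by blast
    then show "(X - a) / b \<le> v" using b by (simp add: field_simps)
  qed
  then show ?thesis using b by (simp add: field_simps)
qed

lemma nn_integral_hessian_rep:
  fixes U :: "(real^'n::finite) set"
  assumes op: "open U" and F: "\<And>x. 0 \<le> F x" "\<And>x. x \<notin> U \<Longrightarrow> F x = 0" "AE x\<in>U in lborel. norm (H x) = F x"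
  shows "(\<integral>\<^sup>+x. ennreal (\<bar>norm (H x)\<bar> powr p) \<partial>restrict_space lebesgue U) = (\<integral>\<^sup>+x. ennreal (F x powr p) \<partial>lborel)"
proof -
  have "U \<inter> space lebesgue \<in> sets lebesgue" using op by simp
  then have "(\<integral>\<^sup>+x. ennreal (\<bar>norm (H x)\<bar> powr p) \<partial>restrict_space lebesgue U) = (\<integral>\<^sup>+x. ennreal (\<bar>norm (H x)\<bar> powr p) * indicator U x \<partial>lborel)"
    by (simp only: nn_integral_restrict_space nn_integral_completion)
  also have "... = (\<integral>\<^sup>+x. ennreal (F x powr p) \<partial>lborel)"
  proof (rule nn_integral_cong_AE, goal_cases)
    case 1
    show ?case using F(3)
    proof eventually_elim
      case (elim x)
      then show ?case using F(1,2)[of x] by (cases "x \<in> U") auto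
    qed
  qed
  finally show ?thesis .
qed

lemma Lp_norm_powr:
  assumes "Lp_mem M p f" and p: "0 < p"
  shows "(\<integral>\<^sup>+x. ennreal (\<bar>f x\<bar> powr p) \<partial>M) = ennreal (Lp_norm M p f powr p)" "0 \<le> Lp_norm M p f"
  using assms by (auto simp: Lp_mem_def Lp_norm_def powr_powr)

lemma luxemburg_norm_le:
  assumes "0 < c" "(\<integral>\<^sup>+x. ennreal (\<Phi> (\<bar>f x\<bar> / c)) \<partial>M) \<le> 1"
  shows "luxemburg_norm \<Phi> M f \<le> c"
  unfolding luxemburg_norm_def by (rule cInf_lower) (use assms in \<open>auto intro: bdd_belowI[of _ 0]\<close>)

text \<open>Attainment of the infimum is not established, so only numbers strictly above it are
  used.\<close>

lemma luxemburg_norm_less: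
  assumes "orlicz_mem \<Phi> M f" "luxemburg_norm \<Phi> M f < k"
  obtains c where "0 < c" "c < k" "(\<integral>\<^sup>+x. ennreal (\<Phi> (\<bar>f x\<bar> / c)) \<partial>M) \<le> 1"
proof -
  have "{c. 0 < c \<and> (\<integral>\<^sup>+x. ennreal (\<Phi> (\<bar>f x\<bar> / c)) \<partial>M) \<le> 1} \<noteq> {}" using assms(1) by (auto simp: orlicz_mem_def)
  from cInf_lessD[OF this assms(2)[unfolded luxemburg_norm_def]] show ?thesis using that by blast
qed

lemma luxemburg_norm_nonneg: "orlicz_mem \<Phi> M f \<Longrightarrow> 0 \<le> luxemburg_norm \<Phi> M f"
  unfolding luxemburg_norm_def by (rule cInf_greatest) (auto simp: orlicz_mem_def)

lemma riesz_cmult: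
  assumes sM [measurable_cong]: "sets M = sets borel" and [measurable]: "f \<in> borel_measurable borel"
  shows "riesz M (\<lambda>y. k * f y) x = k * riesz M f x"
  unfolding riesz_def mult.assoc by (rule nn_integral_cmult) measurable

lemma excess_scale:
  assumes k: "0 < k"
  shows "excess (k * s) g y = ennreal k * excess s (\<lambda>y. g y / k) y"
proof -
  have "k * s < \<bar>g y\<bar> \<longleftrightarrow> s < \<bar>g y / k\<bar>" using k by (simp add: pos_less_divide_eq mult.commute)
  moreover have "ennreal \<bar>g y\<bar> = ennreal k * ennreal \<bar>g y / k\<bar>" using k by (subst ennreal_mult[symmetric]) auto
  ultimately show ?thesis by (simp add: excess_def indicator_def)
qed

lemma norm_weak_gradient_measurable:
  fixes U :: "(real^'n::finite) set"
  assumes op: "open U" and l: "\<And>i. loc_integrable U (\<lambda>x. G x $ i)"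
  shows "(\<lambda>x. norm (G x)) \<in> borel_measurable (restrict_space lebesgue U)"
proof -
  have U: "U \<inter> space lebesgue \<in> sets lebesgue" using op by simp
  have [measurable]: "(\<lambda>x. G x $ i) \<in> borel_measurable (restrict_space lebesgue U)" for i
    using loc_integrable_measurable[OF op l[of i]] by (subst borel_measurable_restrict_space_iff[OF U]) simp
  show ?thesis unfolding norm_vec_def L2_set_def by measurable
qed

text \<open>With b = n or b = n - 1, the power of the mass m is rewritten as a power of
  m^(b/\<alpha>); its exponent is nonnegative because q \<le> Q, so taking the maximum can only
  enlarge it.\<close>

lemma powr_le_max_powr:
  fixes m b \<alpha> q Q Y :: real
  assumes "0 \<le> m" "0 < b" "0 < \<alpha>" "0 < q" "q \<le> Q"
  shows "m powr (1 / q - 1 / Q) \<le> max (m powr (b / \<alpha>)) Y powr (\<alpha> / (q * b) - \<alpha> / (Q * b))"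
proof -
  have e: "\<alpha> / (q * b) - \<alpha> / (Q * b) = \<alpha> / b * (1 / q - 1 / Q)" using assms by (simp add: field_simps)
  have "0 \<le> 1 / q - 1 / Q" using assms by (simp add: field_simps)
  then have "(m powr (b / \<alpha>)) powr (\<alpha> / b * (1 / q - 1 / Q)) \<le> max (m powr (b / \<alpha>)) Y powr (\<alpha> / b * (1 / q - 1 / Q))"
    using assms by (intro powr_mono2) auto
  then show ?thesis unfolding e using assms by (simp add: powr_powr)
qed

text \<open>The pointwise bound is homogeneous once the level is scaled along, which reduces the
  exponential case to normalised data and the constant 1.\<close>

lemma riesz_bounded_scale:
  assumes rb: "riesz_bounded M N F g c \<phi>" and c: "0 < c" and k: "0 < k"
  shows "riesz_bounded M N (\<lambda>y. F y / k) (\<lambda>y. g y / k) 1 (\<lambda>x. \<phi> x / (c * k))"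
proof -
  have [measurable]: "F \<in> borel_measurable borel" "g \<in> borel_measurable borel" "\<phi> \<in> borel_measurable borel"
    and N: "sets N = sets borel" "finite_measure N" and F0: "\<And>y. 0 \<le> F y" and \<phi>0: "\<And>x. 0 \<le> \<phi> x"
    and bd: "AE x in M. riesz lborel (\<lambda>y. ennreal (F y)) x < \<infinity> \<longrightarrow> (\<forall>s\<ge>0. ennreal (\<phi> x) \<le>
      ennreal c * (riesz lborel (\<lambda>y. ennreal (F y)) x + ennreal s + riesz N (excess s g) x))"
    using rb by (auto simp: riesz_bounded_def)
  have rF: "riesz lborel (\<lambda>y. ennreal (F y)) x = ennreal k * riesz lborel (\<lambda>y. ennreal (F y / k)) x" for x
  proof -
    have "(\<lambda>y. ennreal (F y)) = (\<lambda>y. ennreal k * ennreal (F y / k))" using k F0 by (simp add: ennreal_mult[symmetric])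
    then show ?thesis by (simp only:) (rule riesz_cmult, auto)
  qed
  have rg: "riesz N (excess (k * s) g) x = ennreal k * riesz N (excess s (\<lambda>y. g y / k)) x" for s x
    unfolding excess_scale[OF k, abs_def] by (rule riesz_cmult[OF N(1)]) measurable
  have "AE x in M. riesz lborel (\<lambda>y. ennreal (F y / k)) x < \<infinity> \<longrightarrow> (\<forall>s\<ge>0. ennreal (\<phi> x / (c * k)) \<le>
    ennreal 1 * (riesz lborel (\<lambda>y. ennreal (F y / k)) x + ennreal s + riesz N (excess s (\<lambda>y. g y / k)) x))" using bd
  proof (eventually_elim, intro impI allI, goal_cases)
    case (1 x s)
    let ?R = "riesz lborel (\<lambda>y. ennreal (F y / k)) x + ennreal s + riesz N (excess s (\<lambda>y. g y / k)) x"
    have "riesz lborel (\<lambda>y. ennreal (F y)) x < \<infinity>" unfolding rF using 1 by (simp add: ennreal_mult_less_top)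
    then have "ennreal (\<phi> x) \<le> ennreal c * (riesz lborel (\<lambda>y. ennreal (F y)) x + ennreal (k * s) + riesz N (excess (k * s) g) x)"
      using 1 k by auto
    also have "... = ennreal (c * k) * ?R" unfolding rF rg using c k 1 by (simp add: ennreal_mult distrib_left mult.assoc)
    finally have "ennreal (c * k) * ennreal (\<phi> x / (c * k)) \<le> ennreal (c * k) * ?R"
      using c k \<phi>0 by (simp add: ennreal_mult[symmetric])
    then show ?case using c k by (subst (asm) ennreal_mult_le_mult_iff) auto
  qed
  then show ?thesis using N F0 \<phi>0 c k by (simp add: riesz_bounded_def)
qed

text \<open>The bound on the precise representative holds at every point of finite potential, so it
  needs no relation between \<mu> and Lebesgue measure. The function \<phi> is cut off to the domain
  in order to be Borel on the whole space.\<close>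

lemma trace_reduction:
  fixes U :: "(real^'n::finite) set"
  assumes dim: "2 \<le> CARD('n)" and dom: "admissible_domain U" and wgh: "weak_grad_hess U u G H"
    and cb: "Cb_closure U u" and adm: "admissible_measure U \<mu> \<alpha> C\<mu>" and C\<mu>: "0 < C\<mu>"
    and ug: "hajlasz_ug (bdry_measure U) u g0"
  obtains M N F g \<phi> where "growth_measure M \<alpha> (3 powr \<alpha> * C\<mu>)" "measure M UNIV = measure \<mu> U"
    "riesz_bounded M N F g (grad_const TYPE(real^'n)) \<phi>" "\<And>y. y \<notin> U \<Longrightarrow> F y = 0"
    "\<And>p. (\<integral>\<^sup>+x. ennreal (\<bar>norm (H x)\<bar> powr p) \<partial>restrict_space lebesgue U) = (\<integral>\<^sup>+x. ennreal (F x powr p) \<partial>lborel)"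
    "\<And>\<Phi>. \<Phi> \<in> borel_measurable borel \<Longrightarrow> (\<integral>\<^sup>+y. \<Phi> (g0 y) \<partial>bdry_measure U) = (\<integral>\<^sup>+y. \<Phi> (g y) \<partial>N)"
    "\<And>\<Phi>. \<Phi> \<in> borel_measurable borel \<Longrightarrow> (\<integral>\<^sup>+x. \<Phi> (norm (prec_rep G x)) \<partial>\<mu>) = (\<integral>\<^sup>+x. \<Phi> (\<phi> x) \<partial>M)"
    "(\<lambda>x. norm (prec_rep G x)) \<in> borel_measurable \<mu>"
proof (rule gradient_reduction[OF dim dom wgh cb ug], goal_cases)
  case (1 F g N)
  note gr = 1(2-)
  have op: "open U" using dom by (simp add: admissible_domain_def)
  have sp: "space \<mu> = U" and st: "sets \<mu> = sets (restrict_space borel U)" using adm by (auto simp: admissible_measure_def)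
  define \<phi> where "\<phi> x = indicator U x *\<^sub>R norm (prec_rep G x)" for x
  have \<phi>m: "\<phi> \<in> borel_measurable borel"
    using gr(12) op unfolding \<phi>_def by (subst (asm) borel_measurable_restrict_space_iff) auto
  show ?case
  proof (rule admissible_measure_extend[OF op adm C\<mu>], goal_cases)
    case (1 M)
    show thesis
    proof (rule that[of M N F g \<phi>])
      have "AE x in M. riesz lborel (\<lambda>y. ennreal (F y)) x < \<infinity> \<longrightarrow> (\<forall>s\<ge>0. ennreal (\<phi> x) \<le>
        ennreal (grad_const TYPE(real^'n)) * (riesz lborel (\<lambda>y. ennreal (F y)) x + ennreal s + riesz N (excess s g) x))"
        using 1(3) by eventually_elim (simp add: \<phi>_def gr(11))
      then show "riesz_bounded M N F g (grad_const TYPE(real^'n)) \<phi>"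
        using gr \<phi>m by (simp add: riesz_bounded_def) (simp add: \<phi>_def)
      fix \<Phi> :: "real \<Rightarrow> ennreal" assume [measurable]: "\<Phi> \<in> borel_measurable borel"
      have "(\<integral>\<^sup>+x. \<Phi> (norm (prec_rep G x)) \<partial>\<mu>) = (\<integral>\<^sup>+x. \<Phi> (\<phi> x) \<partial>\<mu>)" by (intro nn_integral_cong) (simp add: sp \<phi>_def)
      also have "... = (\<integral>\<^sup>+x. \<Phi> (\<phi> x) \<partial>M)" using \<phi>m by (intro 1(4)[symmetric]) measurable
      finally show "(\<integral>\<^sup>+x. \<Phi> (norm (prec_rep G x)) \<partial>\<mu>) = (\<integral>\<^sup>+x. \<Phi> (\<phi> x) \<partial>M)" .
    qed (use 1 gr nn_integral_hessian_rep[OF op gr(2-4)] in \<open>simp_all add: measurable_cong_sets[OF st refl]\<close>)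
  qed
qed

theorem theorem4p3:
  fixes dummy :: "real^'n"
  assumes "CARD('n) \<ge> 2"
  shows
  \<comment> \<open>(i)\<close>
  "(\<forall>p r \<alpha> C\<mu>. 1 < p \<and> p < real CARD('n) \<and> 1 < r \<and>
      real CARD('n) - 1 < \<alpha> \<and> \<alpha> \<le> real CARD('n) \<and> 0 < C\<mu> \<longrightarrow>
    (\<exists>C::real. \<forall>(\<Omega>::(real^'n) set) \<mu> u G H.
      admissible_domain \<Omega> \<and> admissible_measure \<Omega> \<mu> \<alpha> C\<mu> \<and>
      weak_grad_hess \<Omega> u G H \<and>
      Lp_mem (restrict_space lebesgue \<Omega>) p (\<lambda>x. norm (H x)) \<and>
      V1_mem (Lp_mem (bdry_measure \<Omega>) r) (bdry_measure \<Omega>) u \<and>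
      Cb_closure \<Omega> u \<longrightarrow>
      (let q = min (p * \<alpha> / (real CARD('n) - p)) (r * \<alpha> / (real CARD('n) - 1)) in
        Lp_mem \<mu> q (\<lambda>x. norm (prec_rep G x)) \<and>
        Lp_norm \<mu> q (\<lambda>x. norm (prec_rep G x)) \<le>
          C * ((max (measure \<mu> \<Omega> powr (real CARD('n) / \<alpha>)) (measure lebesgue \<Omega>))
                 powr (\<alpha> / (q * real CARD('n)) - (real CARD('n) - p) / (p * real CARD('n)))
               * Lp_norm (restrict_space lebesgue \<Omega>) p (\<lambda>x. norm (H x))
             + (max (measure \<mu> \<Omega> powr ((real CARD('n) - 1) / \<alpha>)) (Hn1 \<Omega>))
                 powr (\<alpha> / (q * (real CARD('n) - 1)) - 1 / r)
               * V1_seminorm (Lp_mem (bdry_measure \<Omega>) r) (Lp_norm (bdry_measure \<Omega>) r)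
                   (bdry_measure \<Omega>) u))))
  \<and>
  \<comment> \<open>(ii)\<close>
  (\<forall>\<beta> \<alpha> C\<mu> L S M. 0 < \<beta> \<and>
      real CARD('n) - 1 < \<alpha> \<and> \<alpha> \<le> real CARD('n) \<and> 0 < C\<mu> \<longrightarrow>
    (\<exists>C::real. \<forall>(\<Omega>::(real^'n) set) \<mu> u G H.
      admissible_domain \<Omega> \<and> admissible_measure \<Omega> \<mu> \<alpha> C\<mu> \<and>
      measure lebesgue \<Omega> = L \<and> Hn1 \<Omega> = S \<and> measure \<mu> \<Omega> = M \<and>
      weak_grad_hess \<Omega> u G H \<and>
      Lp_mem (restrict_space lebesgue \<Omega>) (real CARD('n)) (\<lambda>x. norm (H x)) \<and>
      V1_mem (expL_mem \<beta> (bdry_measure \<Omega>)) (bdry_measure \<Omega>) u \<and>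
      Cb_closure \<Omega> u \<longrightarrow>
      (let \<gamma> = min (real CARD('n) / (real CARD('n) - 1)) \<beta> in
        expL_mem \<gamma> \<mu> (\<lambda>x. norm (prec_rep G x)) \<and>
        expL_norm \<gamma> \<mu> (\<lambda>x. norm (prec_rep G x)) \<le>
          C * (Lp_norm (restrict_space lebesgue \<Omega>) (real CARD('n)) (\<lambda>x. norm (H x))
             + V1_seminorm (expL_mem \<beta> (bdry_measure \<Omega>)) (expL_norm \<beta> (bdry_measure \<Omega>))
                 (bdry_measure \<Omega>) u))))
  \<and>
  \<comment> \<open>(iii)\<close>
  (\<forall>p. real CARD('n) < p \<longrightarrow>
    (\<exists>C::real. \<forall>(\<Omega>::(real^'n) set) u G H.
      admissible_domain \<Omega> \<and>
      weak_grad_hess \<Omega> u G H \<and>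
      Lp_mem (restrict_space lebesgue \<Omega>) p (\<lambda>x. norm (H x)) \<and>
      V1_mem (Linf_mem (bdry_measure \<Omega>)) (bdry_measure \<Omega>) u \<and>
      Cb_closure \<Omega> u \<longrightarrow>
      Linf_mem (restrict_space lebesgue \<Omega>) (\<lambda>x. norm (G x)) \<and>
      Linf_norm (restrict_space lebesgue \<Omega>) (\<lambda>x. norm (G x)) \<le>
        C * (measure lebesgue \<Omega> powr (1 / real CARD('n) - 1 / p)
               * Lp_norm (restrict_space lebesgue \<Omega>) p (\<lambda>x. norm (H x))
             + V1_seminorm (Linf_mem (bdry_measure \<Omega>)) (Linf_norm (bdry_measure \<Omega>))
                 (bdry_measure \<Omega>) u)))"
proof (intro conjI allI impI, goal_cases)
  note dim = assms
  have D: "DIM(real^'n) = CARD('n)" by simp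
  let ?n = "real CARD('n)" and ?c = "grad_const TYPE(real^'n)"
  have n: "1 < ?n" using dim by simp
  have cpos: "0 < ?c" using grad_const_pos[where 'a = "real^'n"] dim by simp
  {
    case (1 p r \<alpha> C\<mu>)
    then have p: "1 < p" "p < ?n" and r: "1 < r" and \<alpha>: "?n - 1 < \<alpha>" and C\<mu>: "0 < C\<mu>" by auto
    define Q1 where "Q1 = p * \<alpha> / (?n - p)"
    define Q2 where "Q2 = r * \<alpha> / (?n - 1)"
    define q where "q = min Q1 Q2"
    have \<alpha>0: "0 < \<alpha>" using \<alpha> n by linarith
    have Q: "0 < Q1" "0 < Q2" using p r n \<alpha>0 by (auto simp: Q1_def Q2_def)
    then have q: "0 < q" "q \<le> Q1" "q \<le> Q2" by (auto simp: q_def)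
    have Kpos: "0 < 3 powr \<alpha> * C\<mu>" using C\<mu> by simp
    obtain C where C: "0 < C" and est: "\<And>(M::(real^'n) measure) N F g \<phi> h z. growth_measure M \<alpha> (3 powr \<alpha> * C\<mu>) \<Longrightarrow> riesz_bounded M N F g ?c \<phi> \<Longrightarrow>
      0 \<le> h \<Longrightarrow> (\<integral>\<^sup>+y. ennreal (F y powr p) \<partial>lborel) \<le> ennreal (h powr p) \<Longrightarrow>
      0 \<le> z \<Longrightarrow> (\<integral>\<^sup>+y. ennreal (\<bar>g y\<bar> powr r) \<partial>N) \<le> ennreal (z powr r) \<Longrightarrow>
      (\<integral>\<^sup>+x. ennreal (\<phi> x powr q) \<partial>M) \<le> ennreal ((C * (measure M UNIV powr (1 / q - 1 / Q1) * h + measure M UNIV powr (1 / q - 1 / Q2) * z)) powr q)"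
      using gradient_power_estimate[where 'a = "real^'n", unfolded D, OF dim p r \<alpha> Kpos cpos] unfolding q_def Q1_def Q2_def by meson
    show ?case
    proof (intro exI[of _ C] allI impI, goal_cases)
      case (1 U \<mu> u G H)
      let ?Hp = "Lp_norm (restrict_space lebesgue U) p (\<lambda>x. norm (H x))"
      let ?W1 = "max (measure \<mu> U powr (?n / \<alpha>)) (measure lebesgue U) powr (\<alpha> / (q * ?n) - (?n - p) / (p * ?n))"
      let ?W2 = "max (measure \<mu> U powr ((?n - 1) / \<alpha>)) (Hn1 U) powr (\<alpha> / (q * (?n - 1)) - 1 / r)"
      let ?f = "\<lambda>x. norm (prec_rep G x)"
      have dom: "admissible_domain U" and wgh: "weak_grad_hess U u G H" and cb: "Cb_closure U u" and adm: "admissible_measure U \<mu> \<alpha> C\<mu>"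
        and Hp: "Lp_mem (restrict_space lebesgue U) p (\<lambda>x. norm (H x))"
        and V: "V1_mem (Lp_mem (bdry_measure U) r) (bdry_measure U) u" using 1 by auto
      \<comment> \<open>These identities turn the exponents of the statement into multiples of 1/q -
        1/Q1 and 1/q - 1/Q2.\<close>
      have "\<alpha> / (Q1 * ?n) = (?n - p) / (p * ?n)" "\<alpha> / (Q2 * (?n - 1)) = 1 / r"
        using p r n \<alpha>0 by (auto simp: Q1_def Q2_def)
      then have W1: "measure \<mu> U powr (1 / q - 1 / Q1) \<le> ?W1" and W2: "measure \<mu> U powr (1 / q - 1 / Q2) \<le> ?W2"
        using powr_le_max_powr[of "measure \<mu> U" ?n \<alpha> q Q1 "measure lebesgue U"]
          powr_le_max_powr[of "measure \<mu> U" "?n - 1" \<alpha> q Q2 "Hn1 U"] n \<alpha>0 q by auto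
      \<comment> \<open>A fixed upper gradient is treated here; the infimum over all of them is
        taken at the end.\<close>
      have key: "Lp_mem \<mu> q ?f \<and> Lp_norm \<mu> q ?f \<le> C * ?W1 * ?Hp + C * ?W2 * Lp_norm (bdry_measure U) r g0"
        if ug: "hajlasz_ug (bdry_measure U) u g0" and g0: "Lp_mem (bdry_measure U) r g0" for g0
      proof (rule trace_reduction[OF dim dom wgh cb adm C\<mu> ug], goal_cases)
        case (1 M N F g \<phi>)
        let ?z = "Lp_norm (bdry_measure U) r g0"
        have nn: "0 \<le> ?Hp" "0 \<le> ?z" by (auto simp: Lp_norm_def)
        let ?X = "C * (measure \<mu> U powr (1 / q - 1 / Q1) * ?Hp + measure \<mu> U powr (1 / q - 1 / Q2) * ?z)"
        have "(\<integral>\<^sup>+x. ennreal (\<phi> x powr q) \<partial>M) \<le> ennreal (?X powr q)" unfolding 1(2)[symmetric]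
        proof (rule est[OF 1(1,3) nn(1) _ nn(2)])
          show "(\<integral>\<^sup>+y. ennreal (F y powr p) \<partial>lborel) \<le> ennreal (?Hp powr p)" using Lp_norm_powr[OF Hp] p 1(5)[of p] by simp
          show "(\<integral>\<^sup>+y. ennreal (\<bar>g y\<bar> powr r) \<partial>N) \<le> ennreal (?z powr r)"
            using Lp_norm_powr[OF g0] r 1(6)[of "\<lambda>t. ennreal (\<bar>t\<bar> powr r)"] by simp
        qed
        then have fin: "(\<integral>\<^sup>+x. ennreal (\<bar>?f x\<bar> powr q) \<partial>\<mu>) \<le> ennreal (?X powr q)" using 1(7)[of "\<lambda>t. ennreal (t powr q)"] by simp
        have mem: "Lp_mem \<mu> q ?f" unfolding Lp_mem_def using 1(8) fin by (auto intro: order_le_less_trans)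
        have X0: "0 \<le> ?X" using C nn by (intro mult_nonneg_nonneg add_nonneg_nonneg) auto
        have "Lp_norm \<mu> q ?f \<le> (?X powr q) powr (1 / q)" unfolding Lp_norm_def[of \<mu>]
          using q enn2real_mono[OF fin] by (intro powr_mono2) auto
        also have "... = ?X" using q X0 by (simp add: powr_powr)
        also have "... \<le> C * (?W1 * ?Hp + ?W2 * ?z)"
          using C nn W1 W2 by (intro mult_left_mono add_mono mult_right_mono) auto
        finally show ?case using mem by (simp add: algebra_simps)
      qed
      have "Lp_mem \<mu> q ?f" using V key by (auto simp: V1_mem_def)
      moreover have "Lp_norm \<mu> q ?f \<le> C * ?W1 * ?Hp + C * ?W2 * V1_seminorm (Lp_mem (bdry_measure U) r) (Lp_norm (bdry_measure U) r) (bdry_measure U) u"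
        using V key C by (intro V1_seminorm_bound) auto
      ultimately show ?case
        unfolding Let_def Q1_def[symmetric] Q2_def[symmetric] q_def[symmetric] by (simp add: distrib_left mult.assoc)
    qed
  next
    case (2 \<beta> \<alpha> C\<mu> L S M)
    then have \<beta>: "0 < \<beta>" and \<alpha>: "?n - 1 < \<alpha>" and C\<mu>: "0 < C\<mu>" by auto
    define \<gamma> where "\<gamma> = min (?n / (?n - 1)) \<beta>"
    have Kpos: "0 < 3 powr \<alpha> * C\<mu>" using C\<mu> by simp
    \<comment> \<open>The constant is fixed by the numbers \<open>L\<close> and \<open>M\<close>
      before any domain is given; clamping them at 0 meets the sign hypotheses.\<close>
    obtain C where C: "0 < C" and est: "\<And>(M'::(real^'n) measure) N F g \<phi> U. growth_measure M' \<alpha> (3 powr \<alpha> * C\<mu>) \<Longrightarrow>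
      measure M' UNIV \<le> max 0 M \<Longrightarrow> riesz_bounded M' N F g 1 \<phi> \<Longrightarrow> (\<integral>\<^sup>+y. ennreal (F y powr ?n) \<partial>lborel) \<le> 1 \<Longrightarrow>
      U \<in> sets borel \<Longrightarrow> (\<forall>y. y \<notin> U \<longrightarrow> F y = 0) \<Longrightarrow> emeasure lborel U \<le> ennreal (max 0 L) \<Longrightarrow>
      (\<integral>\<^sup>+y. ennreal (young_exp \<beta> \<bar>g y\<bar>) \<partial>N) \<le> 1 \<Longrightarrow> (\<integral>\<^sup>+x. ennreal (young_exp \<gamma> (\<phi> x / C)) \<partial>M') \<le> 1"
      using gradient_exponential_estimate[where 'a = "real^'n", unfolded D, OF dim \<beta> \<alpha> Kpos max.cobounded1[of 0 L] max.cobounded1[of 0 M]]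
      unfolding \<gamma>_def by meson
    show ?case
    proof (intro exI[of _ "C * ?c"] allI impI, goal_cases)
      case (1 U \<mu> u G H)
      let ?Hn = "Lp_norm (restrict_space lebesgue U) ?n (\<lambda>x. norm (H x))"
      let ?f = "\<lambda>x. norm (prec_rep G x)" and ?B = "bdry_measure U"
      have dom: "admissible_domain U" and wgh: "weak_grad_hess U u G H" and cb: "Cb_closure U u" and adm: "admissible_measure U \<mu> \<alpha> C\<mu>"
        and Hn: "Lp_mem (restrict_space lebesgue U) ?n (\<lambda>x. norm (H x))" and V: "V1_mem (expL_mem \<beta> ?B) ?B u" using 1 by auto
      have op: "open U" using dom by (simp add: admissible_domain_def)
      \<comment> \<open>A strict upper bound k of the sum is positive and exceeds the Luxemburg
        norm. Division by k thus normalises Hessian and upper gradient even if both norms vanish,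
        and does not require an attained infimum.\<close>
      have key: "expL_mem \<gamma> \<mu> ?f \<and> expL_norm \<gamma> \<mu> ?f \<le> C * ?c * k"
        if ug: "hajlasz_ug ?B u g0" and g0: "expL_mem \<beta> ?B g0" and k: "?Hn + expL_norm \<beta> ?B g0 < k" for g0 k
      proof (rule trace_reduction[OF dim dom wgh cb adm C\<mu> ug], goal_cases)
        case tr: (1 M' N F g \<phi>)
        have Hn0: "0 \<le> ?Hn" by (simp add: Lp_norm_def)
        have k0: "0 < k" "?Hn \<le> k" "expL_norm \<beta> ?B g0 < k" using Hn0 luxemburg_norm_nonneg[OF g0] k by auto
        from luxemburg_norm_less[OF g0 k0(3)] obtain c0 where c0: "0 < c0" "c0 < k"
          "(\<integral>\<^sup>+y. ennreal (young_exp \<beta> (\<bar>g0 y\<bar> / c0)) \<partial>?B) \<le> 1" by blast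
        have rb: "riesz_bounded M' N (\<lambda>y. F y / k) (\<lambda>y. g y / k) 1 (\<lambda>x. \<phi> x / (?c * k))"
          by (rule riesz_bounded_scale[OF tr(3) cpos k0(1)])
        have F0: "\<And>y. 0 \<le> F y" and [measurable]: "F \<in> borel_measurable borel" using tr(3) by (auto simp: riesz_bounded_def)
        have "(\<integral>\<^sup>+y. ennreal ((F y / k) powr ?n) \<partial>lborel) = (\<integral>\<^sup>+y. ennreal (k powr - ?n) * ennreal (F y powr ?n) \<partial>lborel)"
          using k0 F0 by (intro nn_integral_cong) (simp add: powr_divide powr_minus ennreal_mult[symmetric] field_simps)
        also have "... = ennreal (k powr - ?n) * ennreal (?Hn powr ?n)"
          using Lp_norm_powr[OF Hn] n tr(5)[of ?n] by (simp add: nn_integral_cmult)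
        also have "... \<le> ennreal (k powr - ?n) * ennreal (k powr ?n)"
          using k0 Hn0 n by (intro mult_left_mono ennreal_leI powr_mono2) auto
        also have "... = 1" using k0 by (simp add: ennreal_mult[symmetric] powr_add[symmetric])
        finally have FN: "(\<integral>\<^sup>+y. ennreal ((F y / k) powr ?n) \<partial>lborel) \<le> 1" .
        have "(\<integral>\<^sup>+y. ennreal (young_exp \<beta> \<bar>g y / k\<bar>) \<partial>N) \<le> (\<integral>\<^sup>+y. ennreal (young_exp \<beta> (\<bar>g y\<bar> / c0)) \<partial>N)"
        proof (intro nn_integral_mono ennreal_leI young_exp_mono \<beta>)
          fix y
          show "\<bar>g y / k\<bar> \<le> \<bar>g y\<bar> / c0" using c0 k0 divide_left_mono[of c0 k "\<bar>g y\<bar>"] by simp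
        qed simp
        also have "... \<le> 1" using c0(3) tr(6)[of "\<lambda>t. ennreal (young_exp \<beta> (\<bar>t\<bar> / c0))"] by simp
        finally have gN: "(\<integral>\<^sup>+y. ennreal (young_exp \<beta> \<bar>g y / k\<bar>) \<partial>N) \<le> 1" .
        have "emeasure lebesgue U = ennreal (measure lebesgue U)"
          using dom by (intro emeasure_eq_ennreal_measure) (auto simp: admissible_domain_def)
        then have UL: "emeasure lborel U \<le> ennreal (max 0 L)" using 1 op by (auto intro: ennreal_leI)
        have "(\<integral>\<^sup>+x. ennreal (young_exp \<gamma> (\<phi> x / (?c * k) / C)) \<partial>M') \<le> 1"
          using tr(2,4) 1 op by (intro est[OF tr(1) _ rb FN _ _ UL gN]) auto
        then have le: "(\<integral>\<^sup>+x. ennreal (young_exp \<gamma> (\<bar>?f x\<bar> / (C * ?c * k))) \<partial>\<mu>) \<le> 1"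
          using tr(7)[of "\<lambda>t. ennreal (young_exp \<gamma> (t / (?c * k) / C))"] by (simp add: mult_ac)
        have pos: "0 < C * ?c * k" using C cpos k0 by simp
        show ?case using luxemburg_norm_le[OF pos le] tr(8) le pos by (auto simp: orlicz_mem_def)
      qed
      have key': "expL_norm \<gamma> \<mu> ?f \<le> C * ?c * ?Hn + C * ?c * expL_norm \<beta> ?B g0"
        if "hajlasz_ug ?B u g0" "expL_mem \<beta> ?B g0" for g0
      proof -
        have Cc: "0 < C * ?c" using C cpos by simp
        have "expL_norm \<gamma> \<mu> ?f / (C * ?c) \<le> ?Hn + expL_norm \<beta> ?B g0"
        proof (rule dense_ge)
          \<comment> \<open>Here k decreases to the sum of the two norms.\<close>
          fix k assume "?Hn + expL_norm \<beta> ?B g0 < k"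
          then have "expL_norm \<gamma> \<mu> ?f \<le> C * ?c * k" using key that by blast
          then show "expL_norm \<gamma> \<mu> ?f / (C * ?c) \<le> k" using Cc by (simp add: pos_divide_le_eq mult.commute)
        qed
        then show ?thesis using Cc by (simp add: pos_divide_le_eq distrib_left mult.commute)
      qed
      obtain g0 where "hajlasz_ug ?B u g0" "expL_mem \<beta> ?B g0" using V by (auto simp: V1_mem_def)
      then have "expL_mem \<gamma> \<mu> ?f" using key[of g0 "?Hn + expL_norm \<beta> ?B g0 + 1"] by simp
      moreover have "expL_norm \<gamma> \<mu> ?f \<le> C * ?c * ?Hn + C * ?c * V1_seminorm (expL_mem \<beta> ?B) (expL_norm \<beta> ?B) ?B u"
        using V key' C cpos by (intro V1_seminorm_bound) auto
      ultimately show ?case unfolding Let_def \<gamma>_def[symmetric] by (simp add: distrib_left)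
    qed
  next
    case (3 p)
    \<comment> \<open>Part (iii) concerns the gradient itself off a Lebesgue null set, so the
      constant without the averaging factor applies.\<close>
    let ?c = "pointwise_const TYPE(real^'n)"
    have cpos: "0 < ?c" using pointwise_const_pos[where 'a = "real^'n"] dim by simp
    let ?s = "sup_const CARD('n) p"
    have spos: "0 \<le> ?s" by (simp add: sup_const_def)
    define C where "C = ?c * max 1 ?s"
    have C: "0 \<le> C" using cpos by (simp add: C_def)
    have p1: "1 < p" using 3 dim by simp
    show ?case
    proof (intro exI[of _ C] allI impI, goal_cases)
      case (1 U u G H)
      let ?W = "measure lebesgue U powr (1 / ?n - 1 / p) * Lp_norm (restrict_space lebesgue U) p (\<lambda>x. norm (H x))"
      let ?B = "bdry_measure U" and ?L = "restrict_space lebesgue U" and ?f = "\<lambda>x. norm (G x)"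
      have dom: "admissible_domain U" and wgh: "weak_grad_hess U u G H" and cb: "Cb_closure U u" using 1 by auto
      have op: "open U" using dom by (simp add: admissible_domain_def)
      have Ul: "U \<inter> space lebesgue \<in> sets lebesgue" using op by simp
      have UL: "emeasure lborel U \<le> ennreal (measure lebesgue U)"
      proof -
        have "emeasure lebesgue U = ennreal (measure lebesgue U)"
          using dom by (intro emeasure_eq_ennreal_measure) (auto simp: admissible_domain_def)
        then show ?thesis using op by simp
      qed
      have W0: "0 \<le> ?W" by (simp add: Lp_norm_def)
      have fm: "?f \<in> borel_measurable ?L"
        using wgh by (intro norm_weak_gradient_measurable[OF op]) (auto simp: weak_grad_hess_def weak_pd_def)
      have key: "Linf_mem ?L ?f \<and> Linf_norm ?L ?f \<le> C * ?W + C * Linf_norm ?B g0"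
        if ug: "hajlasz_ug ?B u g0" and g0: "Linf_mem ?B g0" for g0
      proof (rule gradient_reduction[OF dim dom wgh cb ug], goal_cases)
        case gr: (1 F g Hb)
        note F = gr(1-4) and ae = gr(8) and bd = gr(10)
        let ?z = "Linf_norm ?B g0"
        have z0: "0 \<le> ?z" by (simp add: Linf_norm_def)
        \<comment> \<open>The essential supremum is -\<infinity> if the boundary measure vanishes;
          the clamp in \<open>Linf_norm\<close> and the case distinction cover this.\<close>
        have "AE y in ?B. \<bar>g0 y\<bar> \<le> ?z" using esssup_AE[of "\<lambda>x. ereal \<bar>g0 x\<bar>" ?B]
        proof eventually_elim
          case (elim y)
          then show ?case using g0 unfolding Linf_mem_def Linf_norm_def by (cases "esssup ?B (\<lambda>x. ereal \<bar>g0 x\<bar>)") auto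
        qed
        then have "AE y in Hb. \<bar>g y\<bar> \<le> ?z" by (rule ae)
        \<comment> \<open>With s equal to the sup norm of the upper gradient the boundary potential
          disappears, and the level alone represents the boundary.\<close>
        then have "AE y in Hb. excess ?z g y = 0" by eventually_elim (simp add: excess_def)
        then have J: "riesz Hb (excess ?z g) x = 0" for x by (rule riesz_AE_zero)
        have I: "riesz lborel (\<lambda>y. ennreal (F y)) x \<le> ennreal (?s * ?W)" for x
        proof -
          have "(\<integral>\<^sup>+y. ennreal (F y powr p) \<partial>lborel) = ennreal (Lp_norm ?L p (\<lambda>x. norm (H x)) powr p)"
            using Lp_norm_powr(1)[of ?L p "\<lambda>x. norm (H x)"] 1 p1 nn_integral_hessian_rep[where p = p, OF op F(2,3,4)] by simp
          then have "riesz lborel (\<lambda>y. ennreal (F y)) x \<le> ennreal (sup_const DIM(real^'n) p * (measure lebesgue U powr (1 / real DIM(real^'n) - 1 / p) *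
            (Lp_norm ?L p (\<lambda>x. norm (H x)) powr p) powr (1 / p)))"
            using dim 3 F op UL by (intro riesz_sup_bound[where U = U]) auto
          then show ?thesis using p1 by (simp add: powr_powr Lp_norm_def)
        qed
        have "AE x\<in>U in lborel. ?f x \<le> C * ?W + C * ?z" using bd
        proof (eventually_elim, intro impI)
          fix x assume b: "x \<in> U \<longrightarrow> (\<forall>s\<ge>0. ennreal (norm (G x)) \<le> ennreal ?c *
            (riesz lborel (\<lambda>y. ennreal (F y)) x + ennreal s + riesz Hb (excess s g) x))" and x: "x \<in> U"
          have "ennreal (?f x) \<le> ennreal ?c * (riesz lborel (\<lambda>y. ennreal (F y)) x + ennreal ?z + riesz Hb (excess ?z g) x)"
            using b x z0 by blast
          also have "... \<le> ennreal ?c * (ennreal (?s * ?W) + ennreal ?z)" unfolding J by (intro mult_left_mono) (simp_all add: I)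
          also have "... = ennreal (?c * (?s * ?W + ?z))" using cpos spos W0 z0 by (simp add: ennreal_mult)
          finally have "?f x \<le> ?c * (?s * ?W + ?z)" using cpos spos W0 z0 by (simp add: ennreal_le_iff)
          also have "... \<le> ?c * (max 1 ?s * ?W + max 1 ?s * ?z)"
            using cpos W0 z0 mult_right_mono[of 1 "max 1 ?s" ?z] by (intro mult_left_mono add_mono mult_right_mono) auto
          finally show "?f x \<le> C * ?W + C * ?z" by (simp add: C_def algebra_simps)
        qed
        then have "AE x in ?L. ereal \<bar>?f x\<bar> \<le> ereal (C * ?W + C * ?z)"
          using Ul by (simp add: AE_restrict_space_iff AE_completion_iff)
        then have e: "esssup ?L (\<lambda>x. ereal \<bar>?f x\<bar>) \<le> ereal (C * ?W + C * ?z)"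
          by (intro esssup_I measurable_compose[OF fm]) measurable
        have "Linf_mem ?L ?f" unfolding Linf_mem_def using fm e by (auto intro: order_le_less_trans)
        moreover have "Linf_norm ?L ?f \<le> C * ?W + C * ?z"
          using e C W0 z0 unfolding Linf_norm_def by (cases "esssup ?L (\<lambda>x. ereal \<bar>?f x\<bar>)") auto
        ultimately show ?case by blast
      qed
      have "Linf_mem ?L ?f" using 1 key by (auto simp: V1_mem_def)
      moreover have "Linf_norm ?L ?f \<le> C * ?W + C * V1_seminorm (Linf_mem ?B) (Linf_norm ?B) ?B u"
        using 1 key C by (intro V1_seminorm_bound) auto
      ultimately show ?case by (simp add: distrib_left)
    qed
  }
qed

end
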